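(* Let $d\ge1$. For every real $s>d+1$ there is a constant $C=C(d,s)$ such that for every radial $f\in\mathcal{S}(\mathbb{R}^{2d})$, $$\|L_{\mathcal{F}_\sigma f}\|_{\mathcal{S}_1}\le C\,\big\|(1+\mathcal{H}_{2d})^{s/2}f\big\|_{L^2(\mathbb{R}^{2d})}.$$ In particular (taking $s=d+2$), there is a constant $C'=C'(d)$ such that for every radial $f\in\mathcal{S}(\mathbb{R}^{2d})$, $$\|L_{\mathcal{F}_\sigma f}\|_{\mathcal{S}_1}\le C'\,\|f\|_{(d+2,2)}.$$
   Context: $\mathcal{S}(\mathbb{R}^{2d})$ is the Schwartz space. $\mathcal{H}_{2d}=-\Delta_z+\frac14|z|^2$ on $\mathbb{R}^{2d}$ is the scaled Hermite operator (positive self-adjoint on $L^2(\mathbb{R}^{2d})$); powers of $1+\mathcal{H}_{2d}$ are defined by the spectral theorem. For $N\in\mathbb{N}$, $\|f\|_{(N,2)}=\sum_{|\alpha|+|\beta|\le N}\|\partial^\alpha(z^\beta f)\|_{L^2(\mathbb{R}^{2d})}$, the sum being over multi-indices $\alpha,\beta\in\mathbb{N}^{2d}$. For $z=(x,\xi),\,w=(y,\eta)\in\mathbb{R}^{d}\times\mathbb{R}^d$ let $\sigma(w,z)=\eta\cdot x-y\cdot\xi$ and $\mathcal{F}_\sigma F(w)=(2\pi)^{-d}\int_{\mathbb{R}^{2d}}F(z)e^{-i\sigma(w,z)}\,dz$ (symplectic Fourier transform; $\mathcal{F}_\sigma^2=\mathrm{Id}$). Let $[\rho(x,\xi)g](t)=e^{-\frac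 i2x\cdot\xi}e^{it\cdot\xi}g(t-x)$ for $g\in L^2(\mathbb{R}^d)$, $\rho(F)=(2\pi)^{-d}\int_{\mathbb{R}^{2d}}F(z)\rho(z)\,dz$ for $F\in L^1(\mathbb{R}^{2d})$, and let the Weyl operator be $L_a=\rho(\mathcal{F}_\sigma a)$; hence $L_{\mathcal{F}_\sigma f}=\rho(f)$, an operator on $L^2(\mathbb{R}^d)$. $\mathcal{S}_1$ is the trace class on $L^2(\mathbb{R}^d)$ with the trace norm. *)

theory Defs
  imports "HOL-Analysis.Analysis"
begin

section \<open>Square-integrable functions\<close>

text \<open>Elements of \<open>L\<^sup>2\<close> are represented by measurable functions; equality in
  \<open>L\<^sup>2\<close> is equality almost everywhere, and operators act on representatives.\<close>

definition L2 :: "'a measure \<Rightarrow> ('a \<Rightarrow> complex) set" where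
  "L2 M = {f \<in> borel_measurable M. integrable M (\<lambda>x. (cmod (f x))\<^sup>2)}"

definition l2_inner :: "'a measure \<Rightarrow> ('a \<Rightarrow> complex) \<Rightarrow> ('a \<Rightarrow> complex) \<Rightarrow> complex" where
  "l2_inner M f g = (LINT x|M. f x * cnj (g x))"

definition l2_norm :: "'a measure \<Rightarrow> ('a \<Rightarrow> complex) \<Rightarrow> real" where
  "l2_norm M f = sqrt (LINT x|M. (cmod (f x))\<^sup>2)"

definition l2_linear ::
  "'a measure \<Rightarrow> 'b measure \<Rightarrow> (('a \<Rightarrow> complex) \<Rightarrow> ('b \<Rightarrow> complex)) \<Rightarrow> bool" where
  "l2_linear M N T \<longleftrightarrow>
     (\<forall>f\<in>L2 M. T f \<in> L2 N) \<and>
     (\<forall>f\<in>L2 M. \<forall>g\<in>L2 M. AE x in N. T (\<lambda>y. f y + g y) x = T f x + T g x) \<and>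
     (\<forall>f\<in>L2 M. \<forall>c. AE x in N. T (\<lambda>y. c * f y) x = c * T f x)"

text \<open>A linear map with a norm bound automatically respects equality almost everywhere.\<close>

definition l2_bounded_op :: "'a measure \<Rightarrow> (('a \<Rightarrow> complex) \<Rightarrow> ('a \<Rightarrow> complex)) \<Rightarrow> bool" where
  "l2_bounded_op M T \<longleftrightarrow>
     l2_linear M M T \<and> (\<exists>K. \<forall>f\<in>L2 M. l2_norm M (T f) \<le> K * l2_norm M f)"

definition l2_unitary ::
  "'a measure \<Rightarrow> 'b measure \<Rightarrow> (('a \<Rightarrow> complex) \<Rightarrow> ('b \<Rightarrow> complex)) \<Rightarrow> bool" where
  "l2_unitary M N U \<longleftrightarrow>
     l2_linear M N U \<and> (\<forall>f\<in>L2 M. l2_norm N (U f) = l2_norm M f) \<and>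
     (\<forall>h\<in>L2 N. \<exists>f\<in>L2 M. AE x in N. U f x = h x)"


section \<open>Trace norm\<close>

definition l2_onb :: "'a measure \<Rightarrow> (nat \<Rightarrow> 'a \<Rightarrow> complex) \<Rightarrow> bool" where
  "l2_onb M e \<longleftrightarrow>
     (\<forall>i. e i \<in> L2 M) \<and>
     (\<forall>i j. l2_inner M (e i) (e j) = (if i = j then 1 else 0)) \<and>
     (\<forall>f\<in>L2 M. (\<forall>i. l2_inner M f (e i) = 0) \<longrightarrow> (AE x in M. f x = 0))"

text \<open>\<open>P = |T|\<close>: the positive square root of \<open>T\<^sup>*T\<close>. A positive operator on a complex
  Hilbert space is self-adjoint; the last clause is \<open>P\<^sup>2 = T\<^sup>*T\<close> with the adjoint moved across
  the inner product.\<close>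

definition l2_abs_op ::
  "'a measure \<Rightarrow> (('a \<Rightarrow> complex) \<Rightarrow> ('a \<Rightarrow> complex)) \<Rightarrow> (('a \<Rightarrow> complex) \<Rightarrow> ('a \<Rightarrow> complex)) \<Rightarrow> bool"
  where
  "l2_abs_op M T P \<longleftrightarrow>
     l2_bounded_op M P \<and>
     (\<forall>g\<in>L2 M. Im (l2_inner M (P g) g) = 0 \<and> 0 \<le> Re (l2_inner M (P g) g)) \<and>
     (\<forall>g\<in>L2 M. \<forall>h\<in>L2 M. l2_inner M (P (P g)) h = l2_inner M (T g) (T h))"

text \<open>The trace of \<open>|T|\<close>, for \<open>L\<^sup>2\<close> spaces that are infinite-dimensional and separable.
  It does not depend on the chosen basis, and a bounded operator is of trace class iff the value
  is finite.\<close>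

definition trace_norm :: "'a measure \<Rightarrow> (('a \<Rightarrow> complex) \<Rightarrow> ('a \<Rightarrow> complex)) \<Rightarrow> ennreal" where
  "trace_norm M T =
     (if l2_bounded_op M T then
        (let P = (SOME P. l2_abs_op M T P); e = (SOME e. l2_onb M e)
         in \<Sum>k. ennreal (Re (l2_inner M (P (e k)) (e k))))
      else \<infinity>)"


section \<open>Functional calculus\<close>

text \<open>An unbounded operator \<open>A\<close> is given by its graph. A spectral representation (the spectral
  theorem in multiplication-operator form) is a unitary map \<open>U\<close> onto some \<open>L\<^sup>2(N)\<close> that turns
  \<open>A\<close> into multiplication by a real function \<open>m\<close>; the equivalence below also says that
  \<open>f\<close> lies in the domain of \<open>A\<close> iff \<open>m \<cdot> U f\<close> is in \<open>L\<^sup>2(N)\<close>. For separable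
  \<open>L\<^sup>2(M)\<close> the space \<open>nat \<times> real\<close> carries enough measures \<open>N\<close>, since every self-adjoint operator is a
  countable direct sum of multiplications by the coordinate on spaces \<open>L\<^sup>2(\<real>, \<mu>\<^sub>n)\<close>.\<close>

definition spectral_rep ::
  "'a measure \<Rightarrow> (('a \<Rightarrow> complex) \<times> ('a \<Rightarrow> complex)) set \<Rightarrow> (nat \<times> real) measure \<Rightarrow>
   (('a \<Rightarrow> complex) \<Rightarrow> (nat \<times> real \<Rightarrow> complex)) \<Rightarrow> (nat \<times> real \<Rightarrow> real) \<Rightarrow> bool" where
  "spectral_rep M A N U m \<longleftrightarrow>
     sigma_finite_measure N \<and> m \<in> borel_measurable N \<and> l2_unitary M N U \<and> A \<subseteq> L2 M \<times> L2 M \<and>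
     (\<forall>f\<in>L2 M. \<forall>g\<in>L2 M.
        (f, g) \<in> A \<longleftrightarrow> (AE x in N. U g x = complex_of_real (m x) * U f x))"

text \<open>\<open>p(A) f\<close> for a real Borel function \<open>p\<close>; it does not depend on the spectral
  representation.\<close>

definition spectral_apply ::
  "'a measure \<Rightarrow> (('a \<Rightarrow> complex) \<times> ('a \<Rightarrow> complex)) set \<Rightarrow> (real \<Rightarrow> real) \<Rightarrow>
   ('a \<Rightarrow> complex) \<Rightarrow> ('a \<Rightarrow> complex)" where
  "spectral_apply M A p f =
     (SOME g. g \<in> L2 M \<and>
        (\<exists>N U m. spectral_rep M A N U m \<and>
           (AE x in N. U g x = complex_of_real (p (m x)) * U f x)))"


section \<open>Partial derivatives and Schwartz functions\<close>

definition partial_deriv ::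
  "'a::euclidean_space \<Rightarrow> ('a \<Rightarrow> complex) \<Rightarrow> 'a \<Rightarrow> complex" where
  "partial_deriv b f z = frechet_derivative f (at z) b"

definition smooth_fun :: "('a::euclidean_space \<Rightarrow> complex) \<Rightarrow> bool" where
  "smooth_fun f \<longleftrightarrow>
     (\<forall>bs. set bs \<subseteq> Basis \<longrightarrow> (\<forall>z. (foldr partial_deriv bs f) differentiable (at z)))"

text \<open>A multi-index is a function on the standard basis. The order in which the coordinates are
  enumerated is irrelevant for smooth functions.\<close>

definition basis_list :: "'a::euclidean_space list" where
  "basis_list = (SOME bs. distinct bs \<and> set bs = Basis)"

definition multi_deriv ::
  "('a::euclidean_space \<Rightarrow> nat) \<Rightarrow> ('a \<Rightarrow> complex) \<Rightarrow> 'a \<Rightarrow> complex" where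
  "multi_deriv \<alpha> f = foldr (\<lambda>b g. (partial_deriv b ^^ \<alpha> b) g) basis_list f"

definition monomial :: "('a::euclidean_space \<Rightarrow> nat) \<Rightarrow> 'a \<Rightarrow> real" where
  "monomial \<beta> z = (\<Prod>b\<in>Basis. (z \<bullet> b) ^ \<beta> b)"

definition schwartz :: "('a::euclidean_space \<Rightarrow> complex) set" where
  "schwartz = {f. smooth_fun f \<and>
     (\<forall>\<alpha> \<beta>. bounded (range (\<lambda>z. monomial \<beta> z *\<^sub>R multi_deriv \<alpha> f z)))}"

definition radial :: "('a::real_normed_vector \<Rightarrow> 'b) \<Rightarrow> bool" where
  "radial f \<longleftrightarrow> (\<forall>z w. norm z = norm w \<longrightarrow> f z = f w)"

text \<open>Multi-indices are normalised to vanish off the basis, so that each pair is counted once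
  and the set is finite.\<close>

definition multi_index_pairs ::
  "nat \<Rightarrow> (('a::euclidean_space \<Rightarrow> nat) \<times> ('a \<Rightarrow> nat)) set" where
  "multi_index_pairs N =
     {(\<alpha>, \<beta>). (\<forall>b. b \<notin> Basis \<longrightarrow> \<alpha> b = 0 \<and> \<beta> b = 0) \<and>
              (\<Sum>b\<in>Basis. \<alpha> b) + (\<Sum>b\<in>Basis. \<beta> b) \<le> N}"

lemma finite_multi_index_pairs: "finite (multi_index_pairs N)"
proof -
  let ?F = "{\<alpha>::'a \<Rightarrow> nat. \<forall>b. (b \<in> Basis \<longrightarrow> \<alpha> b \<in> {..N}) \<and> (b \<notin> Basis \<longrightarrow> \<alpha> b = 0)}"
  have "finite ?F"
    by (rule finite_set_of_finite_funs) auto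
  moreover have "\<alpha> b \<le> N" if "b \<in> Basis" "(\<Sum>b\<in>Basis. \<alpha> b) \<le> N" for \<alpha> :: "'a \<Rightarrow> nat" and b
    using member_le_sum[of b Basis \<alpha>] that by simp
  then have "multi_index_pairs N \<subseteq> ?F \<times> ?F"
    unfolding multi_index_pairs_def by fastforce
  ultimately show ?thesis
    by (meson finite_SigmaI finite_subset)
qed

definition sobolev_norm :: "nat \<Rightarrow> ('a::euclidean_space \<Rightarrow> complex) \<Rightarrow> real" where
  "sobolev_norm N f =
     (\<Sum>(\<alpha>, \<beta>)\<in>multi_index_pairs N.
        l2_norm lborel (multi_deriv \<alpha> (\<lambda>z. monomial \<beta> z *\<^sub>R f z)))"


section \<open>The scaled Hermite operator\<close>

definition hermite_expr :: "('a::euclidean_space \<Rightarrow> complex) \<Rightarrow> 'a \<Rightarrow> complex" where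
  "hermite_expr f z =
     - (\<Sum>b\<in>Basis. partial_deriv b (partial_deriv b f) z) + ((norm z)\<^sup>2 / 4) *\<^sub>R f z"

text \<open>The self-adjoint realisation on \<open>L\<^sup>2\<close>: the graph closure of \<open>-\<Delta> + |z|\<^sup>2/4\<close> on Schwartz
  functions, where this expression is essentially self-adjoint.\<close>

definition hermite_op :: "(('a::euclidean_space \<Rightarrow> complex) \<times> ('a \<Rightarrow> complex)) set" where
  "hermite_op =
     {(f, g). f \<in> L2 lborel \<and> g \<in> L2 lborel \<and>
        (\<exists>\<phi>. (\<forall>n. \<phi> n \<in> schwartz) \<and>
             (\<lambda>n. l2_norm lborel (\<lambda>z. \<phi> n z - f z)) \<longlonglongrightarrow> 0 \<and>
             (\<lambda>n. l2_norm lborel (\<lambda>z. hermite_expr (\<phi> n) z - g z)) \<longlonglongrightarrow> 0)}"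


section \<open>Weyl operators\<close>

text \<open>Phase space \<open>\<real>\<^bsup>2d\<^esup>\<close> is \<open>(real ^ 'n) \<times> (real ^ 'n)\<close> with \<open>d = CARD('n)\<close>; its norm and
  inner product are the Euclidean ones.\<close>

definition symp :: "(real ^ 'n) \<times> (real ^ 'n) \<Rightarrow> (real ^ 'n) \<times> (real ^ 'n) \<Rightarrow> real" where
  "symp w z = snd w \<bullet> fst z - fst w \<bullet> snd z"

definition symp_fourier ::
  "((real ^ 'n) \<times> (real ^ 'n) \<Rightarrow> complex) \<Rightarrow> (real ^ 'n) \<times> (real ^ 'n) \<Rightarrow> complex" where
  "symp_fourier F w =
     (1 / (2 * pi) ^ CARD('n)) *\<^sub>R (LINT z|lborel. F z * exp (- \<i> * complex_of_real (symp w z)))"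

definition rho ::
  "(real ^ 'n) \<times> (real ^ 'n) \<Rightarrow> (real ^ 'n \<Rightarrow> complex) \<Rightarrow> real ^ 'n \<Rightarrow> complex" where
  "rho z g t = (case z of (x, \<xi>) \<Rightarrow>
     exp (- (\<i> / 2) * complex_of_real (x \<bullet> \<xi>)) * exp (\<i> * complex_of_real (t \<bullet> \<xi>)) * g (t - x))"

text \<open>For integrable \<open>F\<close> and \<open>g\<close> in \<open>L\<^sup>2\<close> the integral below converges absolutely for almost
  every \<open>t\<close> and represents the \<open>L\<^sup>2\<close>-valued integral of \<open>F(z) \<rho>(z) g\<close>.\<close>

definition rho_int ::
  "((real ^ 'n) \<times> (real ^ 'n) \<Rightarrow> complex) \<Rightarrow> (real ^ 'n \<Rightarrow> complex) \<Rightarrow> real ^ 'n \<Rightarrow> complex" where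
  "rho_int F g t = (1 / (2 * pi) ^ CARD('n)) *\<^sub>R (LINT z|lborel. F z * rho z g t)"

definition weyl_op ::
  "((real ^ 'n) \<times> (real ^ 'n) \<Rightarrow> complex) \<Rightarrow> (real ^ 'n \<Rightarrow> complex) \<Rightarrow> real ^ 'n \<Rightarrow> complex" where
  "weyl_op a = rho_int (symp_fourier a)"

end

theory Submission
  imports Defs "HOL-Probability.Probability"
begin

text \<open>Let \<open>h\<^sub>\<alpha>\<close> be the Hermite basis of \<open>L\<^sup>2(\<real>\<^bsup>d\<^esup>)\<close>. The matrix coefficients
  \<open>z \<mapsto> \<langle>\<rho>(z) h\<^sub>\<alpha>, h\<^sub>\<beta>\<rangle>\<close> are, up to conjugation and a constant, the special Hermite functions
  \<open>\<Phi>\<^sub>\<alpha>\<^sub>\<beta>\<close>, an orthonormal basis of \<open>L\<^sup>2(\<real>\<^bsup>2d\<^esup>)\<close> of eigenfunctions of \<open>-\<Delta> + |z|\<^sup>2/4\<close> with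
  eigenvalues \<open>|\<alpha>| + |\<beta>| + d\<close>. A radial \<open>f\<close> is invariant under the rotations in each
  plane \<open>(x\<^sub>i, \<xi>\<^sub>i)\<close>, so \<open>\<langle>f, \<Phi>\<^sub>\<alpha>\<^sub>\<beta>\<rangle> = 0\<close> for \<open>\<alpha> \<noteq> \<beta>\<close>. Hence \<open>\<rho>(f)\<close> is diagonal in the Hermite
  basis and its trace norm is a multiple of \<open>\<Sum>\<^sub>\<alpha> |\<langle>f, \<Phi>\<^sub>\<alpha>\<^sub>\<alpha>\<rangle>|\<close>. By Cauchy-Schwarz with the
  weights \<open>(1 + 2|\<alpha>| + d)\<^bsup>s/2\<^esup>\<close> this is at most a constant times the norm of
  \<open>(1 + H)\<^bsup>s/2\<^esup> f\<close>, since \<open>\<Sum>\<^sub>\<alpha> (1 + 2|\<alpha>| + d)\<^bsup>-s\<^esup>\<close> converges already for \<open>s > d\<close>.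

  For the Sobolev norm the weighted coefficient sum is bounded directly. The operator
  \<open>\<partial>\<^sub>b + z\<^sub>b/2\<close> is half the difference of two commuting annihilation operators. Pairing its \<open>N\<close>-th power on
  a radial \<open>f\<close> with \<open>\<Phi>\<^sub>\<alpha>\<^sub>\<beta>\<close>, where \<open>\<beta> = \<alpha> - N e\<^sub>i\<close>, leaves a single term, which is
  \<open>\<langle>f, \<Phi>\<^sub>\<alpha>\<^sub>\<alpha>\<rangle>\<close> times the square root of about \<open>\<alpha>\<^sub>i\<^bsup>N\<^esup>\<close>; Bessel's inequality then gives
  \<open>\<Sum>\<^sub>\<alpha> \<alpha>\<^sub>i\<^bsup>N\<^esup> |\<langle>f, \<Phi>\<^sub>\<alpha>\<^sub>\<alpha>\<rangle>|\<^sup>2 < \<infinity>\<close> using only \<open>N\<close> derivatives and coordinates in the direction \<open>b\<close>.\<close>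

section \<open>Hilbert space structure of \<open>L\<^sup>2\<close>\<close>

text \<open>The Sobolev estimate is not deduced from the spectral one: for odd \<open>d\<close> the
  exponent \<open>(d + 2) / 2\<close> is not an integer, and bounding a fractional power by
  derivatives and coordinates would need interpolation. The direct bound by integer powers of a
  first-order operator avoids this and has a second use: \<open>spectral_apply\<close> is a choice
  that is controlled only if \<open>f\<close> lies in the domain of the power, and the bound with an
  integer exponent above \<open>s\<close> supplies that membership.

  The trace norm is evaluated at a chosen absolute value and a chosen basis, so the estimate must
  hold for every choice.

  Both Hermite systems are kept unnormalised and given by recursions, which makes derivatives,
  eigenvalues and ladder relations finite algebra. A Gaussian ground state, closure under
  coordinates and derivatives, and a ladder relation then yield orthogonality, norms and
  completeness for both alike. The symplectic Fourier transform enters only through its inversion,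
  which turns the Weyl operator into \<open>rho_int f\<close>.\<close>

lemma L2_measurable: "f \<in> L2 M \<Longrightarrow> f \<in> borel_measurable M"
  by (simp add: L2_def)

lemma L2_integrable_square: "f \<in> L2 M \<Longrightarrow> integrable M (\<lambda>x. (cmod (f x))\<^sup>2)"
  by (simp add: L2_def)

lemma two_mult_le_squares: "2 * (a * b) \<le> a\<^sup>2 + (b::real)\<^sup>2"
  using sum_squares_bound[of a b] by simp

lemma integrable_L2_mult:
  assumes f: "f \<in> L2 M" and g: "g \<in> L2 M"
  shows "integrable M (\<lambda>x. f x * g x)"
proof (rule Bochner_Integration.integrable_bound)
  show "integrable M (\<lambda>x. (cmod (f x))\<^sup>2 + (cmod (g x))\<^sup>2)"
    using f g by (simp add: L2_integrable_square)
  show "(\<lambda>x. f x * g x) \<in> borel_measurable M"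
    using L2_measurable[OF f] L2_measurable[OF g] by measurable
  show "AE x in M. norm (f x * g x) \<le> norm ((cmod (f x))\<^sup>2 + (cmod (g x))\<^sup>2)"
  proof (rule AE_I2)
    fix x
    have "0 \<le> cmod (f x) * cmod (g x)" by simp
    then have "cmod (f x) * cmod (g x) \<le> (cmod (f x))\<^sup>2 + (cmod (g x))\<^sup>2"
      using two_mult_le_squares[of "cmod (f x)" "cmod (g x)"] by linarith
    then show "norm (f x * g x) \<le> norm ((cmod (f x))\<^sup>2 + (cmod (g x))\<^sup>2)"
      by (simp add: norm_mult)
  qed
qed

lemma borel_measurable_cnj:
  "f \<in> borel_measurable M \<Longrightarrow> (\<lambda>x. cnj (f x)) \<in> borel_measurable M"
  by (rule measurable_compose[OF _ borel_measurable_continuous_onI[OF continuous_on_cnj[OF continuous_on_id]]])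

lemma complex_of_real_cmod_square: "complex_of_real ((cmod z)\<^sup>2) = z * cnj z"
  using complex_norm_square by simp

lemma L2_cnj: "f \<in> L2 M \<Longrightarrow> (\<lambda>x. cnj (f x)) \<in> L2 M"
  by (auto simp: L2_def intro: borel_measurable_cnj)

lemma integrable_L2_inner: "f \<in> L2 M \<Longrightarrow> g \<in> L2 M \<Longrightarrow> integrable M (\<lambda>x. f x * cnj (g x))"
  using integrable_L2_mult[OF _ L2_cnj] by blast

lemma L2_add:
  assumes f: "f \<in> L2 M" and g: "g \<in> L2 M"
  shows "(\<lambda>x. f x + g x) \<in> L2 M"
proof -
  have m: "(\<lambda>x. f x + g x) \<in> borel_measurable M"
    using L2_measurable[OF f] L2_measurable[OF g] by measurable
  have "integrable M (\<lambda>x. (cmod (f x + g x))\<^sup>2)"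
  proof (rule Bochner_Integration.integrable_bound)
    show "integrable M (\<lambda>x. 2 * ((cmod (f x))\<^sup>2 + (cmod (g x))\<^sup>2))"
      using f g by (simp add: L2_integrable_square)
    show "(\<lambda>x. (cmod (f x + g x))\<^sup>2) \<in> borel_measurable M" using m by measurable
    show "AE x in M. norm ((cmod (f x + g x))\<^sup>2) \<le> norm (2 * ((cmod (f x))\<^sup>2 + (cmod (g x))\<^sup>2))"
    proof (rule AE_I2)
      fix x
      have "(cmod (f x + g x))\<^sup>2 \<le> (cmod (f x) + cmod (g x))\<^sup>2"
        by (simp add: norm_triangle_ineq power_mono)
      also have "\<dots> \<le> 2 * ((cmod (f x))\<^sup>2 + (cmod (g x))\<^sup>2)"
        using two_mult_le_squares[of "cmod (f x)" "cmod (g x)"] by (simp add: power2_sum)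
      finally show "norm ((cmod (f x + g x))\<^sup>2) \<le> norm (2 * ((cmod (f x))\<^sup>2 + (cmod (g x))\<^sup>2))"
        by simp
    qed
  qed
  then show ?thesis using m by (simp add: L2_def)
qed

lemma L2_scale: "f \<in> L2 M \<Longrightarrow> (\<lambda>x. c * f x) \<in> L2 M"
  by (auto simp: L2_def norm_mult power_mult_distrib)

lemma L2_diff:
  assumes "f \<in> L2 M" "g \<in> L2 M"
  shows "(\<lambda>x. f x - g x) \<in> L2 M"
  using L2_add[OF assms(1) L2_scale[OF assms(2), of "-1"]] by simp

lemma L2_zero: "(\<lambda>x. 0) \<in> L2 M"
  by (simp add: L2_def)

lemma L2_sum: "(\<And>i. i \<in> I \<Longrightarrow> f i \<in> L2 M) \<Longrightarrow> (\<lambda>x. \<Sum>i\<in>I. f i x) \<in> L2 M"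
  by (induction I rule: infinite_finite_induct) (auto simp: L2_zero L2_add)

lemma l2_inner_cong_AE:
  assumes "f \<in> L2 M" "f' \<in> L2 M" "g \<in> L2 M" "g' \<in> L2 M"
    and "AE x in M. f x = f' x" "AE x in M. g x = g' x"
  shows "l2_inner M f g = l2_inner M f' g'"
  unfolding l2_inner_def
proof (rule integral_cong_AE)
  show "(\<lambda>x. f x * cnj (g x)) \<in> borel_measurable M" "(\<lambda>x. f' x * cnj (g' x)) \<in> borel_measurable M"
    using assms(1-4) integrable_L2_inner borel_measurable_integrable by blast+
  show "AE x in M. f x * cnj (g x) = f' x * cnj (g' x)"
    using assms(5,6) by eventually_elim simp
qed

lemma l2_norm_cong_AE:
  assumes "f \<in> L2 M" "f' \<in> L2 M" and "AE x in M. f x = f' x"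
  shows "l2_norm M f = l2_norm M f'"
proof -
  have "(LINT x|M. (cmod (f x))\<^sup>2) = (LINT x|M. (cmod (f' x))\<^sup>2)"
    using assms by (intro integral_cong_AE) (auto simp: L2_def)
  then show ?thesis by (simp add: l2_norm_def)
qed

lemma l2_inner_add_left:
  "f \<in> L2 M \<Longrightarrow> g \<in> L2 M \<Longrightarrow> h \<in> L2 M \<Longrightarrow>
    l2_inner M (\<lambda>x. f x + g x) h = l2_inner M f h + l2_inner M g h"
  by (simp add: l2_inner_def integrable_L2_inner distrib_right)

lemma l2_inner_cnj: "cnj (l2_inner M f g) = l2_inner M g f"
proof -
  have "cnj (l2_inner M f g) = (LINT x|M. cnj (f x * cnj (g x)))"
    unfolding l2_inner_def
    by (rule integral_bounded_linear'[OF bounded_linear_cnj bounded_linear_cnj, symmetric]) simp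
  then show ?thesis by (simp add: l2_inner_def mult.commute)
qed

lemma l2_inner_commute: "l2_inner M f g = cnj (l2_inner M g f)"
  by (simp add: l2_inner_cnj)

lemma l2_inner_scale_left: "l2_inner M (\<lambda>x. c * f x) h = c * l2_inner M f h"
  by (simp add: l2_inner_def mult.assoc)

lemma l2_inner_scale_right: "l2_inner M f (\<lambda>x. c * h x) = cnj c * l2_inner M f h"
  by (subst l2_inner_commute) (simp add: l2_inner_scale_left l2_inner_cnj)

lemma l2_inner_add_right:
  "f \<in> L2 M \<Longrightarrow> g \<in> L2 M \<Longrightarrow> h \<in> L2 M \<Longrightarrow>
    l2_inner M h (\<lambda>x. f x + g x) = l2_inner M h f + l2_inner M h g"
  by (subst l2_inner_commute) (simp add: l2_inner_add_left l2_inner_cnj)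

lemma l2_inner_zero_left [simp]: "l2_inner M (\<lambda>x. 0) h = 0"
  by (simp add: l2_inner_def)

lemma l2_inner_zero_right [simp]: "l2_inner M h (\<lambda>x. 0) = 0"
  by (simp add: l2_inner_def)

lemma l2_inner_diff_left:
  "f \<in> L2 M \<Longrightarrow> g \<in> L2 M \<Longrightarrow> h \<in> L2 M \<Longrightarrow>
    l2_inner M (\<lambda>x. f x - g x) h = l2_inner M f h - l2_inner M g h"
  by (simp add: l2_inner_def integrable_L2_inner left_diff_distrib)

lemma l2_inner_diff_right:
  "f \<in> L2 M \<Longrightarrow> g \<in> L2 M \<Longrightarrow> h \<in> L2 M \<Longrightarrow>
    l2_inner M h (\<lambda>x. f x - g x) = l2_inner M h f - l2_inner M h g"
  by (subst l2_inner_commute) (simp add: l2_inner_diff_left l2_inner_cnj)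

lemma l2_inner_sum_left:
  "(\<And>i. i \<in> I \<Longrightarrow> f i \<in> L2 M) \<Longrightarrow> h \<in> L2 M \<Longrightarrow>
    l2_inner M (\<lambda>x. \<Sum>i\<in>I. f i x) h = (\<Sum>i\<in>I. l2_inner M (f i) h)"
  by (induction I rule: infinite_finite_induct)
    (auto simp: l2_inner_add_left L2_sum)

lemma l2_inner_self: "l2_inner M f f = complex_of_real ((l2_norm M f)\<^sup>2)"
proof -
  have "l2_inner M f f = (LINT x|M. complex_of_real ((cmod (f x))\<^sup>2))"
    unfolding l2_inner_def by (simp only: complex_of_real_cmod_square)
  also have "\<dots> = complex_of_real (LINT x|M. (cmod (f x))\<^sup>2)"
    by (rule integral_complex_of_real)
  finally show ?thesis by (simp add: l2_norm_def)
qed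

lemma l2_norm_nonneg [simp]: "0 \<le> l2_norm M f"
  by (simp add: l2_norm_def)

lemma l2_norm_scale: "l2_norm M (\<lambda>x. c * f x) = cmod c * l2_norm M f"
  by (simp add: l2_norm_def norm_mult power_mult_distrib real_sqrt_mult)

lemma l2_norm_eq_0_iff:
  assumes "f \<in> L2 M"
  shows "l2_norm M f = 0 \<longleftrightarrow> (AE x in M. f x = 0)"
  using integral_nonneg_eq_0_iff_AE[OF L2_integrable_square[OF assms]]
  by (simp add: l2_norm_def)

lemma l2_norm_sq_add:
  assumes "f \<in> L2 M" "g \<in> L2 M"
  shows "(l2_norm M (\<lambda>x. f x + g x))\<^sup>2 = (l2_norm M f)\<^sup>2 + (l2_norm M g)\<^sup>2 + 2 * Re (l2_inner M f g)"
proof -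
  have "complex_of_real ((l2_norm M (\<lambda>x. f x + g x))\<^sup>2) =
     l2_inner M f f + l2_inner M g g + (l2_inner M f g + cnj (l2_inner M f g))"
    unfolding l2_inner_self[symmetric] l2_inner_cnj
    using assms by (simp add: l2_inner_add_left l2_inner_add_right L2_add)
  also have "\<dots> = complex_of_real ((l2_norm M f)\<^sup>2 + (l2_norm M g)\<^sup>2 + 2 * Re (l2_inner M f g))"
    by (simp add: l2_inner_self complex_add_cnj)
  finally show ?thesis by (simp only: of_real_eq_iff)
qed

lemma l2_Cauchy_Schwarz:
  assumes f: "f \<in> L2 M" and g: "g \<in> L2 M"
  shows "cmod (l2_inner M f g) \<le> l2_norm M f * l2_norm M g"
proof (cases "l2_norm M g = 0")
  case True
  then have "AE x in M. g x = 0" using l2_norm_eq_0_iff[OF g] by simp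
  then have "l2_inner M f g = l2_inner M f (\<lambda>x. 0)"
    by (intro l2_inner_cong_AE) (auto simp: f g L2_zero)
  then show ?thesis by simp
next
  case False
  then have pos: "0 < (l2_norm M g)\<^sup>2" by simp
  \<comment> \<open>The minimiser of the norm of \<open>f + c g\<close>; for it, nonnegativity of
    the squared norm is the inequality.\<close>
  define c where "c = - l2_inner M f g / complex_of_real ((l2_norm M g)\<^sup>2)"
  have "0 \<le> (l2_norm M (\<lambda>x. f x + c * g x))\<^sup>2" by simp
  also have "\<dots> = (l2_norm M f)\<^sup>2 + (cmod c * l2_norm M g)\<^sup>2 + 2 * Re (cnj c * l2_inner M f g)"
    by (simp add: l2_norm_sq_add f g L2_scale l2_norm_scale l2_inner_scale_right)
  also have "cnj c * l2_inner M f g = - complex_of_real ((cmod (l2_inner M f g))\<^sup>2 / (l2_norm M g)\<^sup>2)"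
    by (simp add: c_def complex_norm_square mult.commute del: of_real_power)
  also have "cmod c * l2_norm M g = cmod (l2_inner M f g) / l2_norm M g"
    using False by (simp add: c_def norm_divide power2_eq_square norm_mult)
  finally have "(cmod (l2_inner M f g))\<^sup>2 / (l2_norm M g)\<^sup>2 \<le> (l2_norm M f)\<^sup>2"
    by (simp add: power_divide)
  then have "(cmod (l2_inner M f g))\<^sup>2 \<le> (l2_norm M f * l2_norm M g)\<^sup>2"
    using pos by (simp add: divide_le_eq power_mult_distrib)
  then show ?thesis
    by (rule power2_le_imp_le) simp
qed

lemma l2_norm_triangle:
  assumes f: "f \<in> L2 M" and g: "g \<in> L2 M"
  shows "l2_norm M (\<lambda>x. f x + g x) \<le> l2_norm M f + l2_norm M g"
proof (rule power2_le_imp_le)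
  have "Re (l2_inner M f g) \<le> l2_norm M f * l2_norm M g"
    using l2_Cauchy_Schwarz[OF f g] complex_Re_le_cmod order_trans by blast
  then show "(l2_norm M (\<lambda>x. f x + g x))\<^sup>2 \<le> (l2_norm M f + l2_norm M g)\<^sup>2"
    by (simp add: l2_norm_sq_add f g power2_sum)
qed simp

lemma l2_norm_minus: "l2_norm M (\<lambda>x. f x - g x) = l2_norm M (\<lambda>x. g x - f x)"
  by (simp add: l2_norm_def norm_minus_commute)

lemma l2_inner_tendsto_left:
  assumes "\<And>n. F n \<in> L2 M" "f \<in> L2 M" "h \<in> L2 M"
    and "(\<lambda>n. l2_norm M (\<lambda>x. F n x - f x)) \<longlonglongrightarrow> 0"
  shows "(\<lambda>n. l2_inner M (F n) h) \<longlonglongrightarrow> l2_inner M f h"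
proof (rule Lim_null[THEN iffD2], rule Lim_null_comparison)
  show "\<forall>\<^sub>F n in sequentially.
      norm (l2_inner M (F n) h - l2_inner M f h) \<le> l2_norm M (\<lambda>x. F n x - f x) * l2_norm M h"
    using l2_Cauchy_Schwarz[OF L2_diff[OF assms(1,2)] assms(3)] assms(1-3)
    by (simp add: l2_inner_diff_left)
  show "(\<lambda>n. l2_norm M (\<lambda>x. F n x - f x) * l2_norm M h) \<longlonglongrightarrow> 0"
    using assms(4) by (rule tendsto_mult_left_zero)
qed

section \<open>Completeness of \<open>L\<^sup>2\<close>\<close>

lemma nn_integral_square_l2_norm:
  assumes "f \<in> L2 M"
  shows "(\<integral>\<^sup>+x. ennreal ((cmod (f x))\<^sup>2) \<partial>M) = ennreal ((l2_norm M f)\<^sup>2)"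
  by (subst nn_integral_eq_integral[OF L2_integrable_square[OF assms]]) (simp_all add: l2_norm_def)

text \<open>Extended integrals require no prior integrability, so one bound gives membership and the
  norm estimate together. It serves functions known only as limits or as parameter
  integrals.\<close>

lemma L2_nn_integral:
  assumes m: "f \<in> borel_measurable M"
    and le: "(\<integral>\<^sup>+x. ennreal ((cmod (f x))\<^sup>2) \<partial>M) \<le> ennreal (K\<^sup>2)" and K: "0 \<le> K"
  shows "f \<in> L2 M" "l2_norm M f \<le> K"
proof -
  have "(\<integral>\<^sup>+x. ennreal (norm ((cmod (f x))\<^sup>2)) \<partial>M) < \<infinity>"
    using le by (simp add: le_less_trans)
  then have "integrable M (\<lambda>x. (cmod (f x))\<^sup>2)"
    using m by (intro integrableI_bounded) auto
  then show *: "f \<in> L2 M" using m by (simp add: L2_def)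
  show "l2_norm M f \<le> K"
    using le nn_integral_square_l2_norm[OF *] K by (simp add: ennreal_le_iff)
qed

text \<open>Riesz-Fischer: a subsequence with geometrically small gaps converges almost everywhere,
  and Fatou carries the Cauchy estimate over to the pointwise limit.\<close>

lemma L2_complete:
  assumes F: "\<And>n. F n \<in> L2 M"
    and cauchy: "\<And>e. e > 0 \<Longrightarrow> \<exists>N. \<forall>m\<ge>N. \<forall>n\<ge>N. l2_norm M (\<lambda>x. F m x - F n x) < e"
  shows "\<exists>f\<in>L2 M. (\<lambda>n. l2_norm M (\<lambda>x. F n x - f x)) \<longlonglongrightarrow> 0"
proof -
  have "\<exists>N. \<forall>m\<ge>N. \<forall>n\<ge>N. l2_norm M (\<lambda>x. F m x - F n x) < (1/2)^k" for k :: nat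
    using cauchy by simp
  then obtain N where N: "\<And>k m n. m \<ge> N k \<Longrightarrow> n \<ge> N k \<Longrightarrow> l2_norm M (\<lambda>x. F m x - F n x) < (1/2::real)^k"
    by metis
  \<comment> \<open>Summing the thresholds up to \<open>k\<close> makes \<open>r\<close> monotone
    and at least \<open>N k\<close> although the \<open>N i\<close> need not be ordered; the summand
    \<open>k\<close> makes it unbounded.\<close>
  define r where "r k = (\<Sum>i\<le>k. N i) + k" for k
  have rN: "N k \<le> r k" for k
    unfolding r_def by (metis atMost_iff finite_atMost le_add1 le_trans member_le_sum order_refl zero_le)
  have rk: "k \<le> r k" and rS: "r k \<le> r (Suc k)" for k by (simp_all add: r_def)
  have FM [measurable]: "F n \<in> borel_measurable M" for n by (rule L2_measurable[OF F])
  define D where "D k x = cmod (F (r (Suc k)) x - F (r k) x)" for k x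
  have Dm [measurable]: "D k \<in> borel_measurable M" for k unfolding D_def by measurable
  have "l2_norm M (\<lambda>x. F (r (Suc k)) x - F (r k) x) \<le> (1/2)^k" for k
    using N[of k "r (Suc k)" "r k"] rN[of k] rS[of k] by simp
  then have sq: "(l2_norm M (\<lambda>x. F (r (Suc k)) x - F (r k) x))\<^sup>2 \<le> ((1/2)^k)\<^sup>2" for k
    by (intro power_mono) simp_all
  have "((1/2)^k)\<^sup>2 = ((1/4)^k :: real)" for k
    by (simp add: power2_eq_square power_mult_distrib[symmetric])
  with sq have D4: "(\<integral>\<^sup>+x. ennreal ((D k x)\<^sup>2) \<partial>M) \<le> ennreal ((1/4)^k)" for k
    unfolding D_def nn_integral_square_l2_norm[OF L2_diff[OF F F]] by (metis ennreal_leI)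
  have "(\<integral>\<^sup>+x. (\<Sum>k. ennreal (2^k * (D k x)\<^sup>2)) \<partial>M) = (\<Sum>k. \<integral>\<^sup>+x. ennreal (2^k * (D k x)\<^sup>2) \<partial>M)"
    by (rule nn_integral_suminf) measurable
  also have "\<dots> \<le> (\<Sum>k. ennreal ((1/2)^k))"
  proof (intro suminf_le summableI)
    fix k
    have "(\<integral>\<^sup>+x. ennreal (2^k * (D k x)\<^sup>2) \<partial>M) = ennreal (2^k) * (\<integral>\<^sup>+x. ennreal ((D k x)\<^sup>2) \<partial>M)"
      by (simp add: ennreal_mult' nn_integral_cmult)
    also have "\<dots> \<le> ennreal (2^k) * ennreal ((1/4)^k)" by (intro mult_left_mono D4) simp
    also have "\<dots> = ennreal ((1/2)^k)"
      by (subst ennreal_mult'[symmetric]) (simp_all add: power_mult_distrib[symmetric])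
    finally show "(\<integral>\<^sup>+x. ennreal (2^k * (D k x)\<^sup>2) \<partial>M) \<le> ennreal ((1/2)^k)" .
  qed
  also have "\<dots> < \<infinity>"
    by (simp add: suminf_ennreal2 summable_geometric less_top[symmetric])
  finally have fin: "(\<integral>\<^sup>+x. (\<Sum>k. ennreal (2^k * (D k x)\<^sup>2)) \<partial>M) \<noteq> \<infinity>" by simp
  have "AE x in M. (\<Sum>k. ennreal (2^k * (D k x)\<^sup>2)) \<noteq> \<infinity>"
    by (rule nn_integral_noteq_infinite[OF _ fin]) measurable
  then have conv: "AE x in M. convergent (\<lambda>k. F (r k) x)"
  proof eventually_elim
    case (elim x)
    \<comment> \<open>The squared gaps integrate to at most 4^-k, so the weight 2^k still leaves a
      finite sum almost everywhere. Boundedness of its terms puts the gaps themselves below a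
      multiple of 2^(-k/2), which is summable.\<close>
    have sm: "summable (\<lambda>k. 2^k * (D k x)\<^sup>2)"
      by (rule summable_suminf_not_top) (use elim in auto)
    then obtain B where B: "\<And>k. norm (2^k * (D k x)\<^sup>2) \<le> B"
      using BseqE[OF summable_imp_Bseq[OF sm]] by blast
    have Dle: "D k x \<le> sqrt B * (1 / sqrt 2)^k" for k
    proof -
      have "(D k x)\<^sup>2 \<le> B / 2^k" using B[of k] by (simp add: field_simps)
      then have "D k x \<le> sqrt (B / 2^k)" by (simp add: D_def real_le_rsqrt)
      then show ?thesis by (simp add: real_sqrt_divide real_sqrt_power power_divide)
    qed
    have "summable (\<lambda>k. sqrt B * (1 / sqrt 2)^k)"
      by (intro summable_mult summable_geometric) simp
    then have "summable (\<lambda>k. norm (F (r (Suc k)) x - F (r k) x))"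
      by (rule summable_comparison_test') (use Dle in \<open>simp add: D_def\<close>)
    then have "summable (\<lambda>k. F (r (Suc k)) x - F (r k) x)" by (rule summable_norm_cancel)
    then have "convergent (\<lambda>n. \<Sum>k<n. F (r (Suc k)) x - F (r k) x)" by (simp add: summable_iff_convergent)
    then have "convergent (\<lambda>n. F (r n) x - F (r 0) x)" by (simp only: sum_lessThan_telescope[of "\<lambda>k. F (r k) x"])
    then have "convergent (\<lambda>n. (F (r n) x - F (r 0) x) + F (r 0) x)"
      by (intro convergent_add convergent_const)
    then show ?case by simp
  qed
  define f where "f x = lim (\<lambda>k. F (r k) x)" for x
  have fm [measurable]: "f \<in> borel_measurable M" unfolding f_def by measurable
  have lim: "AE x in M. (\<lambda>k. F (r k) x) \<longlonglongrightarrow> f x"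
    using conv by eventually_elim (simp add: f_def convergent_LIMSEQ_iff)
  \<comment> \<open>Fatou in the subsequence index \<open>j\<close>, with \<open>n\<close> held
    fixed.\<close>
  have est: "(\<integral>\<^sup>+x. ennreal ((cmod (F n x - f x))\<^sup>2) \<partial>M) \<le> ennreal (((1/2)^k)\<^sup>2)" if "n \<ge> N k" for n k
  proof -
    have "(\<integral>\<^sup>+x. ennreal ((cmod (F n x - f x))\<^sup>2) \<partial>M)
        = (\<integral>\<^sup>+x. liminf (\<lambda>j. ennreal ((cmod (F n x - F (r j) x))\<^sup>2)) \<partial>M)"
    proof (rule nn_integral_cong_AE)
      show "AE x in M. ennreal ((cmod (F n x - f x))\<^sup>2) = liminf (\<lambda>j. ennreal ((cmod (F n x - F (r j) x))\<^sup>2))"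
        using lim
      proof eventually_elim
        case (elim x)
        then have "(\<lambda>j. ennreal ((cmod (F n x - F (r j) x))\<^sup>2)) \<longlonglongrightarrow> ennreal ((cmod (F n x - f x))\<^sup>2)"
          by (intro tendsto_ennrealI tendsto_intros)
        then show ?case by (rule lim_imp_Liminf[OF sequentially_bot, symmetric])
      qed
    qed
    also have "\<dots> \<le> liminf (\<lambda>j. \<integral>\<^sup>+x. ennreal ((cmod (F n x - F (r j) x))\<^sup>2) \<partial>M)"
      by (rule nn_integral_liminf) measurable
    also have "\<dots> \<le> ennreal (((1/2)^k)\<^sup>2)"
    proof (rule Liminf_le, simp, rule eventually_sequentiallyI[of "N k"])
      fix j assume "j \<ge> N k"
      then have "l2_norm M (\<lambda>x. F n x - F (r j) x) \<le> (1/2)^k"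
        using N[of k n "r j"] that rk[of j] by simp
      then show "(\<integral>\<^sup>+x. ennreal ((cmod (F n x - F (r j) x))\<^sup>2) \<partial>M) \<le> ennreal (((1/2)^k)\<^sup>2)"
        using power_mono by (subst nn_integral_square_l2_norm[OF L2_diff[OF F F]])
          (simp add: ennreal_leI)
    qed
    finally show ?thesis .
  qed
  have d: "(\<lambda>x. F n x - f x) \<in> L2 M" "l2_norm M (\<lambda>x. F n x - f x) \<le> (1/2)^k" if "n \<ge> N k" for n k
    using L2_nn_integral[OF _ est[OF that]] by simp_all
  have "(\<lambda>x. F (N 0) x - (F (N 0) x - f x)) \<in> L2 M"
    by (rule L2_diff[OF F d(1)[where k=0]]) simp
  then have fL: "f \<in> L2 M" by simp
  have "(\<lambda>n. l2_norm M (\<lambda>x. F n x - f x)) \<longlonglongrightarrow> 0"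
  proof (rule LIMSEQ_I)
    fix e :: real assume "e > 0"
    then obtain k where "(1/2)^k < e" using real_arch_pow_inv[of e "1/2"] by auto
    then show "\<exists>no. \<forall>n\<ge>no. norm (l2_norm M (\<lambda>x. F n x - f x) - 0) < e"
      using d(2) by (intro exI[of _ "N k"]) fastforce
  qed
  with fL show ?thesis by blast
qed

section \<open>Orthonormal systems\<close>

text \<open>Unlike \<open>l2_onb\<close>, this allows any index type and asks for no completeness,
  so families indexed by multi-indices qualify directly.\<close>

definition l2_ons :: "'a measure \<Rightarrow> ('i \<Rightarrow> 'a \<Rightarrow> complex) \<Rightarrow> bool" where
  "l2_ons M e \<longleftrightarrow> (\<forall>i. e i \<in> L2 M) \<and> (\<forall>i j. l2_inner M (e i) (e j) = (if i = j then 1 else 0))"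

lemma l2_onsD:
  assumes "l2_ons M e"
  shows "e i \<in> L2 M" "l2_inner M (e i) (e j) = (if i = j then 1 else 0)"
  using assms by (auto simp: l2_ons_def)

lemma l2_onb_ons: "l2_onb M e \<Longrightarrow> l2_ons M e"
  by (simp add: l2_onb_def l2_ons_def)

lemma l2_ons_reindex: "l2_ons M e \<Longrightarrow> inj h \<Longrightarrow> l2_ons M (\<lambda>i. e (h i))"
  by (auto simp: l2_ons_def inj_eq)

lemma l2_ons_inner_sum:
  assumes e: "l2_ons M e" and "finite I"
  shows "l2_inner M (\<lambda>x. \<Sum>i\<in>I. c i * e i x) (e j) = (if j \<in> I then c j else 0)"
  using assms(2)
  by (simp add: l2_inner_sum_left L2_scale l2_onsD[OF e] l2_inner_scale_left if_distrib cong: if_cong)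

lemma l2_ons_norm_sum:
  assumes e: "l2_ons M e" and I: "finite I"
  shows "(l2_norm M (\<lambda>x. \<Sum>i\<in>I. c i * e i x))\<^sup>2 = (\<Sum>i\<in>I. (cmod (c i))\<^sup>2)"
proof -
  let ?S = "\<lambda>x. \<Sum>i\<in>I. c i * e i x"
  have S: "?S \<in> L2 M" by (intro L2_sum L2_scale l2_onsD[OF e])
  have "complex_of_real ((l2_norm M ?S)\<^sup>2) = (\<Sum>i\<in>I. l2_inner M (\<lambda>x. c i * e i x) ?S)"
    unfolding l2_inner_self[symmetric]
    by (subst l2_inner_sum_left) (auto intro!: L2_sum L2_scale l2_onsD[OF e])
  also have "\<dots> = (\<Sum>i\<in>I. c i * cnj (c i))"
  proof (intro sum.cong refl)
    fix i assume "i \<in> I"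
    then show "l2_inner M (\<lambda>x. c i * e i x) ?S = c i * cnj (c i)"
      by (simp add: l2_inner_scale_left l2_inner_commute[of M "e i"] l2_ons_inner_sum[OF e I])
  qed
  also have "\<dots> = complex_of_real (\<Sum>i\<in>I. (cmod (c i))\<^sup>2)"
    by (simp only: of_real_sum complex_of_real_cmod_square)
  finally show ?thesis by (simp only: of_real_eq_iff)
qed

lemma l2_Bessel:
  assumes e: "l2_ons M e" and I: "finite I" and f: "f \<in> L2 M"
  shows "(\<Sum>i\<in>I. (cmod (l2_inner M f (e i)))\<^sup>2) \<le> (l2_norm M f)\<^sup>2"
proof -
  let ?S = "\<lambda>x. \<Sum>i\<in>I. l2_inner M f (e i) * e i x"
  let ?s = "\<Sum>i\<in>I. (cmod (l2_inner M f (e i)))\<^sup>2"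
  have S: "?S \<in> L2 M" by (intro L2_sum L2_scale l2_onsD[OF e])
  have "l2_inner M ?S f = (\<Sum>i\<in>I. l2_inner M f (e i) * l2_inner M (e i) f)"
    by (subst l2_inner_sum_left) (auto intro!: L2_scale l2_onsD[OF e] f simp: l2_inner_scale_left)
  also have "\<dots> = complex_of_real ?s"
    by (simp only: of_real_sum complex_of_real_cmod_square l2_inner_cnj)
  finally have in1: "l2_inner M ?S f = complex_of_real ?s" .
  have "0 \<le> (l2_norm M (\<lambda>x. (-1) * ?S x + f x))\<^sup>2" by simp
  also have "\<dots> = ?s + (l2_norm M f)\<^sup>2 + 2 * Re (- complex_of_real ?s)"
    by (subst l2_norm_sq_add[OF L2_scale[OF S] f])
      (simp only: l2_norm_scale l2_inner_scale_left in1 power_mult_distrib l2_ons_norm_sum[OF e I], simp)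
  finally show ?thesis by simp
qed

lemma l2_Riesz_Fischer:
  assumes e: "l2_ons M e" and s: "summable (\<lambda>i::nat. (cmod (c i))\<^sup>2)"
  shows "\<exists>f\<in>L2 M. (\<lambda>n. l2_norm M (\<lambda>x. (\<Sum>i<n. c i * e i x) - f x)) \<longlonglongrightarrow> 0 \<and>
           (\<forall>i. l2_inner M f (e i) = c i)"
proof -
  define S where "S n x = (\<Sum>i<n. c i * e i x)" for n x
  have SL: "S n \<in> L2 M" for n unfolding S_def by (intro L2_sum L2_scale l2_onsD[OF e])
  have cs: "l2_norm M (\<lambda>x. S n x - S m x) = sqrt (\<Sum>i\<in>{m..<n}. (cmod (c i))\<^sup>2)" if "m \<le> n" for m n
  proof -
    have "S n x - S m x = (\<Sum>i\<in>{m..<n}. c i * e i x)" for x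
      unfolding S_def using sum_diff_nat_ivl[of 0 m n "\<lambda>i. c i * e i x"] that by (simp add: atLeast0LessThan)
    then have "(l2_norm M (\<lambda>x. S n x - S m x))\<^sup>2 = (\<Sum>i\<in>{m..<n}. (cmod (c i))\<^sup>2)"
      by (simp add: l2_ons_norm_sum[OF e])
    then show ?thesis by (metis l2_norm_nonneg real_sqrt_unique)
  qed
  have "\<exists>f\<in>L2 M. (\<lambda>n. l2_norm M (\<lambda>x. S n x - f x)) \<longlonglongrightarrow> 0"
  proof (rule L2_complete[OF SL])
    fix d :: real assume d: "d > 0"
    then have "d\<^sup>2 > 0" by simp
    with s obtain N where N: "\<And>m n. m \<ge> N \<Longrightarrow> norm (\<Sum>i\<in>{m..<n}. (cmod (c i))\<^sup>2) < d\<^sup>2"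
      unfolding summable_Cauchy by metis
    have lt: "l2_norm M (\<lambda>x. S n x - S m x) < d" if "N \<le> m" "m \<le> n" for m n
    proof -
      have "sqrt (\<Sum>i\<in>{m..<n}. (cmod (c i))\<^sup>2) < sqrt (d\<^sup>2)"
        using N[OF that(1), of n] by (simp only: real_sqrt_less_iff) (simp add: abs_of_nonneg sum_nonneg)
      then show ?thesis using cs[OF that(2)] d by simp
    qed
    have "l2_norm M (\<lambda>x. S m x - S n x) < d" if "N \<le> m" "N \<le> n" for m n
      using lt[of m n] lt[of n m] that l2_norm_minus[of M "S m" "S n"] by (metis nat_le_linear)
    then show "\<exists>N. \<forall>m\<ge>N. \<forall>n\<ge>N. l2_norm M (\<lambda>x. S m x - S n x) < d" by blast
  qed
  then obtain f where f: "f \<in> L2 M" and lim: "(\<lambda>n. l2_norm M (\<lambda>x. S n x - f x)) \<longlonglongrightarrow> 0" by blast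
  have "l2_inner M f (e j) = c j" for j
  proof -
    have "(\<lambda>n. l2_inner M (S n) (e j)) \<longlonglongrightarrow> l2_inner M f (e j)"
      by (rule l2_inner_tendsto_left[OF SL f l2_onsD(1)[OF e] lim])
    moreover have "(\<lambda>n. l2_inner M (S n) (e j)) \<longlonglongrightarrow> c j"
      by (rule tendsto_eventually, rule eventually_sequentiallyI[of "Suc j"])
        (simp add: S_def[abs_def] l2_ons_inner_sum[OF e])
    ultimately show ?thesis by (rule LIMSEQ_unique)
  qed
  with f lim show ?thesis unfolding S_def by blast
qed

lemma l2_coeffs_summable:
  assumes "l2_ons M e" "f \<in> L2 M"
  shows "summable (\<lambda>i::nat. (cmod (l2_inner M f (e i)))\<^sup>2)"
  by (rule summableI_nonneg_bounded[of _ "(l2_norm M f)\<^sup>2"]) (simp_all add: l2_Bessel[OF assms(1) _ assms(2)])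

text \<open>Riesz-Fischer provides some limit \<open>h\<close> with the same coefficients as
  \<open>f\<close>; completeness of the basis, applied to \<open>h - f\<close>, identifies the
  two.\<close>

lemma l2_onb_expansion:
  assumes e: "l2_onb M e" and f: "f \<in> L2 M"
  shows "(\<lambda>n. l2_norm M (\<lambda>x. (\<Sum>i<n. l2_inner M f (e i) * e i x) - f x)) \<longlonglongrightarrow> 0"
proof -
  note ons = l2_onb_ons[OF e]
  obtain h where h: "h \<in> L2 M"
    and lim: "(\<lambda>n. l2_norm M (\<lambda>x. (\<Sum>i<n. l2_inner M f (e i) * e i x) - h x)) \<longlonglongrightarrow> 0"
    and c: "\<And>i. l2_inner M h (e i) = l2_inner M f (e i)"
    using l2_Riesz_Fischer[OF ons l2_coeffs_summable[OF ons f]] by blast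
  have "l2_inner M (\<lambda>x. h x - f x) (e i) = 0" for i
    by (simp add: l2_inner_diff_left h f l2_onsD[OF ons] c)
  then have ae: "AE x in M. h x - f x = 0"
    using e L2_diff[OF h f] unfolding l2_onb_def by blast
  have "l2_norm M (\<lambda>x. (\<Sum>i<n. l2_inner M f (e i) * e i x) - h x)
      = l2_norm M (\<lambda>x. (\<Sum>i<n. l2_inner M f (e i) * e i x) - f x)" for n
    by (rule l2_norm_cong_AE) (use ae in \<open>auto intro!: L2_diff L2_sum L2_scale l2_onsD[OF ons] h f\<close>)
  with lim show ?thesis by simp
qed

lemma l2_onb_Parseval:
  assumes e: "l2_onb M e" and f: "f \<in> L2 M" and h: "h \<in> L2 M"
  shows "(\<lambda>i. l2_inner M f (e i) * l2_inner M (e i) h) sums l2_inner M f h"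
proof -
  note ons = l2_onb_ons[OF e]
  have "(\<lambda>n. l2_inner M (\<lambda>x. \<Sum>i<n. l2_inner M f (e i) * e i x) h) \<longlonglongrightarrow> l2_inner M f h"
    by (rule l2_inner_tendsto_left[OF _ f h l2_onb_expansion[OF e f]])
      (intro L2_sum L2_scale l2_onsD[OF ons])
  moreover have "l2_inner M (\<lambda>x. \<Sum>i<n. l2_inner M f (e i) * e i x) h
      = (\<Sum>i<n. l2_inner M f (e i) * l2_inner M (e i) h)" for n
    by (subst l2_inner_sum_left) (auto intro!: L2_scale l2_onsD[OF ons] h simp: l2_inner_scale_left)
  ultimately show ?thesis by (simp add: sums_def)
qed

lemma l2_onb_eqI:
  assumes e: "l2_onb M e" and "f \<in> L2 M" "g \<in> L2 M"
    and "\<And>i. l2_inner M f (e i) = l2_inner M g (e i)"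
  shows "AE x in M. f x = g x"
proof -
  have "l2_inner M (\<lambda>x. f x - g x) (e i) = 0" for i
    using assms(2-4) l2_onsD(1)[OF l2_onb_ons[OF e]] by (simp add: l2_inner_diff_left)
  then have "AE x in M. f x - g x = 0"
    using e L2_diff[OF assms(2,3)] unfolding l2_onb_def by blast
  then show ?thesis by simp
qed

section \<open>Integration on Euclidean spaces\<close>

lemma
  fixes f :: "'a::euclidean_space \<Rightarrow> real \<Rightarrow> 'b::{real_normed_field,banach,second_countable_topology}"
  assumes f: "\<And>b. b \<in> Basis \<Longrightarrow> integrable lborel (f b)"
  shows lborel_integrable_prod: "integrable lborel (\<lambda>z::'a. \<Prod>b\<in>Basis. f b (z \<bullet> b))"
    and lborel_integral_prod: "(LINT z|lborel. (\<Prod>b\<in>Basis. f b (z \<bullet> b))) = (\<Prod>b\<in>Basis. LINT t|lborel. f b t)"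
proof -
  interpret product_sigma_finite "\<lambda>_::'a. lborel::real measure" ..
  let ?T = "\<lambda>x::'a \<Rightarrow> real. \<Sum>b\<in>Basis. x b *\<^sub>R b"
  have m: "(\<lambda>z::'a. \<Prod>b\<in>Basis. f b (z \<bullet> b)) \<in> borel_measurable borel"
  proof (intro borel_measurable_prod)
    fix b :: 'a assume "b \<in> Basis"
    then have [measurable]: "f b \<in> borel_measurable borel"
      using borel_measurable_integrable[OF f] by simp
    show "(\<lambda>z. f b (z \<bullet> b)) \<in> borel_measurable borel" by measurable
  qed
  have T: "?T \<in> (\<Pi>\<^sub>M b\<in>Basis. lborel) \<rightarrow>\<^sub>M borel" by measurable
  have coord: "(\<Prod>b\<in>Basis. f b (?T x \<bullet> b)) = (\<Prod>b\<in>Basis. f b (x b))" for x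
    by (intro prod.cong refl) simp
  show "integrable lborel (\<lambda>z::'a. \<Prod>b\<in>Basis. f b (z \<bullet> b))"
    by (subst lborel_eq, subst integrable_distr_eq[OF T m], subst coord)
      (rule product_integrable_prod[OF finite_Basis f])
  show "(LINT z|lborel. (\<Prod>b\<in>Basis. f b (z \<bullet> b))) = (\<Prod>b\<in>Basis. LINT t|lborel. f b t)"
    by (subst lborel_eq, subst integral_distr[OF T m], subst coord)
      (rule product_integral_prod[OF finite_Basis f])
qed

lemma lborel_integral_translation:
  fixes f :: "'a::euclidean_space \<Rightarrow> 'b::{banach,second_countable_topology}"
  assumes [measurable]: "f \<in> borel_measurable borel"
  shows "(LINT z|lborel. f (z + c)) = (LINT z|lborel. f z)"
proof -
  have "(LINT z|lborel. f z) = (LINT z|distr lborel borel ((+) c). f z)"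
    by (simp add: lborel_distr_plus)
  also have "\<dots> = (LINT z|lborel. f (c + z))" by (rule integral_distr) simp_all
  finally show ?thesis by (simp add: add.commute)
qed

lemma lborel_integrable_translation:
  fixes f :: "'a::euclidean_space \<Rightarrow> 'b::{banach,second_countable_topology}"
  assumes "integrable lborel f"
  shows "integrable lborel (\<lambda>z. f (z + c))"
proof -
  have [measurable]: "f \<in> borel_measurable borel" using borel_measurable_integrable[OF assms] by simp
  have "integrable (distr lborel borel ((+) c)) f"
    using assms by (simp add: lborel_distr_plus)
  then have "integrable lborel (\<lambda>z. f (c + z))" by (subst (asm) integrable_distr_eq) simp_all
  then show ?thesis by (simp add: add.commute)
qed

lemma integrable_inverse_1_plus_square: "integrable lborel (\<lambda>t::real. 1 / (1 + t\<^sup>2))"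
proof -
  have "set_integrable lborel (einterval (-\<infinity>) \<infinity>) (\<lambda>t::real. 1 / (1 + t\<^sup>2))"
  proof (rule interval_integral_FTC_nonneg(1)[where F = arctan and A = "-(pi/2)" and B = "pi/2"])
    show "DERIV arctan x :> 1 / (1 + x\<^sup>2)" for x
      using DERIV_arctan[of x] by (simp add: inverse_eq_divide)
    show "isCont (\<lambda>t::real. 1 / (1 + t\<^sup>2)) x" for x
      by (intro continuous_intros) (smt (verit) zero_le_power2)
    show "((arctan \<circ> real_of_ereal) \<longlongrightarrow> - (pi/2)) (at_right (-\<infinity>))"
      unfolding ereal_tendsto_simps using tendsto_arctan_at_bot by simp
    show "((arctan \<circ> real_of_ereal) \<longlongrightarrow> pi/2) (at_left \<infinity>)"
      unfolding ereal_tendsto_simps using tendsto_arctan_at_top by simp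
  qed simp_all
  then show ?thesis by (simp add: set_integrable_def einterval_eq)
qed

text \<open>All factors are replaced by the one with the largest \<open>t j\<close>. The point is
  that a product weight is dominated by pure powers of single variables, so decay needs to be
  checked in one coordinate at a time.\<close>

lemma prod_one_plus_le:
  fixes t :: "'i \<Rightarrow> real"
  assumes "finite I" "\<And>i. i \<in> I \<Longrightarrow> 0 \<le> t i"
  shows "(\<Prod>i\<in>I. 1 + t i) \<le> 1 + (\<Sum>i\<in>I. 2 ^ card I * (1 + t i ^ card I))"
proof (cases "I = {}")
  case False
  define M where "M = Max (t ` I)"
  have "M \<in> t ` I" unfolding M_def using assms False by (intro Max_in) auto
  then obtain j where j: "j \<in> I" "M = t j" by auto
  have M0: "0 \<le> M" using j assms by simp
  have le: "t i \<le> M" if "i \<in> I" for i unfolding M_def using assms that by simp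
  have "(\<Prod>i\<in>I. 1 + t i) \<le> (\<Prod>i\<in>I. 1 + M)"
    by (intro prod_mono) (use assms le in auto)
  also have "\<dots> = (1 + M) ^ card I" by simp
  also have "\<dots> \<le> (2 * max 1 M) ^ card I" by (intro power_mono) (use M0 in auto)
  also have "\<dots> = 2 ^ card I * (max 1 M) ^ card I" by (simp add: power_mult_distrib)
  also have "\<dots> \<le> 2 ^ card I * (1 + M ^ card I)"
    using M0 by (intro mult_left_mono) (auto simp: max_def)
  also have "\<dots> \<le> (\<Sum>i\<in>I. 2 ^ card I * (1 + t i ^ card I))"
    unfolding j(2) by (rule member_le_sum[OF j(1)]) (use assms in auto)
  finally show ?thesis by simp
qed simp

text \<open>The comparison function is the product of \<open>1 / (1 + t^2)\<close> over the
  coordinates. Its reciprocal has total degree twice the dimension, which is the exponent asked of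
  each single coordinate.\<close>

lemma integrable_if_decay:
  fixes u :: "'a::euclidean_space \<Rightarrow> complex"
  assumes [measurable]: "u \<in> borel_measurable borel"
    and C: "\<And>z. cmod (u z) \<le> C"
    and D: "\<And>z b. b \<in> Basis \<Longrightarrow> \<bar>z \<bullet> b\<bar> ^ (2 * DIM('a)) * cmod (u z) \<le> D"
  shows "integrable lborel u"
proof (rule Bochner_Integration.integrable_bound)
  let ?n = "DIM('a)"
  let ?K = "C + real ?n * (2 ^ ?n * (C + D))"
  show "integrable lborel (\<lambda>z::'a. ?K * (\<Prod>b\<in>Basis. 1 / (1 + (z \<bullet> b)\<^sup>2)))"
    by (intro integrable_mult_right lborel_integrable_prod integrable_inverse_1_plus_square)
  show "AE z in lborel. norm (u z) \<le> norm (?K * (\<Prod>b\<in>Basis. 1 / (1 + (z \<bullet> b)\<^sup>2)))"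
  proof (rule AE_I2)
    fix z :: 'a
    let ?P = "\<Prod>b\<in>Basis. 1 + (z \<bullet> b)\<^sup>2"
    have P: "?P > 0" by (intro prod_pos) (simp add: add_pos_nonneg)
    have power_even: "\<bar>z \<bullet> b\<bar> ^ (2 * ?n) = ((z \<bullet> b)\<^sup>2) ^ ?n" for b by (simp add: power_mult)
    have "?P * cmod (u z) \<le> (1 + (\<Sum>b\<in>(Basis::'a set). 2 ^ ?n * (1 + ((z \<bullet> b)\<^sup>2) ^ ?n))) * cmod (u z)"
      by (intro mult_right_mono prod_one_plus_le) auto
    also have "\<dots> = cmod (u z) + (\<Sum>b\<in>(Basis::'a set). 2 ^ ?n * (cmod (u z) + \<bar>z \<bullet> b\<bar> ^ (2 * ?n) * cmod (u z)))"
      unfolding power_even by (simp add: algebra_simps sum_distrib_left)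
    also have "\<dots> \<le> C + (\<Sum>b\<in>(Basis::'a set). 2 ^ ?n * (C + D))"
      by (intro add_mono sum_mono mult_left_mono C D) auto
    also have "\<dots> = ?K" by simp
    finally have "cmod (u z) \<le> ?K / ?P" using P by (simp add: field_simps)
    also have "?K / ?P = ?K * (\<Prod>b\<in>Basis. 1 / (1 + (z \<bullet> b)\<^sup>2))" by (simp add: prod_dividef)
    finally have "norm (u z) \<le> ?K * (\<Prod>b\<in>Basis. 1 / (1 + (z \<bullet> b)\<^sup>2))" .
    then show "norm (u z) \<le> norm (?K * (\<Prod>b\<in>Basis. 1 / (1 + (z \<bullet> b)\<^sup>2)))"
      by (rule order_trans) simp
  qed
qed simp

section \<open>Rapidly decreasing functions\<close>

text \<open>Schwartz decay without derivatives: enough for integrability and square integrability,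
  and stable under sums, products and multiplication by coordinates.\<close>

definition rapid :: "('a::euclidean_space \<Rightarrow> complex) \<Rightarrow> bool" where
  "rapid u \<longleftrightarrow> continuous_on UNIV u \<and> (\<forall>\<beta>. bounded (range (\<lambda>z. monomial \<beta> z *\<^sub>R u z)))"

lemma monomial_0 [simp]: "monomial (\<lambda>_. 0) z = 1"
  by (simp add: monomial_def)

lemma monomial_single:
  "b \<in> Basis \<Longrightarrow> monomial (\<lambda>c. if c = b then n else 0) z = (z \<bullet> b) ^ n"
  by (simp add: monomial_def if_distrib[of "\<lambda>k. _ ^ k"] prod.delta cong: if_cong)

lemma monomial_Suc:
  assumes "b \<in> Basis"
  shows "monomial (\<beta>(b := Suc (\<beta> b))) z = (z \<bullet> b) * monomial \<beta> z"
proof -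
  have "monomial (\<beta>(b := Suc (\<beta> b))) z = (z \<bullet> b) ^ Suc (\<beta> b) * (\<Prod>c\<in>Basis - {b}. (z \<bullet> c) ^ (\<beta>(b := Suc (\<beta> b))) c)"
    unfolding monomial_def by (subst prod.remove[OF finite_Basis assms]) simp
  also have "(\<Prod>c\<in>Basis - {b}. (z \<bullet> c) ^ (\<beta>(b := Suc (\<beta> b))) c) = (\<Prod>c\<in>Basis - {b}. (z \<bullet> c) ^ \<beta> c)"
    by (intro prod.cong) auto
  also have "(z \<bullet> b) ^ Suc (\<beta> b) * (\<Prod>c\<in>Basis - {b}. (z \<bullet> c) ^ \<beta> c) = (z \<bullet> b) * monomial \<beta> z"
    unfolding monomial_def
    by (subst prod.remove[OF finite_Basis assms, of "\<lambda>c. (z \<bullet> c) ^ \<beta> c"]) (simp add: ac_simps)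
  finally show ?thesis .
qed

lemma rapid_continuous: "rapid u \<Longrightarrow> continuous_on UNIV u"
  by (simp add: rapid_def)

lemma rapid_measurable: "rapid u \<Longrightarrow> u \<in> borel_measurable borel"
  by (intro borel_measurable_continuous_onI rapid_continuous)

lemma rapid_bounded: "rapid u \<Longrightarrow> bounded (range u)"
  unfolding rapid_def by (metis (no_types, lifting) monomial_0 scaleR_one image_cong)

lemma rapid_add:
  assumes "rapid u" "rapid v"
  shows "rapid (\<lambda>z. u z + v z)"
  using assms unfolding rapid_def
  by (auto simp: scaleR_add_right intro!: continuous_intros bounded_plus_comp)

lemma rapid_mult_bounded:
  assumes u: "rapid u" and v: "continuous_on UNIV v" "bounded (range v)"
  shows "rapid (\<lambda>z. v z * u z)"
  unfolding rapid_def
proof (intro conjI allI)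
  show "continuous_on UNIV (\<lambda>z. v z * u z)"
    by (intro continuous_intros rapid_continuous u v)
  fix \<beta>
  obtain B where B: "\<And>z. norm (v z) \<le> B" using v(2) unfolding bounded_iff by auto
  have "bounded (range (\<lambda>z. monomial \<beta> z *\<^sub>R u z))" using u by (simp add: rapid_def)
  then obtain C where C: "\<And>z. norm (monomial \<beta> z *\<^sub>R u z) \<le> C" unfolding bounded_iff by auto
  have "norm (monomial \<beta> z *\<^sub>R (v z * u z)) \<le> B * C" for z
  proof -
    have "norm (monomial \<beta> z *\<^sub>R (v z * u z)) = norm (v z) * norm (monomial \<beta> z *\<^sub>R u z)"
      by (simp add: norm_mult)
    also have "\<dots> \<le> B * C" by (intro mult_mono B C) (auto intro: order_trans[OF norm_ge_zero B])
    finally show ?thesis .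
  qed
  then show "bounded (range (\<lambda>z. monomial \<beta> z *\<^sub>R (v z * u z)))" unfolding bounded_iff by auto
qed

lemma rapid_scale: "rapid u \<Longrightarrow> rapid (\<lambda>z. c * u z)"
  by (rule rapid_mult_bounded) auto

lemma rapid_mult: "rapid u \<Longrightarrow> rapid v \<Longrightarrow> rapid (\<lambda>z. u z * v z)"
  using rapid_mult_bounded[of v u] rapid_bounded[of u] rapid_continuous[of u] by blast

lemma rapid_cnj: "rapid u \<Longrightarrow> rapid (\<lambda>z. cnj (u z))"
  unfolding rapid_def bounded_iff by (auto intro!: continuous_intros)

lemma rapid_zero: "rapid (\<lambda>z. 0)"
  unfolding rapid_def bounded_iff by auto

lemma rapid_sum: "(\<And>i. i \<in> I \<Longrightarrow> rapid (u i)) \<Longrightarrow> rapid (\<lambda>z. \<Sum>i\<in>I. u i z)"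
  by (induction I rule: infinite_finite_induct) (auto intro: rapid_add rapid_zero)

lemma rapid_coord:
  assumes u: "rapid u" and b: "b \<in> Basis"
  shows "rapid (\<lambda>z. complex_of_real (z \<bullet> b) * u z)"
  unfolding rapid_def
proof (intro conjI allI)
  show "continuous_on UNIV (\<lambda>z. complex_of_real (z \<bullet> b) * u z)"
    by (intro continuous_intros rapid_continuous u)
  fix \<beta> :: "'a \<Rightarrow> nat"
  have "monomial (\<beta>(b := Suc (\<beta> b))) z *\<^sub>R u z = monomial \<beta> z *\<^sub>R (complex_of_real (z \<bullet> b) * u z)" for z
    unfolding monomial_Suc[OF b] by (simp add: scaleR_conv_of_real)
  moreover have "bounded (range (\<lambda>z. monomial (\<beta>(b := Suc (\<beta> b))) z *\<^sub>R u z))"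
    using u unfolding rapid_def by blast
  ultimately show "bounded (range (\<lambda>z. monomial \<beta> z *\<^sub>R (complex_of_real (z \<bullet> b) * u z)))" by simp
qed

lemma rapid_integrable:
  fixes u :: "'a::euclidean_space \<Rightarrow> complex"
  assumes u: "rapid u"
  shows "integrable lborel u"
proof -
  obtain C where C: "\<And>z. cmod (u z) \<le> C" using rapid_bounded[OF u] unfolding bounded_iff by auto
  have "\<exists>D. \<forall>z. \<bar>z \<bullet> b\<bar> ^ (2 * DIM('a)) * cmod (u z) \<le> D" if b: "b \<in> Basis" for b :: 'a
  proof -
    let ?\<beta> = "\<lambda>c. if c = b then 2 * DIM('a) else 0"
    have "bounded (range (\<lambda>z. monomial ?\<beta> z *\<^sub>R u z))" using u by (simp add: rapid_def)
    then obtain D where "\<And>z. norm (monomial ?\<beta> z *\<^sub>R u z) \<le> D" unfolding bounded_iff by auto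
    then show ?thesis unfolding monomial_single[OF b] by (auto simp: power_abs)
  qed
  then obtain D where D: "\<And>b z. b \<in> Basis \<Longrightarrow> \<bar>z \<bullet> b\<bar> ^ (2 * DIM('a)) * cmod (u z) \<le> D b" by metis
  have "\<bar>z \<bullet> b\<bar> ^ (2 * DIM('a)) * cmod (u z) \<le> Max (D ` Basis)" if "b \<in> Basis" for z b
    using D[OF that, of z] that by (meson Max_ge finite_Basis finite_imageI imageI order_trans)
  then show ?thesis by (rule integrable_if_decay[OF rapid_measurable[OF u] C])
qed

lemma rapid_L2:
  assumes u: "rapid u"
  shows "u \<in> L2 lborel"
proof -
  have "integrable lborel (\<lambda>z. u z * cnj (u z))"
    by (intro rapid_integrable rapid_mult rapid_cnj u)
  then have "integrable lborel (\<lambda>z. norm (u z * cnj (u z)))" by (rule integrable_norm)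
  then have "integrable lborel (\<lambda>z. (cmod (u z))\<^sup>2)" by (simp add: norm_mult power2_eq_square)
  then show ?thesis using rapid_measurable[OF u] by (simp add: L2_def)
qed

section \<open>Integration by parts\<close>

lemma partial_derivI: "(f has_derivative D) (at z) \<Longrightarrow> partial_deriv b f z = D b"
  unfolding partial_deriv_def using frechet_derivative_at by metis

lemma partial_deriv_line:
  assumes "f differentiable (at (z + s *\<^sub>R b))"
  shows "((\<lambda>s. f (z + s *\<^sub>R b)) has_vector_derivative partial_deriv b f (z + s *\<^sub>R b)) (at s)"
proof -
  let ?D = "frechet_derivative f (at (z + s *\<^sub>R b))"
  have D: "(f has_derivative ?D) (at (z + s *\<^sub>R b))" using assms frechet_derivative_works by blast
  have "((\<lambda>s. z + s *\<^sub>R b) has_derivative (\<lambda>h. h *\<^sub>R b)) (at s)"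
    by (auto intro!: derivative_eq_intros)
  then have "((\<lambda>s. f (z + s *\<^sub>R b)) has_derivative (\<lambda>h. ?D (h *\<^sub>R b))) (at s)"
    using has_derivative_compose[of "\<lambda>s. z + s *\<^sub>R b" "\<lambda>h. h *\<^sub>R b" s UNIV f ?D] D by blast
  moreover have "?D (h *\<^sub>R b) = h *\<^sub>R ?D b" for h
    using has_derivative_bounded_linear[OF D] by (simp add: linear_simps)
  ultimately show ?thesis by (simp add: has_vector_derivative_def partial_deriv_def)
qed

lemma partial_deriv_mult:
  assumes "u differentiable (at z)" "v differentiable (at z)"
  shows "partial_deriv b (\<lambda>z. u z * v z) z = u z * partial_deriv b v z + partial_deriv b u z * v z"
proof -
  have "((\<lambda>z. u z * v z) has_derivative (\<lambda>h. u z * frechet_derivative v (at z) h + frechet_derivative u (at z) h * v z)) (at z)"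
    using assms by (intro has_derivative_mult) (simp_all add: frechet_derivative_works)
  from partial_derivI[OF this, of b] show ?thesis by (simp only: partial_deriv_def)
qed

lemma partial_deriv_add:
  assumes "u differentiable (at z)" "v differentiable (at z)"
  shows "partial_deriv b (\<lambda>z. u z + v z) z = partial_deriv b u z + partial_deriv b v z"
proof -
  have "((\<lambda>z. u z + v z) has_derivative (\<lambda>h. frechet_derivative u (at z) h + frechet_derivative v (at z) h)) (at z)"
    using assms by (intro has_derivative_add) (simp_all add: frechet_derivative_works)
  from partial_derivI[OF this, of b] show ?thesis by (simp only: partial_deriv_def)
qed

lemma partial_deriv_scale:
  assumes "u differentiable (at z)"
  shows "partial_deriv b (\<lambda>z. c * u z) z = c * partial_deriv b u z"
proof -
  have "((\<lambda>z. c * u z) has_derivative (\<lambda>h. c * frechet_derivative u (at z) h)) (at z)"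
    using assms by (intro has_derivative_mult_right) (simp_all add: frechet_derivative_works)
  from partial_derivI[OF this, of b] show ?thesis by (simp only: partial_deriv_def)
qed

lemma partial_deriv_coord_has_derivative:
  "((\<lambda>z. complex_of_real (z \<bullet> b)) has_derivative (\<lambda>h. complex_of_real (h \<bullet> b))) (at z)"
  by (auto intro!: derivative_eq_intros)

lemma coord_differentiable: "(\<lambda>z. complex_of_real (z \<bullet> b)) differentiable (at z)"
  using partial_deriv_coord_has_derivative differentiable_def by blast

lemma partial_deriv_coord:
  "partial_deriv c (\<lambda>z. complex_of_real (z \<bullet> b)) z = complex_of_real (c \<bullet> b)"
  by (rule partial_derivI[OF partial_deriv_coord_has_derivative])

text \<open>The integral of \<open>w(z + b) - w(z)\<close> vanishes by translation invariance; by Fubini it is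
  also the integral of \<open>\<partial>\<^sub>b w\<close>.\<close>

lemma integral_partial_deriv_eq_0:
  fixes w :: "'a::euclidean_space \<Rightarrow> complex"
  assumes d: "\<And>z. w differentiable (at z)" and c: "continuous_on UNIV (partial_deriv b w)"
    and w: "integrable lborel w" and dw: "integrable lborel (partial_deriv b w)"
  shows "(LINT z|lborel. partial_deriv b w z) = 0"
proof -
  let ?W = "partial_deriv b w"
  define f where "f s z = indicator {0..1::real} s *\<^sub>R ?W (z + s *\<^sub>R b)" for s z
  have [measurable]: "?W \<in> borel_measurable borel" by (rule borel_measurable_continuous_onI[OF c])
  have [measurable]: "w \<in> borel_measurable borel" using borel_measurable_integrable[OF w] by simp
  have inner: "(LINT s|lborel. f s z) = w (z + b) - w z" for z
    unfolding f_def
  proof (subst integral_FTC_atLeastAtMost[where F = "\<lambda>s. w (z + s *\<^sub>R b)"])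
    show "((\<lambda>s. w (z + s *\<^sub>R b)) has_vector_derivative ?W (z + x *\<^sub>R b)) (at x within {0..1})" for x
      by (rule has_vector_derivative_at_within[OF partial_deriv_line[OF d]])
    show "continuous_on {0..1} (\<lambda>s. ?W (z + s *\<^sub>R b))"
      by (rule continuous_on_compose2[OF c]) (auto intro!: continuous_intros)
  qed simp_all
  have "integrable (lborel \<Otimes>\<^sub>M lborel) (\<lambda>(s, z). f s z)"
  proof (rule lborel_pair.Fubini_integrable)
    show "(\<lambda>(s, z). f s z) \<in> borel_measurable (lborel \<Otimes>\<^sub>M lborel)"
      unfolding f_def by measurable
    have "(LINT z|lborel. norm (f s z)) = indicator {0..1} s *\<^sub>R (LINT z|lborel. norm (?W z))" for s
      unfolding f_def using lborel_integral_translation[of "\<lambda>z. norm (?W z)" "s *\<^sub>R b"] by simp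
    then show "integrable lborel (\<lambda>s. LINT z|lborel. norm (case (s, z) of (s, z) \<Rightarrow> f s z))"
      by simp
    show "AE s in lborel. integrable lborel (\<lambda>z. case (s, z) of (s, z) \<Rightarrow> f s z)"
      unfolding f_def by (rule AE_I2) (auto intro!: lborel_integrable_translation dw)
  qed
  then have "(LINT z|lborel. (LINT s|lborel. f s z)) = (LINT s|lborel. (LINT z|lborel. f s z))"
    by (rule lborel_pair.Fubini_integral)
  also have "\<dots> = (LINT s|lborel. indicator {0..1::real} s *\<^sub>R (LINT z|lborel. ?W z))"
    unfolding f_def by (simp add: lborel_integral_translation)
  also have "\<dots> = (LINT z|lborel. ?W z)" by simp
  also have "(LINT z|lborel. (LINT s|lborel. f s z)) = (LINT z|lborel. w (z + b)) - (LINT z|lborel. w z)"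
    unfolding inner using lborel_integrable_translation[OF w] w by simp
  also have "\<dots> = 0" by (simp add: lborel_integral_translation)
  finally show ?thesis by simp
qed

lemma integral_by_parts:
  fixes u v :: "'a::euclidean_space \<Rightarrow> complex"
  assumes u: "\<And>z. u differentiable (at z)" and v: "\<And>z. v differentiable (at z)"
    and cu: "continuous_on UNIV (partial_deriv b u)" and cv: "continuous_on UNIV (partial_deriv b v)"
    and i: "integrable lborel (\<lambda>z. u z * v z)" "integrable lborel (\<lambda>z. partial_deriv b u z * v z)"
      "integrable lborel (\<lambda>z. u z * partial_deriv b v z)"
  shows "(LINT z|lborel. partial_deriv b u z * v z) = - (LINT z|lborel. u z * partial_deriv b v z)"
proof -
  have p: "partial_deriv b (\<lambda>z. u z * v z) = (\<lambda>z. u z * partial_deriv b v z + partial_deriv b u z * v z)"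
    using partial_deriv_mult[OF u v] by blast
  have con: "continuous_on UNIV u" "continuous_on UNIV v"
    using u v differentiable_imp_continuous_on differentiable_on_def differentiable_at_withinI by blast+
  have "(LINT z|lborel. partial_deriv b (\<lambda>z. u z * v z) z) = 0"
    by (rule integral_partial_deriv_eq_0)
      (use u v i in \<open>auto simp: p intro!: continuous_intros con cu cv differentiable_mult\<close>)
  then show ?thesis using i by (simp add: p add_eq_0_iff)
qed

section \<open>Uniqueness of the Fourier transform\<close>

text \<open>The functions \<open>min 1 (k * dist)\<close>, with the distance to the complement of
  \<open>U\<close>, are continuous and increase to the indicator of \<open>U\<close>; dominated
  convergence does the rest.\<close>

lemma integral_open_eq_0:
  fixes G :: "'a::euclidean_space \<Rightarrow> complex"
  assumes G: "integrable lborel G"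
    and z: "\<And>\<phi>::'a \<Rightarrow> real. continuous_on UNIV \<phi> \<Longrightarrow> (\<And>y. \<bar>\<phi> y\<bar> \<le> 1) \<Longrightarrow> (LINT y|lborel. G y * complex_of_real (\<phi> y)) = 0"
    and U: "open U"
  shows "set_lebesgue_integral lborel U G = 0"
\<comment> \<open>The distance to the empty set is 0 by convention, so the approximating functions
  would vanish for the whole space; there the constant 1 is used.\<close>
proof (cases "U = UNIV")
  case True
  then show ?thesis using z[of "\<lambda>_. 1"] by (simp add: set_lebesgue_integral_def)
next
  case False
  define \<phi> where "\<phi> k y = min 1 (real k * infdist y (- U))" for k y
  have le: "\<bar>\<phi> k y\<bar> \<le> 1" for k y unfolding \<phi>_def by (simp add: infdist_nonneg)
  have c: "continuous_on UNIV (\<phi> k)" for k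
    unfolding \<phi>_def by (intro continuous_intros)
  have lim: "(\<lambda>k. \<phi> k y) \<longlonglongrightarrow> indicator U y" for y
  proof (cases "y \<in> U")
    case True
    have "infdist y (- U) \<noteq> 0"
      using in_closed_iff_infdist_zero[of "- U" y] U False True by (auto simp: closed_def)
    then have pos: "infdist y (- U) > 0" using infdist_nonneg[of y "- U"] by simp
    then obtain N where N: "real N * infdist y (- U) > 1" using reals_Archimedean3 by blast
    have "\<phi> k y = 1" if "k \<ge> N" for k
    proof -
      have "real N * infdist y (- U) \<le> real k * infdist y (- U)"
        using that pos by (intro mult_right_mono) auto
      then show ?thesis using N unfolding \<phi>_def by simp
    qed
    then show ?thesis using True by (intro tendsto_eventually eventually_sequentiallyI[of N]) simp
  next
    case False
    then show ?thesis by (simp add: \<phi>_def)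
  qed
  have "(\<lambda>k. LINT y|lborel. G y * \<phi> k y) \<longlonglongrightarrow> (LINT y|lborel. G y * indicator U y)"
  proof (rule integral_dominated_convergence[where w = "\<lambda>y. norm (G y)"])
    have [measurable]: "G \<in> borel_measurable borel" using borel_measurable_integrable[OF G] by simp
    have [measurable]: "U \<in> sets borel" using U by simp
    show "(\<lambda>y. G y * indicator U y) \<in> borel_measurable lborel" by measurable
    show "(\<lambda>y. G y * complex_of_real (\<phi> k y)) \<in> borel_measurable lborel" for k
      using borel_measurable_continuous_onI[OF c[of k]] by measurable
    show "AE y in lborel. (\<lambda>k. G y * \<phi> k y) \<longlonglongrightarrow> G y * indicator U y"
    proof (rule AE_I2)
      fix y
      have "(\<lambda>k. G y * complex_of_real (\<phi> k y)) \<longlonglongrightarrow> G y * complex_of_real (indicator U y)"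
        by (intro tendsto_intros lim)
      then show "(\<lambda>k. G y * \<phi> k y) \<longlonglongrightarrow> G y * indicator U y" by (simp add: indicator_def of_bool_def split: if_splits)
    qed
    show "AE y in lborel. norm (G y * \<phi> k y) \<le> norm (G y)" for k
      using le[of k] by (intro AE_I2) (simp add: norm_mult mult_left_le)
  qed (use G in simp)
  then have "(LINT y|lborel. G y * indicator U y) = 0"
    using z[OF c le] by (simp add: LIMSEQ_const_iff)
  moreover have "G y * indicator U y = indicator U y *\<^sub>R G y" for y by (simp add: indicator_def)
  ultimately show ?thesis by (simp add: set_lebesgue_integral_def)
qed

text \<open>The open sets form an intersection-stable generator of the Borel sets, and the sets over
  which \<open>G\<close> integrates to 0 are closed under complements and countable disjoint
  unions.\<close>

lemma AE_eq_0_if_integral_continuous: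
  fixes G :: "'a::euclidean_space \<Rightarrow> complex"
  assumes G: "integrable lborel G"
    and z: "\<And>\<phi>::'a \<Rightarrow> real. continuous_on UNIV \<phi> \<Longrightarrow> (\<And>y. \<bar>\<phi> y\<bar> \<le> 1) \<Longrightarrow> (LINT y|lborel. G y * complex_of_real (\<phi> y)) = 0"
  shows "AE y in lborel. G y = 0"
proof (rule sigma_finite_measure.density_zero[OF sigma_finite_lborel G])
  fix A :: "'a set" assume "A \<in> sets lborel"
  then have A: "A \<in> sigma_sets UNIV {S. open S}" by (simp add: sets_borel)
  have stable: "Int_stable {S::'a set. open S}" and sub: "{S::'a set. open S} \<subseteq> Pow UNIV"
    by (auto simp: Int_stable_def)
  note open0 = integral_open_eq_0[OF G z]
  have si: "set_integrable lborel A G" if "A \<in> sets borel" for A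
    unfolding set_integrable_def using G that by (intro integrable_mult_indicator) auto
  have b: "A \<in> sets borel" if "A \<in> sigma_sets UNIV {S. open S}" for A :: "'a set"
    using that by (simp add: sets_borel)
  show "set_lebesgue_integral lborel A G = 0"
    using stable sub A
  proof (induction rule: sigma_sets_induct_disjoint)
    case (basic A) then show ?case by (intro open0) auto
  next
    case empty then show ?case by (simp add: set_lebesgue_integral_def)
  next
    case (compl A)
    have "(LINT x:A \<union> (UNIV - A)|lborel. G x) = (LINT x:A|lborel. G x) + (LINT x:UNIV - A|lborel. G x)"
      using b[OF compl(1)] by (intro set_integral_Un si) auto
    moreover have "(LINT x:UNIV|lborel. G x) = 0" by (intro open0) auto
    ultimately show ?case using compl by (simp add: Un_absorb1)
  next
    case (union A)
    have "(LINT x:(\<Union>i. A i)|lborel. G x) = (\<Sum>i. (LINT x:A i|lborel. G x))"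
    proof (intro lebesgue_integral_countable_add si)
      show Ai: "A i \<in> sets lborel" for i using union(2) b by auto
      show "(\<Union>i. A i) \<in> sets borel" using Ai by auto
    qed (use union(1) in \<open>auto simp: disjoint_family_on_def\<close>)
    then show ?case using union by simp
  qed
qed

lemma sin_scaled_tendsto: "(\<lambda>n. real (Suc n) * sin (x / real (Suc n))) \<longlonglongrightarrow> x"
proof (cases "x = 0")
  case False
  have "((\<lambda>h. sin h / h) \<longlongrightarrow> 1) (at (0::real))"
    using DERIV_sin[of 0] by (simp add: has_field_derivative_iff)
  moreover have "(\<lambda>n. x / real (Suc n)) \<longlonglongrightarrow> 0" by (rule LIMSEQ_Suc[OF lim_const_over_n])
  then have "filterlim (\<lambda>n. x / real (Suc n)) (at 0) sequentially"
    unfolding filterlim_at using False by (simp del: of_nat_Suc)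
  ultimately have "(\<lambda>n. sin (x / real (Suc n)) / (x / real (Suc n))) \<longlonglongrightarrow> 1"
    by (rule filterlim_compose)
  then have "(\<lambda>n. x * (sin (x / real (Suc n)) / (x / real (Suc n)))) \<longlonglongrightarrow> x * 1"
    by (intro tendsto_intros)
  then show ?thesis using False by (simp add: field_simps del: of_nat_Suc)
qed simp

text \<open>Bounded functions that \<open>G\<close> annihilates together with all their modulations are closed under
  multiplication by \<open>sin (a \<bullet> y)\<close>. By Stone-Weierstrass and dominated convergence along
  \<open>R sin (y\<^sub>b / R) \<rightarrow> y\<^sub>b\<close> they contain all bounded continuous functions.\<close>

lemma Fourier_unique:
  fixes G :: "'a::euclidean_space \<Rightarrow> complex"
  assumes G: "integrable lborel G"
    and z: "\<And>w. (LINT y|lborel. G y * exp (\<i> * complex_of_real (w \<bullet> y))) = 0"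
  shows "AE y in lborel. G y = 0"
proof -
  have Gm [measurable]: "G \<in> borel_measurable borel" using borel_measurable_integrable[OF G] by simp
  define E where "E w y = exp (\<i> * complex_of_real (w \<bullet> y))" for w y :: 'a
  have Em [measurable]: "E w \<in> borel_measurable borel" for w
    unfolding E_def by (intro borel_measurable_continuous_onI continuous_intros)
  have En: "cmod (E w y) = 1" for w y unfolding E_def by simp
  have Emul: "E a y * E w y = E (a + w) y" for a w y
    unfolding E_def by (simp add: exp_add[symmetric] inner_add_left distrib_left)
  define W where "W = {\<phi>. \<phi> \<in> borel_measurable borel \<and> bounded (range \<phi>) \<and>
    (\<forall>w. (LINT y|lborel. G y * (\<phi> y * E w y)) = 0)}"
  have int: "integrable lborel (\<lambda>y. G y * (\<phi> y * E w y))"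
    if [measurable]: "\<phi> \<in> borel_measurable borel" and bd: "bounded (range \<phi>)" for \<phi> w
  proof -
    obtain B where B: "\<And>y. norm (\<phi> y) \<le> B" using bd unfolding bounded_iff by auto
    show ?thesis
    proof (rule Bochner_Integration.integrable_bound)
      show "integrable lborel (\<lambda>y. B * norm (G y))" using G by simp
      show "AE y in lborel. norm (G y * (\<phi> y * E w y)) \<le> norm (B * norm (G y))"
      proof (rule AE_I2)
        fix y
        have "norm (G y) * norm (\<phi> y) \<le> norm (G y) * \<bar>B\<bar>"
          by (intro mult_left_mono order_trans[OF B abs_ge_self]) simp
        then show "norm (G y * (\<phi> y * E w y)) \<le> norm (B * norm (G y))"
          by (simp add: norm_mult En abs_mult mult.commute)
      qed
    qed measurable
  qed
  have Wadd: "(\<lambda>y. \<phi> y + \<psi> y) \<in> W" if "\<phi> \<in> W" "\<psi> \<in> W" for \<phi> \<psi>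
    using that int unfolding W_def
    by (auto simp: distrib_right distrib_left intro!: bounded_plus_comp)
  have Wscale: "(\<lambda>y. c * \<phi> y) \<in> W" if \<phi>: "\<phi> \<in> W" for c \<phi>
  proof -
    obtain B where "\<And>y. norm (\<phi> y) \<le> B" using \<phi> unfolding W_def bounded_iff by auto
    then have "norm (c * \<phi> y) \<le> norm c * B" for y by (simp add: norm_mult mult_left_mono)
    then have "bounded (range (\<lambda>y. c * \<phi> y))" unfolding bounded_iff by blast
    moreover have "(LINT y|lborel. G y * (c * \<phi> y * E w y)) = c * (LINT y|lborel. G y * (\<phi> y * E w y))" for w
      by (simp add: integral_mult_right_zero[symmetric] algebra_simps del: integral_mult_right_zero)
    ultimately show ?thesis using \<phi> unfolding W_def by auto
  qed
  have WE: "(\<lambda>y. E a y * \<phi> y) \<in> W" if \<phi>: "\<phi> \<in> W" for a \<phi>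
  proof -
    obtain B where "\<And>y. norm (\<phi> y) \<le> B" using \<phi> unfolding W_def bounded_iff by auto
    then have "bounded (range (\<lambda>y. E a y * \<phi> y))" unfolding bounded_iff by (auto simp: norm_mult En)
    moreover have eq: "E a y * \<phi> y * E w y = \<phi> y * E (a + w) y" for w y
      unfolding Emul[symmetric] by simp
    ultimately show ?thesis using \<phi> unfolding W_def by (simp add: eq borel_measurable_times[OF Em])
  qed
  have Wsin: "(\<lambda>y. complex_of_real (sin (a \<bullet> y)) * \<phi> y) \<in> W" if "\<phi> \<in> W" for a \<phi>
  proof -
    have "(\<lambda>y. 1 / (2 * \<i>) * (E a y * \<phi> y) + - 1 / (2 * \<i>) * (E (- a) y * \<phi> y)) \<in> W"
      by (intro Wadd Wscale WE that)
    moreover have "1 / (2 * \<i>) * (E a y * \<phi> y) + - 1 / (2 * \<i>) * (E (- a) y * \<phi> y)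
        = complex_of_real (sin (a \<bullet> y)) * \<phi> y" for y
      unfolding E_def by (simp add: sin_of_real[symmetric] sin_exp_eq field_simps)
    ultimately show ?thesis by simp
  qed
  have Wsum: "(\<lambda>y. \<Sum>i\<in>I. \<phi> i y) \<in> W" if "finite I" "\<And>i. i \<in> I \<Longrightarrow> \<phi> i \<in> W" for \<phi> and I :: "'a set"
    using that
  proof (induction I rule: finite_induct)
    case empty
    then show ?case unfolding W_def by (auto simp: image_constant_conv)
  qed (auto intro!: Wadd)
  \<comment> \<open>A bounded substitute for the identity map: its values stay in a ball of radius
    proportional to \<open>R\<close>, so polynomials in \<open>S R y\<close> are bounded, and its
    coordinates are sines, under which \<open>W\<close> is stable.\<close>
  define S where "S R y = (\<Sum>b\<in>Basis. (R * sin (y \<bullet> b / R)) *\<^sub>R b)" for R :: real and y :: 'a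
  have Wpoly: "(\<lambda>y. complex_of_real (p (S R y)) * \<phi> y) \<in> W" if "real_polynomial_function p" "\<phi> \<in> W" for p R \<phi>
    using that
  proof (induction arbitrary: \<phi>)
    case (linear f)
    have "f (S R y) = (\<Sum>b\<in>Basis. (R * f b) * sin (((1 / R) *\<^sub>R b) \<bullet> y))" for y
      unfolding S_def using linear(1)
      by (simp add: linear_simps linear_sum bounded_linear.linear inner_commute mult_ac)
    then have "complex_of_real (f (S R y)) * \<phi> y
        = (\<Sum>b\<in>Basis. complex_of_real (R * f b) * (complex_of_real (sin (((1 / R) *\<^sub>R b) \<bullet> y)) * \<phi> y))" for y
      by (simp add: sum_distrib_right mult.assoc)
    then show ?case by (simp only:) (intro Wsum Wscale Wsin linear finite_Basis)
  next
    case (const c) then show ?case by (intro Wscale)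
  next
    case (add f g)
    then show ?case using Wadd[OF add.IH(1) add.IH(2)] by (simp add: distrib_right)
  next
    case (mult f g)
    then show ?case using mult.IH(1)[OF mult.IH(2)[OF mult.prems]] by (simp add: mult.assoc)
  qed
  have W1: "(\<lambda>_. 1) \<in> W" using z unfolding W_def E_def by (auto simp: image_constant_conv)
  show ?thesis
  proof (rule AE_eq_0_if_integral_continuous[OF G])
    fix \<phi> :: "'a \<Rightarrow> real" assume c: "continuous_on UNIV \<phi>" and le: "\<And>y. \<bar>\<phi> y\<bar> \<le> 1"
    have cS: "continuous_on UNIV (S R)" for R
    proof (cases "R = 0")
      case False then show ?thesis unfolding S_def by (intro continuous_intros) auto
    qed (simp add: S_def)
    have m: "(\<lambda>y. \<phi> (S R y)) \<in> borel_measurable borel" for R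
      by (intro borel_measurable_continuous_onI continuous_on_compose2[OF c cS]) auto
    have R: "(LINT y|lborel. G y * \<phi> (S R y)) = 0" if "R > 0" for R
    proof -
      let ?I = "LINT y|lborel. G y * \<phi> (S R y)"
      let ?g = "LINT y|lborel. norm (G y)"
      define K where "K = cball (0::'a) (real DIM('a) * R)"
      have SK: "S R y \<in> K" for y
      proof -
        have "norm (S R y) \<le> (\<Sum>b\<in>(Basis::'a set). R)"
          unfolding S_def
        proof (rule sum_norm_le)
          fix b :: 'a assume "b \<in> Basis"
          then show "norm ((R * sin (y \<bullet> b / R)) *\<^sub>R b) \<le> R"
            using that abs_sin_le_one[of "y \<bullet> b / R"] by (simp add: abs_mult mult_left_le)
        qed
        then show ?thesis unfolding K_def by simp
      qed
      have int2: "integrable lborel (\<lambda>y. G y * \<phi> (S R y))"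
      proof (rule Bochner_Integration.integrable_bound)
        show "integrable lborel (\<lambda>y. norm (G y))" using G by simp
        show "AE y in lborel. norm (G y * complex_of_real (\<phi> (S R y))) \<le> norm (norm (G y))"
          using le by (intro AE_I2) (simp add: norm_mult mult_left_le)
      qed (use m[of R] in measurable)
      have "norm ?I \<le> e * ?g" if "e > 0" for e
      proof -
        obtain p where p: "real_polynomial_function p" "\<And>x. x \<in> K \<Longrightarrow> \<bar>\<phi> x - p x\<bar> < e"
          using Stone_Weierstrass_real_polynomial_function[OF _ continuous_on_subset[OF c] \<open>e > 0\<close>, of K]
          unfolding K_def by (metis compact_cball subset_UNIV)
        have pW: "(\<lambda>y. complex_of_real (p (S R y))) \<in> W" using Wpoly[OF p(1) W1, of R] by simp
        then have p0: "(LINT y|lborel. G y * complex_of_real (p (S R y))) = 0"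
          and ip: "integrable lborel (\<lambda>y. G y * complex_of_real (p (S R y)))"
          using int[of "\<lambda>y. complex_of_real (p (S R y))" 0] unfolding W_def
          by (auto simp: E_def dest: spec[of _ 0])
        have "?I = (LINT y|lborel. G y * \<phi> (S R y) - G y * complex_of_real (p (S R y)))"
          using p0 by (simp add: Bochner_Integration.integral_diff[OF int2 ip])
        also have "norm \<dots> \<le> (LINT y|lborel. e * norm (G y))"
        proof (rule order_trans[OF Bochner_Integration.integral_norm_bound], rule integral_mono)
          show "integrable lborel (\<lambda>y. norm (G y * \<phi> (S R y) - G y * complex_of_real (p (S R y))))"
            by (intro integrable_norm Bochner_Integration.integrable_diff int2 ip)
          show "integrable lborel (\<lambda>y. e * norm (G y))" using G by simp
          fix y
          have "norm (G y * complex_of_real (\<phi> (S R y)) - G y * complex_of_real (p (S R y)))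
            = norm (G y) * \<bar>\<phi> (S R y) - p (S R y)\<bar>"
            by (simp add: right_diff_distrib[symmetric] norm_mult of_real_diff[symmetric] del: of_real_diff)
          also have "\<dots> \<le> norm (G y) * e" using p(2)[OF SK[of y]] by (intro mult_left_mono) auto
          finally show "norm (G y * complex_of_real (\<phi> (S R y)) - G y * complex_of_real (p (S R y))) \<le> e * norm (G y)"
            by (simp add: mult.commute)
        qed
        finally show ?thesis by simp
      qed
      \<comment> \<open>The previous bound is used with \<open>e / (?g + 1)\<close>, which also
        covers \<open>?g = 0\<close>.\<close>
      then have "norm ?I \<le> 0 + e" if "e > 0" for e
      proof -
        have frac: "a / (g + 1) * g \<le> a" if "0 < a" "0 \<le> g" for a g :: real
          using that by (simp add: field_simps)
        have g0: "0 \<le> ?g" by simp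
        have "norm ?I \<le> e / (?g + 1) * ?g" using \<open>\<And>e. e > 0 \<Longrightarrow> norm ?I \<le> e * ?g\<close>[of "e / (?g + 1)"] that g0 by simp
        also have "\<dots> \<le> e" by (rule frac[OF that g0])
        finally show ?thesis by simp
      qed
      then have "norm ?I \<le> 0" by (rule field_le_epsilon)
      then show ?thesis by simp
    qed
    have "(\<lambda>n. LINT y|lborel. G y * \<phi> (S (real (Suc n)) y)) \<longlonglongrightarrow> (LINT y|lborel. G y * \<phi> y)"
    proof (rule integral_dominated_convergence[where w = "\<lambda>y. norm (G y)"])
      show "AE y in lborel. (\<lambda>n. G y * \<phi> (S (real (Suc n)) y)) \<longlonglongrightarrow> G y * \<phi> y"
      proof (rule AE_I2)
        fix y
        have "(\<lambda>n. S (real (Suc n)) y) \<longlonglongrightarrow> (\<Sum>b\<in>Basis. (y \<bullet> b) *\<^sub>R b)"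
          unfolding S_def by (intro tendsto_sum tendsto_scaleR sin_scaled_tendsto tendsto_const)
        then have "(\<lambda>n. S (real (Suc n)) y) \<longlonglongrightarrow> y" by (simp add: euclidean_representation)
        then have "(\<lambda>n. \<phi> (S (real (Suc n)) y)) \<longlonglongrightarrow> \<phi> y"
          using c by (intro isCont_tendsto_compose[where g = \<phi>]) (auto simp: continuous_on_eq_continuous_at)
        then show "(\<lambda>n. G y * \<phi> (S (real (Suc n)) y)) \<longlonglongrightarrow> G y * \<phi> y"
          by (intro tendsto_intros)
      qed
      show "AE y in lborel. norm (G y * complex_of_real (\<phi> (S (real (Suc n)) y))) \<le> norm (G y)" for n
        using le by (intro AE_I2) (simp add: norm_mult mult_left_le)
      show "(\<lambda>y. G y * complex_of_real (\<phi> (S (real (Suc n)) y))) \<in> borel_measurable lborel" for n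
        using m[of "real (Suc n)"] by measurable
      show "(\<lambda>y. G y * complex_of_real (\<phi> y)) \<in> borel_measurable lborel"
        using borel_measurable_continuous_onI[OF c] by measurable
    qed (use G in simp)
    then show "(LINT y|lborel. G y * \<phi> y) = 0"
      by (subst (asm) R) (simp_all add: LIMSEQ_const_iff)
  qed
qed

section \<open>A totality criterion\<close>

text \<open>A single term of the exponential series at \<open>c * t\<close> is at most its
  sum.\<close>

lemma power_times_exp_le:
  fixes t c :: real
  assumes "0 \<le> t" "0 < c"
  shows "t ^ n * exp (- (c * t)) \<le> fact n / c ^ n"
proof -
  have "(c * t) ^ n /\<^sub>R fact n \<le> exp (c * t)"
    unfolding exp_def using assms summable_exp_generic[of "c * t"]
    by (intro sum_le_suminf[of _ "{n}", simplified]) auto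
  then have "(c * t) ^ n \<le> fact n * exp (c * t)" by (simp add: field_simps)
  then show ?thesis using assms by (simp add: exp_minus power_mult_distrib field_simps)
qed

lemma abs_inner_Basis_power_le:
  assumes "b \<in> Basis"
  shows "\<bar>z \<bullet> b\<bar> ^ (2 * n) \<le> ((norm z)\<^sup>2) ^ n"
  unfolding power_mult using Basis_le_norm[OF assms, of z] by (intro power_mono) auto

lemma gaussian_integrable:
  assumes c: "0 < c"
  shows "integrable lborel (\<lambda>z::'a::euclidean_space. complex_of_real (exp (- (c * (norm z)\<^sup>2))))"
proof (rule integrable_if_decay)
  show "(\<lambda>z::'a. complex_of_real (exp (- (c * (norm z)\<^sup>2)))) \<in> borel_measurable borel" by measurable
  show "cmod (complex_of_real (exp (- (c * (norm z)\<^sup>2)))) \<le> 1" for z :: 'a using c by simp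
  fix z b :: 'a assume b: "b \<in> Basis"
  have "\<bar>z \<bullet> b\<bar> ^ (2 * DIM('a)) * cmod (complex_of_real (exp (- (c * (norm z)\<^sup>2))))
      \<le> ((norm z)\<^sup>2) ^ DIM('a) * exp (- (c * (norm z)\<^sup>2))"
    using abs_inner_Basis_power_le[OF b] by (simp add: mult_right_mono)
  also have "\<dots> \<le> fact DIM('a) / c ^ DIM('a)" by (rule power_times_exp_le) (use c in auto)
  finally show "\<bar>z \<bullet> b\<bar> ^ (2 * DIM('a)) * cmod (complex_of_real (exp (- (c * (norm z)\<^sup>2)))) \<le> fact DIM('a) / c ^ DIM('a)" .
qed

text \<open>Provides the dominating function for the exponential series of a character times a
  Gaussian, paired with a square-integrable function.\<close>

lemma exp_norm_gaussian_L2: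
  assumes c: "0 < c"
  shows "(\<lambda>z::'a::euclidean_space. complex_of_real (exp (K * norm z) * exp (- (c * (norm z)\<^sup>2)))) \<in> L2 lborel"
proof -
  have m: "(\<lambda>z::'a. complex_of_real (exp (K * norm z) * exp (- (c * (norm z)\<^sup>2)))) \<in> borel_measurable borel" by measurable
  have "integrable lborel (\<lambda>z::'a. (cmod (complex_of_real (exp (K * norm z) * exp (- (c * (norm z)\<^sup>2)))))\<^sup>2)"
  proof (rule Bochner_Integration.integrable_bound)
    have "integrable lborel (\<lambda>z::'a. norm (complex_of_real (exp (- (c * (norm z)\<^sup>2)))))"
      by (intro integrable_norm gaussian_integrable c)
    then show "integrable lborel (\<lambda>z::'a. exp (K\<^sup>2 / c) * exp (- (c * (norm z)\<^sup>2)))" by simp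
    show "AE z::'a in lborel. norm ((cmod (complex_of_real (exp (K * norm z) * exp (- (c * (norm z)\<^sup>2)))))\<^sup>2)
        \<le> norm (exp (K\<^sup>2 / c) * exp (- (c * (norm z)\<^sup>2)))"
    proof (rule AE_I2)
      fix z :: 'a
      \<comment> \<open>Completing the square absorbs the linear exponent at the price of half of
        the Gaussian decay and the constant \<open>exp (K^2 / c)\<close>.\<close>
      have "0 \<le> (K - c * norm z)\<^sup>2 / c" using c by simp
      also have "\<dots> = K\<^sup>2 / c - 2 * (K * norm z) + c * (norm z)\<^sup>2"
        using c by (simp add: power2_eq_square field_simps)
      finally have le: "2 * (K * norm z) - 2 * (c * (norm z)\<^sup>2) \<le> K\<^sup>2 / c - c * (norm z)\<^sup>2" by simp
      have "(exp (K * norm z) * exp (- (c * (norm z)\<^sup>2)))\<^sup>2 = exp (2 * (K * norm z) - 2 * (c * (norm z)\<^sup>2))"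
        by (simp add: exp_add[symmetric] exp_double[symmetric] algebra_simps)
      also have "\<dots> \<le> exp (K\<^sup>2 / c - c * (norm z)\<^sup>2)" using le by simp
      also have "\<dots> = exp (K\<^sup>2 / c) * exp (- (c * (norm z)\<^sup>2))" by (simp add: exp_add[symmetric])
      finally show "norm ((cmod (complex_of_real (exp (K * norm z) * exp (- (c * (norm z)\<^sup>2)))))\<^sup>2)
          \<le> norm (exp (K\<^sup>2 / c) * exp (- (c * (norm z)\<^sup>2)))"
        by (simp only: norm_of_real abs_mult abs_exp_cancel norm_power real_norm_def power2_abs abs_power2)
    qed
  qed (use m in measurable)
  then show ?thesis using m by (simp add: L2_def)
qed

text \<open>The closure properties put every polynomial times the Gaussian into \<open>S\<close>.
  Expanding a character in its exponential series, which the Gaussian dominates, shows that the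
  Fourier transform of \<open>g\<close> times the Gaussian vanishes identically; the Gaussian has no
  zeros.\<close>

lemma Gaussian_span_total:
  fixes g :: "'a::euclidean_space \<Rightarrow> complex"
  assumes g: "g \<in> L2 lborel" and c: "0 < c"
    and gauss: "(\<lambda>z. complex_of_real (exp (- (c * (norm z)\<^sup>2)))) \<in> S"
    and add: "\<And>u v. u \<in> S \<Longrightarrow> v \<in> S \<Longrightarrow> (\<lambda>z. u z + v z) \<in> S"
    and scale: "\<And>u a. u \<in> S \<Longrightarrow> (\<lambda>z. a * u z) \<in> S"
    and coord: "\<And>u b. u \<in> S \<Longrightarrow> b \<in> Basis \<Longrightarrow> (\<lambda>z. complex_of_real (z \<bullet> b) * u z) \<in> S"
    and orth: "\<And>u. u \<in> S \<Longrightarrow> (LINT z|lborel. g z * u z) = 0"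
  shows "AE z in lborel. g z = 0"
proof -
  let ?e = "\<lambda>z::'a. complex_of_real (exp (- (c * (norm z)\<^sup>2)))"
  have gm [measurable]: "g \<in> borel_measurable borel" using L2_measurable[OF g] by simp
  have zeroS: "(\<lambda>z. 0) \<in> S" using scale[OF gauss, of 0] by simp
  have sum: "(\<lambda>z. \<Sum>i\<in>I. u i z) \<in> S" if "finite I" "\<And>i. i \<in> I \<Longrightarrow> u i \<in> S" for u :: "'i \<Rightarrow> _" and I
    using that by (induction I rule: finite_induct) (auto intro: zeroS add)
  have inner: "(\<lambda>z. complex_of_real (w \<bullet> z) * u z) \<in> S" if "u \<in> S" for w u
  proof -
    have "(\<lambda>z. \<Sum>b\<in>Basis. complex_of_real (w \<bullet> b) * (complex_of_real (z \<bullet> b) * u z)) \<in> S"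
      by (intro sum scale coord that finite_Basis)
    moreover have "(\<Sum>b\<in>Basis. complex_of_real (w \<bullet> b) * (complex_of_real (z \<bullet> b) * u z)) = complex_of_real (w \<bullet> z) * u z" for z
      by (subst (3) euclidean_inner) (simp add: sum_distrib_right mult.assoc)
    ultimately show ?thesis by simp
  qed
  have pow: "(\<lambda>z. (\<i> * complex_of_real (w \<bullet> z)) ^ k * ?e z) \<in> S" for w k
  proof (induction k)
    case (Suc k)
    then show ?case using scale[OF inner[OF Suc, of w], of \<i>] by (simp add: mult_ac)
  qed (simp add: gauss)
  have bigint: "integrable lborel (\<lambda>z. g z * complex_of_real (exp (K * norm z) * exp (- (c * (norm z)\<^sup>2))))" for K
    by (rule integrable_L2_mult[OF g exp_norm_gaussian_L2[OF c]])
  have "AE z in lborel. g z * ?e z = 0"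
  proof (rule Fourier_unique)
    show "integrable lborel (\<lambda>z. g z * ?e z)" using bigint[of 0] by simp
    fix w :: 'a
    let ?s = "\<lambda>n z. g z * (\<Sum>k<n. inverse (fact k) * ((\<i> * complex_of_real (w \<bullet> z)) ^ k * ?e z))"
    have "(\<lambda>n. LINT z|lborel. ?s n z) \<longlonglongrightarrow> (LINT z|lborel. g z * ?e z * exp (\<i> * complex_of_real (w \<bullet> z)))"
    proof (rule integral_dominated_convergence[where
          w = "\<lambda>z. norm (g z * complex_of_real (exp (norm w * norm z) * exp (- (c * (norm z)\<^sup>2))))"])
      show "integrable lborel (\<lambda>z. norm (g z * complex_of_real (exp (norm w * norm z) * exp (- (c * (norm z)\<^sup>2)))))"
        by (intro integrable_norm bigint)
      show "AE z in lborel. (\<lambda>n. ?s n z) \<longlonglongrightarrow> g z * ?e z * exp (\<i> * complex_of_real (w \<bullet> z))"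
      proof (rule AE_I2)
        fix z
        have "(\<lambda>k. (\<i> * complex_of_real (w \<bullet> z)) ^ k /\<^sub>R fact k) sums exp (\<i> * complex_of_real (w \<bullet> z))"
          by (rule exp_converges)
        then have "(\<lambda>n. (g z * ?e z) * (\<Sum>k<n. (\<i> * complex_of_real (w \<bullet> z)) ^ k /\<^sub>R fact k))
            \<longlonglongrightarrow> (g z * ?e z) * exp (\<i> * complex_of_real (w \<bullet> z))"
          unfolding sums_def by (intro tendsto_intros)
        then show "(\<lambda>n. ?s n z) \<longlonglongrightarrow> g z * ?e z * exp (\<i> * complex_of_real (w \<bullet> z))"
          by (simp add: sum_distrib_left scaleR_conv_of_real mult_ac)
      qed
      show "AE z in lborel. norm (?s n z)
          \<le> norm (g z * complex_of_real (exp (norm w * norm z) * exp (- (c * (norm z)\<^sup>2))))" for n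
      proof (rule AE_I2)
        fix z
        have "norm (\<Sum>k<n. inverse (fact k) * ((\<i> * complex_of_real (w \<bullet> z)) ^ k * ?e z))
            \<le> (\<Sum>k<n. (norm w * norm z) ^ k /\<^sub>R fact k * exp (- (c * (norm z)\<^sup>2)))"
        proof (rule sum_norm_le)
          fix k
          have "\<bar>w \<bullet> z\<bar> ^ k \<le> (norm w * norm z) ^ k"
            by (intro power_mono Cauchy_Schwarz_ineq2) auto
          then show "norm (inverse (fact k) * ((\<i> * complex_of_real (w \<bullet> z)) ^ k * ?e z))
              \<le> (norm w * norm z) ^ k /\<^sub>R fact k * exp (- (c * (norm z)\<^sup>2))"
            by (simp add: norm_mult norm_power norm_inverse mult_left_mono mult_right_mono)
        qed
        also have "\<dots> = (\<Sum>k<n. (norm w * norm z) ^ k /\<^sub>R fact k) * exp (- (c * (norm z)\<^sup>2))"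
          by (simp add: sum_distrib_right)
        also have "\<dots> \<le> exp (norm w * norm z) * exp (- (c * (norm z)\<^sup>2))"
        proof (rule mult_right_mono)
          show "(\<Sum>k<n. (norm w * norm z) ^ k /\<^sub>R fact k) \<le> exp (norm w * norm z)"
            unfolding exp_def by (intro sum_le_suminf summable_exp_generic) auto
        qed simp
        finally show "norm (?s n z) \<le> norm (g z * complex_of_real (exp (norm w * norm z) * exp (- (c * (norm z)\<^sup>2))))"
          by (simp add: norm_mult mult_left_mono)
      qed
      show "(\<lambda>z. ?s n z) \<in> borel_measurable lborel" for n by measurable
      show "(\<lambda>z. g z * ?e z * exp (\<i> * complex_of_real (w \<bullet> z))) \<in> borel_measurable lborel" by measurable
    qed
    moreover have "(LINT z|lborel. ?s n z) = 0" for n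
      by (intro orth sum scale pow finite_lessThan)
    ultimately show "(LINT z|lborel. g z * ?e z * exp (\<i> * complex_of_real (w \<bullet> z))) = 0"
      by (simp add: LIMSEQ_const_iff)
  qed
  then show ?thesis by simp
qed

section \<open>The Fourier transform of the Gaussian\<close>

text \<open>This is the characteristic function of the standard normal distribution with the density
  constant \<open>1 / sqrt (2 * pi)\<close> moved to the other side.\<close>

lemma Fourier_gaussian_real:
  fixes w :: real
  shows "integrable lborel (\<lambda>t. complex_of_real (exp (- (t\<^sup>2 / 2))) * exp (\<i> * complex_of_real (w * t)))"
    and "(LINT t|lborel. complex_of_real (exp (- (t\<^sup>2 / 2))) * exp (\<i> * complex_of_real (w * t)))
      = complex_of_real (sqrt (2 * pi) * exp (- (w\<^sup>2 / 2)))"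
proof -
  have g: "integrable lborel (\<lambda>t. complex_of_real (exp (- (t\<^sup>2 / 2))))"
    using gaussian_integrable[of "1/2", where 'a = real] by simp
  show "integrable lborel (\<lambda>t. complex_of_real (exp (- (t\<^sup>2 / 2))) * exp (\<i> * complex_of_real (w * t)))"
    by (rule Bochner_Integration.integrable_bound[OF g]) (auto simp: norm_mult)
  have "complex_of_real (exp (- (w\<^sup>2) / 2)) = char std_normal_distribution w"
    by (simp add: char_std_normal_distribution)
  also have "\<dots> = (LINT t|lborel. std_normal_density t *\<^sub>R exp (\<i> * complex_of_real (w * t)))"
    unfolding char_def by (subst integral_density) (auto simp: normal_density_nonneg)
  also have "\<dots> = (LINT t|lborel. complex_of_real (1 / sqrt (2 * pi)) *
      (complex_of_real (exp (- (t\<^sup>2 / 2))) * exp (\<i> * complex_of_real (w * t))))"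
    by (simp add: std_normal_density_def scaleR_conv_of_real mult.assoc)
  also have "\<dots> = complex_of_real (1 / sqrt (2 * pi)) *
      (LINT t|lborel. complex_of_real (exp (- (t\<^sup>2 / 2))) * exp (\<i> * complex_of_real (w * t)))"
    by (rule integral_mult_right_zero)
  finally show "(LINT t|lborel. complex_of_real (exp (- (t\<^sup>2 / 2))) * exp (\<i> * complex_of_real (w * t)))
      = complex_of_real (sqrt (2 * pi) * exp (- (w\<^sup>2 / 2)))"
    by (simp add: field_simps)
qed

lemma Fourier_gaussian:
  fixes w :: "'a::euclidean_space"
  shows "(LINT z|lborel. complex_of_real (exp (- ((norm z)\<^sup>2 / 2))) * exp (\<i> * complex_of_real (w \<bullet> z)))
      = complex_of_real (sqrt (2 * pi) ^ DIM('a) * exp (- ((norm w)\<^sup>2 / 2)))"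
proof -
  have norm_sq: "(norm z)\<^sup>2 = (\<Sum>b\<in>Basis. (z \<bullet> b)\<^sup>2)" for z :: 'a
    by (subst power2_norm_eq_inner, subst euclidean_inner) (simp add: power2_eq_square)
  have gauss_prod: "complex_of_real (exp (- ((norm z)\<^sup>2 / 2))) = (\<Prod>b\<in>Basis. complex_of_real (exp (- ((z \<bullet> b)\<^sup>2 / 2))))" for z :: 'a
    by (simp add: norm_sq exp_sum[symmetric] sum_divide_distrib sum_negf of_real_prod[symmetric] del: of_real_prod)
  have "exp (\<i> * complex_of_real (w \<bullet> z)) = (\<Prod>b\<in>Basis. exp (\<i> * complex_of_real ((w \<bullet> b) * (z \<bullet> b))))" for z
    by (subst euclidean_inner) (simp add: exp_sum[symmetric] sum_distrib_left)
  then have "complex_of_real (exp (- ((norm z)\<^sup>2 / 2))) * exp (\<i> * complex_of_real (w \<bullet> z))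
      = (\<Prod>b\<in>Basis. complex_of_real (exp (- ((z \<bullet> b)\<^sup>2 / 2))) * exp (\<i> * complex_of_real ((w \<bullet> b) * (z \<bullet> b))))" for z
    by (simp add: gauss_prod prod.distrib)
  then have "(LINT z|lborel. complex_of_real (exp (- ((norm z)\<^sup>2 / 2))) * exp (\<i> * complex_of_real (w \<bullet> z)))
      = (\<Prod>b\<in>Basis. complex_of_real (sqrt (2 * pi) * exp (- ((w \<bullet> b)\<^sup>2 / 2))))"
    by (simp only: lborel_integral_prod[where f = "\<lambda>b t. complex_of_real (exp (- (t\<^sup>2 / 2))) * exp (\<i> * complex_of_real ((w \<bullet> b) * t))",
          OF Fourier_gaussian_real(1)] Fourier_gaussian_real(2))
  also have "\<dots> = complex_of_real (sqrt (2 * pi) ^ DIM('a)) * (\<Prod>b\<in>Basis. complex_of_real (exp (- ((w \<bullet> b)\<^sup>2 / 2))))"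
    by (simp add: prod.distrib)
  finally show ?thesis by (simp only: gauss_prod of_real_mult)
qed

section \<open>Function classes closed under differentiation and multiplication\<close>

text \<open>Exactly what one integration by parts in the direction \<open>b\<close> consumes; no
  other derivative is involved.\<close>

definition nice :: "'a::euclidean_space \<Rightarrow> ('a \<Rightarrow> complex) \<Rightarrow> bool" where
  "nice b u \<longleftrightarrow> (\<forall>z. u differentiable (at z)) \<and> rapid u \<and> rapid (partial_deriv b u)"

lemma cnj_has_derivative:
  "(f has_derivative D) F \<Longrightarrow> ((\<lambda>z. cnj (f z)) has_derivative (\<lambda>h. cnj (D h))) F"
  by (rule bounded_linear.has_derivative[OF bounded_linear_cnj])

lemma cnj_differentiable: "f differentiable F \<Longrightarrow> (\<lambda>z. cnj (f z)) differentiable F"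
  using cnj_has_derivative unfolding differentiable_def by blast

lemma partial_deriv_cnj:
  assumes "f differentiable (at z)"
  shows "partial_deriv b (\<lambda>z. cnj (f z)) z = cnj (partial_deriv b f z)"
  using partial_derivI[OF cnj_has_derivative[OF assms[unfolded frechet_derivative_works]], of b]
  by (simp only: partial_deriv_def)

lemma nice_by_parts:
  assumes u: "nice b u" and v: "nice b v"
  shows "l2_inner lborel (partial_deriv b u) v = - l2_inner lborel u (partial_deriv b v)"
proof -
  have eq: "partial_deriv b (\<lambda>z. cnj (v z)) = (\<lambda>z. cnj (partial_deriv b v z))"
    using v by (auto simp: nice_def partial_deriv_cnj)
  have "(LINT z|lborel. partial_deriv b u z * cnj (v z)) = - (LINT z|lborel. u z * partial_deriv b (\<lambda>z. cnj (v z)) z)"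
  proof (rule integral_by_parts)
    show "continuous_on UNIV (partial_deriv b (\<lambda>z. cnj (v z)))"
      unfolding eq using v by (intro rapid_continuous rapid_cnj) (simp add: nice_def)
    show "integrable lborel (\<lambda>z. u z * partial_deriv b (\<lambda>z. cnj (v z)) z)"
      unfolding eq using u v by (intro rapid_integrable rapid_mult rapid_cnj) (simp_all add: nice_def)
  qed (use u v in \<open>auto simp: nice_def intro!: rapid_integrable rapid_mult rapid_cnj rapid_continuous cnj_differentiable\<close>)
  then show ?thesis by (simp add: l2_inner_def eq)
qed

lemma l2_inner_coord:
  "l2_inner M (\<lambda>z. complex_of_real (z \<bullet> b) * u z) v = l2_inner M u (\<lambda>z. complex_of_real (z \<bullet> b) * v z)"
  by (simp add: l2_inner_def mult_ac)

text \<open>Stability under coordinates and derivatives upgrades boundedness to full Schwartz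
  behaviour, so for a span only boundedness, differentiability and stability of the generators have
  to be verified.\<close>

definition test_class :: "('a::euclidean_space \<Rightarrow> complex) set \<Rightarrow> bool" where
  "test_class S \<longleftrightarrow> (\<forall>u\<in>S. bounded (range u) \<and> (\<forall>z. u differentiable (at z))) \<and>
     (\<forall>u\<in>S. \<forall>v\<in>S. (\<lambda>z. u z + v z) \<in> S) \<and> (\<forall>u\<in>S. \<forall>c. (\<lambda>z. c * u z) \<in> S) \<and>
     (\<forall>u\<in>S. \<forall>b\<in>Basis. (\<lambda>z. complex_of_real (z \<bullet> b) * u z) \<in> S \<and> partial_deriv b u \<in> S)"

context
  fixes S :: "('a::euclidean_space \<Rightarrow> complex) set"
  assumes S: "test_class S"
begin

lemma test_classD:
  "u \<in> S \<Longrightarrow> bounded (range u)" "u \<in> S \<Longrightarrow> u differentiable (at z)"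
  "u \<in> S \<Longrightarrow> v \<in> S \<Longrightarrow> (\<lambda>z. u z + v z) \<in> S" "u \<in> S \<Longrightarrow> (\<lambda>z. c * u z) \<in> S"
  "u \<in> S \<Longrightarrow> b \<in> Basis \<Longrightarrow> (\<lambda>z. complex_of_real (z \<bullet> b) * u z) \<in> S"
  "u \<in> S \<Longrightarrow> b \<in> Basis \<Longrightarrow> partial_deriv b u \<in> S"
  using S unfolding test_class_def by blast+

lemma test_class_monomial:
  assumes u: "u \<in> S"
  shows "(\<lambda>z. monomial \<beta> z *\<^sub>R u z) \<in> S"
proof -
  have pow: "(\<lambda>z. complex_of_real ((z \<bullet> b) ^ n) * v z) \<in> S" if "b \<in> Basis" "v \<in> S" for b n v
  proof (induction n)
    case (Suc n)
    then show ?case using test_classD(5)[OF Suc that(1)] by (simp add: mult.assoc)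
  qed (use that in simp)
  have "(\<lambda>z. complex_of_real (\<Prod>b\<in>B. (z \<bullet> b) ^ \<beta> b) * u z) \<in> S" if "finite B" "B \<subseteq> Basis" for B
    using that
  proof (induction B rule: finite_induct)
    case (insert b B)
    then show ?case using pow[of b "\<lambda>z. complex_of_real (\<Prod>b\<in>B. (z \<bullet> b) ^ \<beta> b) * u z" "\<beta> b"]
      by (simp add: mult.assoc)
  qed (use u in simp)
  then show ?thesis by (simp add: monomial_def scaleR_conv_of_real)
qed

lemma test_class_rapid: "u \<in> S \<Longrightarrow> rapid u"
  unfolding rapid_def
  using test_classD(1)[OF test_class_monomial] test_classD(2)
  by (auto simp: continuous_on_eq_continuous_at intro: differentiable_imp_continuous_within)

lemma test_class_L2: "u \<in> S \<Longrightarrow> u \<in> L2 lborel"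
  by (intro rapid_L2 test_class_rapid)

lemma test_class_nice: "u \<in> S \<Longrightarrow> b \<in> Basis \<Longrightarrow> nice b u"
  by (simp add: nice_def test_classD test_class_rapid)

lemma test_class_schwartz:
  assumes u: "u \<in> S"
  shows "u \<in> schwartz"
proof -
  have fold: "foldr partial_deriv bs u \<in> S" if "set bs \<subseteq> Basis" for bs
    using that by (induction bs) (auto simp: u intro: test_classD)
  have pow: "(partial_deriv b ^^ n) v \<in> S" if "b \<in> Basis" "v \<in> S" for b n v
    using that by (induction n) (auto intro: test_classD)
  have bl: "set (basis_list :: 'a list) = Basis"
    using someI_ex[of "\<lambda>bs::'a list. distinct bs \<and> set bs = Basis"] finite_distinct_list[OF finite_Basis]
    unfolding basis_list_def by blast
  have "foldr (\<lambda>b g. (partial_deriv b ^^ \<alpha> b) g) bs u \<in> S" if "set bs \<subseteq> Basis" for bs \<alpha>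
    using that by (induction bs) (auto simp: u intro: pow)
  then have "multi_deriv \<alpha> u \<in> S" for \<alpha> unfolding multi_deriv_def using bl by blast
  then show ?thesis
    unfolding schwartz_def smooth_fun_def using fold test_classD(1)[OF test_class_monomial] test_classD(2) by blast
qed

end

text \<open>The complex linear span, generated inductively so that linear properties pass from the
  generators to all members by rule induction.\<close>

inductive_set fspan :: "('i \<Rightarrow> 'a \<Rightarrow> complex) \<Rightarrow> ('a \<Rightarrow> complex) set" for \<Phi> where
  base: "\<Phi> i \<in> fspan \<Phi>"
| add: "u \<in> fspan \<Phi> \<Longrightarrow> v \<in> fspan \<Phi> \<Longrightarrow> (\<lambda>z. u z + v z) \<in> fspan \<Phi>"
| scale: "u \<in> fspan \<Phi> \<Longrightarrow> (\<lambda>z. c * u z) \<in> fspan \<Phi>"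

lemma fspan_sum:
  assumes "finite I" "\<And>i. i \<in> I \<Longrightarrow> u i \<in> fspan \<Phi>"
  shows "(\<lambda>z. \<Sum>i\<in>I. u i z) \<in> fspan \<Phi>"
  using assms
proof (induction I rule: finite_induct)
  case empty
  show ?case using fspan.scale[OF fspan.base, where c = 0] by simp
qed (auto intro: fspan.add)

lemma test_class_fspan:
  assumes b: "\<And>i. bounded (range (\<Phi> i))" and d: "\<And>i z. \<Phi> i differentiable (at z)"
    and c: "\<And>i b. b \<in> Basis \<Longrightarrow> (\<lambda>z. complex_of_real (z \<bullet> b) * \<Phi> i z) \<in> fspan \<Phi>"
    and p: "\<And>i b. b \<in> Basis \<Longrightarrow> partial_deriv b (\<Phi> i) \<in> fspan \<Phi>"
  shows "test_class (fspan \<Phi>)"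
proof -
  have bd: "bounded (range u) \<and> (\<forall>z. u differentiable (at z))" if "u \<in> fspan \<Phi>" for u
    using that
  proof induction
    case (add u v)
    then show ?case by (auto intro: bounded_plus_comp differentiable_add)
  next
    case (scale u c)
    then obtain B where "\<And>z. norm (u z) \<le> B" unfolding bounded_iff by auto
    then have "norm (c * u z) \<le> norm c * B" for z by (simp add: norm_mult mult_left_mono)
    then have "bounded (range (\<lambda>z. c * u z))" unfolding bounded_iff by blast
    then show ?case using scale by (auto intro: differentiable_mult)
  qed (simp add: b d)
  have co: "(\<lambda>z. complex_of_real (z \<bullet> b) * u z) \<in> fspan \<Phi>" if "u \<in> fspan \<Phi>" "b \<in> Basis" for u b
    using that
  proof induction
    case (add u v)
    then show ?case using fspan.add[of "\<lambda>z. complex_of_real (z \<bullet> b) * u z" \<Phi> "\<lambda>z. complex_of_real (z \<bullet> b) * v z"]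
      by (simp add: distrib_left)
  next
    case (scale u c)
    then show ?case using fspan.scale[of "\<lambda>z. complex_of_real (z \<bullet> b) * u z" \<Phi> c]
      by (simp add: mult.left_commute)
  qed (simp add: c)
  have pa: "partial_deriv b u \<in> fspan \<Phi>" if "u \<in> fspan \<Phi>" "b \<in> Basis" for u b
    using that
  proof induction
    case (add u v)
    have "partial_deriv b (\<lambda>z. u z + v z) = (\<lambda>z. partial_deriv b u z + partial_deriv b v z)"
      using add bd by (auto simp: partial_deriv_add)
    then show ?case using add by (auto intro: fspan.add)
  next
    case (scale u c)
    have "partial_deriv b (\<lambda>z. c * u z) = (\<lambda>z. c * partial_deriv b u z)"
      using scale bd by (auto simp: partial_deriv_scale)
    then show ?case using scale by (auto intro: fspan.scale)
  qed (simp add: p)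
  show ?thesis unfolding test_class_def using bd co pa by (auto intro: fspan.intros)
qed

section \<open>Ladders\<close>

definition up :: "'k \<Rightarrow> ('k \<Rightarrow> nat) \<Rightarrow> 'k \<Rightarrow> nat" where "up k \<gamma> = \<gamma>(k := Suc (\<gamma> k))"

definition dn :: "'k \<Rightarrow> ('k \<Rightarrow> nat) \<Rightarrow> 'k \<Rightarrow> nat" where "dn k \<gamma> = \<gamma>(k := \<gamma> k - 1)"

lemma up_dn: "0 < \<gamma> k \<Longrightarrow> up k (dn k \<gamma>) = \<gamma>"
  by (simp add: up_def dn_def fun_eq_iff)

lemma sum_up: "(\<Sum>i\<in>UNIV. up k \<gamma> i) = Suc (\<Sum>i\<in>UNIV. \<gamma> i)" for k :: "'k::finite"
proof -
  have "(\<Sum>i\<in>UNIV. up k \<gamma> i) = (\<Sum>i\<in>UNIV. \<gamma> i + (if i = k then 1 else 0))"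
    by (intro sum.cong) (auto simp: up_def)
  then show ?thesis by (simp add: sum.distrib)
qed

text \<open>The squared norm of a ladder state relative to the ground state: raising an index from
  \<open>k\<close> to \<open>k + 1\<close> multiplies it by \<open>2 * (k + 1)\<close>.\<close>

definition mfact :: "('k::finite \<Rightarrow> nat) \<Rightarrow> real" where
  "mfact \<gamma> = (\<Prod>k\<in>UNIV. 2 ^ \<gamma> k * fact (\<gamma> k))"

lemma mfact_pos: "0 < mfact \<gamma>"
  unfolding mfact_def by (intro prod_pos) simp

lemma mfact_zero [simp]: "mfact (\<lambda>_. 0) = 1"
  by (simp add: mfact_def)

lemma mfact_up: "mfact (up k \<gamma>) = 2 * real (Suc (\<gamma> k)) * mfact \<gamma>"
proof -
  have "mfact (up k \<gamma>) = (2 ^ Suc (\<gamma> k) * fact (Suc (\<gamma> k))) * (\<Prod>i\<in>UNIV - {k}. 2 ^ up k \<gamma> i * fact (up k \<gamma> i))"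
    unfolding mfact_def by (subst prod.remove[of UNIV k]) (simp_all add: up_def)
  also have "(\<Prod>i\<in>UNIV - {k}. 2 ^ up k \<gamma> i * fact (up k \<gamma> i)) = (\<Prod>i\<in>UNIV - {k}. 2 ^ \<gamma> i * fact (\<gamma> i) :: real)"
    by (intro prod.cong) (auto simp: up_def)
  also have "(2 ^ Suc (\<gamma> k) * fact (Suc (\<gamma> k))) * \<dots> = 2 * real (Suc (\<gamma> k)) * mfact \<gamma>"
    unfolding mfact_def
    by (subst prod.remove[of UNIV k "\<lambda>i. 2 ^ \<gamma> i * fact (\<gamma> i) :: real"]) (simp_all add: algebra_simps)
  finally show ?thesis .
qed

text \<open>The ladder relation alone determines all inner products: each raising step on the left
  becomes a lowering step on the right, until the left factor is the ground state. The induction is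
  on the total degree of \<open>\<gamma>\<close>.\<close>

lemma ladder_inner:
  fixes \<Phi> :: "('k::finite \<Rightarrow> nat) \<Rightarrow> 'a \<Rightarrow> complex"
  assumes lad: "\<And>k \<gamma> \<delta>. l2_inner M (\<Phi> (up k \<gamma>)) (\<Phi> \<delta>) = complex_of_real (2 * real (\<delta> k)) * l2_inner M (\<Phi> \<gamma>) (\<Phi> (dn k \<delta>))"
  shows "l2_inner M (\<Phi> \<gamma>) (\<Phi> \<delta>) =
    (if \<gamma> = \<delta> then complex_of_real (mfact \<gamma>) * l2_inner M (\<Phi> (\<lambda>_. 0)) (\<Phi> (\<lambda>_. 0)) else 0)"
proof (induction "\<Sum>k\<in>UNIV. \<gamma> k" arbitrary: \<gamma> \<delta>)
  case 0
  then have g0: "\<gamma> = (\<lambda>_. 0)" by auto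
  show ?case
  proof (cases "\<delta> = (\<lambda>_. 0)")
    case False
    \<comment> \<open>Here the relation is used with the arguments exchanged: raising to
      \<open>\<delta>\<close> on the left would lower the ground state on the right, which carries
      the factor 0.\<close>
    then obtain k where "0 < \<delta> k" by auto
    then have "l2_inner M (\<Phi> \<delta>) (\<Phi> \<gamma>) = 0"
      using lad[of k "dn k \<delta>" \<gamma>] by (simp add: up_dn g0)
    then have "l2_inner M (\<Phi> \<gamma>) (\<Phi> \<delta>) = 0" by (subst l2_inner_commute) simp
    then show ?thesis using False g0 by auto
  qed (simp add: g0)
next
  case (Suc n)
  have "\<exists>k. 0 < \<gamma> k"
  proof (rule ccontr)
    assume "\<nexists>k. 0 < \<gamma> k"
    then have "(\<Sum>k\<in>UNIV. \<gamma> k) = 0" by simp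
    then show False using Suc by simp
  qed
  then obtain k where k: "0 < \<gamma> k" by blast
  have n: "n = (\<Sum>i\<in>UNIV. dn k \<gamma> i)"
    using Suc(2) sum_up[of k "dn k \<gamma>"] by (simp add: up_dn k)
  have "l2_inner M (\<Phi> \<gamma>) (\<Phi> \<delta>) = complex_of_real (2 * real (\<delta> k)) * l2_inner M (\<Phi> (dn k \<gamma>)) (\<Phi> (dn k \<delta>))"
    using lad[of k "dn k \<gamma>" \<delta>] by (simp add: up_dn k)
  note eq = this[unfolded Suc(1)[OF n, of "dn k \<delta>"]]
  show ?case
  proof (cases "\<gamma> = \<delta>")
    case True
    then show ?thesis using eq k mfact_up[of k "dn k \<gamma>"] by (simp add: up_dn) (simp add: dn_def)
  next
    case False
    then have "\<delta> k = 0 \<or> dn k \<gamma> \<noteq> dn k \<delta>" using up_dn[of \<gamma> k] up_dn[of \<delta> k] k by (cases "\<delta> k") auto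
    then show ?thesis using eq False by auto
  qed
qed

section \<open>Hermite functions in one variable\<close>

text \<open>At \<open>k = 0\<close> the truncated index \<open>k - 1\<close> only occurs with the factor \<open>k\<close>; the same
  convention is used for all ladder relations.\<close>

fun herm :: "nat \<Rightarrow> real \<Rightarrow> real" where
  "herm 0 t = exp (- (t\<^sup>2 / 2))"
| "herm (Suc k) t = 2 * t * herm k t - 2 * real k * herm (k - 1) t"

lemma herm_mult: "t * herm k t = herm (Suc k) t / 2 + real k * herm (k - 1) t"
  by (simp add: field_simps)

declare herm.simps(2) [simp del]

text \<open>\<open>herm k\<close> is the physicists' Hermite polynomial times
  \<open>exp (- t^2 / 2)\<close>, and the formula is half the difference of lowering and raising.
  Strong induction is needed because the recursion reaches back two steps.\<close>

lemma herm_deriv: "(herm k has_real_derivative (real k * herm (k - 1) t - herm (Suc k) t / 2)) (at t)"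
proof (induction k arbitrary: t rule: less_induct)
  case (less k)
  show ?case
  proof (cases k)
    case 0
    have "((\<lambda>t. exp (- (t\<^sup>2 / 2))) has_real_derivative (- (t * exp (- (t\<^sup>2 / 2))))) (at t)"
      by (auto intro!: derivative_eq_intros)
    then show ?thesis unfolding 0 herm.simps(1)[abs_def] by (simp add: herm.simps(2))
  next
    case (Suc m)
    have a: "(herm m has_real_derivative (real m * herm (m - 1) t - herm (Suc m) t / 2)) (at t)"
      by (rule less) (simp add: Suc)
    have b: "(herm (m - 1) has_real_derivative (real (m - 1) * herm (m - 1 - 1) t - herm (Suc (m - 1)) t / 2)) (at t)"
      by (rule less) (simp add: Suc)
    have "((\<lambda>t. 2 * t * herm m t - 2 * real m * herm (m - 1) t) has_real_derivative
        (2 * herm m t + 2 * t * (real m * herm (m - 1) t - herm (Suc m) t / 2)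
         - 2 * real m * (real (m - 1) * herm (m - 1 - 1) t - herm (Suc (m - 1)) t / 2))) (at t)"
      by (rule derivative_eq_intros a b refl | simp)+
    moreover have "2 * herm m t + 2 * t * (real m * herm (m - 1) t - herm (Suc m) t / 2)
         - 2 * real m * (real (m - 1) * herm (m - 1 - 1) t - herm (Suc (m - 1)) t / 2)
        = real k * herm (k - 1) t - herm (Suc k) t / 2"
    proof -
      have e1: "t * herm (Suc m) t = herm (Suc (Suc m)) t / 2 + real (Suc m) * herm m t"
        using herm_mult[of t "Suc m"] by simp
      have e2: "t * herm (m - 1) t = herm (Suc (m - 1)) t / 2 + real (m - 1) * herm (m - 1 - 1) t"
        by (rule herm_mult)
      have "2 * herm m t + 2 * t * (real m * herm (m - 1) t - herm (Suc m) t / 2)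
         - 2 * real m * (real (m - 1) * herm (m - 1 - 1) t - herm (Suc (m - 1)) t / 2)
        = 2 * herm m t + 2 * real m * (t * herm (m - 1) t) - t * herm (Suc m) t
         - 2 * real m * (real (m - 1) * herm (m - 1 - 1) t - herm (Suc (m - 1)) t / 2)"
        by (simp add: algebra_simps)
      also have "\<dots> = real k * herm (k - 1) t - herm (Suc k) t / 2"
        unfolding e1 e2 Suc by (cases m) (simp_all add: algebra_simps)
      finally show ?thesis .
    qed
    ultimately show ?thesis unfolding Suc herm.simps(2)[abs_def] by simp
  qed
qed

lemma rapid_gaussian:
  assumes c: "0 < c"
  shows "rapid (\<lambda>z::'a::euclidean_space. complex_of_real (exp (- (c * (norm z)\<^sup>2))))"
  unfolding rapid_def
proof (intro conjI allI)
  show "continuous_on UNIV (\<lambda>z::'a. complex_of_real (exp (- (c * (norm z)\<^sup>2))))"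
    by (intro continuous_intros)
  fix \<beta> :: "'a \<Rightarrow> nat"
  let ?n = "\<Sum>b\<in>Basis. \<beta> b"
  have "norm (monomial \<beta> z *\<^sub>R complex_of_real (exp (- (c * (norm z)\<^sup>2)))) \<le> sqrt (fact ?n / (2 * c) ^ ?n)" for z :: 'a
  \<comment> \<open>Squaring turns the power of \<open>norm z\<close> into a power of its square,
    the variable in which the Gaussian decays, whatever the parity of the degree.\<close>
  proof (rule real_le_rsqrt)
    have m: "\<bar>monomial \<beta> z\<bar> \<le> norm z ^ ?n"
      unfolding monomial_def abs_prod power_sum
      by (intro prod_mono) (auto simp: power_abs intro!: power_mono Basis_le_norm)
    have "(norm (monomial \<beta> z *\<^sub>R complex_of_real (exp (- (c * (norm z)\<^sup>2)))))\<^sup>2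
        = \<bar>monomial \<beta> z\<bar>\<^sup>2 * (exp (- (c * (norm z)\<^sup>2)))\<^sup>2"
      by (simp add: power_mult_distrib)
    also have "\<dots> \<le> (norm z ^ ?n)\<^sup>2 * (exp (- (c * (norm z)\<^sup>2)))\<^sup>2"
      by (intro mult_right_mono power_mono m) auto
    also have "\<dots> = ((norm z)\<^sup>2) ^ ?n * exp (- ((2 * c) * (norm z)\<^sup>2))"
      by (simp add: power_mult[symmetric] mult.commute[of 2] exp_double[symmetric] mult.left_commute)
    also have "\<dots> \<le> fact ?n / (2 * c) ^ ?n" by (rule power_times_exp_le) (use c in auto)
    finally show "(norm (monomial \<beta> z *\<^sub>R complex_of_real (exp (- (c * (norm z)\<^sup>2)))))\<^sup>2 \<le> fact ?n / (2 * c) ^ ?n" .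
  qed
  then show "bounded (range (\<lambda>z::'a. monomial \<beta> z *\<^sub>R complex_of_real (exp (- (c * (norm z)\<^sup>2)))))"
    unfolding bounded_iff by blast
qed

lemma rapid_herm: "rapid (\<lambda>t. complex_of_real (herm k t))"
proof (induction k rule: less_induct)
  case (less k)
  show ?case
  proof (cases k)
    case 0
    then show ?thesis using rapid_gaussian[of "1/2", where 'a = real] by simp
  next
    case (Suc m)
    have "rapid (\<lambda>t. 2 * (complex_of_real (t \<bullet> 1) * complex_of_real (herm m t))
        + complex_of_real (- 2 * real m) * complex_of_real (herm (m - 1) t))"
      using less Suc by (intro rapid_add rapid_scale rapid_coord) auto
    then show ?thesis unfolding Suc herm.simps(2) by (simp add: mult.assoc)
  qed
qed

lemma herm_bounded: "\<exists>B. \<forall>t. \<bar>herm k t\<bar> \<le> B"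
  using rapid_bounded[OF rapid_herm[of k]] unfolding bounded_iff by auto

lemma herm_continuous: "continuous_on UNIV (herm k)"
  using DERIV_isCont[OF herm_deriv] by (auto simp: continuous_on_eq_continuous_at)

lemma herm_measurable [measurable]: "herm k \<in> borel_measurable borel"
  by (rule borel_measurable_continuous_onI[OF herm_continuous])

section \<open>The Fourier-Wigner transforms of pairs of Hermite functions\<close>

text \<open>These are the recursions satisfied by \<open>\<integral> e\<^bsup>-it\<xi>\<^esup> h\<^sub>j(t - x/2) h\<^sub>k(t + x/2) dt / \<surd>\<pi>\<close>, taken as a
  definition so that derivatives and ladders can be computed algebraically.\<close>

fun psi :: "nat \<Rightarrow> nat \<Rightarrow> real \<Rightarrow> real \<Rightarrow> complex" where
  "psi 0 0 x \<xi> = complex_of_real (exp (- ((x\<^sup>2 + \<xi>\<^sup>2) / 4)))"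
| "psi (Suc j) 0 x \<xi> = - (Complex x \<xi>) * psi j 0 x \<xi>"
| "psi j (Suc k) x \<xi> = Complex x (- \<xi>) * psi j k x \<xi> + 2 * of_nat j * psi (j - 1) k x \<xi>"

declare psi.simps [simp del]

lemma psi_conj_mult: "Complex x (- \<xi>) * psi j k x \<xi> = psi j (Suc k) x \<xi> - 2 * of_nat j * psi (j - 1) k x \<xi>"
  by (simp add: psi.simps(3))

text \<open>The recursion prescribes multiplication by \<open>x + i \<xi>\<close> only for second
  index 0. Since this commutes with multiplication by \<open>x - i \<xi>\<close>, which raises the
  second index, the rule propagates to all indices.\<close>

lemma psi_mult: "Complex x \<xi> * psi j k x \<xi> = 2 * of_nat k * psi j (k - 1) x \<xi> - psi (Suc j) k x \<xi>"
proof (induction k arbitrary: j)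
  case 0
  then show ?case by (simp add: psi.simps(2))
next
  case (Suc k)
  let ?c = "Complex x (- \<xi>)" and ?P = "\<lambda>j k. psi j k x \<xi>"
  have "Complex x \<xi> * ?P j (Suc k) = ?c * (Complex x \<xi> * ?P j k) + 2 * of_nat j * (Complex x \<xi> * ?P (j - 1) k)"
    by (simp add: psi.simps(3) algebra_simps)
  also have "\<dots> = 2 * of_nat k * (?c * ?P j (k - 1)) - ?c * ?P (Suc j) k
      + 2 * of_nat j * (2 * of_nat k * ?P (j - 1) (k - 1) - ?P (Suc (j - 1)) k)"
    unfolding Suc by (simp add: algebra_simps)
  also have "\<dots> = 2 * of_nat k * (?P j (Suc (k - 1)) - 2 * of_nat j * ?P (j - 1) (k - 1))
      - (?P (Suc j) (Suc k) - 2 * of_nat (Suc j) * ?P j k)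
      + 2 * of_nat j * (2 * of_nat k * ?P (j - 1) (k - 1) - ?P (Suc (j - 1)) k)"
    unfolding psi_conj_mult by simp
  also have "\<dots> = 2 * of_nat (Suc k) * ?P j k - ?P (Suc j) (Suc k)"
    by (cases k; cases j) (simp_all add: algebra_simps)
  finally show ?case by simp
qed

lemma psi_x: "complex_of_real x * psi j k x \<xi> = (2 * of_nat k * psi j (k - 1) x \<xi> - psi (Suc j) k x \<xi>
    + psi j (Suc k) x \<xi> - 2 * of_nat j * psi (j - 1) k x \<xi>) / 2"
proof -
  have "complex_of_real x * psi j k x \<xi> = (Complex x \<xi> * psi j k x \<xi> + Complex x (- \<xi>) * psi j k x \<xi>) / 2"
    by (simp add: Complex_eq algebra_simps)
  then show ?thesis by (simp add: psi_mult psi_conj_mult)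
qed

lemma psi_xi: "complex_of_real \<xi> * psi j k x \<xi> = - \<i> * (2 * of_nat k * psi j (k - 1) x \<xi> - psi (Suc j) k x \<xi>
    - psi j (Suc k) x \<xi> + 2 * of_nat j * psi (j - 1) k x \<xi>) / 2"
proof -
  have "complex_of_real \<xi> * psi j k x \<xi> = - \<i> * (Complex x \<xi> * psi j k x \<xi> - Complex x (- \<xi>) * psi j k x \<xi>) / 2"
    by (simp add: Complex_eq algebra_simps)
  then show ?thesis by (simp add: psi_mult psi_conj_mult)
qed

text \<open>The candidate for the \<open>x\<close>-derivative, as for \<open>\<xi>\<close> below,
  written as a combination of neighbouring indices. It is defined before any differentiation so that
  its recursion can be checked algebraically; \<open>psi_has_derivative\<close> then confirms
  it.\<close>

definition psi_dx :: "nat \<Rightarrow> nat \<Rightarrow> real \<Rightarrow> real \<Rightarrow> complex" where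
  "psi_dx j k x \<xi> = (2 * of_nat k * psi j (k - 1) x \<xi> - psi j (Suc k) x \<xi>
    - 2 * of_nat j * psi (j - 1) k x \<xi> + psi (Suc j) k x \<xi>) / 4"

definition psi_dxi :: "nat \<Rightarrow> nat \<Rightarrow> real \<Rightarrow> real \<Rightarrow> complex" where
  "psi_dxi j k x \<xi> = - \<i> * (2 * of_nat j * psi (j - 1) k x \<xi> + psi (Suc j) k x \<xi>
    + 2 * of_nat k * psi j (k - 1) x \<xi> + psi j (Suc k) x \<xi>) / 4"

text \<open>This and the next three identities are the defining equations of \<open>psi\<close>,
  differentiated by the product rule with the candidates in place of the derivatives. They are the
  induction steps of \<open>psi_has_derivative\<close>.\<close>

lemma psi_dx_Suc0: "psi_dx (Suc j) 0 x \<xi> = - psi j 0 x \<xi> - Complex x \<xi> * psi_dx j 0 x \<xi>"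
proof -
  have eq: "Complex x \<xi> * psi_dx j 0 x \<xi> = (- (Complex x \<xi> * psi j (Suc 0) x \<xi>)
    - 2 * of_nat j * (Complex x \<xi> * psi (j - 1) 0 x \<xi>) + Complex x \<xi> * psi (Suc j) 0 x \<xi>) / 4"
    by (simp add: psi_dx_def algebra_simps)
  show ?thesis unfolding eq psi_mult by (cases j) (simp_all add: psi_dx_def field_simps)
qed

lemma psi_dxi_Suc0: "psi_dxi (Suc j) 0 x \<xi> = - \<i> * psi j 0 x \<xi> - Complex x \<xi> * psi_dxi j 0 x \<xi>"
proof -
  have eq: "Complex x \<xi> * psi_dxi j 0 x \<xi> = - \<i> * (2 * of_nat j * (Complex x \<xi> * psi (j - 1) 0 x \<xi>)
    + Complex x \<xi> * psi (Suc j) 0 x \<xi> + Complex x \<xi> * psi j (Suc 0) x \<xi>) / 4"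
    by (simp add: psi_dxi_def algebra_simps)
  show ?thesis unfolding eq psi_mult by (cases j) (simp_all add: psi_dxi_def field_simps)
qed

lemma psi_dx_Suc: "psi_dx j (Suc k) x \<xi> = psi j k x \<xi> + Complex x (- \<xi>) * psi_dx j k x \<xi> + 2 * of_nat j * psi_dx (j - 1) k x \<xi>"
proof -
  have eq: "Complex x (- \<xi>) * psi_dx j k x \<xi> = (2 * of_nat k * (Complex x (- \<xi>) * psi j (k - 1) x \<xi>) - Complex x (- \<xi>) * psi j (Suc k) x \<xi>
    - 2 * of_nat j * (Complex x (- \<xi>) * psi (j - 1) k x \<xi>) + Complex x (- \<xi>) * psi (Suc j) k x \<xi>) / 4"
    by (simp add: psi_dx_def algebra_simps)
  show ?thesis unfolding eq psi_conj_mult by (cases j; cases k) (simp_all add: psi_dx_def field_simps)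
qed

lemma psi_dxi_Suc: "psi_dxi j (Suc k) x \<xi> = - \<i> * psi j k x \<xi> + Complex x (- \<xi>) * psi_dxi j k x \<xi> + 2 * of_nat j * psi_dxi (j - 1) k x \<xi>"
proof -
  have eq: "Complex x (- \<xi>) * psi_dxi j k x \<xi> = - \<i> * (2 * of_nat j * (Complex x (- \<xi>) * psi (j - 1) k x \<xi>) + Complex x (- \<xi>) * psi (Suc j) k x \<xi>
    + 2 * of_nat k * (Complex x (- \<xi>) * psi j (k - 1) x \<xi>) + Complex x (- \<xi>) * psi j (Suc k) x \<xi>) / 4"
    by (simp add: psi_dxi_def algebra_simps)
  show ?thesis unfolding eq psi_conj_mult by (cases j; cases k) (simp_all add: psi_dxi_def field_simps)
qed

lemma psi_has_derivative:
  "((\<lambda>p. psi j k (fst p) (snd p)) has_derivative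
    (\<lambda>h. complex_of_real (fst h) * psi_dx j k (fst p) (snd p) + complex_of_real (snd h) * psi_dxi j k (fst p) (snd p))) (at p)"
proof (induction j k "fst p" "snd p" rule: psi.induct)
  case 1
  have "((\<lambda>p. complex_of_real (exp (- (((fst p)\<^sup>2 + (snd p)\<^sup>2) / 4)))) has_derivative
    (\<lambda>h. complex_of_real (- ((fst p * fst h + snd p * snd h) / 2) * exp (- (((fst p)\<^sup>2 + (snd p)\<^sup>2) / 4))))) (at p)"
    by (auto intro!: derivative_eq_intros simp: field_simps)
  moreover have "psi_dx 0 0 (fst p) (snd p) = - (complex_of_real (fst p) / 2) * psi 0 0 (fst p) (snd p)"
    using psi_x[of "fst p" 0 0 "snd p"] by (simp add: psi_dx_def field_simps)
  moreover have "psi_dxi 0 0 (fst p) (snd p) = - (complex_of_real (snd p) / 2) * psi 0 0 (fst p) (snd p)"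
    using psi_xi[of "snd p" 0 0 "fst p"] by (simp add: psi_dxi_def field_simps)
  ultimately show ?case
    by (simp add: psi.simps(1) algebra_simps add_divide_distrib)
next
  case (2 j)
  have C: "((\<lambda>p. Complex (fst p) (snd p)) has_derivative (\<lambda>h. Complex (fst h) (snd h))) (at p)"
    unfolding Complex_eq by (auto intro!: derivative_eq_intros)
  show ?case
    unfolding psi.simps(2) psi_dx_Suc0 psi_dxi_Suc0
    by (rule has_derivative_eq_rhs[OF has_derivative_mult[OF has_derivative_minus[OF C] 2]])
      (auto simp: Complex_eq algebra_simps)
next
  case (3 j k)
  have C: "((\<lambda>p. Complex (fst p) (- snd p)) has_derivative (\<lambda>h. Complex (fst h) (- snd h))) (at p)"
    unfolding Complex_eq by (auto intro!: derivative_eq_intros)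
  show ?case
    unfolding psi.simps(3) psi_dx_Suc psi_dxi_Suc
    by (rule has_derivative_eq_rhs[OF has_derivative_add[OF has_derivative_mult[OF C 3(1)] has_derivative_mult_right[OF 3(2)]]])
      (auto simp: Complex_eq algebra_simps)
qed

text \<open>The two quotients are the second derivatives in \<open>x\<close> and
  \<open>\<xi>\<close>, obtained by differentiating \<open>psi_dx\<close> and \<open>psi_dxi\<close>
  term by term. Together with the factorisation of \<open>x^2 + \<xi>^2\<close> into conjugate
  factors, everything reduces to neighbouring values of \<open>psi\<close>.\<close>

lemma psi_eigen:
  "- ((2 * of_nat k * psi_dx j (k - 1) x \<xi> - psi_dx j (Suc k) x \<xi> - 2 * of_nat j * psi_dx (j - 1) k x \<xi> + psi_dx (Suc j) k x \<xi>) / 4)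
   - (- \<i> * (2 * of_nat j * psi_dxi (j - 1) k x \<xi> + psi_dxi (Suc j) k x \<xi> + 2 * of_nat k * psi_dxi j (k - 1) x \<xi> + psi_dxi j (Suc k) x \<xi>) / 4)
   + complex_of_real ((x\<^sup>2 + \<xi>\<^sup>2) / 4) * psi j k x \<xi> = complex_of_real (real j + real k + 1) * psi j k x \<xi>"
proof -
  let ?P = "\<lambda>j k. psi j k x \<xi>"
  have "complex_of_real (x\<^sup>2 + \<xi>\<^sup>2) * ?P j k = Complex x (- \<xi>) * (Complex x \<xi> * ?P j k)"
    by (simp add: Complex_eq algebra_simps power2_eq_square)
  also have "\<dots> = 2 * of_nat k * (Complex x (- \<xi>) * ?P j (k - 1)) - Complex x (- \<xi>) * ?P (Suc j) k"
    unfolding psi_mult by (simp add: algebra_simps)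
  also have "\<dots> = 2 * of_nat k * (?P j (Suc (k - 1)) - 2 * of_nat j * ?P (j - 1) (k - 1)) - (?P (Suc j) (Suc k) - 2 * of_nat (Suc j) * ?P j k)"
    unfolding psi_conj_mult by simp
  finally have sq0: "complex_of_real (x\<^sup>2 + \<xi>\<^sup>2) * ?P j k =
      2 * of_nat k * (?P j (Suc (k - 1)) - 2 * of_nat j * ?P (j - 1) (k - 1)) - (?P (Suc j) (Suc k) - 2 * of_nat (Suc j) * ?P j k)" .
  have sq: "complex_of_real ((x\<^sup>2 + \<xi>\<^sup>2) / 4) * ?P j k =
      (2 * of_nat k * (?P j (Suc (k - 1)) - 2 * of_nat j * ?P (j - 1) (k - 1)) - (?P (Suc j) (Suc k) - 2 * of_nat (Suc j) * ?P j k)) / 4"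
    unfolding sq0[symmetric] by simp
  show ?thesis unfolding sq psi_dx_def psi_dxi_def
    by (cases j; cases k) (simp_all add: field_simps)
qed

section \<open>The integral representation of \<open>psi\<close>\<close>

definition wig :: "nat \<Rightarrow> nat \<Rightarrow> real \<Rightarrow> real \<Rightarrow> real \<Rightarrow> complex" where
  "wig j k x \<xi> t = exp (- (\<i> * complex_of_real (t * \<xi>))) * complex_of_real (herm j (t - x / 2) * herm k (t + x / 2))"

lemma wig_continuous: "continuous_on UNIV (wig j k x \<xi>)"
  unfolding wig_def[abs_def] by (intro continuous_intros continuous_on_compose2[OF herm_continuous]) auto

lemma wig_integrable: "integrable lborel (wig j k x \<xi>)"
proof -
  obtain B where B: "\<And>t. \<bar>herm j t\<bar> \<le> B" using herm_bounded by blast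
  have "integrable lborel (\<lambda>t. norm (complex_of_real (herm k (t + x / 2))))"
    by (intro integrable_norm lborel_integrable_translation rapid_integrable rapid_herm)
  then have "integrable lborel (\<lambda>t. B * norm (complex_of_real (herm k (t + x / 2))))" by simp
  then show ?thesis
  proof (rule Bochner_Integration.integrable_bound)
    show "wig j k x \<xi> \<in> borel_measurable lborel"
      using borel_measurable_continuous_onI[OF wig_continuous] by simp
    show "AE t in lborel. norm (wig j k x \<xi> t) \<le> norm (B * norm (complex_of_real (herm k (t + x / 2))))"
    proof (rule AE_I2)
      fix t
      have "norm (wig j k x \<xi> t) = \<bar>herm j (t - x / 2)\<bar> * \<bar>herm k (t + x / 2)\<bar>"
        by (simp add: wig_def norm_mult abs_mult)
      also have "\<dots> \<le> \<bar>B\<bar> * \<bar>herm k (t + x / 2)\<bar>"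
        by (intro mult_right_mono order_trans[OF B abs_ge_self]) auto
      finally show "norm (wig j k x \<xi> t) \<le> norm (B * norm (complex_of_real (herm k (t + x / 2))))"
        by (simp add: abs_mult)
    qed
  qed
qed

text \<open>The integrals obey the recursion that defines \<open>psi\<close>: multiplication by
  \<open>\<xi>\<close> comes from integrating a total derivative, multiplication by \<open>x\<close>
  from a splitting of \<open>x\<close>. Their combinations give both index shifts, and the initial
  value is a Gaussian Fourier transform.\<close>

lemma wig_integral:
  "(LINT t|lborel. wig j k x \<xi> t) = complex_of_real (sqrt pi) * psi j k x \<xi>"
proof -
  define I where "I j k = (LINT t|lborel. wig j k x \<xi> t)" for j k
  have w: "((\<lambda>t. wig j k x \<xi> t) has_vector_derivative
      (- \<i> * \<xi> * wig j k x \<xi> t + (of_nat j * wig (j - 1) k x \<xi> t - wig (Suc j) k x \<xi> t / 2)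
        + (of_nat k * wig j (k - 1) x \<xi> t - wig j (Suc k) x \<xi> t / 2))) (at t)" for j k t
  proof -
    have h: "((\<lambda>t. herm k (t + c)) has_real_derivative (real k * herm (k - 1) (t + c) - herm (Suc k) (t + c) / 2)) (at t)" for k c
      using DERIV_shift[of "herm k" _ t c] herm_deriv by blast
    have h': "((\<lambda>t. herm j (t - x / 2)) has_real_derivative (real j * herm (j - 1) (t - x / 2) - herm (Suc j) (t - x / 2) / 2)) (at t)"
      using h[of j "- (x / 2)"] by simp
    have h2: "((\<lambda>t. complex_of_real (herm j (t - x / 2) * herm k (t + x / 2))) has_vector_derivative
       complex_of_real ((real j * herm (j - 1) (t - x / 2) - herm (Suc j) (t - x / 2) / 2) * herm k (t + x / 2)
        + (real k * herm (k - 1) (t + x / 2) - herm (Suc k) (t + x / 2) / 2) * herm j (t - x / 2))) (at t)"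
      by (rule has_vector_derivative_of_real[OF DERIV_mult[OF h' h]])
    have "((\<lambda>z. exp (- (\<i> * (z * complex_of_real \<xi>)))) has_field_derivative
        (- \<i> * \<xi> * exp (- (\<i> * (complex_of_real t * complex_of_real \<xi>))))) (at (complex_of_real t))"
      by (auto intro!: derivative_eq_intros)
    from has_vector_derivative_real_field[OF this]
    have e: "((\<lambda>t. exp (- (\<i> * complex_of_real (t * \<xi>)))) has_vector_derivative (- \<i> * \<xi> * exp (- (\<i> * complex_of_real (t * \<xi>))))) (at t)"
      by simp
    show ?thesis
      using has_vector_derivative_mult[OF e h2]
      unfolding wig_def by (simp add: algebra_simps)
  qed
  \<comment> \<open>The integral of the \<open>t\<close>-derivative vanishes; the derivative of the
    oscillating factor contributes the \<open>\<xi>\<close> term.\<close>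
  have A: "- \<i> * \<xi> * I j k + (of_nat j * I (j - 1) k - I (Suc j) k / 2) + (of_nat k * I j (k - 1) - I j (Suc k) / 2) = 0" for j k
  proof -
    let ?D = "\<lambda>t. - \<i> * \<xi> * wig j k x \<xi> t + (of_nat j * wig (j - 1) k x \<xi> t - wig (Suc j) k x \<xi> t / 2)
        + (of_nat k * wig j (k - 1) x \<xi> t - wig j (Suc k) x \<xi> t / 2)"
    have p: "partial_deriv 1 (wig j k x \<xi>) = ?D"
      using partial_derivI[OF w[unfolded has_vector_derivative_def], of 1] by (intro ext) simp
    have int: "integrable lborel ?D"
      by (intro Bochner_Integration.integrable_add Bochner_Integration.integrable_diff integrable_mult_right
          integrable_divide wig_integrable)
    have "(LINT t|lborel. partial_deriv 1 (wig j k x \<xi>) t) = 0"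
    proof (rule integral_partial_deriv_eq_0)
      show "wig j k x \<xi> differentiable (at t)" for t
        using w unfolding has_vector_derivative_def differentiable_def by blast
      show "continuous_on UNIV (partial_deriv 1 (wig j k x \<xi>))" unfolding p by (intro continuous_intros wig_continuous) auto
    qed (simp_all only: p int wig_integrable)
    then show ?thesis unfolding p I_def by (simp add: wig_integrable)
  qed
  \<comment> \<open>\<open>x\<close> is written as \<open>(t + x / 2) - (t - x / 2)\<close>, and
    each part is absorbed by the Hermite factor with that argument.\<close>
  have B: "complex_of_real x * I j k = (I j (Suc k) / 2 + of_nat k * I j (k - 1)) - (I (Suc j) k / 2 + of_nat j * I (j - 1) k)" for j k
  proof -
    have "complex_of_real x * wig j k x \<xi> t = (wig j (Suc k) x \<xi> t / 2 + of_nat k * wig j (k - 1) x \<xi> t)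
        - (wig (Suc j) k x \<xi> t / 2 + of_nat j * wig (j - 1) k x \<xi> t)" for t
    proof -
      have "x * (herm j (t - x / 2) * herm k (t + x / 2)) =
        herm j (t - x / 2) * ((t + x / 2) * herm k (t + x / 2)) - ((t - x / 2) * herm j (t - x / 2)) * herm k (t + x / 2)"
        by (simp add: algebra_simps)
      then have eq: "complex_of_real (x * (herm j (t - x / 2) * herm k (t + x / 2))) =
        complex_of_real (herm j (t - x / 2) * (herm (Suc k) (t + x / 2) / 2 + real k * herm (k - 1) (t + x / 2))
         - (herm (Suc j) (t - x / 2) / 2 + real j * herm (j - 1) (t - x / 2)) * herm k (t + x / 2))"
        by (simp only: herm_mult)
      have "complex_of_real x * wig j k x \<xi> t =
          exp (- (\<i> * complex_of_real (t * \<xi>))) * complex_of_real (x * (herm j (t - x / 2) * herm k (t + x / 2)))"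
        by (simp add: wig_def)
      then show ?thesis unfolding eq by (simp add: wig_def algebra_simps)
    qed
    then have "(LINT t|lborel. complex_of_real x * wig j k x \<xi> t) = (LINT t|lborel. (wig j (Suc k) x \<xi> t / 2 + of_nat k * wig j (k - 1) x \<xi> t)
        - (wig (Suc j) k x \<xi> t / 2 + of_nat j * wig (j - 1) k x \<xi> t))" by simp
    then show ?thesis unfolding I_def by (simp add: wig_integrable)
  qed
  have A': "- \<i> * \<xi> * I j k = - ((of_nat j * I (j - 1) k - I (Suc j) k / 2) + (of_nat k * I j (k - 1) - I j (Suc k) / 2))" for j k
    using A[of j k] unfolding add.assoc by (rule eq_neg_iff_add_eq_0[THEN iffD2])
  have r1: "I j (Suc k) = Complex x (- \<xi>) * I j k + 2 * of_nat j * I (j - 1) k" for j k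
  proof -
    have eq: "Complex x (- \<xi>) * I j k = complex_of_real x * I j k + - \<i> * \<xi> * I j k"
      by (simp add: Complex_eq algebra_simps)
    show ?thesis unfolding eq A' B by (simp add: field_simps)
  qed
  have r2: "I (Suc j) k = 2 * of_nat k * I j (k - 1) - Complex x \<xi> * I j k" for j k
  proof -
    have eq: "Complex x \<xi> * I j k = complex_of_real x * I j k - - \<i> * \<xi> * I j k"
      by (simp add: Complex_eq algebra_simps)
    show ?thesis unfolding eq A' B by (simp add: field_simps)
  qed
  have I00: "I 0 0 = complex_of_real (sqrt pi) * psi 0 0 x \<xi>"
  proof -
    \<comment> \<open>The product of the two shifted Gaussians decays like
      \<open>exp (- t^2)\<close>; rescaling by this factor brings it to the standard form
      \<open>exp (- t^2 / 2)\<close>.\<close>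
    let ?c = "1 / sqrt 2 :: real"
    have "wig 0 0 x \<xi> (0 + ?c * t) = complex_of_real (exp (- (x\<^sup>2 / 4))) *
        (complex_of_real (exp (- (t\<^sup>2 / 2))) * exp (\<i> * complex_of_real ((- (\<xi> / sqrt 2)) * t)))" for t
    proof -
      have "- ((?c * t - x / 2)\<^sup>2 / 2) + - ((?c * t + x / 2)\<^sup>2 / 2) = - (x\<^sup>2 / 4) + - (t\<^sup>2 / 2)"
        by (simp add: power2_eq_square field_simps)
      then have "exp (- ((?c * t - x / 2)\<^sup>2 / 2)) * exp (- ((?c * t + x / 2)\<^sup>2 / 2)) = exp (- (x\<^sup>2 / 4)) * exp (- (t\<^sup>2 / 2))"
        by (simp only: exp_add[symmetric])
      then show ?thesis unfolding wig_def by (simp add: mult_ac of_real_mult[symmetric] del: of_real_mult)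
    qed
    moreover have "I 0 0 = \<bar>?c\<bar> *\<^sub>R (LINT t|lborel. wig 0 0 x \<xi> (0 + ?c * t))"
      unfolding I_def by (rule lborel_integral_real_affine) simp
    ultimately have "I 0 0 = ?c *\<^sub>R (complex_of_real (exp (- (x\<^sup>2 / 4))) *
        complex_of_real (sqrt (2 * pi) * exp (- ((- (\<xi> / sqrt 2))\<^sup>2 / 2))))"
      by (simp only: integral_mult_right_zero Fourier_gaussian_real(2)) simp
    also have "\<dots> = complex_of_real (?c * sqrt (2 * pi) * (exp (- (x\<^sup>2 / 4)) * exp (- ((- (\<xi> / sqrt 2))\<^sup>2 / 2))))"
      by (simp add: scaleR_conv_of_real)
    also have "?c * sqrt (2 * pi) = sqrt pi" by (simp add: real_sqrt_mult)
    also have "exp (- (x\<^sup>2 / 4)) * exp (- ((- (\<xi> / sqrt 2))\<^sup>2 / 2)) = exp (- ((x\<^sup>2 + \<xi>\<^sup>2) / 4))"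
      by (simp add: exp_add[symmetric] power_divide add_divide_distrib)
    finally show ?thesis by (simp add: psi.simps(1))
  qed
  have Ij0: "I j 0 = complex_of_real (sqrt pi) * psi j 0 x \<xi>" for j
  proof (induction j)
    case (Suc j)
    then show ?case by (simp add: r2 psi.simps(2))
  qed (rule I00)
  have "I j k = complex_of_real (sqrt pi) * psi j k x \<xi>" for j
  proof (induction k arbitrary: j)
    case (Suc k)
    show ?case unfolding r1 Suc psi.simps(3) by (simp add: algebra_simps)
  qed (rule Ij0)
  then show ?thesis by (simp add: I_def)
qed

section \<open>Bases of products of Hermite functions\<close>

lemma l2_norm_pos_if_nonzero:
  fixes u :: "'a::euclidean_space \<Rightarrow> complex"
  assumes "u \<in> L2 lborel" "\<And>z. u z \<noteq> 0"
  shows "0 < l2_norm lborel u"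
proof (rule ccontr)
  assume "\<not> 0 < l2_norm lborel u"
  then have "l2_norm lborel u = 0" using l2_norm_nonneg[of lborel u] by linarith
  then have "AE z in lborel. u z = 0" using l2_norm_eq_0_iff[OF assms(1)] by simp
  then have "AE z::'a in lborel. False" using assms(2) by simp
  then show False by (simp add: ae_filter_eq_bot_iff trivial_limit_def[symmetric] eventually_False)
qed

text \<open>The totality criterion pairs bilinearly while the inner product conjugates its second
  argument, hence it is applied to the conjugates of the span.\<close>

lemma fspan_total:
  fixes \<Phi> :: "'i \<Rightarrow> 'a::euclidean_space \<Rightarrow> complex"
  assumes S: "test_class (fspan \<Phi>)" and c: "0 < c"
    and gauss: "\<Phi> i0 = (\<lambda>z. complex_of_real (exp (- (c * (norm z)\<^sup>2))))"
    and g: "g \<in> L2 lborel" and orth: "\<And>i. l2_inner lborel g (\<Phi> i) = 0"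
  shows "AE z in lborel. g z = 0"
proof (rule Gaussian_span_total[OF g c, where S = "(\<lambda>u z. cnj (u z)) ` fspan \<Phi>"])
  have "\<Phi> i0 \<in> fspan \<Phi>" by (rule fspan.base)
  then show "(\<lambda>z. complex_of_real (exp (- (c * (norm z)\<^sup>2)))) \<in> (\<lambda>u z. cnj (u z)) ` fspan \<Phi>"
    by (rule rev_image_eqI) (simp add: gauss)
  fix u assume "u \<in> (\<lambda>u z. cnj (u z)) ` fspan \<Phi>"
  then obtain u' where u': "u' \<in> fspan \<Phi>" "u = (\<lambda>z. cnj (u' z))" by auto
  show "(\<lambda>z. a * u z) \<in> (\<lambda>u z. cnj (u z)) ` fspan \<Phi>" for a
    by (rule rev_image_eqI[OF fspan.scale[OF u'(1), where c = "cnj a"]]) (simp add: u')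
  show "(\<lambda>z. complex_of_real (z \<bullet> b) * u z) \<in> (\<lambda>u z. cnj (u z)) ` fspan \<Phi>" if "b \<in> Basis" for b
    by (rule rev_image_eqI[OF test_classD(5)[OF S u'(1) that]]) (simp add: u')
  have "l2_inner lborel g u' = 0"
    using u'(1)
  proof induction
    case (add u v)
    then show ?case by (simp add: l2_inner_add_right g test_class_L2[OF S])
  qed (simp_all add: orth l2_inner_scale_right)
  then show "(LINT z|lborel. g z * u z) = 0" by (simp add: l2_inner_def u')
  fix v assume "v \<in> (\<lambda>u z. cnj (u z)) ` fspan \<Phi>"
  then obtain v' where v': "v' \<in> fspan \<Phi>" "v = (\<lambda>z. cnj (v' z))" by auto
  show "(\<lambda>z. u z + v z) \<in> (\<lambda>u z. cnj (u z)) ` fspan \<Phi>"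
    by (rule rev_image_eqI[OF fspan.add[OF u'(1) v'(1)]]) (simp add: u' v')
qed

definition normalized :: "(('k::finite \<Rightarrow> nat) \<Rightarrow> 'a \<Rightarrow> complex) \<Rightarrow> 'a measure \<Rightarrow> ('k \<Rightarrow> nat) \<Rightarrow> 'a \<Rightarrow> complex" where
  "normalized \<Phi> M \<gamma> z = complex_of_real (1 / (sqrt (mfact \<gamma>) * l2_norm M (\<Phi> (\<lambda>_. 0)))) * \<Phi> \<gamma> z"

lemma normalized_ons:
  fixes \<Phi> :: "('k::finite \<Rightarrow> nat) \<Rightarrow> 'a \<Rightarrow> complex"
  assumes lad: "\<And>k \<gamma> \<delta>. l2_inner M (\<Phi> (up k \<gamma>)) (\<Phi> \<delta>) = complex_of_real (2 * real (\<delta> k)) * l2_inner M (\<Phi> \<gamma>) (\<Phi> (dn k \<delta>))"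
    and L2: "\<And>\<gamma>. \<Phi> \<gamma> \<in> L2 M" and n0: "0 < l2_norm M (\<Phi> (\<lambda>_. 0))"
  shows "l2_ons M (normalized \<Phi> M)"
  unfolding l2_ons_def
proof (intro conjI allI)
  show "normalized \<Phi> M \<gamma> \<in> L2 M" for \<gamma> unfolding normalized_def[abs_def] by (intro L2_scale L2)
  fix \<gamma> \<delta>
  let ?n = "l2_norm M (\<Phi> (\<lambda>_. 0))"
  have "l2_inner M (normalized \<Phi> M \<gamma>) (normalized \<Phi> M \<delta>) =
    complex_of_real (1 / (sqrt (mfact \<gamma>) * ?n)) * (complex_of_real (1 / (sqrt (mfact \<delta>) * ?n)) * l2_inner M (\<Phi> \<gamma>) (\<Phi> \<delta>))"
    unfolding normalized_def[abs_def] l2_inner_scale_left l2_inner_scale_right by simp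
  also have "\<dots> = (if \<gamma> = \<delta> then complex_of_real ((1 / (sqrt (mfact \<gamma>) * ?n)) * ((1 / (sqrt (mfact \<gamma>) * ?n)) * (mfact \<gamma> * ?n\<^sup>2))) else 0)"
    by (subst ladder_inner[OF lad]) (simp add: l2_inner_self)
  also have "(1 / (sqrt (mfact \<gamma>) * ?n)) * ((1 / (sqrt (mfact \<gamma>) * ?n)) * (mfact \<gamma> * ?n\<^sup>2)) = (mfact \<gamma> / (sqrt (mfact \<gamma>))\<^sup>2) * (?n\<^sup>2 / ?n\<^sup>2)"
    by (simp add: power2_eq_square)
  also have "\<dots> = 1" using mfact_pos[of \<gamma>] n0 by simp
  finally show "l2_inner M (normalized \<Phi> M \<gamma>) (normalized \<Phi> M \<delta>) = (if \<gamma> = \<delta> then 1 else 0)" by simp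
qed

lemma l2_inner_normalized:
  "l2_inner M f (\<Phi> \<gamma>) = complex_of_real (sqrt (mfact \<gamma>) * l2_norm M (\<Phi> (\<lambda>_. 0))) * l2_inner M f (normalized \<Phi> M \<gamma>)"
  if "0 < l2_norm M (\<Phi> (\<lambda>_. 0))"
  unfolding normalized_def[abs_def] l2_inner_scale_right using that mfact_pos[of \<gamma>] by (simp add: field_simps)

text \<open>\<open>l2_onb\<close> requires bases indexed by natural numbers, whereas the Hermite
  systems are indexed by multi-indices.\<close>

definition mi_enum :: "nat \<Rightarrow> ('k::finite \<Rightarrow> nat)" where
  "mi_enum = from_nat_into UNIV"

lemma bij_mi_enum: "bij (mi_enum :: nat \<Rightarrow> ('k::finite \<Rightarrow> nat))"
proof -
  have "inj (\<lambda>n (k::'k). n::nat)" by (auto simp: inj_def fun_eq_iff)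
  then have "infinite (UNIV :: ('k \<Rightarrow> nat) set)"
    using infinite_super[OF subset_UNIV] range_inj_infinite by blast
  then show ?thesis unfolding mi_enum_def by (intro bij_betw_from_nat_into) auto
qed

text \<open>The common interface of both systems: orthogonality and norms come from the ladder
  relation, completeness from the Gaussian ground state and stability of the span. It is used with
  \<open>c = 1/2\<close> on configuration space and \<open>c = 1/4\<close> on phase space.\<close>

lemma normalized_onb:
  fixes \<Phi> :: "('k::finite \<Rightarrow> nat) \<Rightarrow> 'a::euclidean_space \<Rightarrow> complex"
  assumes S: "test_class (fspan \<Phi>)" and c: "0 < c"
    and gauss: "\<Phi> (\<lambda>_. 0) = (\<lambda>z. complex_of_real (exp (- (c * (norm z)\<^sup>2))))"
    and lad: "\<And>k \<gamma> \<delta>. l2_inner lborel (\<Phi> (up k \<gamma>)) (\<Phi> \<delta>) = complex_of_real (2 * real (\<delta> k)) * l2_inner lborel (\<Phi> \<gamma>) (\<Phi> (dn k \<delta>))"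
  shows "0 < l2_norm lborel (\<Phi> (\<lambda>_. 0))" "l2_ons lborel (normalized \<Phi> lborel)"
    "l2_onb lborel (\<lambda>n. normalized \<Phi> lborel (mi_enum n))"
proof -
  have L2: "\<Phi> \<gamma> \<in> L2 lborel" for \<gamma> by (intro test_class_L2[OF S] fspan.base)
  show n0: "0 < l2_norm lborel (\<Phi> (\<lambda>_. 0))" by (rule l2_norm_pos_if_nonzero[OF L2]) (simp add: gauss)
  show ons: "l2_ons lborel (normalized \<Phi> lborel)" by (rule normalized_ons[OF lad L2 n0])
  have "AE z in lborel. f z = 0"
    if f: "f \<in> L2 lborel" and "\<forall>n. l2_inner lborel f (normalized \<Phi> lborel (mi_enum n)) = 0" for f
  proof (rule fspan_total[where \<Phi> = \<Phi> and ?i0.0 = "\<lambda>_. 0", OF S c gauss f])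
    fix \<gamma> :: "'k \<Rightarrow> nat"
    obtain n where "\<gamma> = mi_enum n" using bij_mi_enum by (metis bij_pointE)
    then show "l2_inner lborel f (\<Phi> \<gamma>) = 0" using that(2) by (simp add: l2_inner_normalized[where \<Phi> = \<Phi> and M = lborel, OF n0])
  qed
  then show "l2_onb lborel (\<lambda>n. normalized \<Phi> lborel (mi_enum n))"
    using l2_ons_reindex[OF ons, of mi_enum] bij_mi_enum
    unfolding l2_onb_def l2_ons_def bij_def by blast
qed

lemma prod_UNIV_remove:
  fixes f :: "'i::finite \<Rightarrow> 'b::comm_monoid_mult"
  shows "(\<Prod>j\<in>UNIV. f j) = f i * (\<Prod>j\<in>UNIV - {i}. f j)"
  by (rule prod.remove) simp_all

lemma norm_vec_square: "(norm x)\<^sup>2 = (\<Sum>i\<in>UNIV. (x $ i)\<^sup>2)" for x :: "real ^ 'n"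
  unfolding power2_norm_eq_inner inner_vec_def by (simp add: power2_eq_square)

lemma Basis_vec_cases:
  fixes b :: "real ^ 'n"
  assumes "b \<in> Basis"
  obtains i where "b = axis i 1"
  using assms by (auto simp: Basis_vec_def)

section \<open>The Hermite basis in \<open>d\<close> variables\<close>

definition hermn :: "('n::finite \<Rightarrow> nat) \<Rightarrow> real ^ 'n \<Rightarrow> complex" where
  "hermn \<alpha> t = complex_of_real (\<Prod>i\<in>UNIV. herm (\<alpha> i) (t $ i))"

lemma hermn_split:
  "hermn \<alpha> t = complex_of_real (herm (\<alpha> i) (t $ i) * (\<Prod>j\<in>UNIV - {i}. herm (\<alpha> j) (t $ j)))"
  unfolding hermn_def by (subst prod_UNIV_remove[of _ i]) simp

lemma hermn_up: "hermn (up i \<alpha>) t = complex_of_real (herm (Suc (\<alpha> i)) (t $ i) * (\<Prod>j\<in>UNIV - {i}. herm (\<alpha> j) (t $ j)))"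
  unfolding hermn_split[of _ _ i] by (simp add: up_def)

lemma hermn_dn: "hermn (dn i \<alpha>) t = complex_of_real (herm (\<alpha> i - 1) (t $ i) * (\<Prod>j\<in>UNIV - {i}. herm (\<alpha> j) (t $ j)))"
  unfolding hermn_split[of _ _ i] by (simp add: dn_def)

lemma hermn_coord:
  "complex_of_real (t $ i) * hermn \<alpha> t = (1/2) * hermn (up i \<alpha>) t + of_nat (\<alpha> i) * hermn (dn i \<alpha>) t"
proof -
  let ?R = "\<Prod>j\<in>UNIV - {i}. herm (\<alpha> j) (t $ j)"
  have "complex_of_real (t $ i) * hermn \<alpha> t = complex_of_real ((t $ i * herm (\<alpha> i) (t $ i)) * ?R)"
    unfolding hermn_split[of _ _ i] by simp
  then show ?thesis unfolding herm_mult hermn_up hermn_dn by (simp add: algebra_simps)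
qed

lemma hermn_has_derivative:
  "(hermn \<alpha> has_derivative (\<lambda>h. complex_of_real (\<Sum>i\<in>UNIV. (h $ i * (real (\<alpha> i) * herm (\<alpha> i - 1) (t $ i) - herm (Suc (\<alpha> i)) (t $ i) / 2))
      * (\<Prod>j\<in>UNIV - {i}. herm (\<alpha> j) (t $ j))))) (at t)"
proof -
  have "((\<lambda>t. herm (\<alpha> i) (t $ i)) has_derivative
      (\<lambda>h. h $ i * (real (\<alpha> i) * herm (\<alpha> i - 1) (t $ i) - herm (Suc (\<alpha> i)) (t $ i) / 2))) (at t)" for i
    using has_derivative_compose[OF bounded_linear_imp_has_derivative[OF bounded_linear_vec_nth]
        herm_deriv[unfolded has_field_derivative_def]]
    by (simp add: mult.commute)
  then show ?thesis
    unfolding hermn_def[abs_def] by (intro has_derivative_of_real has_derivative_prod) auto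
qed

lemma hermn_partial:
  "partial_deriv (axis i 1) (hermn \<alpha>) t = of_nat (\<alpha> i) * hermn (dn i \<alpha>) t + (- 1/2) * hermn (up i \<alpha>) t"
proof -
  let ?D = "\<lambda>k. (real (\<alpha> k) * herm (\<alpha> k - 1) (t $ k) - herm (Suc (\<alpha> k)) (t $ k) / 2)"
  let ?R = "\<lambda>k. \<Prod>j\<in>UNIV - {k}. herm (\<alpha> j) (t $ j)"
  have "(\<Sum>k\<in>UNIV. (axis i 1 $ k * ?D k) * ?R k) = (\<Sum>k\<in>UNIV. if k = i then ?D k * ?R k else 0)"
    by (intro sum.cong refl) (simp add: axis_def)
  then have "partial_deriv (axis i 1) (hermn \<alpha>) t = complex_of_real (?D i * ?R i)"
    unfolding partial_derivI[OF hermn_has_derivative] by simp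
  then show ?thesis unfolding hermn_up hermn_dn by (simp add: algebra_simps)
qed

lemma test_class_hermn: "test_class (fspan (hermn :: ('n::finite \<Rightarrow> nat) \<Rightarrow> _))"
proof (rule test_class_fspan)
  fix \<alpha> :: "'n \<Rightarrow> nat"
  have "\<forall>i. \<exists>B. \<forall>t. \<bar>herm (\<alpha> i) t\<bar> \<le> B" using herm_bounded by blast
  then obtain B where B: "\<And>i t. \<bar>herm (\<alpha> i) t\<bar> \<le> B i" by metis
  have "norm (hermn \<alpha> t) \<le> (\<Prod>i\<in>UNIV. B i)" for t
    unfolding hermn_def norm_of_real abs_prod by (intro prod_mono) (simp add: B)
  then show "bounded (range (hermn \<alpha>))" unfolding bounded_iff by blast
  show "hermn \<alpha> differentiable (at t)" for t
    using hermn_has_derivative unfolding differentiable_def by blast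
  fix b :: "real ^ 'n" assume "b \<in> Basis"
  then obtain i where b: "b = axis i 1" by (rule Basis_vec_cases)
  have "(\<lambda>t. (1/2) * hermn (up i \<alpha>) t + of_nat (\<alpha> i) * hermn (dn i \<alpha>) t) \<in> fspan hermn"
    by (intro fspan.add fspan.scale fspan.base)
  then show "(\<lambda>t. complex_of_real (t \<bullet> b) * hermn \<alpha> t) \<in> fspan hermn"
    unfolding b inner_axis by (simp add: hermn_coord)
  have "(\<lambda>t. of_nat (\<alpha> i) * hermn (dn i \<alpha>) t + (- 1/2) * hermn (up i \<alpha>) t) \<in> fspan hermn"
    by (intro fspan.add fspan.scale fspan.base)
  then show "partial_deriv b (hermn \<alpha>) \<in> fspan hermn"
    unfolding b using hermn_partial[of i \<alpha>, abs_def] by (simp add: fun_eq_iff[symmetric])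
qed

lemma hermn_L2: "hermn \<alpha> \<in> L2 lborel"
  by (intro test_class_L2[OF test_class_hermn] fspan.base)

text \<open>The raising operator is coordinate minus derivative. Integration by parts makes its
  adjoint coordinate plus derivative, which lowers.\<close>

lemma hermn_ladder:
  "l2_inner lborel (hermn (up i \<alpha>)) (hermn \<delta>) = complex_of_real (2 * real (\<delta> i)) * l2_inner lborel (hermn \<alpha>) (hermn (dn i \<delta>))"
proof -
  let ?e = "axis i 1 :: real ^ 'a"
  let ?x = "\<lambda>u t. complex_of_real (t \<bullet> ?e) * u t"
  note T = test_class_hermn
  have mem: "?x (hermn \<alpha>) \<in> L2 lborel" "partial_deriv ?e (hermn \<alpha>) \<in> L2 lborel" for \<alpha> :: "'a \<Rightarrow> nat"
    by (intro test_class_L2[OF T] test_classD(5,6)[OF T] fspan.base; simp)+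
  have "hermn (up i \<alpha>) = (\<lambda>t. ?x (hermn \<alpha>) t - partial_deriv ?e (hermn \<alpha>) t)"
    by (auto simp: inner_axis hermn_coord hermn_partial)
  then have "l2_inner lborel (hermn (up i \<alpha>)) (hermn \<delta>) =
      l2_inner lborel (?x (hermn \<alpha>)) (hermn \<delta>) - l2_inner lborel (partial_deriv ?e (hermn \<alpha>)) (hermn \<delta>)"
    by (simp only: l2_inner_diff_left[OF mem hermn_L2])
  also have "\<dots> = l2_inner lborel (hermn \<alpha>) (?x (hermn \<delta>)) + l2_inner lborel (hermn \<alpha>) (partial_deriv ?e (hermn \<delta>))"
    unfolding l2_inner_coord
    by (subst nice_by_parts) (auto intro!: test_class_nice[OF T] fspan.base)
  also have "\<dots> = l2_inner lborel (hermn \<alpha>) (\<lambda>t. ?x (hermn \<delta>) t + partial_deriv ?e (hermn \<delta>) t)"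
    by (simp only: l2_inner_add_right[OF mem hermn_L2])
  also have "(\<lambda>t. ?x (hermn \<delta>) t + partial_deriv ?e (hermn \<delta>) t) = (\<lambda>t. complex_of_real (2 * real (\<delta> i)) * hermn (dn i \<delta>) t)"
    by (auto simp: inner_axis hermn_coord hermn_partial)
  finally show ?thesis by (simp add: l2_inner_scale_right)
qed

lemma hermn_zero: "hermn (\<lambda>_. 0) = (\<lambda>t. complex_of_real (exp (- ((1/2) * (norm t)\<^sup>2))))"
  by (intro ext) (simp add: hermn_def norm_vec_square exp_sum[symmetric] sum_negf sum_divide_distrib)

definition hhat :: "('n::finite \<Rightarrow> nat) \<Rightarrow> real ^ 'n \<Rightarrow> complex" where
  "hhat = normalized hermn lborel"

lemmas hermn_basis = normalized_onb[OF test_class_hermn _ hermn_zero hermn_ladder, simplified, folded hhat_def]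

section \<open>Special Hermite functions\<close>

text \<open>The slots \<open>Inl i\<close> and \<open>Inr i\<close> hold the two Hermite indices of
  the plane of \<open>x\<close> and \<open>\<xi>\<close> number \<open>i\<close>. Merging both
  multi-indices into one over the sum type lets the general ladder lemmas apply to phase space
  unchanged.\<close>

definition sherm :: "('n::finite + 'n \<Rightarrow> nat) \<Rightarrow> (real ^ 'n) \<times> (real ^ 'n) \<Rightarrow> complex" where
  "sherm \<gamma> z = (\<Prod>i\<in>UNIV. psi (\<gamma> (Inl i)) (\<gamma> (Inr i)) (fst z $ i) (snd z $ i))"

definition sh_rest :: "'n \<Rightarrow> ('n::finite + 'n \<Rightarrow> nat) \<Rightarrow> (real ^ 'n) \<times> (real ^ 'n) \<Rightarrow> complex" where
  "sh_rest i \<gamma> z = (\<Prod>j\<in>UNIV - {i}. psi (\<gamma> (Inl j)) (\<gamma> (Inr j)) (fst z $ j) (snd z $ j))"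

lemma sherm_split: "sherm \<gamma> z = psi (\<gamma> (Inl i)) (\<gamma> (Inr i)) (fst z $ i) (snd z $ i) * sh_rest i \<gamma> z"
  unfolding sherm_def sh_rest_def by (rule prod_UNIV_remove)

lemma sh_rest_simps:
  "sh_rest i (up (Inl i) \<gamma>) z = sh_rest i \<gamma> z" "sh_rest i (up (Inr i) \<gamma>) z = sh_rest i \<gamma> z"
  "sh_rest i (dn (Inl i) \<gamma>) z = sh_rest i \<gamma> z" "sh_rest i (dn (Inr i) \<gamma>) z = sh_rest i \<gamma> z"
  unfolding sh_rest_def by (auto simp: up_def dn_def intro!: prod.cong)

lemma sherm_move:
  "sherm (up (Inl i) \<gamma>) z = psi (Suc (\<gamma> (Inl i))) (\<gamma> (Inr i)) (fst z $ i) (snd z $ i) * sh_rest i \<gamma> z"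
  "sherm (up (Inr i) \<gamma>) z = psi (\<gamma> (Inl i)) (Suc (\<gamma> (Inr i))) (fst z $ i) (snd z $ i) * sh_rest i \<gamma> z"
  "sherm (dn (Inl i) \<gamma>) z = psi (\<gamma> (Inl i) - 1) (\<gamma> (Inr i)) (fst z $ i) (snd z $ i) * sh_rest i \<gamma> z"
  "sherm (dn (Inr i) \<gamma>) z = psi (\<gamma> (Inl i)) (\<gamma> (Inr i) - 1) (fst z $ i) (snd z $ i) * sh_rest i \<gamma> z"
  unfolding sherm_split[of _ _ i] sh_rest_simps by (simp_all add: up_def dn_def)

abbreviation bx :: "'n::finite \<Rightarrow> (real ^ 'n) \<times> (real ^ 'n)" where "bx i \<equiv> (axis i 1, 0)"
abbreviation bxi :: "'n::finite \<Rightarrow> (real ^ 'n) \<times> (real ^ 'n)" where "bxi i \<equiv> (0, axis i 1)"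

lemma bx_Basis [simp]: "bx i \<in> Basis" "bxi i \<in> Basis"
  by (simp_all add: Basis_prod_def)

lemma inner_bx [simp]: "z \<bullet> bx i = fst z $ i" "z \<bullet> bxi i = snd z $ i"
  by (simp_all add: inner_prod_def inner_axis)

lemma Basis_phase_cases:
  fixes b :: "(real ^ 'n) \<times> (real ^ 'n)"
  assumes "b \<in> Basis"
  obtains i where "b = bx i" | i where "b = bxi i"
  using assms by (auto simp: Basis_prod_def elim!: Basis_vec_cases)

lemma sherm_x:
  "complex_of_real (fst z $ i) * sherm \<gamma> z = of_nat (\<gamma> (Inr i)) * sherm (dn (Inr i) \<gamma>) z + (- 1/2) * sherm (up (Inl i) \<gamma>) z
    + (1/2) * sherm (up (Inr i) \<gamma>) z + (- of_nat (\<gamma> (Inl i))) * sherm (dn (Inl i) \<gamma>) z"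
proof -
  have "complex_of_real (fst z $ i) * sherm \<gamma> z =
    (complex_of_real (fst z $ i) * psi (\<gamma> (Inl i)) (\<gamma> (Inr i)) (fst z $ i) (snd z $ i)) * sh_rest i \<gamma> z"
    unfolding sherm_split[of _ _ i] by simp
  then show ?thesis unfolding psi_x sherm_move by (simp add: field_simps)
qed

lemma sherm_xi:
  "complex_of_real (snd z $ i) * sherm \<gamma> z = (- \<i> * of_nat (\<gamma> (Inr i))) * sherm (dn (Inr i) \<gamma>) z + (\<i>/2) * sherm (up (Inl i) \<gamma>) z
    + (\<i>/2) * sherm (up (Inr i) \<gamma>) z + (- \<i> * of_nat (\<gamma> (Inl i))) * sherm (dn (Inl i) \<gamma>) z"
proof -
  have "complex_of_real (snd z $ i) * sherm \<gamma> z =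
    (complex_of_real (snd z $ i) * psi (\<gamma> (Inl i)) (\<gamma> (Inr i)) (fst z $ i) (snd z $ i)) * sh_rest i \<gamma> z"
    unfolding sherm_split[of _ _ i] by simp
  then show ?thesis unfolding psi_xi sherm_move by (simp add: field_simps)
qed

lemma sherm_has_derivative:
  "(sherm \<gamma> has_derivative (\<lambda>h. \<Sum>i\<in>UNIV. (complex_of_real (fst h $ i) * psi_dx (\<gamma> (Inl i)) (\<gamma> (Inr i)) (fst z $ i) (snd z $ i)
      + complex_of_real (snd h $ i) * psi_dxi (\<gamma> (Inl i)) (\<gamma> (Inr i)) (fst z $ i) (snd z $ i)) * sh_rest i \<gamma> z)) (at z)"
proof -
  have "((\<lambda>z. psi (\<gamma> (Inl i)) (\<gamma> (Inr i)) (fst z $ i) (snd z $ i)) has_derivative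
     (\<lambda>h. complex_of_real (fst h $ i) * psi_dx (\<gamma> (Inl i)) (\<gamma> (Inr i)) (fst z $ i) (snd z $ i)
      + complex_of_real (snd h $ i) * psi_dxi (\<gamma> (Inl i)) (\<gamma> (Inr i)) (fst z $ i) (snd z $ i))) (at z)" for i
  proof -
    have "bounded_linear (\<lambda>z::(real ^ 'a) \<times> (real ^ 'a). (fst z $ i, snd z $ i))"
      by (intro bounded_linear_Pair bounded_linear_compose[OF bounded_linear_vec_nth] bounded_linear_fst bounded_linear_snd)
    from has_derivative_compose[OF bounded_linear_imp_has_derivative[OF this] psi_has_derivative]
    show ?thesis by simp
  qed
  then show ?thesis
    unfolding sherm_def[abs_def] sh_rest_def by (intro has_derivative_prod) auto
qed

lemma sherm_dx:
  "partial_deriv (bx i) (sherm \<gamma>) z = (of_nat (\<gamma> (Inr i)) / 2) * sherm (dn (Inr i) \<gamma>) z + (- 1/4) * sherm (up (Inr i) \<gamma>) z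
    + (- of_nat (\<gamma> (Inl i)) / 2) * sherm (dn (Inl i) \<gamma>) z + (1/4) * sherm (up (Inl i) \<gamma>) z"
  and sherm_dx_psi: "partial_deriv (bx i) (sherm \<gamma>) z = psi_dx (\<gamma> (Inl i)) (\<gamma> (Inr i)) (fst z $ i) (snd z $ i) * sh_rest i \<gamma> z"
proof -
  let ?D = "\<lambda>k. psi_dx (\<gamma> (Inl k)) (\<gamma> (Inr k)) (fst z $ k) (snd z $ k)"
  have "(\<Sum>k\<in>UNIV. (complex_of_real (fst (bx i) $ k) * ?D k
      + complex_of_real (snd (bx i) $ k) * psi_dxi (\<gamma> (Inl k)) (\<gamma> (Inr k)) (fst z $ k) (snd z $ k)) * sh_rest k \<gamma> z)
    = (\<Sum>k\<in>UNIV. if k = i then ?D k * sh_rest k \<gamma> z else 0)"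
    by (intro sum.cong refl) (simp add: axis_def)
  then show a: "partial_deriv (bx i) (sherm \<gamma>) z = ?D i * sh_rest i \<gamma> z"
    unfolding partial_derivI[OF sherm_has_derivative] by simp
  show "partial_deriv (bx i) (sherm \<gamma>) z = (of_nat (\<gamma> (Inr i)) / 2) * sherm (dn (Inr i) \<gamma>) z + (- 1/4) * sherm (up (Inr i) \<gamma>) z
    + (- of_nat (\<gamma> (Inl i)) / 2) * sherm (dn (Inl i) \<gamma>) z + (1/4) * sherm (up (Inl i) \<gamma>) z"
    unfolding a psi_dx_def sherm_move by (simp add: field_simps)
qed

lemma sherm_dxi:
  "partial_deriv (bxi i) (sherm \<gamma>) z = (- \<i> * of_nat (\<gamma> (Inl i)) / 2) * sherm (dn (Inl i) \<gamma>) z + (- \<i>/4) * sherm (up (Inl i) \<gamma>) z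
    + (- \<i> * of_nat (\<gamma> (Inr i)) / 2) * sherm (dn (Inr i) \<gamma>) z + (- \<i>/4) * sherm (up (Inr i) \<gamma>) z"
  and sherm_dxi_psi: "partial_deriv (bxi i) (sherm \<gamma>) z = psi_dxi (\<gamma> (Inl i)) (\<gamma> (Inr i)) (fst z $ i) (snd z $ i) * sh_rest i \<gamma> z"
proof -
  let ?D = "\<lambda>k. psi_dxi (\<gamma> (Inl k)) (\<gamma> (Inr k)) (fst z $ k) (snd z $ k)"
  have "(\<Sum>k\<in>UNIV. (complex_of_real (fst (bxi i) $ k) * psi_dx (\<gamma> (Inl k)) (\<gamma> (Inr k)) (fst z $ k) (snd z $ k)
      + complex_of_real (snd (bxi i) $ k) * ?D k) * sh_rest k \<gamma> z)
    = (\<Sum>k\<in>UNIV. if k = i then ?D k * sh_rest k \<gamma> z else 0)"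
    by (intro sum.cong refl) (simp add: axis_def)
  then show a: "partial_deriv (bxi i) (sherm \<gamma>) z = ?D i * sh_rest i \<gamma> z"
    unfolding partial_derivI[OF sherm_has_derivative] by simp
  show "partial_deriv (bxi i) (sherm \<gamma>) z = (- \<i> * of_nat (\<gamma> (Inl i)) / 2) * sherm (dn (Inl i) \<gamma>) z + (- \<i>/4) * sherm (up (Inl i) \<gamma>) z
    + (- \<i> * of_nat (\<gamma> (Inr i)) / 2) * sherm (dn (Inr i) \<gamma>) z + (- \<i>/4) * sherm (up (Inr i) \<gamma>) z"
    unfolding a psi_dxi_def sherm_move by (simp add: field_simps)
qed

text \<open>The recursion multiplies by unbounded factors and gives no bound; the integral
  representation does, by the supremum of one Hermite function times the integral of the modulus of
  the other.\<close>

lemma psi_bounded: "\<exists>B. \<forall>x \<xi>. cmod (psi j k x \<xi>) \<le> B"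
proof -
  obtain B where B: "\<And>t. \<bar>herm j t\<bar> \<le> B" using herm_bounded by blast
  have int: "integrable lborel (\<lambda>t. \<bar>herm k t\<bar>)"
    using integrable_norm[OF rapid_integrable[OF rapid_herm[of k]]] by simp
  have "cmod (psi j k x \<xi>) \<le> \<bar>B\<bar> * (LINT t|lborel. \<bar>herm k t\<bar>) / sqrt pi" for x \<xi>
  proof -
    have "norm (LINT t|lborel. wig j k x \<xi> t) \<le> (LINT t|lborel. norm (wig j k x \<xi> t))" by simp
    also have "\<dots> \<le> (LINT t|lborel. \<bar>B\<bar> * \<bar>herm k (t + x / 2)\<bar>)"
    proof (rule integral_mono)
      show "integrable lborel (\<lambda>t. norm (wig j k x \<xi> t))" by (intro integrable_norm wig_integrable)
      show "integrable lborel (\<lambda>t. \<bar>B\<bar> * \<bar>herm k (t + x / 2)\<bar>)"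
        using lborel_integrable_translation[OF int, of "x / 2"] by simp
      fix t
      show "norm (wig j k x \<xi> t) \<le> \<bar>B\<bar> * \<bar>herm k (t + x / 2)\<bar>"
        unfolding wig_def by (simp add: norm_mult abs_mult) (intro mult_right_mono order_trans[OF B abs_ge_self] abs_ge_zero)
    qed
    also have "\<dots> = \<bar>B\<bar> * (LINT t|lborel. \<bar>herm k t\<bar>)"
      using lborel_integral_translation[of "\<lambda>t. \<bar>herm k t\<bar>" "x / 2"] by simp
    finally show ?thesis unfolding wig_integral by (simp add: norm_mult field_simps)
  qed
  then show ?thesis by blast
qed

lemma test_class_sherm: "test_class (fspan (sherm :: ('n::finite + 'n \<Rightarrow> nat) \<Rightarrow> _))"
proof (rule test_class_fspan)
  fix \<gamma> :: "'n + 'n \<Rightarrow> nat"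
  have "\<forall>i. \<exists>B. \<forall>x \<xi>. cmod (psi (\<gamma> (Inl i)) (\<gamma> (Inr i)) x \<xi>) \<le> B" using psi_bounded by blast
  then obtain B where B: "\<And>i x \<xi>. cmod (psi (\<gamma> (Inl i)) (\<gamma> (Inr i)) x \<xi>) \<le> B i" by metis
  have "norm (sherm \<gamma> z) \<le> (\<Prod>i\<in>UNIV. B i)" for z
    unfolding sherm_def prod_norm[symmetric] by (intro prod_mono) (simp add: B)
  then show "bounded (range (sherm \<gamma>))" unfolding bounded_iff by blast
  show "sherm \<gamma> differentiable (at z)" for z
    using sherm_has_derivative unfolding differentiable_def by blast
  fix b :: "(real ^ 'n) \<times> (real ^ 'n)" assume "b \<in> Basis"
  then consider i where "b = bx i" | i where "b = bxi i" by (rule Basis_phase_cases)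
  then show "(\<lambda>z. complex_of_real (z \<bullet> b) * sherm \<gamma> z) \<in> fspan sherm"
    by cases (simp_all only: inner_bx sherm_x sherm_xi, (intro fspan.add fspan.scale fspan.base)+)
  from \<open>b \<in> Basis\<close> consider i where "b = bx i" | i where "b = bxi i" by (rule Basis_phase_cases)
  then show "partial_deriv b (sherm \<gamma>) \<in> fspan sherm"
  proof cases
    case (1 i)
    show ?thesis unfolding 1 sherm_dx[abs_def] by (intro fspan.add fspan.scale fspan.base)
  next
    case (2 i)
    show ?thesis unfolding 2 sherm_dxi[abs_def] by (intro fspan.add fspan.scale fspan.base)
  qed
qed

lemma sherm_L2: "sherm \<gamma> \<in> L2 lborel"
  by (intro test_class_L2[OF test_class_sherm] fspan.base)

text \<open>The operator \<open>a d_x + b d_xi + c x + d xi\<close> in plane \<open>i\<close> sends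
  \<open>sherm \<gamma>\<close> to \<open>sherm \<gamma>'\<close>. Its formal adjoint has the
  coefficients of the second hypothesis and sends \<open>sherm \<delta>\<close> to \<open>k\<close>
  times \<open>sherm \<delta>'\<close>.\<close>

lemma sherm_adjoint:
  fixes \<gamma> \<delta> :: "'n::finite + 'n \<Rightarrow> nat"
  defines "x i \<equiv> \<lambda>u z. complex_of_real (z \<bullet> bx i) * u z"
    and "xi i \<equiv> \<lambda>u z. complex_of_real (z \<bullet> bxi i) * u z"
  assumes \<gamma>: "sherm \<gamma>' = (\<lambda>z. a * partial_deriv (bx i) (sherm \<gamma>) z + b * partial_deriv (bxi i) (sherm \<gamma>) z
      + c * x i (sherm \<gamma>) z + d * xi i (sherm \<gamma>) z)"
    and \<delta>: "(\<lambda>z. k * sherm \<delta>' z) = (\<lambda>z. (- cnj a) * partial_deriv (bx i) (sherm \<delta>) z + (- cnj b) * partial_deriv (bxi i) (sherm \<delta>) z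
      + cnj c * x i (sherm \<delta>) z + cnj d * xi i (sherm \<delta>) z)"
  shows "l2_inner lborel (sherm \<gamma>') (sherm \<delta>) = cnj k * l2_inner lborel (sherm \<gamma>) (sherm \<delta>')"
proof -
  note T = test_class_sherm
  have m: "x i (sherm \<gamma>) \<in> L2 lborel" "xi i (sherm \<gamma>) \<in> L2 lborel"
    "partial_deriv (bx i) (sherm \<gamma>) \<in> L2 lborel" "partial_deriv (bxi i) (sherm \<gamma>) \<in> L2 lborel" for \<gamma> :: "'n + 'n \<Rightarrow> nat"
    unfolding x_def xi_def by (intro test_class_L2[OF T] test_classD(5,6)[OF T] fspan.base; simp)+
  have p: "l2_inner lborel (partial_deriv e (sherm \<gamma>)) (sherm \<delta>) = - l2_inner lborel (sherm \<gamma>) (partial_deriv e (sherm \<delta>))"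
    if "e \<in> Basis" for e
    using that by (intro nice_by_parts test_class_nice[OF T] fspan.base)
  have "l2_inner lborel (sherm \<gamma>') (sherm \<delta>) =
      a * l2_inner lborel (partial_deriv (bx i) (sherm \<gamma>)) (sherm \<delta>) + b * l2_inner lborel (partial_deriv (bxi i) (sherm \<gamma>)) (sherm \<delta>)
      + c * l2_inner lborel (x i (sherm \<gamma>)) (sherm \<delta>) + d * l2_inner lborel (xi i (sherm \<gamma>)) (sherm \<delta>)"
    unfolding \<gamma> by (simp only: l2_inner_add_left L2_add L2_scale m sherm_L2 l2_inner_scale_left)
  also have "\<dots> = - a * l2_inner lborel (sherm \<gamma>) (partial_deriv (bx i) (sherm \<delta>)) - b * l2_inner lborel (sherm \<gamma>) (partial_deriv (bxi i) (sherm \<delta>))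
      + c * l2_inner lborel (sherm \<gamma>) (x i (sherm \<delta>)) + d * l2_inner lborel (sherm \<gamma>) (xi i (sherm \<delta>))"
    by (simp add: p x_def xi_def l2_inner_coord del: inner_bx)
  also have "\<dots> = l2_inner lborel (sherm \<gamma>) (\<lambda>z. (- cnj a) * partial_deriv (bx i) (sherm \<delta>) z + (- cnj b) * partial_deriv (bxi i) (sherm \<delta>) z
      + cnj c * x i (sherm \<delta>) z + cnj d * xi i (sherm \<delta>) z)"
    by (simp only: l2_inner_add_right L2_add L2_scale m sherm_L2 l2_inner_scale_right complex_cnj_cnj complex_cnj_minus) simp
  also have "\<dots> = cnj k * l2_inner lborel (sherm \<gamma>) (sherm \<delta>')"
    unfolding \<delta>[symmetric] by (rule l2_inner_scale_right)
  finally show ?thesis .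
qed

text \<open>In terms of \<open>w = x + i \<xi>\<close>, the raising operator is
  \<open>2 d/d(conj w) - w / 2\<close> for the slot \<open>Inl i\<close> and
  \<open>- 2 d/dw + (conj w) / 2\<close> for \<open>Inr i\<close>; the chosen coefficients spell
  these out in real coordinates.\<close>

lemma sherm_ladder:
  "l2_inner lborel (sherm (up k \<gamma>)) (sherm \<delta>) = complex_of_real (2 * real (\<delta> k)) * l2_inner lborel (sherm \<gamma>) (sherm (dn k \<delta>))"
proof (cases k)
  case (Inl i)
  have "l2_inner lborel (sherm (up k \<gamma>)) (sherm \<delta>) = cnj (complex_of_real (2 * real (\<delta> k))) * l2_inner lborel (sherm \<gamma>) (sherm (dn k \<delta>))"
    by (rule sherm_adjoint[where a = 1 and b = \<i> and c = "-1/2" and d = "-\<i>/2" and i = i])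
      (rule ext, simp only: inner_bx sherm_dx sherm_dxi sherm_x sherm_xi Inl, simp add: field_simps)+
  then show ?thesis by simp
next
  case (Inr i)
  have "l2_inner lborel (sherm (up k \<gamma>)) (sherm \<delta>) = cnj (complex_of_real (2 * real (\<delta> k))) * l2_inner lborel (sherm \<gamma>) (sherm (dn k \<delta>))"
    by (rule sherm_adjoint[where a = "-1" and b = \<i> and c = "1/2" and d = "-\<i>/2" and i = i])
      (rule ext, simp only: inner_bx sherm_dx sherm_dxi sherm_x sherm_xi Inr, simp add: field_simps)+
  then show ?thesis by simp
qed

lemma norm_phase_square: "(norm z)\<^sup>2 = (\<Sum>i\<in>UNIV. (fst z $ i)\<^sup>2 + (snd z $ i)\<^sup>2)" for z :: "(real ^ 'n) \<times> (real ^ 'n)"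
proof -
  have "(norm z)\<^sup>2 = (norm (fst z))\<^sup>2 + (norm (snd z))\<^sup>2"
    by (simp add: norm_prod_def)
  then show ?thesis by (simp add: norm_vec_square sum.distrib)
qed

lemma sherm_zero: "sherm (\<lambda>_. 0) = (\<lambda>z. complex_of_real (exp (- ((1/4) * (norm z)\<^sup>2))))"
  by (intro ext) (simp add: sherm_def psi.simps(1) norm_phase_square exp_sum[symmetric] sum_negf sum_divide_distrib
      of_real_prod[symmetric] del: of_real_prod)

definition shat :: "('n::finite + 'n \<Rightarrow> nat) \<Rightarrow> (real ^ 'n) \<times> (real ^ 'n) \<Rightarrow> complex" where
  "shat = normalized sherm lborel"

lemmas sherm_basis = normalized_onb[OF test_class_sherm _ sherm_zero sherm_ladder, simplified, folded shat_def]

section \<open>Eigenvalues of the special Hermite functions\<close>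

lemma sum_Basis_vec:
  fixes f :: "real ^ 'n::finite \<Rightarrow> 'b::comm_monoid_add"
  shows "(\<Sum>b\<in>Basis. f b) = (\<Sum>i\<in>UNIV. f (axis i 1))"
proof -
  have B: "(Basis :: (real ^ 'n) set) = range (\<lambda>i. axis i 1)" by (auto simp: Basis_vec_def)
  have inj: "inj (\<lambda>i::'n. axis i (1::real))" by (auto simp: inj_def axis_eq_axis)
  show ?thesis unfolding B by (subst sum.reindex[OF inj]) (simp add: o_def)
qed

lemma sum_Basis_phase:
  fixes f :: "(real ^ 'n) \<times> (real ^ 'n) \<Rightarrow> 'b::comm_monoid_add"
  shows "(\<Sum>b\<in>Basis. f b) = (\<Sum>i\<in>UNIV. f (bx i) + f (bxi i))"
proof -
  have "inj_on (\<lambda>u. (u, 0 :: real ^ 'n)) (Basis :: (real ^ 'n) set)" "inj_on (\<lambda>u. (0 :: real ^ 'n, u)) (Basis :: (real ^ 'n) set)"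
    by (auto intro!: inj_onI)
  then have "(\<Sum>b\<in>Basis. f b) = (\<Sum>u\<in>Basis. f (u, 0)) + (\<Sum>u\<in>Basis. f (0, u))"
    unfolding Basis_prod_def by (subst sum.union_disjoint) (auto simp: sum.reindex)
  then show ?thesis by (simp add: sum_Basis_vec sum.distrib)
qed

definition sh_ev :: "('n::finite + 'n \<Rightarrow> nat) \<Rightarrow> real" where
  "sh_ev \<gamma> = (\<Sum>i\<in>UNIV. real (\<gamma> (Inl i)) + real (\<gamma> (Inr i)) + 1)"

lemma partial_deriv_lincomb4:
  assumes "\<And>z. u1 differentiable (at z)" "\<And>z. u2 differentiable (at z)" "\<And>z. u3 differentiable (at z)" "\<And>z. u4 differentiable (at z)"
  shows "partial_deriv b (\<lambda>z. a1 * u1 z + a2 * u2 z + a3 * u3 z + a4 * u4 z) z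
    = a1 * partial_deriv b u1 z + a2 * partial_deriv b u2 z + a3 * partial_deriv b u3 z + a4 * partial_deriv b u4 z"
  using assms by (simp add: partial_deriv_add partial_deriv_scale differentiable_add differentiable_mult)

lemma sherm_differentiable: "sherm \<gamma> differentiable (at z)"
  by (intro test_classD(2)[OF test_class_sherm] fspan.base)

text \<open>Derivatives in one plane leave the factors of the other planes alone, so the claim is
  \<open>psi_eigen\<close> times that remaining factor.\<close>

lemma sherm_eigen_pair:
  "- partial_deriv (bx i) (partial_deriv (bx i) (sherm \<gamma>)) z - partial_deriv (bxi i) (partial_deriv (bxi i) (sherm \<gamma>)) z
     + complex_of_real (((fst z $ i)\<^sup>2 + (snd z $ i)\<^sup>2) / 4) * sherm \<gamma> z
   = complex_of_real (real (\<gamma> (Inl i)) + real (\<gamma> (Inr i)) + 1) * sherm \<gamma> z"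
proof -
  let ?j = "\<gamma> (Inl i)" and ?k = "\<gamma> (Inr i)" and ?x = "fst z $ i" and ?xi = "snd z $ i"
  let ?R = "sh_rest i \<gamma> z"
  have xx: "partial_deriv (bx i) (partial_deriv (bx i) (sherm \<gamma>)) z =
     ((2 * of_nat ?k * psi_dx ?j (?k - 1) ?x ?xi - psi_dx ?j (Suc ?k) ?x ?xi - 2 * of_nat ?j * psi_dx (?j - 1) ?k ?x ?xi + psi_dx (Suc ?j) ?k ?x ?xi) / 4) * ?R"
    unfolding sherm_dx[abs_def]
    by (subst partial_deriv_lincomb4) (simp_all add: sherm_differentiable sherm_dx_psi sh_rest_simps, simp add: up_def dn_def field_simps)
  have yy: "partial_deriv (bxi i) (partial_deriv (bxi i) (sherm \<gamma>)) z =
     (- \<i> * (2 * of_nat ?j * psi_dxi (?j - 1) ?k ?x ?xi + psi_dxi (Suc ?j) ?k ?x ?xi + 2 * of_nat ?k * psi_dxi ?j (?k - 1) ?x ?xi + psi_dxi ?j (Suc ?k) ?x ?xi) / 4) * ?R"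
    unfolding sherm_dxi[abs_def]
    by (subst partial_deriv_lincomb4) (simp_all add: sherm_differentiable sherm_dxi_psi sh_rest_simps, simp add: up_def dn_def field_simps)
  have "complex_of_real (real ?j + real ?k + 1) * sherm \<gamma> z = (complex_of_real (real ?j + real ?k + 1) * psi ?j ?k ?x ?xi) * ?R"
    unfolding sherm_split[of _ _ i] by simp
  also have "\<dots> = - partial_deriv (bx i) (partial_deriv (bx i) (sherm \<gamma>)) z - partial_deriv (bxi i) (partial_deriv (bxi i) (sherm \<gamma>)) z
     + complex_of_real ((?x\<^sup>2 + ?xi\<^sup>2) / 4) * sherm \<gamma> z"
    unfolding psi_eigen[symmetric] xx yy sherm_split[of _ _ i] by (simp only: distrib_right left_diff_distrib mult_minus_left mult.assoc)
  finally show ?thesis by simp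
qed

lemma sherm_eigen: "hermite_expr (sherm \<gamma>) z = complex_of_real (sh_ev \<gamma>) * sherm \<gamma> z"
proof -
  have "hermite_expr (sherm \<gamma>) z = (\<Sum>i\<in>UNIV. - partial_deriv (bx i) (partial_deriv (bx i) (sherm \<gamma>)) z - partial_deriv (bxi i) (partial_deriv (bxi i) (sherm \<gamma>)) z
     + complex_of_real (((fst z $ i)\<^sup>2 + (snd z $ i)\<^sup>2) / 4) * sherm \<gamma> z)"
  proof -
    have pot: "((norm z)\<^sup>2 / 4) *\<^sub>R sherm \<gamma> z = (\<Sum>i\<in>UNIV. complex_of_real (((fst z $ i)\<^sup>2 + (snd z $ i)\<^sup>2) / 4) * sherm \<gamma> z)"
      by (simp only: norm_phase_square sum_divide_distrib scaleR_conv_of_real of_real_sum sum_distrib_right)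
    show ?thesis
      unfolding hermite_expr_def sum_Basis_phase pot
      by (simp only: sum.distrib[symmetric] sum_negf[symmetric] minus_add_distrib diff_conv_add_uminus)
  qed
  then show ?thesis unfolding sherm_eigen_pair sh_ev_def by (simp add: sum_distrib_right)
qed

section \<open>The spectral decomposition of the Hermite operator\<close>

lemma hermite_expr_linear:
  assumes "\<And>b z. b \<in> Basis \<Longrightarrow> u differentiable (at z) \<and> partial_deriv b u differentiable (at z)"
    and "\<And>b z. b \<in> Basis \<Longrightarrow> v differentiable (at z) \<and> partial_deriv b v differentiable (at z)"
  shows "hermite_expr (\<lambda>z. u z + c * v z) z = hermite_expr u z + c * hermite_expr v z"
proof -
  obtain b0 :: 'a where b0: "b0 \<in> Basis" using nonempty_Basis by blast
  have "partial_deriv b (\<lambda>z. u z + c * v z) = (\<lambda>z. partial_deriv b u z + c * partial_deriv b v z)" for b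
    using assms b0 by (auto simp: partial_deriv_add partial_deriv_scale differentiable_mult)
  moreover have "partial_deriv b (\<lambda>z. partial_deriv b u z + c * partial_deriv b v z) z
      = partial_deriv b (partial_deriv b u) z + c * partial_deriv b (partial_deriv b v) z" if "b \<in> Basis" for b z
    using assms that by (simp add: partial_deriv_add partial_deriv_scale differentiable_mult)
  ultimately show ?thesis
    unfolding hermite_expr_def by (simp add: sum.distrib sum_distrib_left[symmetric] algebra_simps scaleR_conv_of_real)
qed

lemma hermite_expr_fspan_sum:
  fixes \<gamma> :: "'i \<Rightarrow> 'a::finite + 'a \<Rightarrow> nat"
  assumes "finite I"
  shows "hermite_expr (\<lambda>z. \<Sum>i\<in>I. c i * sherm (\<gamma> i) z) z = (\<Sum>i\<in>I. c i * (complex_of_real (sh_ev (\<gamma> i)) * sherm (\<gamma> i) z))"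
  using assms
proof (induction I rule: finite_induct)
  case empty
  have "partial_deriv b (\<lambda>z. 0) = (\<lambda>z. 0)" for b :: "(real ^ 'a) \<times> (real ^ 'a)"
    by (rule ext, rule partial_derivI) simp
  then show ?case by (simp add: hermite_expr_def)
next
  case (insert i I)
  let ?S = "\<lambda>z. \<Sum>i\<in>I. c i * sherm (\<gamma> i) z"
  have S: "?S \<in> fspan sherm" using insert by (intro fspan_sum fspan.scale fspan.base)
  have "hermite_expr (\<lambda>z. ?S z + c i * sherm (\<gamma> i) z) z = hermite_expr ?S z + c i * hermite_expr (sherm (\<gamma> i)) z"
    by (rule hermite_expr_linear)
      (auto intro!: test_classD(2)[OF test_class_sherm] test_classD(6)[OF test_class_sherm] S fspan.base)
  then show ?case using insert by (simp add: sherm_eigen add.commute)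
qed

section \<open>Schwartz functions and symmetry of the Hermite expression\<close>

lemma multi_deriv_single:
  assumes b: "b \<in> Basis"
  shows "multi_deriv (\<lambda>c. if c = b then n else 0) f = (partial_deriv b ^^ n) f"
proof -
  have "distinct (basis_list :: 'a list) \<and> set (basis_list :: 'a list) = Basis"
    unfolding basis_list_def
    by (rule someI_ex[of "\<lambda>bs::'a list. distinct bs \<and> set bs = Basis"]) (use finite_distinct_list[OF finite_Basis] in blast)
  then have bl: "distinct (basis_list :: 'a list)" "set (basis_list :: 'a list) = Basis" by auto
  let ?\<alpha> = "\<lambda>c. if c = b then n else 0"
  have "foldr (\<lambda>c g. (partial_deriv c ^^ ?\<alpha> c) g) bs f = (if b \<in> set bs then (partial_deriv b ^^ n) f else f)" if "distinct bs" for bs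
    using that by (induction bs) auto
  then show ?thesis unfolding multi_deriv_def using bl b by simp
qed

lemma schwartz_rapid:
  assumes f: "f \<in> schwartz" and b: "b \<in> Basis"
  shows "rapid ((partial_deriv b ^^ n) f)" "((partial_deriv b ^^ n) f) differentiable (at z)"
proof -
  have fold: "foldr partial_deriv (replicate n b) f = (partial_deriv b ^^ n) f" for n by (induction n) auto
  have d: "(partial_deriv b ^^ n) f differentiable (at z)" for n z
  proof -
    have "set (replicate n b) \<subseteq> Basis" using b by auto
    then show ?thesis using f unfolding schwartz_def smooth_fun_def fold[symmetric] by blast
  qed
  then show "((partial_deriv b ^^ n) f) differentiable (at z)" .
  show "rapid ((partial_deriv b ^^ n) f)"
    unfolding rapid_def
  proof (intro conjI allI)
    show "continuous_on UNIV ((partial_deriv b ^^ n) f)"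
      using d by (auto simp: continuous_on_eq_continuous_at intro: differentiable_imp_continuous_within)
    show "bounded (range (\<lambda>z. monomial \<beta> z *\<^sub>R (partial_deriv b ^^ n) f z))" for \<beta>
      using f unfolding schwartz_def multi_deriv_single[OF b, symmetric] by blast
  qed
qed

lemma schwartz_rapid0: "f \<in> schwartz \<Longrightarrow> rapid f"
  using schwartz_rapid(1)[of f _ 0] nonempty_Basis by fastforce

lemma schwartz_nice:
  assumes "f \<in> schwartz" "b \<in> Basis"
  shows "nice b f" "nice b (partial_deriv b f)"
  using schwartz_rapid[OF assms, of 0] schwartz_rapid[OF assms, of 1] schwartz_rapid[OF assms, of 2]
  by (auto simp: nice_def numeral_2_eq_2)

lemma schwartz_L2: "f \<in> schwartz \<Longrightarrow> f \<in> L2 lborel"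
  by (intro rapid_L2 schwartz_rapid0)

lemma rapid_hermite_expr:
  assumes "f \<in> schwartz"
  shows "rapid (hermite_expr f)"
proof -
  have nz: "complex_of_real ((norm z)\<^sup>2) = (\<Sum>b\<in>Basis. complex_of_real (z \<bullet> b) * complex_of_real (z \<bullet> b))" for z :: 'a
    by (subst power2_norm_eq_inner, subst euclidean_inner) simp
  have "rapid (\<lambda>z. (-1) * (\<Sum>b\<in>Basis. partial_deriv b (partial_deriv b f) z)
      + (1/4) * (\<Sum>b\<in>Basis. complex_of_real (z \<bullet> b) * (complex_of_real (z \<bullet> b) * f z)))"
    using schwartz_nice[OF assms] schwartz_rapid0[OF assms]
    by (intro rapid_add rapid_scale rapid_sum rapid_coord) (auto simp: nice_def)
  moreover have "hermite_expr f z = (-1) * (\<Sum>b\<in>Basis. partial_deriv b (partial_deriv b f) z)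
      + (1/4) * (\<Sum>b\<in>Basis. complex_of_real (z \<bullet> b) * (complex_of_real (z \<bullet> b) * f z))" for z
    unfolding hermite_expr_def scaleR_conv_of_real of_real_divide nz
    by (simp add: sum_distrib_right mult.assoc)
  ultimately show ?thesis by presburger
qed

lemma hermite_expr_symmetric:
  assumes f: "f \<in> schwartz" and v: "v \<in> schwartz"
  shows "l2_inner lborel (hermite_expr f) v = l2_inner lborel f (hermite_expr v)"
proof -
  have parts: "l2_inner lborel (partial_deriv b (partial_deriv b f)) v = l2_inner lborel f (partial_deriv b (partial_deriv b v))"
    if "b \<in> Basis" for b
    using nice_by_parts[OF schwartz_nice(2)[OF f that] schwartz_nice(1)[OF v that]]
      nice_by_parts[OF schwartz_nice(1)[OF f that] schwartz_nice(2)[OF v that]] by simp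
  have L: "(\<lambda>z. \<Sum>b\<in>Basis. partial_deriv b (partial_deriv b f) z) \<in> L2 lborel"
    "(\<lambda>z. \<Sum>b\<in>Basis. complex_of_real (z \<bullet> b) * (complex_of_real (z \<bullet> b) * f z)) \<in> L2 lborel"
    "b \<in> Basis \<Longrightarrow> partial_deriv b (partial_deriv b f) \<in> L2 lborel"
    "b \<in> Basis \<Longrightarrow> (\<lambda>z. complex_of_real (z \<bullet> b) * (complex_of_real (z \<bullet> b) * f z)) \<in> L2 lborel"
    if f: "f \<in> schwartz" for f :: "'a \<Rightarrow> complex" and b
    using schwartz_nice[OF f] schwartz_rapid0[OF f]
    by (auto intro!: rapid_L2 rapid_sum rapid_coord simp: nice_def)
  have nz: "complex_of_real ((norm z)\<^sup>2) = (\<Sum>b\<in>Basis. complex_of_real (z \<bullet> b) * complex_of_real (z \<bullet> b))" for z :: 'a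
    by (subst power2_norm_eq_inner, subst euclidean_inner) simp
  have expr: "hermite_expr f = (\<lambda>z. (-1) * (\<Sum>b\<in>Basis. partial_deriv b (partial_deriv b f) z)
      + (1/4) * (\<Sum>b\<in>Basis. complex_of_real (z \<bullet> b) * (complex_of_real (z \<bullet> b) * f z)))" for f :: "'a \<Rightarrow> complex"
    unfolding hermite_expr_def[abs_def] scaleR_conv_of_real of_real_divide nz
    by (simp add: sum_distrib_right mult.assoc)
  have left: "l2_inner lborel (hermite_expr f) v = - (\<Sum>b\<in>Basis. l2_inner lborel (partial_deriv b (partial_deriv b f)) v)
      + (1/4) * (\<Sum>b\<in>Basis. l2_inner lborel (\<lambda>z. complex_of_real (z \<bullet> b) * (complex_of_real (z \<bullet> b) * f z)) v)"
    if f: "f \<in> schwartz" and v: "v \<in> schwartz" for f v :: "'a \<Rightarrow> complex"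
    unfolding expr
    by (subst l2_inner_add_left) (simp_all add: L2_scale[of _ _ "-1", simplified] L2_scale[of _ _ "1/4", simplified] L[OF f] schwartz_L2[OF v] l2_inner_scale_left[of _ "-1", simplified]
       l2_inner_scale_left[of _ "1/4", simplified] l2_inner_sum_left)
  have "l2_inner lborel f (hermite_expr v) = cnj (l2_inner lborel (hermite_expr v) f)" by (rule l2_inner_commute)
  also have "\<dots> = - (\<Sum>b\<in>Basis. l2_inner lborel f (partial_deriv b (partial_deriv b v)))
      + (1/4) * (\<Sum>b\<in>Basis. l2_inner lborel f (\<lambda>z. complex_of_real (z \<bullet> b) * (complex_of_real (z \<bullet> b) * v z)))"
    unfolding left[OF v f] by (simp add: l2_inner_cnj)
  finally show ?thesis
    unfolding left[OF f v] l2_inner_coord by (simp add: parts)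
qed

section \<open>The closed Hermite operator in terms of coefficients\<close>

lemma shat_eq:
  fixes \<gamma> :: "'n::finite + 'n \<Rightarrow> nat"
  shows "shat \<gamma> = (\<lambda>z. complex_of_real (1 / (sqrt (mfact \<gamma>) * l2_norm lborel (sherm (\<lambda>_. 0) :: (real ^ 'n) \<times> (real ^ 'n) \<Rightarrow> complex))) * sherm \<gamma> z)"
  unfolding shat_def normalized_def[abs_def] ..

lemma shat_fspan: "shat \<gamma> \<in> fspan sherm"
  unfolding shat_eq by (intro fspan.scale fspan.base)

lemma shat_schwartz: "shat \<gamma> \<in> schwartz"
  by (rule test_class_schwartz[OF test_class_sherm shat_fspan])

lemma shat_sum_schwartz: "finite I \<Longrightarrow> (\<lambda>z. \<Sum>i\<in>I. c i * shat (\<gamma> i) z) \<in> schwartz"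
  by (intro test_class_schwartz[OF test_class_sherm] fspan_sum fspan.scale shat_fspan)

lemma hermite_expr_shat_sum:
  fixes \<gamma> :: "'i \<Rightarrow> 'n::finite + 'n \<Rightarrow> nat"
  shows "finite I \<Longrightarrow> hermite_expr (\<lambda>z. \<Sum>i\<in>I. c i * shat (\<gamma> i) z) = (\<lambda>z. \<Sum>i\<in>I. (c i * complex_of_real (sh_ev (\<gamma> i))) * shat (\<gamma> i) z)"
  using hermite_expr_fspan_sum[where I = I and \<gamma> = \<gamma> and c = "\<lambda>i. c i * complex_of_real (1 / (sqrt (mfact (\<gamma> i)) * l2_norm lborel (sherm (\<lambda>_. 0) :: (real ^ 'n) \<times> (real ^ 'n) \<Rightarrow> complex)))"]
  by (auto simp: shat_eq mult_ac)

lemma hermite_expr_shat: "hermite_expr (shat \<gamma>) = (\<lambda>z. complex_of_real (sh_ev \<gamma>) * shat \<gamma> z)"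
  using hermite_expr_shat_sum[of "{()}" "\<lambda>_. 1" "\<lambda>_. \<gamma>"] by simp

text \<open>On the approximating Schwartz functions, symmetry moves the differential expression to
  the eigenfunction; continuity of the inner product then passes through the graph closure.\<close>

lemma hermite_op_coeff:
  assumes "(f, g) \<in> hermite_op"
  shows "l2_inner lborel g (shat \<gamma>) = complex_of_real (sh_ev \<gamma>) * l2_inner lborel f (shat \<gamma>)"
proof -
  obtain \<phi> where f: "f \<in> L2 lborel" and g: "g \<in> L2 lborel" and \<phi>: "\<And>n. \<phi> n \<in> schwartz"
    and lim: "(\<lambda>n. l2_norm lborel (\<lambda>z. \<phi> n z - f z)) \<longlonglongrightarrow> 0"
      "(\<lambda>n. l2_norm lborel (\<lambda>z. hermite_expr (\<phi> n) z - g z)) \<longlonglongrightarrow> 0"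
    using assms unfolding hermite_op_def by blast
  note s = schwartz_L2[OF shat_schwartz]
  have "(\<lambda>n. l2_inner lborel (hermite_expr (\<phi> n)) (shat \<gamma>)) \<longlonglongrightarrow> l2_inner lborel g (shat \<gamma>)"
    by (rule l2_inner_tendsto_left[OF _ g s lim(2)]) (intro rapid_L2 rapid_hermite_expr \<phi>)
  moreover have "l2_inner lborel (hermite_expr (\<phi> n)) (shat \<gamma>) = complex_of_real (sh_ev \<gamma>) * l2_inner lborel (\<phi> n) (shat \<gamma>)" for n
    unfolding hermite_expr_symmetric[OF \<phi> shat_schwartz] hermite_expr_shat l2_inner_scale_right by simp
  moreover have "(\<lambda>n. complex_of_real (sh_ev \<gamma>) * l2_inner lborel (\<phi> n) (shat \<gamma>)) \<longlonglongrightarrow> complex_of_real (sh_ev \<gamma>) * l2_inner lborel f (shat \<gamma>)"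
    by (intro tendsto_intros l2_inner_tendsto_left[OF _ f s lim(1)] schwartz_L2 \<phi>)
  ultimately show ?thesis using LIMSEQ_unique by simp
qed

text \<open>The partial sums of the eigenfunction expansion are Schwartz functions, and applying the
  expression to them gives the partial sums for \<open>g\<close>. So they converge in the graph
  norm, which is why no domain is lost by closing on Schwartz functions.\<close>

lemma hermite_opI:
  fixes f g :: "(real ^ 'n::finite) \<times> (real ^ 'n) \<Rightarrow> complex"
  assumes f: "f \<in> L2 lborel" and g: "g \<in> L2 lborel"
    and c: "\<And>\<gamma>. l2_inner lborel g (shat \<gamma>) = complex_of_real (sh_ev \<gamma>) * l2_inner lborel f (shat \<gamma>)"
  shows "(f, g) \<in> hermite_op"
proof -
  let ?e = "\<lambda>n. shat (mi_enum n :: 'n + 'n \<Rightarrow> nat)"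
  let ?\<phi> = "\<lambda>n z. \<Sum>i<n. l2_inner lborel f (?e i) * ?e i z"
  have "hermite_expr (?\<phi> n) = (\<lambda>z. \<Sum>i<n. l2_inner lborel g (?e i) * ?e i z)" for n
    by (subst hermite_expr_shat_sum) (simp_all add: c mult_ac)
  then have "(\<lambda>n. l2_norm lborel (\<lambda>z. hermite_expr (?\<phi> n) z - g z)) \<longlonglongrightarrow> 0"
    using l2_onb_expansion[OF sherm_basis(3) g] by simp
  moreover have "(\<lambda>n. l2_norm lborel (\<lambda>z. ?\<phi> n z - f z)) \<longlonglongrightarrow> 0"
    by (rule l2_onb_expansion[OF sherm_basis(3) f])
  moreover have "?\<phi> n \<in> schwartz" for n by (intro shat_sum_schwartz) simp
  ultimately have "\<exists>\<phi>. (\<forall>n. \<phi> n \<in> schwartz) \<and>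
             (\<lambda>n. l2_norm lborel (\<lambda>z. \<phi> n z - f z)) \<longlonglongrightarrow> 0 \<and>
             (\<lambda>n. l2_norm lborel (\<lambda>z. hermite_expr (\<phi> n) z - g z)) \<longlonglongrightarrow> 0"
    by (intro exI[of _ ?\<phi>]) simp
  then show ?thesis unfolding hermite_op_def using f g by simp
qed

text \<open>Polarisation: only norms are preserved by definition, and linearity holds up to null
  sets. The scalars 1 and the imaginary unit recover real and imaginary part.\<close>

lemma l2_unitary_inner:
  assumes U: "l2_unitary M N U" and f: "f \<in> L2 M" and g: "g \<in> L2 M"
  shows "l2_inner N (U f) (U g) = l2_inner M f g"
proof -
  have L: "U h \<in> L2 N" if "h \<in> L2 M" for h using U that by (simp add: l2_unitary_def l2_linear_def)
  have nrm: "l2_norm N (U h) = l2_norm M h" if "h \<in> L2 M" for h using U that by (simp add: l2_unitary_def)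
  have re: "Re (cnj c * l2_inner N (U f) (U g)) = Re (cnj c * l2_inner M f g)" for c
  proof -
    have cg: "(\<lambda>x. c * g x) \<in> L2 M" by (rule L2_scale[OF g])
    have "\<forall>f\<in>L2 M. \<forall>g\<in>L2 M. AE x in N. U (\<lambda>y. f y + g y) x = U f x + U g x"
      using U by (simp add: l2_unitary_def l2_linear_def)
    from bspec[OF bspec[OF this f] cg]
    have "AE x in N. U (\<lambda>y. f y + c * g y) x = U f x + U (\<lambda>y. c * g y) x" .
    moreover have "AE x in N. U (\<lambda>y. c * g y) x = c * U g x"
      using U g unfolding l2_unitary_def l2_linear_def by blast
    ultimately have ae: "AE x in N. U (\<lambda>y. f y + c * g y) x = U f x + c * U g x" by eventually_elim simp
    have "l2_norm M (\<lambda>x. f x + c * g x) = l2_norm N (U (\<lambda>x. f x + c * g x))"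
      by (rule nrm[symmetric]) (intro L2_add f cg)
    also have "\<dots> = l2_norm N (\<lambda>x. U f x + c * U g x)"
      by (rule l2_norm_cong_AE[OF L[OF L2_add[OF f cg]] _ ae]) (intro L2_add L2_scale L f g)
    finally have "(l2_norm M (\<lambda>x. f x + c * g x))\<^sup>2 = (l2_norm N (\<lambda>x. U f x + c * U g x))\<^sup>2" by simp
    then show ?thesis
      by (simp add: l2_norm_sq_add L2_scale L f g l2_norm_scale nrm l2_inner_scale_right)
  qed
  show ?thesis
    using re[of 1] re[of \<i>] by (simp add: complex_eq_iff)
qed

text \<open>In any spectral representation the image of an eigenfunction is supported where \<open>m\<close> equals
  the eigenvalue.\<close>

lemma spectral_rep_coeff:
  assumes rep: "spectral_rep lborel hermite_op N U m" and f: "f \<in> L2 lborel" and g: "g \<in> L2 lborel"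
    and ae: "AE x in N. U g x = complex_of_real (p (m x)) * U f x"
  shows "l2_inner lborel g (shat \<gamma>) = complex_of_real (p (sh_ev \<gamma>)) * l2_inner lborel f (shat \<gamma>)"
proof -
  let ?s = "shat \<gamma>"
  have s: "?s \<in> L2 lborel" by (rule schwartz_L2[OF shat_schwartz])
  have es: "(\<lambda>z. complex_of_real (sh_ev \<gamma>) * ?s z) \<in> L2 lborel" by (rule L2_scale[OF s])
  have U: "l2_unitary lborel N U" using rep by (simp add: spectral_rep_def)
  have L: "U h \<in> L2 N" if "h \<in> L2 lborel" for h using U that by (simp add: l2_unitary_def l2_linear_def)
  have op: "(?s, \<lambda>z. complex_of_real (sh_ev \<gamma>) * ?s z) \<in> hermite_op"
    by (rule hermite_opI[OF s es]) (simp add: l2_inner_scale_left l2_onsD[OF sherm_basis(2)])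
  have "AE x in N. U (\<lambda>z. complex_of_real (sh_ev \<gamma>) * ?s z) x = complex_of_real (m x) * U ?s x"
    using rep s es op unfolding spectral_rep_def by blast
  moreover have "AE x in N. U (\<lambda>z. complex_of_real (sh_ev \<gamma>) * ?s z) x = complex_of_real (sh_ev \<gamma>) * U ?s x"
    using U s unfolding l2_unitary_def l2_linear_def by blast
  ultimately have supp: "AE x in N. U ?s x = 0 \<or> m x = sh_ev \<gamma>" by eventually_elim auto
  have "l2_inner lborel g ?s = l2_inner N (U g) (U ?s)" by (rule l2_unitary_inner[OF U g s, symmetric])
  also have "\<dots> = (LINT x|N. (complex_of_real (p (sh_ev \<gamma>)) * U f x) * cnj (U ?s x))"
    unfolding l2_inner_def
  proof (rule integral_cong_AE)
    show "(\<lambda>x. U g x * cnj (U ?s x)) \<in> borel_measurable N" "(\<lambda>x. (complex_of_real (p (sh_ev \<gamma>)) * U f x) * cnj (U ?s x)) \<in> borel_measurable N"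
      by (intro borel_measurable_integrable integrable_L2_inner L2_scale L f g s)+
    show "AE x in N. U g x * cnj (U ?s x) = (complex_of_real (p (sh_ev \<gamma>)) * U f x) * cnj (U ?s x)"
      using ae supp by eventually_elim auto
  qed
  also have "\<dots> = complex_of_real (p (sh_ev \<gamma>)) * l2_inner N (U f) (U ?s)"
    by (subst l2_inner_scale_left[symmetric]) (simp add: l2_inner_def)
  also have "l2_inner N (U f) (U ?s) = l2_inner lborel f ?s" by (rule l2_unitary_inner[OF U f s])
  finally show ?thesis .
qed

text \<open>\<open>U\<close> is the coefficient map and \<open>m\<close> the sequence of
  eigenvalues. Sequences are modelled by counting measure on the pairs \<open>(n, 0)\<close>, since
  the representing space has to consist of pairs. The second conjunct lets a coefficient identity
  certify a candidate for \<open>p(A) f\<close> in this representation.\<close>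

lemma spectral_rep_exists:
  "\<exists>N U m. spectral_rep lborel (hermite_op :: (((real ^ 'n) \<times> (real ^ 'n) \<Rightarrow> complex) \<times> _) set) N U m \<and>
     (\<forall>f\<in>L2 lborel. \<forall>g\<in>L2 lborel. \<forall>p. (\<forall>\<gamma>::'n::finite + 'n \<Rightarrow> nat. l2_inner lborel g (shat \<gamma>) = complex_of_real (p (sh_ev \<gamma>)) * l2_inner lborel f (shat \<gamma>))
        \<longrightarrow> (AE x in N. U g x = complex_of_real (p (m x)) * U f x))"
proof -
  let ?e = "\<lambda>n. shat (mi_enum n :: 'n + 'n \<Rightarrow> nat)"
  let ?A = "range (\<lambda>n::nat. (n, 0::real))"
  define N where "N = count_space ?A"
  define U where "U f x = l2_inner lborel f (?e (fst x))" for f and x :: "nat \<times> real"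
  define m where "m x = sh_ev (mi_enum (fst x) :: 'n + 'n \<Rightarrow> nat)" for x :: "nat \<times> real"
  note onb = sherm_basis(3) and ons = l2_onb_ons[OF sherm_basis(3)]
  have eL: "?e n \<in> L2 lborel" for n by (rule schwartz_L2[OF shat_schwartz])
  have bij: "bij_betw (\<lambda>n::nat. (n, 0::real)) UNIV ?A" by (auto simp: bij_betw_def inj_def)
  have inn: "integrable N h \<longleftrightarrow> summable (\<lambda>n. norm (h (n, 0)))" for h :: "nat \<times> real \<Rightarrow> real"
    unfolding N_def using integrable_bij_count_space[OF bij, of h] integrable_count_space_nat_iff[of "\<lambda>n. h (n, 0)"] by simp
  have nint: "(LINT x|N. h x) = (\<Sum>n. h (n, 0))" if "integrable N h" for h :: "nat \<times> real \<Rightarrow> real"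
  proof -
    have "integrable (count_space UNIV) (\<lambda>n::nat. h (n, 0))"
      using that integrable_bij_count_space[OF bij, of h] unfolding N_def by simp
    then show ?thesis
      unfolding N_def integral_bij_count_space[OF bij, symmetric] by (rule integral_count_space_nat)
  qed
  have L2N: "h \<in> L2 N \<longleftrightarrow> summable (\<lambda>n. (cmod (h (n, 0)))\<^sup>2)" for h
    unfolding L2_def using inn[of "\<lambda>x. (cmod (h x))\<^sup>2"] by (simp add: N_def)
  have AEN: "(AE x in N. P x) \<longleftrightarrow> (\<forall>n. P (n, 0))" for P
    unfolding N_def by (simp add: AE_count_space)
  have UL: "U f \<in> L2 N" if "f \<in> L2 lborel" for f
    unfolding L2N U_def using l2_coeffs_summable[OF ons that] by simp
  have nrm: "l2_norm N (U f) = l2_norm lborel f" if f: "f \<in> L2 lborel" for f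
  proof -
    have "(\<lambda>i. l2_inner lborel f (?e i) * l2_inner lborel (?e i) f) sums l2_inner lborel f f"
      by (rule l2_onb_Parseval[OF onb f f])
    moreover have "l2_inner lborel f (?e i) * l2_inner lborel (?e i) f = complex_of_real ((cmod (l2_inner lborel f (?e i)))\<^sup>2)" for i
      by (simp only: complex_of_real_cmod_square l2_inner_cnj)
    ultimately have "(\<lambda>i. (cmod (l2_inner lborel f (?e i)))\<^sup>2) sums (l2_norm lborel f)\<^sup>2"
      unfolding l2_inner_self by (simp only: sums_of_real_iff)
    then have "(\<Sum>i. (cmod (l2_inner lborel f (?e i)))\<^sup>2) = (l2_norm lborel f)\<^sup>2" by (rule sums_unique[symmetric])
    then show ?thesis
      using nint[OF L2_integrable_square[OF UL[OF f]]] unfolding l2_norm_def[of N] by (simp add: U_def)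
  qed
  have unit: "l2_unitary lborel N U"
    unfolding l2_unitary_def l2_linear_def
  proof (intro conjI ballI allI)
    fix h assume h: "h \<in> L2 N"
    then have "summable (\<lambda>n. (cmod (h (n, 0)))\<^sup>2)" by (simp add: L2N)
    then obtain f where "f \<in> L2 lborel" "\<And>i. l2_inner lborel f (?e i) = h (i, 0)"
      using l2_Riesz_Fischer[OF ons, of "\<lambda>n. h (n, 0)"] by blast
    then show "\<exists>f\<in>L2 lborel. AE x in N. U f x = h x" unfolding AEN U_def by auto
  qed (simp_all add: UL nrm AEN, simp_all add: U_def l2_inner_add_left l2_inner_scale_left eL)
  have coeff: "(\<forall>\<gamma>. l2_inner lborel g (shat \<gamma>) = complex_of_real (p (sh_ev \<gamma>)) * l2_inner lborel f (shat \<gamma>))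
      \<longleftrightarrow> (AE x in N. U g x = complex_of_real (p (m x)) * U f x)" for f g p
  proof -
    have all: "(\<forall>\<gamma>. P \<gamma>) \<longleftrightarrow> (\<forall>n. P (mi_enum n))" for P :: "('n + 'n \<Rightarrow> nat) \<Rightarrow> bool"
      by (metis bij_pointE[OF bij_mi_enum])
    show ?thesis unfolding AEN U_def m_def all by simp
  qed
  have "spectral_rep lborel hermite_op N U m"
    unfolding spectral_rep_def
  proof (intro conjI ballI)
    show "sigma_finite_measure N" unfolding N_def by (rule sigma_finite_measure_count_space_countable) simp
    show "m \<in> borel_measurable N" unfolding N_def by simp
    show "hermite_op \<subseteq> L2 lborel \<times> L2 lborel" unfolding hermite_op_def by auto
    fix f g :: "(real ^ 'n) \<times> (real ^ 'n) \<Rightarrow> complex" assume fg: "f \<in> L2 lborel" "g \<in> L2 lborel"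
    show "(f, g) \<in> hermite_op \<longleftrightarrow> (AE x in N. U g x = complex_of_real (m x) * U f x)"
      using hermite_op_coeff[of f g] hermite_opI[OF fg] coeff[of g "\<lambda>l. l" f] by blast
  qed (rule unit)
  then show ?thesis using coeff by blast
qed

text \<open>The defining choice of \<open>p(A) f\<close> is only meaningful when \<open>f\<close> is in the domain of \<open>p(A)\<close>,
  which is the summability assumption.\<close>

lemma spectral_apply_coeff:
  fixes f :: "(real ^ 'n::finite) \<times> (real ^ 'n) \<Rightarrow> complex" and \<gamma> :: "'n + 'n \<Rightarrow> nat"
  assumes f: "f \<in> L2 lborel"
    and s: "summable (\<lambda>n. (cmod (complex_of_real (p (sh_ev (mi_enum n :: 'n + 'n \<Rightarrow> nat))) * l2_inner lborel f (shat (mi_enum n))))\<^sup>2)"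
  shows "spectral_apply lborel hermite_op p f \<in> L2 lborel"
    "l2_inner lborel (spectral_apply lborel hermite_op p f) (shat \<gamma>) = complex_of_real (p (sh_ev \<gamma>)) * l2_inner lborel f (shat \<gamma>)"
proof -
  let ?Q = "\<lambda>g. g \<in> L2 lborel \<and> (\<exists>N U m. spectral_rep lborel hermite_op N U m \<and> (AE x in N. U g x = complex_of_real (p (m x)) * U f x))"
  obtain g where g: "g \<in> L2 lborel"
    and c: "\<And>n. l2_inner lborel g (shat (mi_enum n :: 'n + 'n \<Rightarrow> nat)) = complex_of_real (p (sh_ev (mi_enum n :: 'n + 'n \<Rightarrow> nat))) * l2_inner lborel f (shat (mi_enum n))"
    using l2_Riesz_Fischer[OF l2_onb_ons[OF sherm_basis(3)] s] by blast
  have "\<forall>\<gamma>. l2_inner lborel g (shat \<gamma>) = complex_of_real (p (sh_ev \<gamma>)) * l2_inner lborel f (shat \<gamma>)"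
  proof
    fix \<gamma> :: "'n + 'n \<Rightarrow> nat"
    obtain n where "\<gamma> = mi_enum n" using bij_mi_enum by (metis bij_pointE)
    then show "l2_inner lborel g (shat \<gamma>) = complex_of_real (p (sh_ev \<gamma>)) * l2_inner lborel f (shat \<gamma>)"
      using c[of n] by simp
  qed
  then have "?Q g" using spectral_rep_exists f g by blast
  then have "?Q (spectral_apply lborel hermite_op p f)" unfolding spectral_apply_def by (rule someI[of ?Q])
  then show "spectral_apply lborel hermite_op p f \<in> L2 lborel"
    "l2_inner lborel (spectral_apply lborel hermite_op p f) (shat \<gamma>) = complex_of_real (p (sh_ev \<gamma>)) * l2_inner lborel f (shat \<gamma>)"
    using spectral_rep_coeff[OF _ f] by blast+
qed

section \<open>Radial functions\<close>

lemma partial_deriv_linear_comb: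
  assumes "f differentiable (at z)"
  shows "frechet_derivative f (at z) (c *\<^sub>R a + d *\<^sub>R b) = c *\<^sub>R partial_deriv a f z + d *\<^sub>R partial_deriv b f z"
  using linear_frechet_derivative[OF assms] by (simp add: partial_deriv_def linear_add linear_scale)

text \<open>\<open>f\<close> is constant along the curve that rotates \<open>z\<close> in the plane
  number \<open>i\<close>; the derivative of \<open>f\<close> along it at time 0 is the difference
  of the two sides.\<close>

lemma radial_rotate:
  fixes f :: "(real ^ 'n) \<times> (real ^ 'n) \<Rightarrow> complex"
  assumes rad: "radial f" and d: "f differentiable (at z)"
  shows "complex_of_real (fst z $ i) * partial_deriv (bxi i) f z = complex_of_real (snd z $ i) * partial_deriv (bx i) f z"
proof -
  let ?x = "fst z $ i" and ?y = "snd z $ i"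
  \<comment> \<open>\<open>A t\<close> and \<open>B t\<close> are the increments of the two
    coordinates under rotation by the angle \<open>t\<close>, so that the curve starts at
    \<open>z\<close> and changes nothing outside the plane.\<close>
  define A where "A t = (cos t - 1) * ?x - sin t * ?y" for t
  define B where "B t = sin t * ?x + (cos t - 1) * ?y" for t
  define c where "c t = z + (A t *\<^sub>R bx i + B t *\<^sub>R bxi i)" for t
  have "norm (c t) = norm z" for t
  proof -
    have "c t \<bullet> c t = z \<bullet> z + 2 * (A t * ?x + B t * ?y) + (A t)\<^sup>2 + (B t)\<^sup>2"
      unfolding c_def inner_add_left inner_add_right inner_scaleR_left inner_scaleR_right
      by (simp add: inner_commute[of "bx i" z] inner_commute[of "bxi i" z] inner_prod_def inner_axis inner_axis' power2_eq_square algebra_simps)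
    also have "\<dots> = z \<bullet> z + (?x\<^sup>2 + ?y\<^sup>2) * ((sin t)\<^sup>2 + (cos t)\<^sup>2) - (?x\<^sup>2 + ?y\<^sup>2)"
      unfolding A_def B_def power2_eq_square
      by (simp add: algebra_simps del: sin_cos_squared_add sin_cos_squared_add2 sin_cos_squared_add3)
    also have "\<dots> = z \<bullet> z" by simp
    finally show ?thesis by (simp add: norm_eq_sqrt_inner)
  qed
  then have const: "f (c t) = f z" for t using rad unfolding radial_def by blast
  have c0: "c 0 = z" unfolding c_def A_def B_def by (simp add: zero_prod_def[symmetric])
  have "(c has_derivative (\<lambda>h. h *\<^sub>R ((- ?y) *\<^sub>R bx i + ?x *\<^sub>R bxi i))) (at 0)"
    unfolding c_def[abs_def] A_def B_def
    by (rule derivative_eq_intros refl | simp)+ (auto simp: fun_eq_iff algebra_simps)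
  moreover have "(f has_derivative frechet_derivative f (at z)) (at (c 0))"
    using d unfolding c0 frechet_derivative_works .
  ultimately have "((\<lambda>t. f (c t)) has_derivative (\<lambda>h. frechet_derivative f (at z) (h *\<^sub>R ((- ?y) *\<^sub>R bx i + ?x *\<^sub>R bxi i)))) (at 0)"
    by (rule has_derivative_compose)
  moreover have "((\<lambda>t. f (c t)) has_derivative (\<lambda>h. 0)) (at 0)" unfolding const by simp
  ultimately have "(\<lambda>h::real. frechet_derivative f (at z) (h *\<^sub>R ((- ?y) *\<^sub>R bx i + ?x *\<^sub>R bxi i))) = (\<lambda>h. 0)"
    by (rule has_derivative_unique)
  from fun_cong[OF this, of 1] have "frechet_derivative f (at z) ((- ?y) *\<^sub>R bx i + ?x *\<^sub>R bxi i) = 0" by simp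
  then show ?thesis unfolding partial_deriv_linear_comb[OF d] by (simp add: scaleR_conv_of_real)
qed

text \<open>The rotation generator of the plane has \<open>psi j k\<close> as an eigenfunction: its
  angular momentum is \<open>j - k\<close>.\<close>

lemma psi_rotate:
  "complex_of_real x * psi_dxi j k x \<xi> - complex_of_real \<xi> * psi_dx j k x \<xi> = \<i> * (of_nat j - of_nat k) * psi j k x \<xi>"
proof -
  let ?P = "\<lambda>j k. psi j k x \<xi>"
  have a: "complex_of_real x * psi_dxi j k x \<xi> = - \<i> * (2 * of_nat j * (complex_of_real x * ?P (j - 1) k) + complex_of_real x * ?P (Suc j) k
    + 2 * of_nat k * (complex_of_real x * ?P j (k - 1)) + complex_of_real x * ?P j (Suc k)) / 4"
    by (simp add: psi_dxi_def algebra_simps)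
  have b: "complex_of_real \<xi> * psi_dx j k x \<xi> = (2 * of_nat k * (complex_of_real \<xi> * ?P j (k - 1)) - complex_of_real \<xi> * ?P j (Suc k)
    - 2 * of_nat j * (complex_of_real \<xi> * ?P (j - 1) k) + complex_of_real \<xi> * ?P (Suc j) k) / 4"
    by (simp add: psi_dx_def algebra_simps)
  show ?thesis
    unfolding a b psi_x psi_xi by (cases j; cases k) (simp_all add: field_simps)
qed

lemma sherm_rotate:
  "complex_of_real (fst z $ i) * partial_deriv (bxi i) (sherm \<gamma>) z - complex_of_real (snd z $ i) * partial_deriv (bx i) (sherm \<gamma>) z
    = \<i> * (of_nat (\<gamma> (Inl i)) - of_nat (\<gamma> (Inr i))) * sherm \<gamma> z"
  unfolding sherm_dx_psi sherm_dxi_psi sherm_split[of \<gamma> z i] mult.assoc[symmetric] left_diff_distrib[symmetric] psi_rotate by simp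

lemma coord_nice:
  assumes u: "u \<in> fspan sherm" and b: "b \<in> Basis" and c: "c \<in> Basis"
  shows "nice b (\<lambda>z. complex_of_real (z \<bullet> c) * u z)"
    "partial_deriv b (\<lambda>z. complex_of_real (z \<bullet> c) * u z) = (\<lambda>z. complex_of_real (z \<bullet> c) * partial_deriv b u z + complex_of_real (b \<bullet> c) * u z)"
  using test_class_nice[OF test_class_sherm test_classD(5)[OF test_class_sherm u c] b]
  by (auto simp: partial_deriv_mult coord_differentiable test_classD(2)[OF test_class_sherm u] partial_deriv_coord)

text \<open>The rotation generator annihilates \<open>f\<close> and is skew under integration by
  parts, while it multiplies \<open>sherm \<gamma>\<close> by a nonzero multiple of the difference
  of the two indices.\<close>

lemma radial_off_diagonal:
  fixes f :: "(real ^ 'n) \<times> (real ^ 'n) \<Rightarrow> complex"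
  assumes f: "f \<in> schwartz" and rad: "radial f" and ne: "\<gamma> (Inl i) \<noteq> \<gamma> (Inr i)"
  shows "l2_inner lborel f (sherm \<gamma>) = 0"
proof -
  let ?s = "sherm \<gamma>"
  have s: "?s \<in> fspan sherm" by (rule fspan.base)
  note n = schwartz_nice(1)[OF f bx_Basis(1)[of i]] schwartz_nice(1)[OF f bx_Basis(2)[of i]]
  note m = coord_nice(1)[OF s bx_Basis(2)[of i] bx_Basis(1)[of i]] coord_nice(1)[OF s bx_Basis(1)[of i] bx_Basis(2)[of i]]
  have fL: "f \<in> L2 lborel" by (rule schwartz_L2[OF f])
  have eq: "(\<lambda>z. complex_of_real (z \<bullet> bx i) * partial_deriv (bxi i) f z) = (\<lambda>z. complex_of_real (z \<bullet> bxi i) * partial_deriv (bx i) f z)"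
    using radial_rotate[OF rad] n unfolding inner_bx by (auto simp: nice_def)
  have "l2_inner lborel (partial_deriv (bxi i) f) (\<lambda>z. complex_of_real (z \<bullet> bx i) * ?s z)
      = l2_inner lborel (partial_deriv (bx i) f) (\<lambda>z. complex_of_real (z \<bullet> bxi i) * ?s z)"
    unfolding l2_inner_coord[symmetric] eq ..
  then have "l2_inner lborel f (partial_deriv (bxi i) (\<lambda>z. complex_of_real (z \<bullet> bx i) * ?s z))
      = l2_inner lborel f (partial_deriv (bx i) (\<lambda>z. complex_of_real (z \<bullet> bxi i) * ?s z))"
    unfolding nice_by_parts[OF n(2) m(1)] nice_by_parts[OF n(1) m(2)] by simp
  then have "l2_inner lborel f (\<lambda>z. partial_deriv (bxi i) (\<lambda>z. complex_of_real (z \<bullet> bx i) * ?s z) z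
      - partial_deriv (bx i) (\<lambda>z. complex_of_real (z \<bullet> bxi i) * ?s z) z) = 0"
    using m fL by (subst l2_inner_diff_right) (auto intro: rapid_L2 simp: nice_def)
  moreover have "partial_deriv (bxi i) (\<lambda>z. complex_of_real (z \<bullet> bx i) * ?s z) z
      - partial_deriv (bx i) (\<lambda>z. complex_of_real (z \<bullet> bxi i) * ?s z) z = \<i> * (of_nat (\<gamma> (Inl i)) - of_nat (\<gamma> (Inr i))) * ?s z" for z
    unfolding coord_nice(2)[OF s bx_Basis(2) bx_Basis(1)] coord_nice(2)[OF s bx_Basis(1) bx_Basis(2)]
    using sherm_rotate[of z i \<gamma>] by simp
  ultimately have "cnj (\<i> * (of_nat (\<gamma> (Inl i)) - of_nat (\<gamma> (Inr i)))) * l2_inner lborel f ?s = 0"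
    by (simp only: l2_inner_scale_right)
  then show ?thesis using ne by simp
qed

section \<open>Decay of the diagonal coefficients\<close>

definition aop :: "'a::euclidean_space \<Rightarrow> ('a \<Rightarrow> complex) \<Rightarrow> 'a \<Rightarrow> complex" where
  "aop b u z = partial_deriv b u z + (1/2) * (complex_of_real (z \<bullet> b) * u z)"

text \<open>The span of these functions is stable under the coordinate and the derivative in
  direction \<open>b\<close>, hence under \<open>aop b\<close>; it is the domain on which powers of
  \<open>aop b\<close> can be manipulated.\<close>

definition wfun :: "'a::euclidean_space \<Rightarrow> ('a \<Rightarrow> complex) \<Rightarrow> nat \<times> nat \<Rightarrow> 'a \<Rightarrow> complex" where
  "wfun b f p z = complex_of_real ((z \<bullet> b) ^ fst p) * (partial_deriv b ^^ snd p) f z"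

context
  fixes b :: "'a::euclidean_space" and f :: "'a \<Rightarrow> complex"
  assumes b: "b \<in> Basis" and f: "f \<in> schwartz"
begin

lemma wfun_coord: "u \<in> fspan (wfun b f) \<Longrightarrow> (\<lambda>z. complex_of_real (z \<bullet> b) * u z) \<in> fspan (wfun b f)"
proof (induction rule: fspan.induct)
  case (base p)
  have "(\<lambda>z. complex_of_real (z \<bullet> b) * wfun b f p z) = wfun b f (Suc (fst p), snd p)"
    by (simp add: wfun_def fun_eq_iff)
  then show ?case by (simp add: fspan.base)
next
  case (add u v)
  then show ?case using fspan.add[OF add.IH] by (simp add: distrib_left)
next
  case (scale u c)
  then show ?case using fspan.scale[OF scale.IH, of c] by (simp add: mult.left_commute)
qed

lemma power_coord_has_derivative:
  "((\<lambda>z. complex_of_real ((z \<bullet> b) ^ j)) has_derivative (\<lambda>h. complex_of_real (real j * (z \<bullet> b) ^ (j - 1) * (h \<bullet> b)))) (at z)"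
  by (intro has_derivative_of_real) (auto intro!: derivative_eq_intros)

lemma wfun_differentiable: "u \<in> fspan (wfun b f) \<Longrightarrow> u differentiable (at z)"
proof (induction rule: fspan.induct)
  case (base p)
  have "(\<lambda>z. complex_of_real ((z \<bullet> b) ^ fst p)) differentiable (at z)"
    using power_coord_has_derivative unfolding differentiable_def by blast
  then show ?case unfolding wfun_def[abs_def] by (intro differentiable_mult schwartz_rapid(2)[OF f b])
qed (auto intro: differentiable_add differentiable_mult)

lemma wfun_partial: "u \<in> fspan (wfun b f) \<Longrightarrow> partial_deriv b u \<in> fspan (wfun b f)"
proof (induction rule: fspan.induct)
  case (base p)
  have "partial_deriv b (wfun b f p) z = of_nat (fst p) * wfun b f (fst p - 1, snd p) z + wfun b f (fst p, Suc (snd p)) z" for z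
  proof -
    have d: "(\<lambda>z. complex_of_real ((z \<bullet> b) ^ fst p)) differentiable (at z)"
      using power_coord_has_derivative unfolding differentiable_def by blast
    show ?thesis
      unfolding wfun_def[abs_def] partial_deriv_mult[OF d schwartz_rapid(2)[OF f b]] partial_derivI[OF power_coord_has_derivative]
      using b by (simp add: algebra_simps)
  qed
  then have "partial_deriv b (wfun b f p) = (\<lambda>z. of_nat (fst p) * wfun b f (fst p - 1, snd p) z + wfun b f (fst p, Suc (snd p)) z)" by blast
  then show ?case by (simp only:) (intro fspan.add fspan.scale fspan.base)
next
  case (add u v)
  then have "partial_deriv b (\<lambda>z. u z + v z) = (\<lambda>z. partial_deriv b u z + partial_deriv b v z)"
    by (auto simp: partial_deriv_add wfun_differentiable)
  then show ?case using add by (auto intro: fspan.add)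
next
  case (scale u c)
  then have "partial_deriv b (\<lambda>z. c * u z) = (\<lambda>z. c * partial_deriv b u z)"
    by (auto simp: partial_deriv_scale wfun_differentiable)
  then show ?case using scale by (auto intro: fspan.scale)
qed

lemma wfun_rapid: "u \<in> fspan (wfun b f) \<Longrightarrow> rapid u"
proof (induction rule: fspan.induct)
  case (base p)
  have "rapid (\<lambda>z. complex_of_real ((z \<bullet> b) ^ j) * (partial_deriv b ^^ n) f z)" for j n
  proof (induction j)
    case 0
    then show ?case using schwartz_rapid(1)[OF f b, of n] by simp
  next
    case (Suc j)
    then show ?case using rapid_coord[OF Suc b] by (simp add: mult.assoc)
  qed
  then show ?case by (simp add: wfun_def[abs_def])
qed (auto intro: rapid_add rapid_scale)

lemma wfun_L2: "u \<in> fspan (wfun b f) \<Longrightarrow> u \<in> L2 lborel"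
  by (intro rapid_L2 wfun_rapid)

lemma wfun_nice: "u \<in> fspan (wfun b f) \<Longrightarrow> nice b u"
  by (simp add: nice_def wfun_differentiable wfun_rapid wfun_partial)

lemma wfun_aop: "u \<in> fspan (wfun b f) \<Longrightarrow> aop b u \<in> fspan (wfun b f)"
  unfolding aop_def[abs_def] by (intro fspan.add fspan.scale wfun_partial wfun_coord)

lemma wfun_aop_pow: "u \<in> fspan (wfun b f) \<Longrightarrow> (aop b ^^ n) u \<in> fspan (wfun b f)"
  by (induction n) (auto intro: wfun_aop)

lemma aop_pow_linear:
  assumes "u \<in> fspan (wfun b f)" "v \<in> fspan (wfun b f)"
  shows "(aop b ^^ n) (\<lambda>z. u z + c * v z) = (\<lambda>z. (aop b ^^ n) u z + c * (aop b ^^ n) v z)"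
proof (induction n)
  case (Suc n)
  let ?u = "(aop b ^^ n) u" and ?v = "(aop b ^^ n) v"
  have d: "?u differentiable (at z)" "?v differentiable (at z)" for z
    using assms by (auto intro: wfun_differentiable wfun_aop_pow)
  have "aop b (\<lambda>z. ?u z + c * ?v z) = (\<lambda>z. aop b ?u z + c * aop b ?v z)"
    using d by (auto simp: aop_def partial_deriv_add partial_deriv_scale differentiable_mult algebra_simps)
  then show ?case by (simp add: Suc)
qed simp

lemma wfun_partial_pow: "u \<in> fspan (wfun b f) \<Longrightarrow> (partial_deriv b ^^ n) u \<in> fspan (wfun b f)"
  by (induction n) (auto intro: wfun_partial)

text \<open>The commutator of the \<open>n\<close>-th derivative with the coordinate is
  \<open>n\<close> times the derivative of order \<open>n - 1\<close>.\<close>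

lemma coord_partial_pow:
  assumes u: "u \<in> fspan (wfun b f)"
  shows "(partial_deriv b ^^ n) (\<lambda>z. complex_of_real (z \<bullet> b) * u z)
    = (\<lambda>z. complex_of_real (z \<bullet> b) * (partial_deriv b ^^ n) u z + of_nat n * (partial_deriv b ^^ (n - 1)) u z)"
proof (induction n)
  case (Suc n)
  have d: "(partial_deriv b ^^ k) u differentiable (at z)" for k z
    using wfun_partial_pow[OF u] by (rule wfun_differentiable)
  have "partial_deriv b (\<lambda>z. complex_of_real (z \<bullet> b) * (partial_deriv b ^^ n) u z + of_nat n * (partial_deriv b ^^ (n - 1)) u z) z
    = complex_of_real (z \<bullet> b) * partial_deriv b ((partial_deriv b ^^ n) u) z + (partial_deriv b ^^ n) u z + of_nat n * partial_deriv b ((partial_deriv b ^^ (n - 1)) u) z" for z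
    using d b by (simp add: partial_deriv_add partial_deriv_scale partial_deriv_mult coord_differentiable differentiable_mult partial_deriv_coord)
  moreover have "of_nat n * partial_deriv b ((partial_deriv b ^^ (n - 1)) u) z = of_nat n * (partial_deriv b ^^ n) u z" for z
    by (cases n) auto
  ultimately have "partial_deriv b (\<lambda>z. complex_of_real (z \<bullet> b) * (partial_deriv b ^^ n) u z + of_nat n * (partial_deriv b ^^ (n - 1)) u z)
    = (\<lambda>z. complex_of_real (z \<bullet> b) * (partial_deriv b ^^ Suc n) u z + of_nat (Suc n) * (partial_deriv b ^^ n) u z)"
    by (intro ext) (simp add: algebra_simps)
  then show ?case by (simp only: funpow.simps o_def Suc diff_Suc_1)
qed simp

text \<open>Powers of the coordinate inside, derivatives outside: the order in which they occur in
  \<open>sobolev_norm\<close>, opposite to that of \<open>wfun\<close>.\<close>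

definition Dfun :: "nat \<Rightarrow> nat \<Rightarrow> 'a \<Rightarrow> complex" where
  "Dfun i j = (partial_deriv b ^^ i) (\<lambda>z. complex_of_real ((z \<bullet> b) ^ j) * f z)"

lemma Dfun_wfun: "Dfun i j \<in> fspan (wfun b f)"
proof -
  have "wfun b f (j, 0) \<in> fspan (wfun b f)" by (rule fspan.base)
  then show ?thesis unfolding Dfun_def by (intro wfun_partial_pow) (simp add: wfun_def[abs_def])
qed

lemma aop_Dfun: "aop b (Dfun i j) = (\<lambda>z. Dfun (Suc i) j z + (1/2) * (Dfun i (Suc j) z + (- of_nat i) * Dfun (i - 1) j z))"
proof -
  have "wfun b f (j, 0) \<in> fspan (wfun b f)" by (rule fspan.base)
  then have "(\<lambda>z. complex_of_real ((z \<bullet> b) ^ j) * f z) \<in> fspan (wfun b f)" by (simp add: wfun_def[abs_def])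
  from coord_partial_pow[OF this, of i]
  have "complex_of_real (z \<bullet> b) * Dfun i j z = Dfun i (Suc j) z + (- of_nat i) * Dfun (i - 1) j z" for z
    by (simp add: Dfun_def mult.assoc)
  then show ?thesis by (auto simp: aop_def Dfun_def)
qed

lemma Dfun_sobolev:
  assumes "i + j \<le> N"
  shows "l2_norm lborel (Dfun i j) \<le> sobolev_norm N f"
proof -
  let ?\<alpha> = "\<lambda>c. if c = b then i else 0" and ?\<beta> = "\<lambda>c. if c = b then j else 0"
  have "(?\<alpha>, ?\<beta>) \<in> multi_index_pairs N"
    using assms b by (auto simp: multi_index_pairs_def)
  then have "(case (?\<alpha>, ?\<beta>) of (\<alpha>, \<beta>) \<Rightarrow> l2_norm lborel (multi_deriv \<alpha> (\<lambda>z. monomial \<beta> z *\<^sub>R f z))) \<le> sobolev_norm N f"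
    unfolding sobolev_norm_def by (rule member_le_sum) (auto simp: finite_multi_index_pairs)
  then show ?thesis by (simp add: multi_deriv_single[OF b] monomial_single[OF b] Dfun_def scaleR_conv_of_real)
qed

end

text \<open>One application of \<open>aop b\<close> turns \<open>Dfun b f i j\<close> into such
  functions whose order \<open>i + j\<close> is at most one larger, the commutator producing a term
  of lower order. So \<open>n\<close> applications stay within order \<open>n + i + j\<close>, with
  a constant independent of \<open>f\<close>.\<close>

lemma aop_pow_sobolev:
  fixes b :: "'a::euclidean_space"
  assumes b: "b \<in> Basis" and "n + i + j \<le> N"
  shows "\<exists>K\<ge>0. \<forall>f\<in>schwartz. l2_norm lborel ((aop b ^^ n) (Dfun b f i j)) \<le> K * sobolev_norm N f"
  using assms(2)
proof (induction n arbitrary: i j)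
  case 0
  then show ?case using Dfun_sobolev[OF b] by (intro exI[of _ 1]) simp
next
  case (Suc n)
  obtain K1 where K1: "0 \<le> K1" "\<And>f. f \<in> schwartz \<Longrightarrow> l2_norm lborel ((aop b ^^ n) (Dfun b f (Suc i) j)) \<le> K1 * sobolev_norm N f"
    using Suc.IH[of "Suc i" j] Suc.prems by auto
  obtain K2 where K2: "0 \<le> K2" "\<And>f. f \<in> schwartz \<Longrightarrow> l2_norm lborel ((aop b ^^ n) (Dfun b f i (Suc j))) \<le> K2 * sobolev_norm N f"
    using Suc.IH[of i "Suc j"] Suc.prems by auto
  obtain K3 where K3: "0 \<le> K3" "\<And>f. f \<in> schwartz \<Longrightarrow> l2_norm lborel ((aop b ^^ n) (Dfun b f (i - 1) j)) \<le> K3 * sobolev_norm N f"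
  proof -
    have "n + (i - 1) + j \<le> N" using Suc.prems by linarith
    from Suc.IH[OF this] show ?thesis using that by blast
  qed
  have "l2_norm lborel ((aop b ^^ Suc n) (Dfun b f i j)) \<le> (K1 + (1/2) * (K2 + real i * K3)) * sobolev_norm N f"
    if f: "f \<in> schwartz" for f
  proof -
    let ?W = "fspan (wfun b f)"
    let ?a = "aop b ^^ n" and ?D = "Dfun b f"
    note D = Dfun_wfun[OF b f] and aD = wfun_aop_pow[OF b f Dfun_wfun[OF b f]]
    have mem: "(\<lambda>z. ?D i (Suc j) z + (- of_nat i) * ?D (i - 1) j z) \<in> ?W" by (intro fspan.add fspan.scale D)
    have e: "(aop b ^^ Suc n) (?D i j) = (\<lambda>z. ?a (?D (Suc i) j) z + (1/2) * (?a (?D i (Suc j)) z + (- of_nat i) * ?a (?D (i - 1) j) z))"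
      by (simp only: funpow_Suc_right o_def aop_Dfun[OF b f] aop_pow_linear[OF b f D mem] aop_pow_linear[OF b f D D])
    note L = wfun_L2[OF b f aD]
    have "l2_norm lborel ((aop b ^^ Suc n) (?D i j)) \<le> l2_norm lborel (?a (?D (Suc i) j))
        + l2_norm lborel (\<lambda>z. (1/2) * (?a (?D i (Suc j)) z + (- of_nat i) * ?a (?D (i - 1) j) z))"
      unfolding e by (intro l2_norm_triangle L L2_scale L2_add)
    also have "l2_norm lborel (\<lambda>z. (1/2) * (?a (?D i (Suc j)) z + (- of_nat i) * ?a (?D (i - 1) j) z))
        = (1/2) * l2_norm lborel (\<lambda>z. ?a (?D i (Suc j)) z + (- of_nat i) * ?a (?D (i - 1) j) z)"
      unfolding l2_norm_scale by (simp add: norm_divide)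
    also have "l2_norm lborel (\<lambda>z. ?a (?D i (Suc j)) z + (- of_nat i) * ?a (?D (i - 1) j) z)
        \<le> l2_norm lborel (?a (?D i (Suc j))) + l2_norm lborel (\<lambda>z. (- of_nat i) * ?a (?D (i - 1) j) z)"
      by (intro l2_norm_triangle L L2_scale)
    also have "l2_norm lborel (\<lambda>z. (- of_nat i) * ?a (?D (i - 1) j) z) = real i * l2_norm lborel (?a (?D (i - 1) j))"
      unfolding l2_norm_scale by simp
    also have "l2_norm lborel (?a (?D (Suc i) j)) + (1/2) * (l2_norm lborel (?a (?D i (Suc j))) + real i * l2_norm lborel (?a (?D (i - 1) j)))
       \<le> K1 * sobolev_norm N f + (1/2) * (K2 * sobolev_norm N f + real i * (K3 * sobolev_norm N f))"
      by (intro add_mono mult_left_mono K1 K2 K3 f) auto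
    finally show ?thesis by (simp add: algebra_simps)
  qed
  moreover have "0 \<le> K1 + (1/2) * (K2 + real i * K3)" using K1 K2 K3 by simp
  ultimately show ?case by blast
qed

text \<open>The adjoint of derivative plus half the coordinate is minus derivative plus half the
  coordinate. By the formulas for \<open>sherm\<close> this is half the difference of the raising
  moves in the two slots, with no lowering part left.\<close>

lemma aop_adjoint:
  assumes u: "nice (bx i) u"
  shows "l2_inner lborel (aop (bx i) u) (sherm \<gamma>) = (1/2) * (l2_inner lborel u (sherm (up (Inr i) \<gamma>)) - l2_inner lborel u (sherm (up (Inl i) \<gamma>)))"
proof -
  let ?s = "sherm \<gamma>" and ?b = "bx i"
  note T = test_class_sherm
  have ns: "nice ?b ?s" by (intro test_class_nice[OF T] fspan.base) simp
  have uL: "u \<in> L2 lborel" "partial_deriv ?b u \<in> L2 lborel" "(\<lambda>z. complex_of_real (z \<bullet> ?b) * u z) \<in> L2 lborel"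
    using u by (auto simp: nice_def intro!: rapid_L2 rapid_coord simp del: inner_bx)
  have sL: "partial_deriv ?b ?s \<in> L2 lborel" "(\<lambda>z. complex_of_real (z \<bullet> ?b) * ?s z) \<in> L2 lborel"
    using ns by (auto simp: nice_def intro!: rapid_L2 rapid_coord simp del: inner_bx)
  have "l2_inner lborel (aop ?b u) ?s = l2_inner lborel (partial_deriv ?b u) ?s + (1/2) * l2_inner lborel (\<lambda>z. complex_of_real (z \<bullet> ?b) * u z) ?s"
    unfolding aop_def[abs_def] by (simp only: l2_inner_add_left uL L2_scale sherm_L2 l2_inner_scale_left)
  also have "\<dots> = (-1) * l2_inner lborel u (partial_deriv ?b ?s) + (1/2) * l2_inner lborel u (\<lambda>z. complex_of_real (z \<bullet> ?b) * ?s z)"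
    unfolding l2_inner_coord nice_by_parts[OF u ns] by simp
  also have "\<dots> = l2_inner lborel u (\<lambda>z. (-1) * partial_deriv ?b ?s z + (1/2) * (complex_of_real (z \<bullet> ?b) * ?s z))"
    by (subst l2_inner_add_right[OF L2_scale[OF sL(1)] L2_scale[OF sL(2)] uL(1)]) (simp only: l2_inner_scale_right, simp)
  also have "(\<lambda>z. (-1) * partial_deriv ?b ?s z + (1/2) * (complex_of_real (z \<bullet> ?b) * ?s z))
      = (\<lambda>z. (1/2) * (sherm (up (Inr i) \<gamma>) z - sherm (up (Inl i) \<gamma>) z))"
    by (rule ext, simp only: inner_bx sherm_dx sherm_x) (simp add: field_simps)
  also have "l2_inner lborel u \<dots> = cnj (1/2) * l2_inner lborel u (\<lambda>z. sherm (up (Inr i) \<gamma>) z - sherm (up (Inl i) \<gamma>) z)"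
    by (rule l2_inner_scale_right)
  also have "\<dots> = (1/2) * (l2_inner lborel u (sherm (up (Inr i) \<gamma>)) - l2_inner lborel u (sherm (up (Inl i) \<gamma>)))"
    by (subst l2_inner_diff_right) (simp_all add: sherm_L2 uL)
  finally show ?thesis .
qed

text \<open>The adjoint of \<open>\<partial>\<^sub>b + z\<^sub>b/2\<close> raises either index of plane \<open>i\<close>. Off the diagonal by more than the
  number of remaining steps nothing survives, so on the extremal diagonal only the path that raises
  the second index every time contributes.\<close>

lemma aop_pow_inner:
  fixes f :: "(real ^ 'n) \<times> (real ^ 'n) \<Rightarrow> complex"
  assumes f: "f \<in> schwartz" and rad: "radial f"
  shows "(\<gamma> (Inr i) + m < \<gamma> (Inl i) \<longrightarrow> l2_inner lborel ((aop (bx i) ^^ m) f) (sherm \<gamma>) = 0) \<and>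
    (\<gamma> (Inl i) = \<gamma> (Inr i) + m \<longrightarrow> l2_inner lborel ((aop (bx i) ^^ m) f) (sherm \<gamma>) = (1/2) ^ m * l2_inner lborel f (sherm (\<gamma>(Inr i := \<gamma> (Inl i)))))"
proof (induction m arbitrary: \<gamma>)
  case 0
  show ?case using radial_off_diagonal[OF f rad, of \<gamma> i] by (auto simp: fun_upd_idem)
next
  case (Suc m)
  have "wfun (bx i) f (0, 0) = f" by (simp add: wfun_def fun_eq_iff)
  then have "f \<in> fspan (wfun (bx i) f)" using fspan.base[of "wfun (bx i) f" "(0, 0)"] by simp
  then have "nice (bx i) ((aop (bx i) ^^ m) f)"
    by (intro wfun_nice[OF bx_Basis(1) f] wfun_aop_pow[OF bx_Basis(1) f])
  note ad = aop_adjoint[OF this, of \<gamma>]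
  have r: "up (Inr i) \<gamma> (Inl i) = \<gamma> (Inl i)" "up (Inr i) \<gamma> (Inr i) = Suc (\<gamma> (Inr i))"
    "up (Inl i) \<gamma> (Inl i) = Suc (\<gamma> (Inl i))" "up (Inl i) \<gamma> (Inr i) = \<gamma> (Inr i)"
    "(up (Inr i) \<gamma>)(Inr i := \<gamma> (Inl i)) = \<gamma>(Inr i := \<gamma> (Inl i))" by (auto simp: up_def)
  note IHr = Suc.IH[of "up (Inr i) \<gamma>", unfolded r] and IHl = Suc.IH[of "up (Inl i) \<gamma>", unfolded r]
  show ?case
  proof (intro conjI impI)
    assume "\<gamma> (Inr i) + Suc m < \<gamma> (Inl i)"
    then show "l2_inner lborel ((aop (bx i) ^^ Suc m) f) (sherm \<gamma>) = 0"
      using IHr IHl by (simp add: ad)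
  next
    assume "\<gamma> (Inl i) = \<gamma> (Inr i) + Suc m"
    then have "l2_inner lborel ((aop (bx i) ^^ m) f) (sherm (up (Inr i) \<gamma>)) = (1/2) ^ m * l2_inner lborel f (sherm (\<gamma>(Inr i := \<gamma> (Inl i))))"
      "l2_inner lborel ((aop (bx i) ^^ m) f) (sherm (up (Inl i) \<gamma>)) = 0"
      using conjunct2[OF IHr] conjunct1[OF IHl] by linarith+
    then show "l2_inner lborel ((aop (bx i) ^^ Suc m) f) (sherm \<gamma>) = (1/2) ^ Suc m * l2_inner lborel f (sherm (\<gamma>(Inr i := \<gamma> (Inl i))))"
      by (simp add: ad)
  qed
qed

section \<open>Weighted sums over the diagonal\<close>

definition dg :: "('n \<Rightarrow> nat) \<Rightarrow> 'n + 'n \<Rightarrow> nat" where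
  "dg \<alpha> = case_sum \<alpha> \<alpha>"

lemma dg_simps [simp]: "dg \<alpha> (Inl i) = \<alpha> i" "dg \<alpha> (Inr i) = \<alpha> i"
  by (simp_all add: dg_def)

lemma mfact_upd: "mfact (\<gamma>(k := p)) * (2 ^ q * fact q) = mfact (\<gamma>(k := q)) * (2 ^ p * fact p)"
proof -
  have "mfact (\<gamma>(k := p)) = (2 ^ p * fact p) * (\<Prod>i\<in>UNIV - {k}. 2 ^ \<gamma> i * fact (\<gamma> i))" for p
    unfolding mfact_def by (subst prod_UNIV_remove[of _ k]) (auto intro!: prod.cong)
  then show ?thesis by simp
qed

text \<open>Passing to normalised functions in \<open>aop_pow_inner\<close> costs the ratio of the
  two \<open>mfact\<close> values, which is \<open>2^N * N!\<close> times the binomial coefficient,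
  against \<open>4^-N\<close> from the halves. The factor \<open>N!\<close> on the favourable side
  is dropped.\<close>

lemma diagonal_coeff_choose:
  fixes f :: "(real ^ 'n::finite) \<times> (real ^ 'n) \<Rightarrow> complex"
  assumes f: "f \<in> schwartz" and rad: "radial f" and N: "N \<le> \<alpha> i"
  shows "real (\<alpha> i choose N) * (cmod (l2_inner lborel f (shat (dg \<alpha>))))\<^sup>2
    \<le> 2 ^ N * (cmod (l2_inner lborel ((aop (bx i) ^^ N) f) (shat ((dg \<alpha>)(Inr i := \<alpha> i - N)))))\<^sup>2"
proof -
  let ?u = "(aop (bx i) ^^ N) f" and ?\<gamma> = "(dg \<alpha>)(Inr i := \<alpha> i - N)" and ?\<delta> = "dg \<alpha>"
  let ?n = "l2_norm lborel (sherm (\<lambda>_. 0) :: (real ^ 'n) \<times> (real ^ 'n) \<Rightarrow> complex)"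
  have n: "0 < ?n" by (rule sherm_basis(1))
  note norm = l2_inner_normalized[where \<Phi> = sherm and M = lborel, OF n, folded shat_def]
  have up: "?\<gamma>(Inr i := ?\<gamma> (Inl i)) = ?\<delta>" by (auto simp: fun_eq_iff dg_def split: sum.splits)
  have "l2_inner lborel ?u (sherm ?\<gamma>) = (1/2) ^ N * l2_inner lborel f (sherm ?\<delta>)"
    using aop_pow_inner[OF f rad, of ?\<gamma> i N] N unfolding up by simp
  then have "complex_of_real (sqrt (mfact ?\<gamma>) * ?n) * l2_inner lborel ?u (shat ?\<gamma>)
      = (1/2) ^ N * (complex_of_real (sqrt (mfact ?\<delta>) * ?n) * l2_inner lborel f (shat ?\<delta>))"
    unfolding norm[of _ ?\<gamma>] norm[of _ ?\<delta>] .
  then have "cmod (complex_of_real (sqrt (mfact ?\<gamma>) * ?n) * l2_inner lborel ?u (shat ?\<gamma>))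
      = cmod ((1/2) ^ N * (complex_of_real (sqrt (mfact ?\<delta>) * ?n) * l2_inner lborel f (shat ?\<delta>)))"
    by (rule arg_cong[where f = cmod])
  then have "sqrt (mfact ?\<gamma>) * cmod (l2_inner lborel ?u (shat ?\<gamma>)) = (1/2) ^ N * (sqrt (mfact ?\<delta>) * cmod (l2_inner lborel f (shat ?\<delta>)))"
    using n mfact_pos[of ?\<gamma>] mfact_pos[of ?\<delta>] by (simp add: norm_mult norm_power norm_divide abs_mult)
  then have "(sqrt (mfact ?\<gamma>) * cmod (l2_inner lborel ?u (shat ?\<gamma>)))\<^sup>2 = ((1/2) ^ N * (sqrt (mfact ?\<delta>) * cmod (l2_inner lborel f (shat ?\<delta>))))\<^sup>2" by simp
  then have sq: "mfact ?\<gamma> * (cmod (l2_inner lborel ?u (shat ?\<gamma>)))\<^sup>2 = ((1/2) ^ N)\<^sup>2 * (mfact ?\<delta> * (cmod (l2_inner lborel f (shat ?\<delta>)))\<^sup>2)"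
    using mfact_pos[of ?\<gamma>] mfact_pos[of ?\<delta>] by (simp add: power_mult_distrib)
  have "mfact (?\<delta>(Inr i := \<alpha> i - N)) * (2 ^ \<alpha> i * fact (\<alpha> i)) = mfact (?\<delta>(Inr i := \<alpha> i)) * (2 ^ (\<alpha> i - N) * fact (\<alpha> i - N))"
    by (rule mfact_upd)
  moreover have "?\<delta>(Inr i := \<alpha> i) = ?\<delta>" by (simp add: fun_upd_idem)
  ultimately have mf: "mfact ?\<gamma> * (2 ^ \<alpha> i * fact (\<alpha> i)) = mfact ?\<delta> * (2 ^ (\<alpha> i - N) * fact (\<alpha> i - N))" by simp
  have p2: "(2::real) ^ \<alpha> i = 2 ^ N * 2 ^ (\<alpha> i - N)" using N by (simp add: power_add[symmetric])
  have fa: "(fact (\<alpha> i) :: real) = fact N * fact (\<alpha> i - N) * real (\<alpha> i choose N)"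
    using binomial_fact_lemma[OF N] by (metis of_nat_fact of_nat_mult)
  have md: "mfact ?\<delta> = mfact ?\<gamma> * (2 ^ N * fact N * real (\<alpha> i choose N))"
    using mf unfolding p2 fa by (simp add: field_simps)
  have g: "mfact ?\<gamma> > 0" by (rule mfact_pos)
  have "(cmod (l2_inner lborel ?u (shat ?\<gamma>)))\<^sup>2 = ((1/2) ^ N)\<^sup>2 * ((2 ^ N * fact N * real (\<alpha> i choose N)) * (cmod (l2_inner lborel f (shat ?\<delta>)))\<^sup>2)"
    using sq g unfolding md by simp
  then have "2 ^ N * (cmod (l2_inner lborel ?u (shat ?\<gamma>)))\<^sup>2 = fact N * (real (\<alpha> i choose N) * (cmod (l2_inner lborel f (shat ?\<delta>)))\<^sup>2)"
    by (simp add: power_divide power2_eq_square field_simps)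
  moreover have "1 * (real (\<alpha> i choose N) * (cmod (l2_inner lborel f (shat ?\<delta>)))\<^sup>2) \<le> fact N * (real (\<alpha> i choose N) * (cmod (l2_inner lborel f (shat ?\<delta>)))\<^sup>2)"
    by (intro mult_right_mono) auto
  ultimately show ?thesis by simp
qed

text \<open>Indices with \<open>\<alpha> i < N\<close> have binomial coefficient 0. For the others,
  the shifted indices are distinct, because the \<open>Inl\<close> slots still contain
  \<open>\<alpha>\<close>, so Bessel's inequality bounds their sum.\<close>

lemma diagonal_sum_choose:
  fixes f :: "(real ^ 'n::finite) \<times> (real ^ 'n) \<Rightarrow> complex"
  assumes f: "f \<in> schwartz" and rad: "radial f" and F: "finite F"
  shows "(\<Sum>\<alpha>\<in>F. real (\<alpha> i choose N) * (cmod (l2_inner lborel f (shat (dg \<alpha>))))\<^sup>2) \<le> 2 ^ N * (l2_norm lborel ((aop (bx i) ^^ N) f))\<^sup>2"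
proof -
  let ?u = "(aop (bx i) ^^ N) f" and ?g = "\<lambda>\<alpha>. (dg \<alpha>)(Inr i := \<alpha> i - N)"
  let ?F = "{\<alpha>\<in>F. N \<le> \<alpha> i}"
  have "wfun (bx i) f (0, 0) = f" by (simp add: wfun_def fun_eq_iff)
  then have "f \<in> fspan (wfun (bx i) f)" using fspan.base[of "wfun (bx i) f" "(0, 0)"] by simp
  then have uL: "?u \<in> L2 lborel" by (intro wfun_L2[OF bx_Basis(1)[of i] f] wfun_aop_pow[OF bx_Basis(1) f])
  have inj: "inj_on ?g ?F"
  proof (rule inj_onI)
    fix \<alpha> \<beta> assume "?g \<alpha> = ?g \<beta>"
    then have "?g \<alpha> (Inl j) = ?g \<beta> (Inl j)" for j by simp
    then show "\<alpha> = \<beta>" by (simp add: fun_eq_iff)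
  qed
  have "(\<Sum>\<alpha>\<in>F. real (\<alpha> i choose N) * (cmod (l2_inner lborel f (shat (dg \<alpha>))))\<^sup>2)
      = (\<Sum>\<alpha>\<in>?F. real (\<alpha> i choose N) * (cmod (l2_inner lborel f (shat (dg \<alpha>))))\<^sup>2)"
    by (rule sum.mono_neutral_right) (auto simp: F not_le)
  also have "\<dots> \<le> (\<Sum>\<alpha>\<in>?F. 2 ^ N * (cmod (l2_inner lborel ?u (shat (?g \<alpha>))))\<^sup>2)"
    by (intro sum_mono diagonal_coeff_choose[OF f rad]) simp
  also have "\<dots> = 2 ^ N * (\<Sum>\<gamma>\<in>?g ` ?F. (cmod (l2_inner lborel ?u (shat \<gamma>)))\<^sup>2)"
    by (simp add: sum.reindex[OF inj] sum_distrib_left)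
  also have "\<dots> \<le> 2 ^ N * (l2_norm lborel ?u)\<^sup>2"
    by (intro mult_left_mono l2_Bessel[OF sherm_basis(2)] uL) (simp_all add: F)
  finally show ?thesis .
qed

text \<open>The weight is at most a constant times \<open>1 + M\<close>, with \<open>M\<close> the
  largest entry. For \<open>0 < N \<le> M\<close> the inequality
  \<open>(M / N)^N \<le> M choose N\<close> gives the part with \<open>(2 * N)^N\<close>; otherwise
  \<open>1 + M\<close> is at most \<open>1 + N\<close>, or the power is trivial, and the summand 1
  suffices.\<close>

lemma power_le_choose:
  fixes \<alpha> :: "'n::finite \<Rightarrow> nat"
  assumes "\<And>i. \<alpha> i \<le> M" and "M = \<alpha> j"
  shows "(1 + sh_ev (dg \<alpha>)) ^ N \<le> (1 + 2 * real CARD('n)) ^ N * ((1 + real N) ^ N + (2 * real N) ^ N)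
    * (1 + (\<Sum>i\<in>UNIV. real (\<alpha> i choose N)))"
proof -
  let ?d = "real CARD('n)" and ?S = "\<Sum>i\<in>UNIV. real (\<alpha> i choose N)"
  have S0: "0 \<le> ?S" by (intro sum_nonneg) simp
  have "sh_ev (dg \<alpha>) \<le> (\<Sum>i\<in>(UNIV::'n set). 2 * (1 + real M))"
    unfolding sh_ev_def
  proof (rule sum_mono)
    fix i
    have "real (\<alpha> i) \<le> real M" using assms(1) by simp
    then show "real (dg \<alpha> (Inl i)) + real (dg \<alpha> (Inr i)) + 1 \<le> 2 * (1 + real M)" by simp
  qed
  then have "1 + sh_ev (dg \<alpha>) \<le> (1 + 2 * ?d) * (1 + real M)" by (simp add: algebra_simps)
  moreover have "0 \<le> sh_ev (dg \<alpha>)" unfolding sh_ev_def by (intro sum_nonneg) simp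
  ultimately have "(1 + sh_ev (dg \<alpha>)) ^ N \<le> ((1 + 2 * ?d) * (1 + real M)) ^ N" by (intro power_mono) auto
  also have "\<dots> = (1 + 2 * ?d) ^ N * (1 + real M) ^ N" by (simp add: power_mult_distrib)
  also have "(1 + real M) ^ N \<le> ((1 + real N) ^ N + (2 * real N) ^ N) * (1 + ?S)"
  proof (cases "N \<le> M \<and> 0 < N")
    case True
    have "1 + real M \<le> 2 * real N * (real M / real N)" using True by simp
    then have "(1 + real M) ^ N \<le> (2 * real N * (real M / real N)) ^ N" by (intro power_mono) auto
    also have "\<dots> = (2 * real N) ^ N * (real M / real N) ^ N" by (rule power_mult_distrib)
    also have "\<dots> \<le> (2 * real N) ^ N * real (M choose N)"
      using binomial_ge_n_over_k_pow_k[of N M, where 'a = real] True by (intro mult_left_mono) auto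
    also have "\<dots> \<le> (2 * real N) ^ N * ?S"
      unfolding assms(2) by (intro mult_left_mono member_le_sum[of j UNIV "\<lambda>i. real (\<alpha> i choose N)"]) auto
    also have "(2 * real N) ^ N * ?S \<le> ((1 + real N) ^ N + (2 * real N) ^ N) * (1 + ?S)"
      using S0 by (intro mult_mono) auto
    finally show ?thesis by simp
  next
    case False
    then have "(1 + real M) ^ N \<le> (1 + real N) ^ N" by (cases "N = 0") (auto intro!: power_mono)
    also have "\<dots> \<le> ((1 + real N) ^ N + (2 * real N) ^ N) * (1 + ?S)"
      using mult_mono[of "(1 + real N) ^ N" "(1 + real N) ^ N + (2 * real N) ^ N" 1 "1 + ?S"] S0 by simp
    finally show ?thesis .
  qed
  finally show ?thesis by (simp add: mult_left_mono mult.assoc)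
qed

lemma sobolev_norm_nonneg: "0 \<le> sobolev_norm N f"
  unfolding sobolev_norm_def by (intro sum_nonneg) auto

text \<open>The weight is split into a constant part, controlled by Bessel's inequality for
  \<open>f\<close>, and one binomial part per plane, controlled by the \<open>N\<close>-th power of
  \<open>aop\<close> in the \<open>x\<close>-direction of that plane. \<open>K\<close> depends only
  on \<open>N\<close> and the dimension.\<close>

lemma diagonal_sobolev:
  "\<exists>K\<ge>0. \<forall>f :: (real ^ 'n::finite) \<times> (real ^ 'n) \<Rightarrow> complex. f \<in> schwartz \<longrightarrow> radial f \<longrightarrow> (\<forall>F. finite F \<longrightarrow>
     (\<Sum>\<alpha>\<in>F. (1 + sh_ev (dg \<alpha>)) ^ N * (cmod (l2_inner lborel f (shat (dg \<alpha>))))\<^sup>2) \<le> (K * sobolev_norm N f)\<^sup>2)"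
proof -
  have "\<forall>i::'n. \<exists>K\<ge>0. \<forall>f\<in>schwartz. l2_norm lborel ((aop (bx i) ^^ N) (Dfun (bx i) f 0 0)) \<le> K * sobolev_norm N f"
  proof
    fix i :: 'n
    show "\<exists>K\<ge>0. \<forall>f\<in>schwartz. l2_norm lborel ((aop (bx i) ^^ N) (Dfun (bx i) f 0 0)) \<le> K * sobolev_norm N f"
      using aop_pow_sobolev[OF bx_Basis(1)[of i], of N 0 0 N] by simp
  qed
  then obtain k where k: "\<And>i. 0 \<le> k i" "\<And>i f. f \<in> schwartz \<Longrightarrow> l2_norm lborel ((aop (bx i) ^^ N) (Dfun (bx i) f 0 0)) \<le> k (i::'n) * sobolev_norm N f"
    by metis
  let ?C = "(1 + 2 * real CARD('n)) ^ N * ((1 + real N) ^ N + (2 * real N) ^ N)"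
  let ?B = "?C * (1 + (\<Sum>i\<in>UNIV. 2 ^ N * (k i)\<^sup>2))"
  have C0: "0 \<le> ?C" by simp
  have B0: "0 \<le> ?B" by (intro mult_nonneg_nonneg C0 add_nonneg_nonneg sum_nonneg) auto
  have "(\<Sum>\<alpha>\<in>F. (1 + sh_ev (dg \<alpha>)) ^ N * (cmod (l2_inner lborel f (shat (dg \<alpha>))))\<^sup>2) \<le> (sqrt ?B * sobolev_norm N f)\<^sup>2"
    if f: "f \<in> schwartz" and rad: "radial f" and F: "finite F" for f :: "(real ^ 'n) \<times> (real ^ 'n) \<Rightarrow> complex" and F
  proof -
    let ?c = "\<lambda>\<alpha>. (cmod (l2_inner lborel f (shat (dg \<alpha>))))\<^sup>2" and ?s = "sobolev_norm N f"
    have D0: "Dfun (bx i) f 0 0 = f" for i :: 'n by (simp add: Dfun_def[OF bx_Basis(1) f])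
    have "l2_norm lborel f \<le> ?s"
      using Dfun_sobolev[OF bx_Basis(1) f, of 0 0 N] unfolding D0 by simp
    then have f2: "(l2_norm lborel f)\<^sup>2 \<le> ?s\<^sup>2" by (intro power_mono) auto
    have inj: "inj_on dg F" by (rule inj_onI) (metis dg_simps(1) ext)
    have "(\<Sum>\<alpha>\<in>F. ?c \<alpha>) = (\<Sum>\<gamma>\<in>dg ` F. (cmod (l2_inner lborel f (shat \<gamma>)))\<^sup>2)" by (simp add: sum.reindex[OF inj])
    also have "\<dots> \<le> (l2_norm lborel f)\<^sup>2" by (intro l2_Bessel[OF sherm_basis(2)] schwartz_L2 f) (simp add: F)
    finally have b0: "(\<Sum>\<alpha>\<in>F. ?c \<alpha>) \<le> ?s\<^sup>2" using f2 by simp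
    have bi: "(\<Sum>\<alpha>\<in>F. real (\<alpha> i choose N) * ?c \<alpha>) \<le> 2 ^ N * (k i)\<^sup>2 * ?s\<^sup>2" for i
    proof -
      have "(l2_norm lborel ((aop (bx i) ^^ N) f))\<^sup>2 \<le> (k i * ?s)\<^sup>2"
        using k(2)[OF f, of i] unfolding D0 by (intro power_mono) auto
      then have "2 ^ N * (l2_norm lborel ((aop (bx i) ^^ N) f))\<^sup>2 \<le> 2 ^ N * (k i * ?s)\<^sup>2" by simp
      from order_trans[OF diagonal_sum_choose[OF f rad F] this]
      show ?thesis by (simp only: power_mult_distrib mult.assoc)
    qed
    have "(\<Sum>\<alpha>\<in>F. (1 + sh_ev (dg \<alpha>)) ^ N * ?c \<alpha>) \<le> (\<Sum>\<alpha>\<in>F. ?C * (1 + (\<Sum>i\<in>UNIV. real (\<alpha> i choose N))) * ?c \<alpha>)"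
    proof (intro sum_mono mult_right_mono)
      fix \<alpha> :: "'n \<Rightarrow> nat"
      have "Max (range \<alpha>) \<in> range \<alpha>" by (intro Max_in) auto
      then obtain j where j: "Max (range \<alpha>) = \<alpha> j" by (rule rangeE)
      show "(1 + sh_ev (dg \<alpha>)) ^ N \<le> ?C * (1 + (\<Sum>i\<in>UNIV. real (\<alpha> i choose N)))"
        by (rule power_le_choose[where \<alpha> = \<alpha>, OF _ j]) (intro Max_ge; simp)
    qed simp
    also have "\<dots> = ?C * ((\<Sum>\<alpha>\<in>F. ?c \<alpha>) + (\<Sum>\<alpha>\<in>F. \<Sum>i\<in>UNIV. real (\<alpha> i choose N) * ?c \<alpha>))"
      by (simp only: mult.assoc distrib_right sum_distrib_left[symmetric] sum_distrib_right sum.distrib mult_1)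
    also have "(\<Sum>\<alpha>\<in>F. \<Sum>i\<in>UNIV. real (\<alpha> i choose N) * ?c \<alpha>) = (\<Sum>i\<in>UNIV. \<Sum>\<alpha>\<in>F. real (\<alpha> i choose N) * ?c \<alpha>)"
      by (rule sum.swap)
    also have "?C * ((\<Sum>\<alpha>\<in>F. ?c \<alpha>) + \<dots>) \<le> ?C * (?s\<^sup>2 + (\<Sum>i\<in>UNIV. 2 ^ N * (k i)\<^sup>2 * ?s\<^sup>2))"
      by (intro mult_left_mono add_mono sum_mono b0 bi C0)
    also have "\<dots> = ?B * ?s\<^sup>2"
      by (simp only: distrib_left distrib_right sum_distrib_right mult.assoc mult_1 mult_1_right)
    also have "\<dots> = (sqrt ?B * ?s)\<^sup>2" using B0 by (simp add: power_mult_distrib)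
    finally show ?thesis .
  qed
  then show ?thesis using B0 by (intro exI[of _ "sqrt ?B"]) auto
qed

section \<open>Summability of the weights\<close>

lemma sh_ev_nonneg: "0 \<le> sh_ev \<gamma>"
  unfolding sh_ev_def by (intro sum_nonneg) simp

text \<open>The exponent is shared equally among the \<open>d\<close> coordinates: with
  \<open>t = s / d > 1\<close> the weight is at most the product of the
  \<open>(1 + \<alpha> i)^-t\<close>, and the sum over a box factors into one-dimensional sums, each
  below the zeta value \<open>?z\<close>.\<close>

lemma diagonal_powr_sum_bounded:
  assumes s: "real CARD('n::finite) < s"
  shows "\<exists>B\<ge>0. \<forall>F :: ('n \<Rightarrow> nat) set. finite F \<longrightarrow> (\<Sum>\<alpha>\<in>F. (1 + sh_ev (dg \<alpha>)) powr (- s)) \<le> B"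
proof -
  let ?d = "real CARD('n)"
  define t where "t = s / ?d"
  have d: "0 < ?d" by simp
  have t: "1 < t" using s d by (simp add: t_def)
  have sm: "summable (\<lambda>m. real (Suc m) powr (- t))"
    unfolding summable_Suc_iff[of "\<lambda>m. real m powr (- t)"] using t by (simp add: summable_real_powr_iff)
  let ?z = "\<Sum>m. real (Suc m) powr (- t)"
  have z0: "0 \<le> ?z" by (intro suminf_nonneg sm) simp
  have "(\<Sum>\<alpha>\<in>F. (1 + sh_ev (dg \<alpha>)) powr (- s)) \<le> (\<Prod>i\<in>(UNIV::'n set). ?z)" if F: "finite F" for F :: "('n \<Rightarrow> nat) set"
  proof -
    have pt: "(1 + sh_ev (dg \<alpha>)) powr (- s) \<le> (\<Prod>i\<in>UNIV. real (Suc (\<alpha> i)) powr (- t))" for \<alpha> :: "'n \<Rightarrow> nat"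
    proof -
      have le: "real (Suc (\<alpha> i)) \<le> 1 + sh_ev (dg \<alpha>)" for i
      proof -
        have "real (\<alpha> i) \<le> real (dg \<alpha> (Inl i)) + real (dg \<alpha> (Inr i)) + 1" by simp
        also have "\<dots> \<le> sh_ev (dg \<alpha>)" unfolding sh_ev_def
          by (rule member_le_sum[of i UNIV "\<lambda>i. real (dg \<alpha> (Inl i)) + real (dg \<alpha> (Inr i)) + 1"]) auto
        finally show ?thesis by simp
      qed
      have pos: "0 < 1 + sh_ev (dg \<alpha>)" using sh_ev_nonneg[of "dg \<alpha>"] by simp
      have "(1 + sh_ev (dg \<alpha>)) powr (- s) = (\<Prod>i\<in>(UNIV::'n set). (1 + sh_ev (dg \<alpha>)) powr (- t))"
        using d pos by (simp add: powr_power[symmetric] powr_realpow[symmetric] powr_powr t_def)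
      also have "\<dots> \<le> (\<Prod>i\<in>UNIV. real (Suc (\<alpha> i)) powr (- t))"
        using le t pos by (intro prod_mono conjI powr_mono2') auto
      finally show ?thesis .
    qed
    have fin: "finite (\<Union>\<alpha>\<in>F. range \<alpha>)" using F by auto
    \<comment> \<open>The side of a box containing \<open>F\<close>; the inserted 0 keeps the
      maximum meaningful for empty \<open>F\<close>.\<close>
    define M where "M = Max (insert 0 (\<Union>\<alpha>\<in>F. range \<alpha>))"
    have M: "\<alpha> i \<le> M" if "\<alpha> \<in> F" for \<alpha> i unfolding M_def using that fin by (intro Max_ge) auto
    have "(\<Sum>\<alpha>\<in>F. (1 + sh_ev (dg \<alpha>)) powr (- s)) \<le> (\<Sum>\<alpha>\<in>F. \<Prod>i\<in>UNIV. real (Suc (\<alpha> i)) powr (- t))"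
      by (intro sum_mono pt)
    also have "\<dots> \<le> (\<Sum>\<alpha>\<in>PiE (UNIV::'n set) (\<lambda>_. {..M}). \<Prod>i\<in>UNIV. real (Suc (\<alpha> i)) powr (- t))"
      by (intro sum_mono2 finite_PiE prod_nonneg) (auto simp: M PiE_def)
    also have "\<dots> = (\<Prod>i\<in>(UNIV::'n set). \<Sum>m\<le>M. real (Suc m) powr (- t))"
      by (subst prod_sum_PiE) auto
    also have "\<dots> \<le> (\<Prod>i\<in>(UNIV::'n set). ?z)"
      by (intro prod_mono conjI sum_nonneg sum_le_suminf sm) auto
    finally show ?thesis .
  qed
  moreover have "0 \<le> (\<Prod>i\<in>(UNIV::'n set). ?z)" by (intro prod_nonneg z0)
  ultimately show ?thesis by blast
qed

section \<open>Inversion of the symplectic Fourier transform\<close>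

definition Jmap :: "'a::real_normed_vector \<times> 'a \<Rightarrow> 'a \<times> 'a" where
  "Jmap w = (snd w, - fst w)"

lemma symp_inner: "symp w z = Jmap w \<bullet> z"
  by (simp add: symp_def Jmap_def inner_prod_def)

lemma norm_Jmap [simp]: "norm (Jmap w) = norm w"
  by (simp add: Jmap_def norm_prod_def add.commute)

lemma symp_antisym: "symp z w = - symp w z"
  by (simp add: symp_def inner_commute)

lemma symp_add: "symp (a + b) z = symp a z + symp b z"
  by (simp add: symp_def inner_add_left)

lemma symp_bx: "symp w (bx i) = w \<bullet> bxi i" "symp w (bxi i) = - (w \<bullet> bx i)"
  by (simp_all add: symp_def inner_axis)

abbreviation sexp :: "(real ^ 'n) \<times> (real ^ 'n) \<Rightarrow> (real ^ 'n) \<times> (real ^ 'n) \<Rightarrow> complex" where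
  "sexp w z \<equiv> exp (- \<i> * complex_of_real (symp w z))"

lemma norm_sexp: "cmod (sexp w z) = 1"
  by (simp add: norm_exp_eq_Re)

lemma sexp_continuous: "continuous_on UNIV (sexp w)"
  unfolding symp_inner by (intro continuous_intros)

lemma sexp_has_derivative: "(sexp w has_derivative (\<lambda>h. - \<i> * complex_of_real (symp w h) * sexp w z)) (at z)"
proof -
  have "bounded_linear (\<lambda>h. - \<i> * complex_of_real (symp w h))"
    unfolding symp_inner
    by (intro bounded_linear_mult_right[THEN bounded_linear_compose] bounded_linear_of_real[THEN bounded_linear_compose] bounded_linear_inner_right)
  from has_derivative_compose[OF bounded_linear_imp_has_derivative[OF this] DERIV_exp[unfolded has_field_derivative_def]]
  show ?thesis by (simp add: mult.commute)
qed

lemma sexp_measurable [measurable]: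
  "(\<lambda>p. sexp (fst p) (snd p)) \<in> borel_measurable (borel \<Otimes>\<^sub>M borel)"
  unfolding borel_prod by (intro borel_measurable_continuous_onI) (auto simp: symp_def intro!: continuous_intros)

lemma integrable_sexp_mult:
  assumes u: "integrable lborel u"
  shows "integrable lborel (\<lambda>z. u z * sexp w z)"
proof (rule Bochner_Integration.integrable_bound[OF u])
  show "(\<lambda>z. u z * sexp w z) \<in> borel_measurable lborel"
    using borel_measurable_integrable[OF u] borel_measurable_continuous_onI[OF sexp_continuous[of w]] by simp
  show "AE z in lborel. norm (u z * sexp w z) \<le> norm (u z)"
    by (rule AE_I2) (simp only: norm_mult norm_sexp mult_1_right order_refl)
qed

lemma Fourier_partial_deriv:
  fixes f :: "(real ^ 'n) \<times> (real ^ 'n) \<Rightarrow> complex"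
  assumes f: "f \<in> schwartz" and b: "b \<in> Basis"
  shows "(LINT z|lborel. (partial_deriv b ^^ m) f z * sexp w z) = (\<i> * complex_of_real (symp w b)) ^ m * (LINT z|lborel. f z * sexp w z)"
proof (induction m)
  case (Suc m)
  let ?u = "(partial_deriv b ^^ m) f"
  have p: "partial_deriv b (sexp w) = (\<lambda>z. - \<i> * complex_of_real (symp w b) * sexp w z)"
    using partial_derivI[OF sexp_has_derivative] by blast
  have "(LINT z|lborel. partial_deriv b ?u z * sexp w z) = - (LINT z|lborel. ?u z * partial_deriv b (sexp w) z)"
  proof (rule integral_by_parts)
    show "?u differentiable (at z)" for z by (rule schwartz_rapid(2)[OF f b])
    show "sexp w differentiable (at z)" for z using sexp_has_derivative unfolding differentiable_def by blast
    show "continuous_on UNIV (partial_deriv b ?u)"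
      using rapid_continuous[OF schwartz_rapid(1)[OF f b, of "Suc m"]] by simp
    show "continuous_on UNIV (partial_deriv b (sexp w))" unfolding p by (intro continuous_intros sexp_continuous)
    have iu: "integrable lborel ?u" by (rule rapid_integrable[OF schwartz_rapid(1)[OF f b]])
    show "integrable lborel (\<lambda>z. ?u z * sexp w z)" by (rule integrable_sexp_mult[OF iu])
    show "integrable lborel (\<lambda>z. partial_deriv b ?u z * sexp w z)"
      using integrable_sexp_mult[OF rapid_integrable[OF schwartz_rapid(1)[OF f b, of "Suc m"]]] by simp
    have "(\<lambda>z. ?u z * partial_deriv b (sexp w) z) = (\<lambda>z. (- \<i> * complex_of_real (symp w b)) * (?u z * sexp w z))"
      unfolding p by (auto simp: mult_ac)
    then show "integrable lborel (\<lambda>z. ?u z * partial_deriv b (sexp w) z)"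
      using integrable_sexp_mult[OF iu, of w] by (simp only: integrable_mult_right)
  qed
  also have "(\<lambda>z. ?u z * partial_deriv b (sexp w) z) = (\<lambda>z. (- \<i> * complex_of_real (symp w b)) * (?u z * sexp w z))"
    unfolding p by (auto simp: mult_ac)
  finally have "(LINT z|lborel. partial_deriv b ?u z * sexp w z) = (\<i> * complex_of_real (symp w b)) * (LINT z|lborel. ?u z * sexp w z)"
    by (simp only: integral_mult_right_zero) simp
  then show ?case unfolding Suc by simp
qed simp

lemma symp_fourier_measurable:
  assumes [measurable]: "F \<in> borel_measurable borel"
  shows "symp_fourier F \<in> borel_measurable borel"
proof -
  have "(\<lambda>(w, z). F z * sexp w z) \<in> borel_measurable (borel \<Otimes>\<^sub>M lborel)" by measurable
  then have "(\<lambda>w. LINT z|lborel. F z * sexp w z) \<in> borel_measurable borel"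
    using lborel.borel_measurable_lebesgue_integral[of "\<lambda>w z. F z * sexp w z" borel] by simp
  then show ?thesis unfolding symp_fourier_def[abs_def] by simp
qed

lemma norm_Fourier_le:
  "norm (LINT z|lborel. u z * sexp w z) \<le> (LINT z|lborel. norm (u z))"
proof -
  have "norm (LINT z|lborel. u z * sexp w z) \<le> (LINT z|lborel. norm (u z * sexp w z))" by simp
  then show ?thesis by (simp only: norm_mult norm_sexp mult_1_right)
qed

text \<open>Powers of each coordinate of \<open>w\<close> times the transform are, up to a
  unimodular factor, transforms of derivatives of \<open>f\<close> and hence bounded; the order is
  the one \<open>integrable_if_decay\<close> asks for.\<close>

lemma symp_fourier_integrable:
  fixes f :: "(real ^ 'n) \<times> (real ^ 'n) \<Rightarrow> complex"
  assumes f: "f \<in> schwartz"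
  shows "integrable lborel (symp_fourier f)"
proof -
  let ?I = "\<lambda>w. LINT z|lborel. f z * sexp w z"
  let ?N = "2 * DIM((real ^ 'n) \<times> (real ^ 'n))"
  let ?c = "\<lambda>b. LINT z|lborel. norm ((partial_deriv b ^^ ?N) f z)"
  have [measurable]: "f \<in> borel_measurable borel" by (rule rapid_measurable[OF schwartz_rapid0[OF f]])
  have "integrable lborel ?I"
  proof (rule integrable_if_decay)
    have "(\<lambda>(w, z). f z * sexp w z) \<in> borel_measurable (borel \<Otimes>\<^sub>M lborel)" by measurable
    then show "?I \<in> borel_measurable borel"
      using lborel.borel_measurable_lebesgue_integral[of "\<lambda>w z. f z * sexp w z" borel] by simp
    show "cmod (?I w) \<le> (LINT z|lborel. norm (f z))" for w by (rule norm_Fourier_le)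
    fix w b :: "(real ^ 'n) \<times> (real ^ 'n)" assume "b \<in> Basis"
    \<comment> \<open>The symplectic form pairs each coordinate of \<open>w\<close> with the
      conjugate basis vector, so the derivative has to be taken in that direction.\<close>
    then obtain b' where b': "b' \<in> Basis" "\<bar>symp w b'\<bar> = \<bar>w \<bullet> b\<bar>"
    proof (cases rule: Basis_phase_cases)
      case (1 i)
      then show ?thesis using that[of "bxi i"] by (simp add: symp_bx del: inner_bx)
    next
      case (2 i)
      then show ?thesis using that[of "bx i"] by (simp add: symp_bx del: inner_bx)
    qed
    have "\<bar>w \<bullet> b\<bar> ^ ?N * cmod (?I w) = cmod ((\<i> * complex_of_real (symp w b')) ^ ?N * ?I w)"
      unfolding norm_mult norm_power norm_ii norm_of_real mult_1 b'(2) ..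
    also have "\<dots> \<le> ?c b'"
      unfolding Fourier_partial_deriv[OF f b'(1), symmetric] by (rule norm_Fourier_le)
    also have "\<dots> \<le> (\<Sum>b\<in>Basis. ?c b)"
      by (rule member_le_sum[OF b'(1)]) auto
    finally show "\<bar>w \<bullet> b\<bar> ^ ?N * cmod (?I w) \<le> (\<Sum>b\<in>Basis. ?c b)" .
  qed
  then show ?thesis unfolding symp_fourier_def[abs_def] by simp
qed

lemma lborel_integrable_product:
  fixes u :: "'a::euclidean_space \<Rightarrow> complex" and v :: "'b::euclidean_space \<Rightarrow> complex"
  assumes u: "integrable lborel u" and v: "integrable lborel v"
  shows "integrable (lborel \<Otimes>\<^sub>M lborel) (\<lambda>(x, y). u x * v y)"
proof (rule lborel_pair.Fubini_integrable)
  have [measurable]: "u \<in> borel_measurable borel" "v \<in> borel_measurable borel"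
    using borel_measurable_integrable[OF u] borel_measurable_integrable[OF v] by simp_all
  show "(\<lambda>(x, y). u x * v y) \<in> borel_measurable (lborel \<Otimes>\<^sub>M lborel)" by measurable
  show "integrable lborel (\<lambda>x. LINT y|lborel. norm (case (x, y) of (x, y) \<Rightarrow> u x * v y))"
    using integrable_norm[OF u] by (simp add: norm_mult)
  show "AE x in lborel. integrable lborel (\<lambda>y. case (x, y) of (x, y) \<Rightarrow> u x * v y)"
    using v by simp
qed

text \<open>Fubini exchanges the two transforms; antisymmetry of the form appears as the reflection
  of the argument.\<close>

lemma symp_fourier_duality:
  fixes F q :: "(real ^ 'n) \<times> (real ^ 'n) \<Rightarrow> complex"
  assumes F: "integrable lborel F" and q: "integrable lborel q"
  shows "(LINT w|lborel. symp_fourier F w * q w) = (LINT z|lborel. F z * symp_fourier q (- z))"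
proof -
  let ?c = "complex_of_real (1 / (2 * pi) ^ CARD('n))"
  have [measurable]: "F \<in> borel_measurable borel" "q \<in> borel_measurable borel"
    using borel_measurable_integrable[OF F] borel_measurable_integrable[OF q] by simp_all
  have int: "integrable (lborel \<Otimes>\<^sub>M lborel) (\<lambda>(w, z). q w * F z * sexp w z)"
  proof (rule Bochner_Integration.integrable_bound[OF lborel_integrable_product[OF q F]])
    show "(\<lambda>(w, z). q w * F z * sexp w z) \<in> borel_measurable (lborel \<Otimes>\<^sub>M lborel)" by measurable
    show "AE p in lborel \<Otimes>\<^sub>M lborel. norm (case p of (w, z) \<Rightarrow> q w * F z * sexp w z) \<le> norm (case p of (w, z) \<Rightarrow> q w * F z)"
      by (rule AE_I2) (simp only: split_beta norm_mult norm_sexp mult_1_right order_refl)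
  qed
  have anti: "sexp (- z) w = sexp w z" for w z :: "(real ^ 'n) \<times> (real ^ 'n)"
    unfolding symp_antisym[of "- z" w] by (simp add: symp_def)
  have "(LINT w|lborel. symp_fourier F w * q w) = (LINT w|lborel. ?c * (LINT z|lborel. q w * F z * sexp w z))"
  proof (rule Bochner_Integration.integral_cong[OF refl])
    fix w
    have "(LINT z|lborel. q w * F z * sexp w z) = q w * (LINT z|lborel. F z * sexp w z)"
      by (simp only: mult.assoc integral_mult_right_zero)
    then show "symp_fourier F w * q w = ?c * (LINT z|lborel. q w * F z * sexp w z)"
      by (simp add: symp_fourier_def scaleR_conv_of_real)
  qed
  also have "\<dots> = ?c * (LINT w|lborel. (LINT z|lborel. q w * F z * sexp w z))" by (rule integral_mult_right_zero)
  also have "(LINT w|lborel. (LINT z|lborel. q w * F z * sexp w z)) = (LINT z|lborel. (LINT w|lborel. q w * F z * sexp w z))"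
    by (rule lborel_pair.Fubini_integral[OF int, symmetric])
  also have "?c * \<dots> = (LINT z|lborel. ?c * (LINT w|lborel. q w * F z * sexp w z))" by (rule integral_mult_right_zero[symmetric])
  also have "\<dots> = (LINT z|lborel. F z * symp_fourier q (- z))"
  proof (rule Bochner_Integration.integral_cong[OF refl])
    fix z
    have "(LINT w|lborel. q w * F z * sexp w z) = (LINT w|lborel. F z * (q w * sexp (- z) w))"
      by (simp only: anti mult.assoc mult.left_commute)
    also have "\<dots> = F z * (LINT w|lborel. q w * sexp (- z) w)" by (rule integral_mult_right_zero)
    finally show "?c * (LINT w|lborel. q w * F z * sexp w z) = F z * symp_fourier q (- z)"
      by (simp add: symp_fourier_def scaleR_conv_of_real)
  qed
  finally show ?thesis .
qed

section \<open>Inversion by Gaussian test functions\<close>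

definition sgauss :: "(real ^ 'n) \<times> (real ^ 'n) \<Rightarrow> complex" where
  "sgauss z = complex_of_real (exp (- ((norm z)\<^sup>2 / 2)))"

lemma sgauss_integrable: "integrable lborel (sgauss :: (real ^ 'n) \<times> (real ^ 'n) \<Rightarrow> complex)"
  using gaussian_integrable[of "1/2", where 'a = "(real ^ 'n) \<times> (real ^ 'n)"] unfolding sgauss_def[abs_def] by simp

lemma sgauss_Fourier:
  fixes w :: "(real ^ 'n) \<times> (real ^ 'n)"
  shows "(1 / (2 * pi) ^ CARD('n)) *\<^sub>R (LINT z|lborel. sgauss z * sexp w z) = sgauss w"
proof -
  have e: "sexp w z = exp (\<i> * complex_of_real ((- Jmap w) \<bullet> z))" for z unfolding symp_inner by simp
  have "sqrt (2 * pi) ^ DIM((real ^ 'n) \<times> (real ^ 'n)) = (2 * pi) ^ CARD('n)"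
    by (simp add: mult_2[symmetric] power_mult)
  then have "(LINT z|lborel. sgauss z * sexp w z) = complex_of_real ((2 * pi) ^ CARD('n) * exp (- ((norm w)\<^sup>2 / 2)))"
    unfolding e sgauss_def Fourier_gaussian by simp
  then show ?thesis by (simp add: sgauss_def scaleR_conv_of_real)
qed

text \<open>The Gaussian is its own transform, so modulation becomes translation and translation
  becomes modulation.\<close>

lemma symp_fourier_modulated:
  fixes a :: "(real ^ 'n) \<times> (real ^ 'n)"
  shows "symp_fourier (\<lambda>z. sgauss z * sexp a z) w = sgauss (a + w)"
    and "symp_fourier (\<lambda>z. sgauss (z - a)) w = sgauss w * sexp w a"
proof -
  have "sexp a z * sexp w z = sexp (a + w) z" for z
    by (simp add: exp_add[symmetric] symp_add algebra_simps)
  then show "symp_fourier (\<lambda>z. sgauss z * sexp a z) w = sgauss (a + w)"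
    unfolding symp_fourier_def sgauss_Fourier[of "a + w", symmetric] by (simp only: mult.assoc)
  have m: "(\<lambda>z. sgauss (z - a) * sexp w z) \<in> borel_measurable borel"
    unfolding sgauss_def by (intro borel_measurable_continuous_onI) (auto simp: symp_def intro!: continuous_intros)
  have "(LINT z|lborel. sgauss (z - a) * sexp w z) = (LINT z|lborel. sgauss (z + a - a) * sexp w (z + a))"
    by (rule lborel_integral_translation[OF m, symmetric])
  also have "\<dots> = (LINT z|lborel. (sgauss z * sexp w z) * sexp w a)"
    by (simp add: exp_add[symmetric] symp_inner inner_add_right algebra_simps)
  also have "\<dots> = (LINT z|lborel. sgauss z * sexp w z) * sexp w a" by (rule integral_mult_left_zero)
  finally show "symp_fourier (\<lambda>z. sgauss (z - a)) w = sgauss w * sexp w a"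
    unfolding symp_fourier_def sgauss_Fourier[of w, symmetric] by simp
qed

text \<open>Both sides are tested against modulated Gaussians, which the transform maps to translated
  Gaussians and back.\<close>

lemma symp_fourier_inversion:
  fixes f :: "(real ^ 'n) \<times> (real ^ 'n) \<Rightarrow> complex"
  assumes f: "f \<in> schwartz"
  shows "AE z in lborel. symp_fourier (symp_fourier f) z = f z"
proof -
  let ?F = "symp_fourier f" and ?G = "symp_fourier (symp_fourier f)"
  have fi: "integrable lborel f" by (rule rapid_integrable[OF schwartz_rapid0[OF f]])
  have Fi: "integrable lborel ?F" by (rule symp_fourier_integrable[OF f])
  have fm [measurable]: "f \<in> borel_measurable borel" by (rule rapid_measurable[OF schwartz_rapid0[OF f]])
  have Gm [measurable]: "?G \<in> borel_measurable borel" by (intro symp_fourier_measurable fm)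
  have sm [measurable]: "(sgauss :: (real ^ 'n) \<times> (real ^ 'n) \<Rightarrow> complex) \<in> borel_measurable borel"
    using borel_measurable_integrable[OF sgauss_integrable] by simp
  have Gle: "cmod (?G z) \<le> (1 / (2 * pi) ^ CARD('n)) * (LINT z|lborel. norm (?F z))" for z
    unfolding symp_fourier_def[of ?F] using norm_Fourier_le[of ?F z] by (simp add: divide_right_mono)
  have Gs: "integrable lborel (\<lambda>z. ?G z * sgauss z)"
  proof (rule Bochner_Integration.integrable_bound)
    show "integrable lborel (\<lambda>z. (1 / (2 * pi) ^ CARD('n)) * (LINT z|lborel. norm (?F z)) * norm (sgauss z :: complex))"
      by (intro integrable_mult_right integrable_norm sgauss_integrable)
    show "AE z in lborel. norm (?G z * sgauss z) \<le> norm ((1 / (2 * pi) ^ CARD('n)) * (LINT z|lborel. norm (?F z)) * norm (sgauss z :: complex))"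
    proof (rule AE_I2)
      fix z :: "(real ^ 'n) \<times> (real ^ 'n)"
      have "norm (?G z * sgauss z) \<le> (1 / (2 * pi) ^ CARD('n)) * (LINT z|lborel. norm (?F z)) * norm (sgauss z)"
        unfolding norm_mult by (rule mult_right_mono[OF Gle norm_ge_zero])
      then show "norm (?G z * sgauss z) \<le> norm ((1 / (2 * pi) ^ CARD('n)) * (LINT z|lborel. norm (?F z)) * norm (sgauss z))"
        unfolding real_norm_def by (rule order_trans[OF _ abs_ge_self])
    qed
  qed measurable
  have fs: "integrable lborel (\<lambda>z. f z * sgauss z)"
  proof (rule Bochner_Integration.integrable_bound[OF fi])
    show "AE z in lborel. norm (f z * sgauss z) \<le> norm (f z)"
      by (intro AE_I2) (simp add: norm_mult sgauss_def mult_left_le)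
  qed measurable
  have test: "(LINT z|lborel. ?G z * (sgauss z * sexp a z)) = (LINT z|lborel. f z * (sgauss z * sexp a z))" for a
  proof -
    have q: "integrable lborel (\<lambda>z. sgauss z * sexp a z)" by (rule integrable_sexp_mult[OF sgauss_integrable])
    have g: "integrable lborel (\<lambda>z. sgauss (z - a) :: complex)"
      using lborel_integrable_translation[OF sgauss_integrable, of "- a"] by simp
    have even: "sgauss (- z) = (sgauss z :: complex)" for z :: "(real ^ 'n) \<times> (real ^ 'n)" by (simp add: sgauss_def)
    have "(LINT z|lborel. ?G z * (sgauss z * sexp a z)) = (LINT z|lborel. ?F z * sgauss (a - z))"
      unfolding symp_fourier_duality[OF Fi q] symp_fourier_modulated by simp
    also have "\<dots> = (LINT z|lborel. ?F z * sgauss (z - a))"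
      using even[of "_ - a"] by (simp add: even[symmetric, of "a - _"])
    also have "\<dots> = (LINT z|lborel. f z * (sgauss (- z) * sexp (- z) a))"
      unfolding symp_fourier_duality[OF fi g] symp_fourier_modulated ..
    also have "\<dots> = (LINT z|lborel. f z * (sgauss z * sexp a z))"
      unfolding even symp_antisym[of "- _" a] by (simp add: symp_def)
    finally show ?thesis .
  qed
  \<comment> \<open>The double transform is so far known only to be bounded. The Gaussian factor
    makes the difference integrable, as uniqueness requires, and has no zeros.\<close>
  have "AE z in lborel. (?G z - f z) * sgauss z = 0"
  proof (rule Fourier_unique)
    show "integrable lborel (\<lambda>z. (?G z - f z) * sgauss z)"
      using Bochner_Integration.integrable_diff[OF Gs fs] by (simp add: left_diff_distrib)
    fix w :: "(real ^ 'n) \<times> (real ^ 'n)"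
    \<comment> \<open>Chosen so that the symplectic character of \<open>?a\<close> is the Euclidean
      character of \<open>w\<close>.\<close>
    let ?a = "(snd w, - fst w)"
    have e: "exp (\<i> * complex_of_real (w \<bullet> z)) = sexp ?a z" for z
    proof -
      have "symp ?a z = - (w \<bullet> z)" by (simp add: symp_def inner_prod_def)
      then show ?thesis by simp
    qed
    have "(LINT z|lborel. (?G z - f z) * sgauss z * exp (\<i> * complex_of_real (w \<bullet> z)))
      = (LINT z|lborel. (?G z * sgauss z) * sexp ?a z - (f z * sgauss z) * sexp ?a z)"
      unfolding e by (simp add: algebra_simps)
    also have "\<dots> = (LINT z|lborel. (?G z * sgauss z) * sexp ?a z) - (LINT z|lborel. (f z * sgauss z) * sexp ?a z)"
      by (intro Bochner_Integration.integral_diff integrable_sexp_mult Gs fs)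
    also have "\<dots> = 0" unfolding mult.assoc test by simp
    finally show "(LINT z|lborel. (?G z - f z) * sgauss z * exp (\<i> * complex_of_real (w \<bullet> z))) = 0" .
  qed
  then show ?thesis by eventually_elim (simp add: sgauss_def)
qed

section \<open>Trace norms of diagonal operators\<close>

context
  fixes M :: "'a measure" and T :: "('a \<Rightarrow> complex) \<Rightarrow> 'a \<Rightarrow> complex"
  assumes T: "l2_bounded_op M T"
begin

lemma op_L2: "f \<in> L2 M \<Longrightarrow> T f \<in> L2 M"
  using T by (simp add: l2_bounded_op_def l2_linear_def)

lemma op_add: "f \<in> L2 M \<Longrightarrow> g \<in> L2 M \<Longrightarrow> AE x in M. T (\<lambda>y. f y + g y) x = T f x + T g x"
  using T by (simp add: l2_bounded_op_def l2_linear_def)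

lemma op_scale: "f \<in> L2 M \<Longrightarrow> AE x in M. T (\<lambda>y. c * f y) x = c * T f x"
  using T by (simp add: l2_bounded_op_def l2_linear_def)

lemma op_add_scale:
  assumes f: "f \<in> L2 M" and g: "g \<in> L2 M"
  shows "AE x in M. T (\<lambda>y. f y + c * g y) x = T f x + c * T g x"
  using op_add[OF f L2_scale[OF g, of c]] op_scale[OF g, of c] by eventually_elim simp

lemma op_sum:
  assumes "\<And>i. f i \<in> L2 M"
  shows "AE x in M. T (\<lambda>y. \<Sum>i<n. c i * f i y) x = (\<Sum>i<(n::nat). c i * T (f i) x)"
proof (induction n)
  case 0
  show ?case using op_scale[OF L2_zero, of 0] by simp
next
  case (Suc n)
  have "(\<lambda>y. \<Sum>i<n. c i * f i y) \<in> L2 M" by (intro L2_sum L2_scale assms)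
  from op_add_scale[OF this assms[of n], of "c n"] Suc show ?case
    by eventually_elim simp
qed

lemma op_tendsto:
  assumes F: "\<And>n. F n \<in> L2 M" and f: "f \<in> L2 M" and lim: "(\<lambda>n. l2_norm M (\<lambda>x. F n x - f x)) \<longlonglongrightarrow> 0"
  shows "(\<lambda>n. l2_norm M (\<lambda>x. T (F n) x - T f x)) \<longlonglongrightarrow> 0"
proof -
  obtain K where K: "\<And>f. f \<in> L2 M \<Longrightarrow> l2_norm M (T f) \<le> K * l2_norm M f"
    using T by (auto simp: l2_bounded_op_def)
  have eq: "l2_norm M (\<lambda>x. T (F n) x - T f x) = l2_norm M (T (\<lambda>x. F n x + (-1) * f x))" for n
  proof (rule l2_norm_cong_AE)
    show "AE x in M. T (F n) x - T f x = T (\<lambda>x. F n x + (-1) * f x) x"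
      using op_add_scale[OF F[of n] f, of "-1"] by eventually_elim simp
  qed (intro L2_diff op_L2 L2_add L2_scale F f)+
  have le: "norm (l2_norm M (\<lambda>x. T (F n) x - T f x)) \<le> K * l2_norm M (\<lambda>x. F n x - f x)" for n
    unfolding eq using K[OF L2_add[OF F[of n] L2_scale[OF f, of "-1"]]] by simp
  have "(\<lambda>n. K * l2_norm M (\<lambda>x. F n x - f x)) \<longlonglongrightarrow> 0" using lim by (rule tendsto_mult_right_zero)
  then show ?thesis
    by (rule Lim_null_comparison[rotated]) (rule always_eventually, rule allI, rule le)
qed

text \<open>Finite linearity, up to null sets, gives the claim for the partial sums of the expansion
  of \<open>g\<close>; boundedness of \<open>T\<close> passes it to the limit.\<close>

lemma diagonal_op_coeff:
  assumes e: "l2_onb M e" and d: "\<And>m n. l2_inner M (T (e m)) (e n) = (if m = n then \<mu> m else 0)" and g: "g \<in> L2 M"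
  shows "l2_inner M (T g) (e n) = \<mu> n * l2_inner M g (e n)"
proof -
  note eL = l2_onsD(1)[OF l2_onb_ons[OF e]]
  let ?S = "\<lambda>N x. \<Sum>i<N. l2_inner M g (e i) * e i x"
  have S: "?S N \<in> L2 M" for N by (intro L2_sum L2_scale eL)
  have "(\<lambda>N. l2_inner M (T (?S N)) (e n)) \<longlonglongrightarrow> l2_inner M (T g) (e n)"
    by (rule l2_inner_tendsto_left[OF op_L2[OF S] op_L2[OF g] eL op_tendsto[OF S g l2_onb_expansion[OF e g]]])
  moreover have "l2_inner M (T (?S N)) (e n) = (if n < N then \<mu> n * l2_inner M g (e n) else 0)" for N
  proof -
    have "l2_inner M (T (?S N)) (e n) = l2_inner M (\<lambda>x. \<Sum>i<N. l2_inner M g (e i) * T (e i) x) (e n)"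
      by (rule l2_inner_cong_AE[OF op_L2[OF S] _ eL eL op_sum[OF eL]]) (auto intro!: L2_sum L2_scale op_L2 eL)
    also have "\<dots> = (\<Sum>i<N. l2_inner M g (e i) * (if i = n then \<mu> i else 0))"
      by (subst l2_inner_sum_left) (auto intro!: L2_scale op_L2 eL simp: l2_inner_scale_left d)
    also have "\<dots> = (if n < N then \<mu> n * l2_inner M g (e n) else 0)"
      by (simp add: if_distrib mult.commute cong: if_cong)
    finally show ?thesis .
  qed
  moreover have "(\<lambda>N. if n < N then \<mu> n * l2_inner M g (e n) else 0) \<longlonglongrightarrow> \<mu> n * l2_inner M g (e n)"
    by (rule tendsto_eventually, rule eventually_sequentiallyI[of "Suc n"]) simp
  ultimately show ?thesis using LIMSEQ_unique by simp
qed

text \<open>The square root of \<open>T\<^sup>* T\<close> is unique on the eigenvectors: for \<open>\<mu> \<noteq> 0\<close> the vector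
  \<open>u = P e - |\<mu>| e\<close> satisfies \<open>P u = - |\<mu>| u\<close>, so positivity forces \<open>u = 0\<close>; for \<open>\<mu> = 0\<close>
  it satisfies \<open>P u = 0\<close> and positivity along the line \<open>e + t u\<close> gives \<open>u = 0\<close>.\<close>

lemma abs_op_eigen:
  assumes e: "l2_onb M e" and d: "\<And>m n. l2_inner M (T (e m)) (e n) = (if m = n then \<mu> m else 0)"
    and P: "l2_abs_op M T P"
  shows "AE x in M. P (e m) x = complex_of_real (cmod (\<mu> m)) * e m x"
proof -
  note eL = l2_onsD(1)[OF l2_onb_ons[OF e]]
  define r where "r = cmod (\<mu> m)"
  have bP: "l2_bounded_op M P" and pos: "\<And>g. g \<in> L2 M \<Longrightarrow> 0 \<le> Re (l2_inner M (P g) g)"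
    and sq: "\<And>g h. g \<in> L2 M \<Longrightarrow> h \<in> L2 M \<Longrightarrow> l2_inner M (P (P g)) h = l2_inner M (T g) (T h)"
    using P by (auto simp: l2_abs_op_def)
  have PL: "P g \<in> L2 M" if "g \<in> L2 M" for g
    using bP that by (simp add: l2_bounded_op_def l2_linear_def)
  have lin: "AE x in M. P (\<lambda>y. f y + c * g y) x = P f x + c * P g x" if "f \<in> L2 M" "g \<in> L2 M" for f g c
  proof -
    have "AE x in M. P (\<lambda>y. f y + c * g y) x = P f x + P (\<lambda>y. c * g y) x"
      using bP that L2_scale[OF that(2), of c] by (simp add: l2_bounded_op_def l2_linear_def)
    moreover have "AE x in M. P (\<lambda>y. c * g y) x = c * P g x"
      using bP that by (simp add: l2_bounded_op_def l2_linear_def)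
    ultimately show ?thesis by eventually_elim simp
  qed
  have PP: "AE x in M. P (P (e m)) x = complex_of_real (r\<^sup>2) * e m x"
  proof (rule l2_onb_eqI[OF e])
    show "P (P (e m)) \<in> L2 M" "(\<lambda>x. complex_of_real (r\<^sup>2) * e m x) \<in> L2 M" by (intro PL L2_scale eL)+
    fix n
    have "l2_inner M (P (P (e m))) (e n) = l2_inner M (T (e m)) (T (e n))" by (rule sq[OF eL eL])
    also have "\<dots> = cnj (l2_inner M (T (e n)) (T (e m)))" by (rule l2_inner_commute)
    also have "l2_inner M (T (e n)) (T (e m)) = (if n = m then complex_of_real (r\<^sup>2) else 0)"
    proof -
      have ae: "AE x in M. T (e k) x = \<mu> k * e k x" for k
        by (rule l2_onb_eqI[OF e op_L2[OF eL] L2_scale[OF eL]])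
          (simp add: d l2_inner_scale_left l2_onsD[OF l2_onb_ons[OF e]])
      have "l2_inner M (T (e n)) (T (e m)) = l2_inner M (\<lambda>x. \<mu> n * e n x) (\<lambda>x. \<mu> m * e m x)"
        by (rule l2_inner_cong_AE[OF op_L2[OF eL] L2_scale[OF eL] op_L2[OF eL] L2_scale[OF eL] ae ae])
      also have "\<dots> = (if n = m then \<mu> m * cnj (\<mu> m) else 0)"
        by (simp add: l2_inner_scale_left l2_inner_scale_right l2_onsD[OF l2_onb_ons[OF e]])
      finally show ?thesis by (simp only: r_def complex_of_real_cmod_square)
    qed
    also have "cnj (if n = m then complex_of_real (r\<^sup>2) else 0) = l2_inner M (\<lambda>x. complex_of_real (r\<^sup>2) * e m x) (e n)"
      by (simp add: l2_inner_scale_left l2_onsD[OF l2_onb_ons[OF e]])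
    finally show "l2_inner M (P (P (e m))) (e n) = l2_inner M (\<lambda>x. complex_of_real (r\<^sup>2) * e m x) (e n)" .
  qed
  define u where "u x = P (e m) x + (- complex_of_real r) * e m x" for x
  have uL: "u \<in> L2 M" unfolding u_def[abs_def] by (intro L2_add L2_scale PL eL)
  have Pu: "AE x in M. P u x = - complex_of_real r * u x"
    using lin[OF PL[OF eL[of m]] eL[of m], of "- complex_of_real r"] PP unfolding u_def[abs_def]
    by eventually_elim (simp add: power2_eq_square algebra_simps)
  have u0: "l2_norm M u = 0"
  proof (cases "r = 0")
    case False
    then have r: "0 < r" by (simp add: r_def)
    have "l2_inner M (P u) u = l2_inner M (\<lambda>x. - complex_of_real r * u x) u"
      by (rule l2_inner_cong_AE[OF PL[OF uL] L2_scale[OF uL] uL uL Pu]) simp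
    also have "\<dots> = complex_of_real (- r * (l2_norm M u)\<^sup>2)" unfolding l2_inner_scale_left l2_inner_self by simp
    finally have "0 \<le> - r * (l2_norm M u)\<^sup>2" using pos[OF uL] by simp
    then show ?thesis using r by (simp add: mult_le_0_iff)
  next
    case True
    have "0 \<le> Re (l2_inner M u (e m)) + t * (l2_norm M u)\<^sup>2" for t :: real
    proof -
      let ?v = "\<lambda>x. e m x + complex_of_real t * u x"
      have vL: "?v \<in> L2 M" by (intro L2_add L2_scale eL uL)
      have "AE x in M. P ?v x = u x"
        using lin[OF eL[of m] uL, of "complex_of_real t"] Pu by eventually_elim (simp add: u_def True)
      then have "l2_inner M (P ?v) ?v = l2_inner M u ?v"
        by (intro l2_inner_cong_AE[OF PL[OF vL] uL vL vL]) auto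
      also have "\<dots> = l2_inner M u (e m) + complex_of_real t * complex_of_real ((l2_norm M u)\<^sup>2)"
        by (simp only: l2_inner_add_right[OF eL L2_scale[OF uL] uL] l2_inner_scale_right l2_inner_self complex_cnj_complex_of_real)
      finally show ?thesis using pos[OF vL] by simp
    qed
    \<comment> \<open>For this value the right-hand side is \<open>Re - \<bar>Re\<bar> - 1\<close>,
      which is negative, unless \<open>u\<close> has norm 0.\<close>
    note line = this[of "- (\<bar>Re (l2_inner M u (e m))\<bar> + 1) / (l2_norm M u)\<^sup>2"]
    show ?thesis
    proof (rule ccontr)
      assume "l2_norm M u \<noteq> 0"
      then have "- (\<bar>Re (l2_inner M u (e m))\<bar> + 1) / (l2_norm M u)\<^sup>2 * (l2_norm M u)\<^sup>2 = - (\<bar>Re (l2_inner M u (e m))\<bar> + 1)" by simp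
      then show False using line by linarith
    qed
  qed
  have "AE x in M. u x = 0" using l2_norm_eq_0_iff[OF uL] u0 by simp
  then show ?thesis unfolding r_def[symmetric] by eventually_elim (simp add: u_def)
qed

text \<open>\<open>P\<close> multiplies the \<open>n\<close>-th coefficient by the modulus of
  \<open>\<mu> n\<close>; boundedness of the \<open>\<mu> n\<close> lets Riesz-Fischer produce the
  image. Existence matters because \<open>trace_norm\<close> chooses an absolute value, and the
  choice is only meaningful if there is one.\<close>

lemma abs_op_exists:
  assumes e: "l2_onb M e" and d: "\<And>m n. l2_inner M (T (e m)) (e n) = (if m = n then \<mu> m else 0)"
    and B: "\<And>n. cmod (\<mu> n) \<le> B"
  shows "\<exists>P. l2_abs_op M T P"
proof -
  note ons = l2_onb_ons[OF e] and eL = l2_onsD(1)[OF l2_onb_ons[OF e]]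
  let ?a = "\<lambda>n. complex_of_real (cmod (\<mu> n))"
  have B0: "0 \<le> B" using B[of 0] norm_ge_zero order_trans by blast
  have le: "(cmod (?a n * c))\<^sup>2 \<le> B\<^sup>2 * (cmod c)\<^sup>2" for n c
    unfolding power_mult_distrib[symmetric] norm_mult using B[of n] by (intro power_mono mult_right_mono) auto
  have "\<exists>h. h \<in> L2 M \<and> (\<forall>n. l2_inner M h (e n) = ?a n * l2_inner M g (e n))" if g: "g \<in> L2 M" for g
  proof -
    have "summable (\<lambda>n. B\<^sup>2 * (cmod (l2_inner M g (e n)))\<^sup>2)" by (intro summable_mult l2_coeffs_summable[OF ons g])
    then have "summable (\<lambda>n. (cmod (?a n * l2_inner M g (e n)))\<^sup>2)"
      by (rule summable_comparison_test') (simp add: le del: norm_mult)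
    from l2_Riesz_Fischer[OF ons this] show ?thesis by blast
  qed
  then have "\<forall>g. \<exists>h. g \<in> L2 M \<longrightarrow> h \<in> L2 M \<and> (\<forall>n. l2_inner M h (e n) = ?a n * l2_inner M g (e n))" by blast
  then obtain P where PL: "\<And>g. g \<in> L2 M \<Longrightarrow> P g \<in> L2 M"
    and Pc: "\<And>g n. g \<in> L2 M \<Longrightarrow> l2_inner M (P g) (e n) = ?a n * l2_inner M g (e n)" by metis
  have "l2_linear M M P"
    unfolding l2_linear_def
  proof (intro conjI ballI allI)
    fix f g assume fg: "f \<in> L2 M" "g \<in> L2 M"
    show "AE x in M. P (\<lambda>y. f y + g y) x = P f x + P g x"
      by (rule l2_onb_eqI[OF e]) (simp_all add: PL L2_add fg Pc l2_inner_add_left eL distrib_left)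
  next
    fix f c assume f: "f \<in> L2 M"
    show "AE x in M. P (\<lambda>y. c * f y) x = c * P f x"
      by (rule l2_onb_eqI[OF e]) (simp_all add: PL L2_scale f Pc l2_inner_scale_left eL)
  qed (rule PL)
  moreover have "l2_norm M (P g) \<le> B * l2_norm M g" if g: "g \<in> L2 M" for g
  proof (rule power2_le_imp_le)
    have "(\<lambda>n. complex_of_real ((cmod (l2_inner M h (e n)))\<^sup>2)) sums complex_of_real ((l2_norm M h)\<^sup>2)" if "h \<in> L2 M" for h
      using l2_onb_Parseval[OF e that that] unfolding complex_of_real_cmod_square l2_inner_cnj l2_inner_self .
    then have s: "(\<lambda>n. (cmod (l2_inner M h (e n)))\<^sup>2) sums (l2_norm M h)\<^sup>2" if "h \<in> L2 M" for h
      using that by (simp only: sums_of_real_iff)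
    show "(l2_norm M (P g))\<^sup>2 \<le> (B * l2_norm M g)\<^sup>2"
      unfolding power_mult_distrib[of B]
      by (rule sums_le[OF _ s[OF PL[OF g]] sums_mult[OF s[OF g]]]) (simp only: Pc[OF g] le)
  qed (simp add: B0)
  ultimately have "l2_bounded_op M P" unfolding l2_bounded_op_def by blast
  moreover have "Im (l2_inner M (P g) g) = 0 \<and> 0 \<le> Re (l2_inner M (P g) g)" if g: "g \<in> L2 M" for g
  proof -
    have "(\<lambda>n. l2_inner M (P g) (e n) * l2_inner M (e n) g) sums l2_inner M (P g) g"
      by (rule l2_onb_Parseval[OF e PL[OF g] g])
    moreover have "l2_inner M (P g) (e n) * l2_inner M (e n) g = complex_of_real (cmod (\<mu> n) * (cmod (l2_inner M g (e n)))\<^sup>2)" for n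
      unfolding Pc[OF g] of_real_mult complex_of_real_cmod_square l2_inner_cnj by (simp add: mult.assoc)
    ultimately have s: "(\<lambda>n. complex_of_real (cmod (\<mu> n) * (cmod (l2_inner M g (e n)))\<^sup>2)) sums l2_inner M (P g) g" by simp
    have "(\<lambda>n. 0) sums Im (l2_inner M (P g) g)" using sums_Im[OF s] by simp
    moreover have "(\<lambda>n. cmod (\<mu> n) * (cmod (l2_inner M g (e n)))\<^sup>2) sums Re (l2_inner M (P g) g)" using sums_Re[OF s] by simp
    then have "0 \<le> Re (l2_inner M (P g) g)" by (rule sums_le[OF _ sums_zero, rotated]) simp
    ultimately show ?thesis using sums_unique2[OF sums_zero] by auto
  qed
  moreover have "l2_inner M (P (P g)) h = l2_inner M (T g) (T h)" if g: "g \<in> L2 M" and h: "h \<in> L2 M" for g h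
  proof -
    have "(\<lambda>n. l2_inner M (P (P g)) (e n) * l2_inner M (e n) h) sums l2_inner M (P (P g)) h"
      by (rule l2_onb_Parseval[OF e PL[OF PL[OF g]] h])
    moreover have "(\<lambda>n. l2_inner M (T g) (e n) * l2_inner M (e n) (T h)) sums l2_inner M (T g) (T h)"
      by (rule l2_onb_Parseval[OF e op_L2[OF g] op_L2[OF h]])
    moreover have "l2_inner M (P (P g)) (e n) * l2_inner M (e n) h = l2_inner M (T g) (e n) * l2_inner M (e n) (T h)" for n
    proof -
      have "l2_inner M (e n) (T h) = cnj (\<mu> n) * l2_inner M (e n) h"
        by (subst l2_inner_commute) (simp add: diagonal_op_coeff[OF e d h] l2_inner_cnj)
      moreover have "?a n * ?a n = \<mu> n * cnj (\<mu> n)"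
        unfolding complex_of_real_cmod_square[symmetric] by (simp add: power2_eq_square)
      ultimately show ?thesis
        unfolding Pc[OF PL[OF g]] Pc[OF g] diagonal_op_coeff[OF e d g] by (simp add: algebra_simps)
    qed
    ultimately show ?thesis using sums_unique2 by simp
  qed
  ultimately show ?thesis unfolding l2_abs_op_def by blast
qed

end

text \<open>Whatever absolute value and basis \<open>f\<close> are chosen, the diagonal terms are
  sums of \<open>cmod (\<mu> n)\<close> times squared moduli of the coefficients of
  \<open>f k\<close> with respect to \<open>e\<close>. For finitely many \<open>k\<close> the sums
  are exchanged, and Bessel's inequality for the unit vector \<open>e n\<close> with respect to
  \<open>f\<close> bounds the inner sum by 1.\<close>

lemma trace_norm_diagonal_le:
  assumes T: "l2_bounded_op M T" and e: "l2_onb M e"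
    and d: "\<And>m n. l2_inner M (T (e m)) (e n) = (if m = n then \<mu> m else 0)"
    and B: "\<And>N. (\<Sum>n<N. cmod (\<mu> n)) \<le> B"
  shows "trace_norm M T \<le> ennreal B"
proof -
  have "cmod (\<mu> n) \<le> B" for n
  proof -
    have "cmod (\<mu> n) \<le> (\<Sum>k<Suc n. cmod (\<mu> k))" by (simp add: sum_nonneg)
    then show ?thesis using B order_trans by blast
  qed
  then have ex: "\<exists>P. l2_abs_op M T P" by (rule abs_op_exists[OF T e d])
  define P where "P = (SOME P. l2_abs_op M T P)"
  define f where "f = (SOME e. l2_onb M e)"
  have P: "l2_abs_op M T P" unfolding P_def using ex by (rule someI_ex)
  have f: "l2_onb M f" unfolding f_def by (rule someI[of _ e]) fact
  note eL = l2_onsD(1)[OF l2_onb_ons[OF e]] and fL = l2_onsD(1)[OF l2_onb_ons[OF f]]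
  have bP: "l2_bounded_op M P" using P by (simp add: l2_abs_op_def)
  have dP: "l2_inner M (P (e m)) (e n) = (if m = n then complex_of_real (cmod (\<mu> m)) else 0)" for m n
  proof -
    have "l2_inner M (P (e m)) (e n) = l2_inner M (\<lambda>x. complex_of_real (cmod (\<mu> m)) * e m x) (e n)"
      by (rule l2_inner_cong_AE[OF op_L2[OF bP eL] L2_scale[OF eL] eL eL abs_op_eigen[OF T e d P]]) simp
    then show ?thesis by (simp add: l2_inner_scale_left l2_onsD[OF l2_onb_ons[OF e]])
  qed
  have sm: "(\<lambda>n. cmod (\<mu> n) * (cmod (l2_inner M (f k) (e n)))\<^sup>2) sums Re (l2_inner M (P (f k)) (f k))" for k
  proof -
    have "(\<lambda>n. l2_inner M (P (f k)) (e n) * l2_inner M (e n) (f k)) sums l2_inner M (P (f k)) (f k)"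
      by (rule l2_onb_Parseval[OF e op_L2[OF bP fL] fL])
    moreover have "l2_inner M (P (f k)) (e n) * l2_inner M (e n) (f k) = complex_of_real (cmod (\<mu> n) * (cmod (l2_inner M (f k) (e n)))\<^sup>2)" for n
      unfolding diagonal_op_coeff[OF bP e dP fL] of_real_mult complex_of_real_cmod_square l2_inner_cnj by (simp add: mult.assoc)
    ultimately have s: "(\<lambda>n. complex_of_real (cmod (\<mu> n) * (cmod (l2_inner M (f k) (e n)))\<^sup>2)) sums l2_inner M (P (f k)) (f k)" by simp
    show ?thesis using sums_Re[OF s] by simp
  qed
  have nn: "0 \<le> Re (l2_inner M (P (f k)) (f k))" for k
    using P fL by (simp add: l2_abs_op_def)
  have bd: "(\<Sum>k<K. Re (l2_inner M (P (f k)) (f k))) \<le> B" for K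
  proof -
    have "(\<lambda>n. \<Sum>k<K. cmod (\<mu> n) * (cmod (l2_inner M (f k) (e n)))\<^sup>2) sums (\<Sum>k<K. Re (l2_inner M (P (f k)) (f k)))"
      by (intro sums_sum sm)
    then have lim: "(\<lambda>N. \<Sum>n<N. \<Sum>k<K. cmod (\<mu> n) * (cmod (l2_inner M (f k) (e n)))\<^sup>2) \<longlonglongrightarrow> (\<Sum>k<K. Re (l2_inner M (P (f k)) (f k)))"
      by (simp add: sums_def)
    have "(\<Sum>n<N. \<Sum>k<K. cmod (\<mu> n) * (cmod (l2_inner M (f k) (e n)))\<^sup>2) \<le> B" for N
    proof -
      have "(\<Sum>n<N. \<Sum>k<K. cmod (\<mu> n) * (cmod (l2_inner M (f k) (e n)))\<^sup>2) \<le> (\<Sum>n<N. cmod (\<mu> n))"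
      proof (rule sum_mono)
        fix n
        have "(\<Sum>k<K. (cmod (l2_inner M (f k) (e n)))\<^sup>2) = (\<Sum>k<K. (cmod (l2_inner M (e n) (f k)))\<^sup>2)"
          by (intro sum.cong refl) (subst l2_inner_commute, simp)
        also have "\<dots> \<le> (l2_norm M (e n))\<^sup>2" by (rule l2_Bessel[OF l2_onb_ons[OF f] _ eL]) simp
        also have "\<dots> = 1"
          using l2_inner_self[of M "e n"] l2_onsD(2)[OF l2_onb_ons[OF e], of n n] by (metis of_real_eq_1_iff)
        finally have "cmod (\<mu> n) * (\<Sum>k<K. (cmod (l2_inner M (f k) (e n)))\<^sup>2) \<le> cmod (\<mu> n) * 1" by (intro mult_left_mono) auto
        then show "(\<Sum>k<K. cmod (\<mu> n) * (cmod (l2_inner M (f k) (e n)))\<^sup>2) \<le> cmod (\<mu> n)" by (simp add: sum_distrib_left)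
      qed
      then show ?thesis using B order_trans by blast
    qed
    then show ?thesis by (intro LIMSEQ_le_const2[OF lim]) blast
  qed
  have "trace_norm M T = (\<Sum>k. ennreal (Re (l2_inner M (P (f k)) (f k))))"
    using T by (simp add: trace_norm_def P_def f_def Let_def)
  also have "\<dots> \<le> ennreal B"
  proof (rule suminf_le_const)
    fix K
    show "(\<Sum>k<K. ennreal (Re (l2_inner M (P (f k)) (f k)))) \<le> ennreal B"
      using bd nn by (simp add: sum_ennreal ennreal_leI)
  qed (rule summableI)
  finally show ?thesis .
qed

section \<open>The integrated Heisenberg representation\<close>

lemma rho_alt: "rho z g t = exp (\<i> * complex_of_real (t \<bullet> snd z - fst z \<bullet> snd z / 2)) * g (t - fst z)"
  by (simp add: rho_def split_beta exp_add[symmetric] algebra_simps)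

lemma norm_rho: "cmod (rho z g t) = cmod (g (t - fst z))"
  unfolding rho_alt norm_mult by (simp only: norm_exp_i_times mult_1)

lemma rho_phase_measurable [measurable]:
  "(\<lambda>p. exp (\<i> * complex_of_real (fst p \<bullet> snd (snd p) - fst (snd p) \<bullet> snd (snd p) / 2)))
    \<in> borel_measurable ((borel :: (real ^ 'n) measure) \<Otimes>\<^sub>M (borel :: ((real ^ 'n) \<times> (real ^ 'n)) measure))"
  unfolding borel_prod by (intro borel_measurable_continuous_onI continuous_intros) auto

lemma diff_fst_measurable [measurable]:
  "(\<lambda>p. fst p - fst (snd p)) \<in> ((borel :: (real ^ 'n) measure) \<Otimes>\<^sub>M (borel :: ((real ^ 'n) \<times> (real ^ 'n)) measure)) \<rightarrow>\<^sub>M borel"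
  unfolding borel_prod by (intro borel_measurable_continuous_onI continuous_intros)

lemma rho_measurable:
  assumes [measurable]: "f \<in> borel_measurable borel" "g \<in> borel_measurable borel"
  shows "(\<lambda>(t, z). f z * rho z g t) \<in> borel_measurable (borel \<Otimes>\<^sub>M borel)"
proof -
  have "(\<lambda>p. f (snd p) * (exp (\<i> * complex_of_real (fst p \<bullet> snd (snd p) - fst (snd p) \<bullet> snd (snd p) / 2)) * g (fst p - fst (snd p))))
      \<in> borel_measurable (borel \<Otimes>\<^sub>M borel)" by measurable
  then show ?thesis unfolding rho_alt split_beta .
qed

lemma rho_section_measurable:
  assumes "f \<in> borel_measurable borel" "g \<in> borel_measurable borel"
  shows "(\<lambda>z. f z * rho z g t) \<in> borel_measurable borel"
  using measurable_compose[OF measurable_Pair1' rho_measurable[OF assms], of t] by simp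

lemma rho_int_cong_AE:
  assumes "F \<in> borel_measurable borel" "F' \<in> borel_measurable borel" "AE z in lborel. F z = F' z"
    and "g \<in> borel_measurable borel"
  shows "rho_int F g = rho_int F' g"
proof
  fix t
  have "(LINT z|lborel. F z * rho z g t) = (LINT z|lborel. F' z * rho z g t)"
    using assms(3) by (intro integral_cong_AE) (auto intro: rho_section_measurable assms elim: eventually_mono)
  then show "rho_int F g t = rho_int F' g t" by (simp add: rho_int_def)
qed

context
  fixes f :: "(real ^ 'n) \<times> (real ^ 'n) \<Rightarrow> complex"
  assumes fi: "integrable lborel f"
begin

lemma f_measurable [measurable]: "f \<in> borel_measurable borel"
  using borel_measurable_integrable[OF fi] by simp

lemma rho_int_measurable:
  assumes g: "g \<in> borel_measurable borel"
  shows "rho_int f g \<in> borel_measurable borel"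
proof -
  have "(\<lambda>(t, z). f z * rho z g t) \<in> borel_measurable (borel \<Otimes>\<^sub>M lborel)"
    using rho_measurable[OF f_measurable g] by simp
  from lborel.borel_measurable_lebesgue_integral[OF this] show ?thesis
    unfolding rho_int_def[abs_def] by simp
qed

text \<open>Cauchy-Schwarz after splitting the weight \<open>cmod (f z)\<close> into two square
  roots, then Tonelli and translation invariance. Working with the absolute integrand yields both
  the convergence for almost every \<open>t\<close> and the operator bound.\<close>

lemma rho_nn_square:
  assumes g: "g \<in> L2 lborel"
  shows "(\<integral>\<^sup>+t. (\<integral>\<^sup>+z. ennreal (cmod (f z) * cmod (g (t - fst z))) \<partial>lborel)\<^sup>2 \<partial>lborel)
      \<le> ennreal (((LINT z|lborel. cmod (f z)) * l2_norm lborel g)\<^sup>2)"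
proof -
  let ?F = "LINT z|lborel. cmod (f z)"
  have [measurable]: "g \<in> borel_measurable borel" using L2_measurable[OF g] by simp
  have F: "(\<integral>\<^sup>+z. ennreal (cmod (f z)) \<partial>lborel) = ennreal ?F"
    by (rule nn_integral_eq_integral) (use fi in auto)
  have F0: "0 \<le> ?F" by simp
  have m: "(\<lambda>(t, z). ennreal (cmod (f z) * (cmod (g (t - fst z)))\<^sup>2)) \<in> borel_measurable (borel \<Otimes>\<^sub>M borel)"
  proof -
    have "(\<lambda>p. ennreal (cmod (f (snd p)) * (cmod (g (fst p - fst (snd p))))\<^sup>2)) \<in> borel_measurable ((borel :: (real ^ 'n) measure) \<Otimes>\<^sub>M borel)" by measurable
    then show ?thesis by (simp add: split_beta)
  qed
  have pt: "(\<integral>\<^sup>+z. ennreal (cmod (f z) * cmod (g (t - fst z))) \<partial>lborel)\<^sup>2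
      \<le> ennreal ?F * (\<integral>\<^sup>+z. ennreal (cmod (f z) * (cmod (g (t - fst z)))\<^sup>2) \<partial>lborel)" for t
  proof -
    have gt: "(\<lambda>z :: (real ^ 'n) \<times> (real ^ 'n). g (t - fst z)) \<in> borel_measurable borel"
      by (rule measurable_compose[OF borel_measurable_continuous_onI \<open>g \<in> borel_measurable borel\<close>]) (intro continuous_intros)
    note [measurable] = gt
    have "(\<integral>\<^sup>+z. ennreal (cmod (f z) * cmod (g (t - fst z))) \<partial>lborel)
      = (\<integral>\<^sup>+z. ennreal (sqrt (cmod (f z))) * ennreal (sqrt (cmod (f z)) * cmod (g (t - fst z))) \<partial>lborel)"
      by (intro nn_integral_cong) (simp add: ennreal_mult'[symmetric] mult.assoc[symmetric])
    then have "(\<integral>\<^sup>+z. ennreal (cmod (f z) * cmod (g (t - fst z))) \<partial>lborel)\<^sup>2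
      \<le> (\<integral>\<^sup>+z. (ennreal (sqrt (cmod (f z))))\<^sup>2 \<partial>lborel) * (\<integral>\<^sup>+z. (ennreal (sqrt (cmod (f z)) * cmod (g (t - fst z))))\<^sup>2 \<partial>lborel)"
      by (simp only:) (rule Cauchy_Schwarz_nn_integral; measurable)
    then show ?thesis by (simp add: ennreal_power power_mult_distrib F)
  qed
  have "(\<integral>\<^sup>+t. (\<integral>\<^sup>+z. ennreal (cmod (f z) * cmod (g (t - fst z))) \<partial>lborel)\<^sup>2 \<partial>lborel)
      \<le> (\<integral>\<^sup>+t. ennreal ?F * (\<integral>\<^sup>+z. ennreal (cmod (f z) * (cmod (g (t - fst z)))\<^sup>2) \<partial>lborel) \<partial>lborel)"
    by (intro nn_integral_mono pt)
  also have "\<dots> = ennreal ?F * (\<integral>\<^sup>+t. (\<integral>\<^sup>+z. ennreal (cmod (f z) * (cmod (g (t - fst z)))\<^sup>2) \<partial>lborel) \<partial>lborel)"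
    using m by (intro nn_integral_cmult) (simp add: lborel.borel_measurable_nn_integral)
  also have "(\<integral>\<^sup>+t. (\<integral>\<^sup>+z. ennreal (cmod (f z) * (cmod (g (t - fst z)))\<^sup>2) \<partial>lborel) \<partial>lborel)
      = (\<integral>\<^sup>+z. (\<integral>\<^sup>+t. ennreal (cmod (f z) * (cmod (g (t - fst z)))\<^sup>2) \<partial>lborel) \<partial>lborel)"
    using lborel_pair.Fubini'[of "\<lambda>t z. ennreal (cmod (f z) * (cmod (g (t - fst z)))\<^sup>2)"] m by simp
  also have "\<dots> = (\<integral>\<^sup>+z. ennreal (cmod (f z)) * ennreal ((l2_norm lborel g)\<^sup>2) \<partial>lborel)"
  proof (rule nn_integral_cong)
    fix z
    have "(\<integral>\<^sup>+t. ennreal (cmod (f z) * (cmod (g (t - fst z)))\<^sup>2) \<partial>lborel) = ennreal (cmod (f z)) * (\<integral>\<^sup>+t. ennreal ((cmod (g (t - fst z)))\<^sup>2) \<partial>lborel)"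
      unfolding ennreal_mult'[OF norm_ge_zero] by (intro nn_integral_cmult) measurable
    also have "(\<integral>\<^sup>+t. ennreal ((cmod (g (t - fst z)))\<^sup>2) \<partial>lborel) = (\<integral>\<^sup>+t. ennreal ((cmod (g t))\<^sup>2) \<partial>distr lborel borel ((+) (- fst z)))"
      by (subst nn_integral_distr) (simp_all add: add.commute)
    also have "\<dots> = ennreal ((l2_norm lborel g)\<^sup>2)"
      unfolding lborel_distr_plus by (rule nn_integral_square_l2_norm[OF g])
    finally show "(\<integral>\<^sup>+t. ennreal (cmod (f z) * (cmod (g (t - fst z)))\<^sup>2) \<partial>lborel) = ennreal (cmod (f z)) * ennreal ((l2_norm lborel g)\<^sup>2)" .
  qed
  also have "\<dots> = ennreal ?F * ennreal ((l2_norm lborel g)\<^sup>2)"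
    by (subst nn_integral_multc) (simp_all add: F)
  also have "ennreal ?F * \<dots> = ennreal ((?F * l2_norm lborel g)\<^sup>2)"
    using F0 by (simp add: ennreal_mult'[symmetric] power_mult_distrib power2_eq_square mult.assoc)
  finally show ?thesis .
qed

lemma rho_integrable_AE:
  assumes g: "g \<in> L2 lborel"
  shows "AE t in lborel. integrable lborel (\<lambda>z. f z * rho z g t)"
proof -
  have gm [measurable]: "g \<in> borel_measurable borel" using L2_measurable[OF g] by simp
  let ?A = "\<lambda>t. \<integral>\<^sup>+z. ennreal (cmod (f z) * cmod (g (t - fst z))) \<partial>lborel"
  have "(\<lambda>p. ennreal (cmod (f (snd p)) * cmod (g (fst p - fst (snd p))))) \<in> borel_measurable ((borel :: (real ^ 'n) measure) \<Otimes>\<^sub>M borel)" by measurable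
  then have "?A \<in> borel_measurable borel"
    by (intro lborel.borel_measurable_nn_integral) (simp add: split_beta)
  then have "AE t in lborel. (?A t)\<^sup>2 \<noteq> \<infinity>"
    using rho_nn_square[OF g] by (intro nn_integral_noteq_infinite) (auto simp: top_unique)
  then show ?thesis
  proof eventually_elim
    case (elim t)
    then have "?A t < \<infinity>" by (auto simp: less_top[symmetric] power2_eq_square)
    then show ?case
      using rho_section_measurable[OF f_measurable gm, of t]
      by (intro integrableI_bounded) (simp_all add: norm_mult norm_rho)
  qed
qed

lemma rho_int_bounded: "l2_bounded_op lborel (rho_int f)"
proof -
  let ?c = "1 / (2 * pi) ^ CARD('n)"
  let ?K = "?c * (LINT z|lborel. cmod (f z))"
  have c: "0 < ?c" by simp
  have "rho_int f g \<in> L2 lborel \<and> l2_norm lborel (rho_int f g) \<le> ?K * l2_norm lborel g" if g: "g \<in> L2 lborel" for g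
  proof -
    have gm: "g \<in> borel_measurable borel" using L2_measurable[OF g] by simp
    let ?A = "\<lambda>t. \<integral>\<^sup>+z. ennreal (cmod (f z) * cmod (g (t - fst z))) \<partial>lborel"
    have pt: "ennreal ((cmod (rho_int f g t))\<^sup>2) \<le> ennreal (?c\<^sup>2) * (?A t)\<^sup>2" for t
    proof -
      \<comment> \<open>Where the integrand is not integrable the integral is 0 by convention, so
        the estimate holds at every \<open>t\<close>.\<close>
      have "ennreal (cmod (LINT z|lborel. f z * rho z g t)) \<le> (\<integral>\<^sup>+z. ennreal (cmod (f z * rho z g t)) \<partial>lborel)"
        by (cases "integrable lborel (\<lambda>z. f z * rho z g t)") (auto simp: integral_norm_bound_ennreal not_integrable_integral_eq)
      then have "ennreal (cmod (LINT z|lborel. f z * rho z g t)) \<le> ?A t" by (simp add: norm_mult norm_rho)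
      then have "ennreal ?c * ennreal (cmod (LINT z|lborel. f z * rho z g t)) \<le> ennreal ?c * ?A t" by (rule mult_left_mono) simp
      moreover have "cmod (rho_int f g t) = ?c * cmod (LINT z|lborel. f z * rho z g t)"
        unfolding rho_int_def norm_scaleR using c by simp
      ultimately have "ennreal (cmod (rho_int f g t)) \<le> ennreal ?c * ?A t" by (simp only: ennreal_mult'[OF less_imp_le[OF c]])
      then have "(ennreal (cmod (rho_int f g t)))\<^sup>2 \<le> (ennreal ?c * ?A t)\<^sup>2" by (rule power_mono) simp
      then show ?thesis using c by (simp only: power_mult_distrib[of "ennreal ?c"] ennreal_power[OF norm_ge_zero] ennreal_power[OF less_imp_le[OF c]])
    qed
    have "(\<lambda>p. ennreal (cmod (f (snd p)) * cmod (g (fst p - fst (snd p))))) \<in> borel_measurable ((borel :: (real ^ 'n) measure) \<Otimes>\<^sub>M borel)"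
      using gm by measurable
    then have Am: "?A \<in> borel_measurable borel"
      by (intro lborel.borel_measurable_nn_integral) (simp add: split_beta)
    have "(\<integral>\<^sup>+t. ennreal ((cmod (rho_int f g t))\<^sup>2) \<partial>lborel) \<le> (\<integral>\<^sup>+t. ennreal (?c\<^sup>2) * (?A t)\<^sup>2 \<partial>lborel)"
      by (intro nn_integral_mono pt)
    also have "\<dots> = ennreal (?c\<^sup>2) * (\<integral>\<^sup>+t. (?A t)\<^sup>2 \<partial>lborel)"
      using Am by (intro nn_integral_cmult) simp
    also have "\<dots> \<le> ennreal (?c\<^sup>2) * ennreal (((LINT z|lborel. cmod (f z)) * l2_norm lborel g)\<^sup>2)"
      by (intro mult_left_mono rho_nn_square g) simp
    also have "\<dots> = ennreal ((?K * l2_norm lborel g)\<^sup>2)"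
      by (simp only: ennreal_mult'[symmetric] zero_le_power2 power_mult_distrib[symmetric] mult.assoc)
    finally have le: "(\<integral>\<^sup>+t. ennreal ((cmod (rho_int f g t))\<^sup>2) \<partial>lborel) \<le> ennreal ((?K * l2_norm lborel g)\<^sup>2)" .
    have "0 \<le> ?K * l2_norm lborel g" by simp
    with L2_nn_integral[OF _ le] rho_int_measurable[OF gm] show ?thesis by simp
  qed
  note main = this
  have "l2_linear lborel lborel (rho_int f)"
    unfolding l2_linear_def
  proof (intro conjI ballI allI)
    fix g h :: "real ^ 'n \<Rightarrow> complex" assume g: "g \<in> L2 lborel" and h: "h \<in> L2 lborel"
    show "AE x in lborel. rho_int f (\<lambda>y. g y + h y) x = rho_int f g x + rho_int f h x"
      using rho_integrable_AE[OF g] rho_integrable_AE[OF h]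
    proof eventually_elim
      case (elim t)
      have "f z * rho z (\<lambda>y. g y + h y) t = f z * rho z g t + f z * rho z h t" for z
        by (simp add: rho_alt algebra_simps)
      then show ?case unfolding rho_int_def using elim by (simp add: scaleR_add_right)
    qed
  next
    fix g :: "real ^ 'n \<Rightarrow> complex" and c
    have eq: "f z * rho z (\<lambda>y. c * g y) t = c * (f z * rho z g t)" for z t
      by (simp add: rho_alt algebra_simps)
    show "AE x in lborel. rho_int f (\<lambda>y. c * g y) x = c * rho_int f g x"
      unfolding rho_int_def eq integral_mult_right_zero by simp
  qed (use main in blast)
  then show ?thesis unfolding l2_bounded_op_def using main by blast
qed

end

section \<open>Matrix coefficients in the Hermite basis\<close>

lemma lborel_integral_vec_prod:
  fixes F :: "'n::finite \<Rightarrow> real \<Rightarrow> complex"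
  assumes F: "\<And>i. integrable lborel (F i)"
  shows "(LINT t|lborel. (\<Prod>i\<in>UNIV. F i ((t :: real ^ 'n) $ i))) = (\<Prod>i\<in>UNIV. LINT s|lborel. F i s)"
proof -
  let ?ax = "\<lambda>i::'n. axis i (1::real)"
  have inj: "inj ?ax" by (auto simp: inj_def axis_eq_axis)
  have B: "(Basis :: (real ^ 'n) set) = range ?ax" by (auto simp: Basis_vec_def)
  have re: "(\<Prod>b\<in>Basis. G b) = (\<Prod>i\<in>UNIV. G (?ax i))" for G :: "real ^ 'n \<Rightarrow> complex"
    unfolding B by (subst prod.reindex[OF inj]) simp
  have "(LINT t|lborel. (\<Prod>b\<in>Basis. F (inv ?ax b) ((t :: real ^ 'n) \<bullet> b))) = (\<Prod>b\<in>Basis. LINT s|lborel. F (inv ?ax b) s)"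
    by (rule lborel_integral_prod) (rule F)
  then show ?thesis unfolding re inv_f_f[OF inj] inner_axis by simp
qed

text \<open>The integrand factors over the coordinates, and translating the \<open>i\<close>-th
  variable by half of the \<open>i\<close>-th component of \<open>fst z\<close> turns its factor
  into the conjugate of \<open>wig\<close>. Each coordinate contributes one
  \<open>sqrt pi\<close>.\<close>

lemma rho_hermn_integral:
  "(LINT t|lborel. rho z (hermn \<alpha>) t * hermn \<beta> t) = complex_of_real (sqrt pi) ^ CARD('n::finite) * cnj (sherm (case_sum \<alpha> \<beta>) (z :: (real ^ 'n) \<times> (real ^ 'n)))"
proof -
  define F where "F i s = exp (\<i> * complex_of_real (s * snd z $ i - fst z $ i * snd z $ i / 2)) *
      complex_of_real (herm (\<alpha> i) (s - fst z $ i) * herm (\<beta> i) s)" for i s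
  have shift: "F i (s + fst z $ i / 2) = cnj (wig (\<alpha> i) (\<beta> i) (fst z $ i) (snd z $ i) s)" for i s
    unfolding F_def wig_def by (simp add: exp_cnj algebra_simps add_divide_distrib)
  have wi: "integrable lborel (\<lambda>s. cnj (wig j k x \<xi> s))" for j k x \<xi>
    using integrable_bounded_linear[OF bounded_linear_cnj wig_integrable] .
  have Fi: "integrable lborel (F i)" for i
  proof -
    have eq: "F i = (\<lambda>s. cnj (wig (\<alpha> i) (\<beta> i) (fst z $ i) (snd z $ i) (s + - (fst z $ i / 2))))"
    proof
      fix s
      show "F i s = cnj (wig (\<alpha> i) (\<beta> i) (fst z $ i) (snd z $ i) (s + - (fst z $ i / 2)))"
        using shift[of i "s + - (fst z $ i / 2)"] by simp
    qed
    show ?thesis unfolding eq by (rule lborel_integrable_translation[OF wi])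
  qed
  have Fm: "F i \<in> borel_measurable borel" for i using borel_measurable_integrable[OF Fi] by simp
  have FI: "(LINT s|lborel. F i s) = complex_of_real (sqrt pi) * cnj (psi (\<alpha> i) (\<beta> i) (fst z $ i) (snd z $ i))" for i
  proof -
    have "(LINT s|lborel. F i s) = (LINT s|lborel. cnj (wig (\<alpha> i) (\<beta> i) (fst z $ i) (snd z $ i) s))"
      using lborel_integral_translation[OF Fm, of i "fst z $ i / 2"] unfolding shift by simp
    also have "\<dots> = cnj (LINT s|lborel. wig (\<alpha> i) (\<beta> i) (fst z $ i) (snd z $ i) s)"
      by (rule integral_bounded_linear'[OF bounded_linear_cnj bounded_linear_cnj]) simp
    finally show ?thesis unfolding wig_integral by simp
  qed
  have "rho z (hermn \<alpha>) t * hermn \<beta> t = (\<Prod>i\<in>UNIV. F i (t $ i))" for t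
  proof -
    have "exp (\<i> * complex_of_real (t \<bullet> snd z - fst z \<bullet> snd z / 2))
        = (\<Prod>i\<in>UNIV. exp (\<i> * complex_of_real (t $ i * snd z $ i - fst z $ i * snd z $ i / 2)))"
      by (simp add: exp_sum[symmetric] inner_vec_def sum_distrib_left[symmetric] sum_subtractf sum_divide_distrib)
    then show ?thesis unfolding rho_alt hermn_def F_def by (simp add: prod.distrib)
  qed
  then have "(LINT t|lborel. rho z (hermn \<alpha>) t * hermn \<beta> t) = (\<Prod>i\<in>UNIV. complex_of_real (sqrt pi) * cnj (psi (\<alpha> i) (\<beta> i) (fst z $ i) (snd z $ i)))"
    by (simp add: lborel_integral_vec_prod[OF Fi] FI)
  then show ?thesis by (simp add: prod.distrib sherm_def)
qed

text \<open>Boundedness of \<open>hermn \<alpha>\<close> dominates the double integrand by a product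
  of integrable functions, so Fubini applies. The conjugate in \<open>rho_hermn_integral\<close> is
  what makes the outcome an inner product with \<open>sherm\<close>.\<close>

lemma rho_int_matrix:
  fixes f :: "(real ^ 'n::finite) \<times> (real ^ 'n) \<Rightarrow> complex"
  assumes fi: "integrable lborel f"
  shows "l2_inner lborel (rho_int f (hermn \<alpha>)) (hermn \<beta>)
    = complex_of_real (sqrt pi ^ CARD('n) / (2 * pi) ^ CARD('n)) * l2_inner lborel f (sherm (case_sum \<alpha> \<beta>))"
proof -
  let ?c = "complex_of_real (1 / (2 * pi) ^ CARD('n))"
  have [measurable]: "f \<in> borel_measurable borel" using borel_measurable_integrable[OF fi] by simp
  have hr: "rapid (hermn \<alpha>)" for \<alpha> :: "'n \<Rightarrow> nat" by (intro test_class_rapid[OF test_class_hermn] fspan.base)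
  have hm [measurable]: "hermn \<alpha> \<in> borel_measurable borel" for \<alpha> :: "'n \<Rightarrow> nat" by (rule rapid_measurable[OF hr])
  obtain B where B: "\<And>t. cmod (hermn \<alpha> t) \<le> B" using rapid_bounded[OF hr[of \<alpha>]] unfolding bounded_iff by auto
  have B0: "0 \<le> B" using B[of 0] norm_ge_zero order_trans by blast
  have int: "integrable (lborel \<Otimes>\<^sub>M lborel) (\<lambda>(t, z). f z * rho z (hermn \<alpha>) t * hermn \<beta> t)"
  proof (rule Bochner_Integration.integrable_bound)
    show "integrable (lborel \<Otimes>\<^sub>M lborel) (\<lambda>p. complex_of_real B * (case p of (t, z) \<Rightarrow> hermn \<beta> t * f z))"
      by (intro integrable_mult_right lborel_integrable_product rapid_integrable hr fi)
    have "(\<lambda>p. (case p of (t, z) \<Rightarrow> f z * rho z (hermn \<alpha>) t) * hermn \<beta> (fst p)) \<in> borel_measurable ((borel :: (real ^ 'n) measure) \<Otimes>\<^sub>M borel)"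
      by (intro borel_measurable_times rho_measurable) measurable
    then show "(\<lambda>(t, z). f z * rho z (hermn \<alpha>) t * hermn \<beta> t) \<in> borel_measurable (lborel \<Otimes>\<^sub>M lborel)"
      by (simp add: split_beta)
    show "AE p in lborel \<Otimes>\<^sub>M lborel. norm (case p of (t, z) \<Rightarrow> f z * rho z (hermn \<alpha>) t * hermn \<beta> t) \<le> norm (complex_of_real B * (case p of (t, z) \<Rightarrow> hermn \<beta> t * f z))"
    proof (rule AE_I2)
      fix p :: "(real ^ 'n) \<times> ((real ^ 'n) \<times> (real ^ 'n))"
      have "cmod (f (snd p)) * cmod (hermn \<alpha> (fst p - fst (snd p))) * cmod (hermn \<beta> (fst p)) \<le> cmod (f (snd p)) * B * cmod (hermn \<beta> (fst p))"
        by (intro mult_right_mono mult_left_mono B) auto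
      then show "norm (case p of (t, z) \<Rightarrow> f z * rho z (hermn \<alpha>) t * hermn \<beta> t) \<le> norm (complex_of_real B * (case p of (t, z) \<Rightarrow> hermn \<beta> t * f z))"
        using B0 by (simp add: split_beta norm_mult norm_rho mult_ac)
    qed
  qed
  have hreal: "cnj (hermn \<beta> t) = hermn \<beta> t" for t by (simp add: hermn_def)
  have "l2_inner lborel (rho_int f (hermn \<alpha>)) (hermn \<beta>) = (LINT t|lborel. ?c * (LINT z|lborel. f z * rho z (hermn \<alpha>) t * hermn \<beta> t))"
    unfolding l2_inner_def rho_int_def hreal
  proof (rule Bochner_Integration.integral_cong[OF refl])
    fix t
    have "(LINT z|lborel. f z * rho z (hermn \<alpha>) t * hermn \<beta> t) = (LINT z|lborel. f z * rho z (hermn \<alpha>) t) * hermn \<beta> t"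
      by (rule integral_mult_left_zero)
    then show "(1 / (2 * pi) ^ CARD('n)) *\<^sub>R (LINT z|lborel. f z * rho z (hermn \<alpha>) t) * hermn \<beta> t = ?c * (LINT z|lborel. f z * rho z (hermn \<alpha>) t * hermn \<beta> t)"
      by (simp add: scaleR_conv_of_real)
  qed
  also have "\<dots> = ?c * (LINT t|lborel. (LINT z|lborel. f z * rho z (hermn \<alpha>) t * hermn \<beta> t))" by (rule integral_mult_right_zero)
  also have "(LINT t|lborel. (LINT z|lborel. f z * rho z (hermn \<alpha>) t * hermn \<beta> t)) = (LINT z|lborel. (LINT t|lborel. f z * rho z (hermn \<alpha>) t * hermn \<beta> t))"
    by (rule lborel_pair.Fubini_integral[OF int, symmetric])
  also have "\<dots> = (LINT z|lborel. complex_of_real (sqrt pi) ^ CARD('n) * (f z * cnj (sherm (case_sum \<alpha> \<beta>) z)))"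
  proof (rule Bochner_Integration.integral_cong[OF refl])
    fix z
    have "(LINT t|lborel. f z * rho z (hermn \<alpha>) t * hermn \<beta> t) = f z * (LINT t|lborel. rho z (hermn \<alpha>) t * hermn \<beta> t)"
      unfolding mult.assoc by (rule integral_mult_right_zero)
    then show "(LINT t|lborel. f z * rho z (hermn \<alpha>) t * hermn \<beta> t) = complex_of_real (sqrt pi) ^ CARD('n) * (f z * cnj (sherm (case_sum \<alpha> \<beta>) z))"
      unfolding rho_hermn_integral by (simp add: mult_ac)
  qed
  also have "\<dots> = complex_of_real (sqrt pi) ^ CARD('n) * l2_inner lborel f (sherm (case_sum \<alpha> \<beta>))"
    unfolding l2_inner_def by (rule integral_mult_right_zero)
  finally show ?thesis by simp
qed

section \<open>The trace norm estimate\<close>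

lemma l2_bounded_op_cong:
  assumes "l2_bounded_op M T'" and eq: "\<And>g. g \<in> L2 M \<Longrightarrow> T g = T' g"
  shows "l2_bounded_op M T"
  using assms(1) unfolding l2_bounded_op_def l2_linear_def by (simp add: eq L2_add L2_scale)

text \<open>The Weyl operator integrates the double transform, which inversion identifies with
  \<open>f\<close> almost everywhere. The defining integral does not see null sets of phase space,
  so the equality holds at every point.\<close>

lemma weyl_op_symp_fourier:
  assumes f: "f \<in> schwartz" and g: "g \<in> L2 lborel"
  shows "weyl_op (symp_fourier f) g = rho_int f g"
proof -
  have fm: "f \<in> borel_measurable borel" by (rule rapid_measurable[OF schwartz_rapid0[OF f]])
  show ?thesis
    unfolding weyl_op_def
    by (rule rho_int_cong_AE[OF _ fm symp_fourier_inversion[OF f]])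
      (use L2_measurable[OF g] fm in \<open>auto intro: symp_fourier_measurable\<close>)
qed

lemma mfact_dg: "mfact (dg \<alpha>) = (mfact \<alpha>)\<^sup>2"
proof -
  have "mfact (dg \<alpha>) = (\<Prod>k\<in>UNIV <+> UNIV. 2 ^ dg \<alpha> k * fact (dg \<alpha> k))"
    unfolding mfact_def UNIV_Plus_UNIV ..
  also have "\<dots> = mfact \<alpha> * mfact \<alpha>"
    unfolding mfact_def by (subst prod.Plus) simp_all
  finally show ?thesis by (simp add: power2_eq_square)
qed

text \<open>The factor between the diagonal entries of \<open>rho_int f\<close> and the normalised
  coefficients of \<open>f\<close>: the constant of \<open>rho_int_matrix\<close>, corrected by the
  norms of the two ground states. It depends on the dimension only, hence the type argument.\<close>

definition diag_const :: "'n::finite itself \<Rightarrow> real" where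
  "diag_const _ = sqrt pi ^ CARD('n) / (2 * pi) ^ CARD('n)
     * l2_norm lborel (sherm (\<lambda>_. 0) :: (real ^ 'n) \<times> (real ^ 'n) \<Rightarrow> complex)
     / (l2_norm lborel (hermn (\<lambda>_. 0) :: real ^ 'n \<Rightarrow> complex))\<^sup>2"

lemma diag_const_nonneg: "0 \<le> diag_const x"
  by (simp add: diag_const_def)

text \<open>On the diagonal the normalisation of the special Hermite function contributes
  \<open>mfact \<alpha>\<close>, because both slots carry \<open>\<alpha>\<close>, and this cancels
  the two square roots from the Hermite functions. Therefore the constant does not depend on
  \<open>\<alpha>\<close>.\<close>

lemma rho_int_hhat:
  fixes f :: "(real ^ 'n::finite) \<times> (real ^ 'n) \<Rightarrow> complex"
  assumes f: "f \<in> schwartz" and rad: "radial f"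
  shows "l2_inner lborel (rho_int f (hhat \<alpha>)) (hhat \<beta>) =
    (if \<alpha> = \<beta> then complex_of_real (diag_const TYPE('n)) * l2_inner lborel f (shat (dg \<alpha>)) else 0)"
proof -
  let ?n = "l2_norm lborel (hermn (\<lambda>_. 0) :: real ^ 'n \<Rightarrow> complex)"
  let ?N = "l2_norm lborel (sherm (\<lambda>_. 0) :: (real ^ 'n) \<times> (real ^ 'n) \<Rightarrow> complex)"
  let ?k = "\<lambda>\<alpha>::'n \<Rightarrow> nat. complex_of_real (1 / (sqrt (mfact \<alpha>) * ?n))"
  let ?c = "sqrt pi ^ CARD('n) / (2 * pi) ^ CARD('n)"
  have n: "0 < ?n" by (rule hermn_basis(1))
  have N: "0 < ?N" by (rule sherm_basis(1))
  have fi: "integrable lborel f" by (rule rapid_integrable[OF schwartz_rapid0[OF f]])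
  have h: "hhat \<alpha> = (\<lambda>t. ?k \<alpha> * hermn \<alpha> t)" for \<alpha> :: "'n \<Rightarrow> nat"
    unfolding hhat_def normalized_def[abs_def] ..
  have "f z * rho z (\<lambda>t. ?k \<alpha> * hermn \<alpha> t) t = ?k \<alpha> * (f z * rho z (hermn \<alpha>) t)" for z t
    by (simp add: rho_alt)
  then have "rho_int f (hhat \<alpha>) = (\<lambda>t. ?k \<alpha> * rho_int f (hermn \<alpha>) t)"
    unfolding rho_int_def h by (simp only: integral_mult_right_zero) (auto simp: scaleR_conv_of_real)
  then have eq: "l2_inner lborel (rho_int f (hhat \<alpha>)) (hhat \<beta>) =
      ?k \<alpha> * (?k \<beta> * (complex_of_real ?c * l2_inner lborel f (sherm (case_sum \<alpha> \<beta>))))"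
    by (simp only: h[of \<beta>] l2_inner_scale_left l2_inner_scale_right rho_int_matrix[OF fi] complex_cnj_complex_of_real)
  show ?thesis
  proof (cases "\<alpha> = \<beta>")
    case True
    note norm = l2_inner_normalized[where \<Phi> = sherm and M = lborel, OF N, folded shat_def]
    have m: "0 < mfact \<alpha>" by (rule mfact_pos)
    have ip: "l2_inner lborel f (sherm (case_sum \<alpha> \<alpha>)) = complex_of_real (mfact \<alpha> * ?N) * l2_inner lborel f (shat (dg \<alpha>))"
      unfolding dg_def[symmetric] norm[of f "dg \<alpha>"] mfact_dg using m by simp
    have "l2_inner lborel (rho_int f (hhat \<alpha>)) (hhat \<beta>) =
        complex_of_real (1 / (sqrt (mfact \<alpha>) * ?n) * (1 / (sqrt (mfact \<alpha>) * ?n) * (?c * (mfact \<alpha> * ?N)))) * l2_inner lborel f (shat (dg \<alpha>))"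
      using eq unfolding True[symmetric] ip by (simp only: of_real_mult mult.assoc)
    also have "1 / (sqrt (mfact \<alpha>) * ?n) * (1 / (sqrt (mfact \<alpha>) * ?n) * (?c * (mfact \<alpha> * ?N)))
        = (mfact \<alpha> / (sqrt (mfact \<alpha>))\<^sup>2) * diag_const TYPE('n)"
    proof -
      have "1 / (r * n) * (1 / (r * n) * (c * (m * N))) = (m / r\<^sup>2) * (c * N / n\<^sup>2)" for r n c m N :: real
        by (simp add: power2_eq_square ac_simps)
      then show ?thesis unfolding diag_const_def .
    qed
    also have "mfact \<alpha> / (sqrt (mfact \<alpha>))\<^sup>2 = 1" using m by simp
    finally show ?thesis using True by simp
  next
    case False
    then obtain i where "\<alpha> i \<noteq> \<beta> i" by auto
    then have "l2_inner lborel f (sherm (case_sum \<alpha> \<beta>)) = 0"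
      by (intro radial_off_diagonal[OF f rad, of _ i]) simp
    then show ?thesis unfolding eq using False by simp
  qed
qed

lemma trace_norm_radial_le:
  fixes f :: "(real ^ 'n::finite) \<times> (real ^ 'n) \<Rightarrow> complex"
  assumes f: "f \<in> schwartz" and rad: "radial f"
    and B: "\<And>F. finite F \<Longrightarrow> (\<Sum>\<alpha>\<in>F. cmod (l2_inner lborel f (shat (dg \<alpha>)))) \<le> B"
  shows "trace_norm lborel (weyl_op (symp_fourier f)) \<le> ennreal (diag_const TYPE('n) * B)"
proof (rule trace_norm_diagonal_le)
  let ?T = "weyl_op (symp_fourier f)"
  let ?e = "\<lambda>n. hhat (mi_enum n :: 'n \<Rightarrow> nat)"
  let ?\<mu> = "\<lambda>n. complex_of_real (diag_const TYPE('n)) * l2_inner lborel f (shat (dg (mi_enum n)))"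
  have fi: "integrable lborel f" by (rule rapid_integrable[OF schwartz_rapid0[OF f]])
  show "l2_bounded_op lborel ?T"
    by (rule l2_bounded_op_cong[OF rho_int_bounded[OF fi] weyl_op_symp_fourier[OF f]])
  show onb: "l2_onb lborel ?e" by (rule hermn_basis(3))
  have eL: "?e n \<in> L2 lborel" for n by (rule l2_onsD(1)[OF l2_onb_ons[OF onb]])
  have inj: "inj (mi_enum :: nat \<Rightarrow> 'n \<Rightarrow> nat)" using bij_mi_enum bij_is_inj by blast
  show "l2_inner lborel (?T (?e m)) (?e n) = (if m = n then ?\<mu> m else 0)" for m n
    unfolding weyl_op_symp_fourier[OF f eL] rho_int_hhat[OF f rad] using inj by (simp add: inj_eq)
  fix K
  have "(\<Sum>n<K. cmod (?\<mu> n)) = diag_const TYPE('n) * (\<Sum>n<K. cmod (l2_inner lborel f (shat (dg (mi_enum n :: 'n \<Rightarrow> nat)))))"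
    using diag_const_nonneg[of "TYPE('n)"] by (simp add: norm_mult sum_distrib_left)
  also have "(\<Sum>n<K. cmod (l2_inner lborel f (shat (dg (mi_enum n :: 'n \<Rightarrow> nat))))) = (\<Sum>\<alpha>\<in>mi_enum ` {..<K}. cmod (l2_inner lborel f (shat (dg \<alpha>))))"
    using inj by (simp add: sum.reindex inj_on_subset)
  also have "diag_const TYPE('n) * \<dots> \<le> diag_const TYPE('n) * B"
    by (intro mult_left_mono B diag_const_nonneg) simp
  finally show "(\<Sum>n<K. cmod (?\<mu> n)) \<le> diag_const TYPE('n) * B" .
qed

text \<open>Cauchy-Schwarz against the summable weights. \<open>E\<close> is left abstract so that
  either of the two norms in the theorem can be inserted, and \<open>B\<close> is fixed before
  \<open>f\<close>.\<close>

lemma diagonal_l1_bound: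
  assumes s: "real CARD('n::finite) < s"
  shows "\<exists>B. \<forall>(f :: (real ^ 'n) \<times> (real ^ 'n) \<Rightarrow> complex) E F. finite F \<longrightarrow> 0 \<le> E \<longrightarrow>
    (\<Sum>\<alpha>\<in>F. ((1 + sh_ev (dg \<alpha>)) powr (s / 2) * cmod (l2_inner lborel f (shat (dg \<alpha>))))\<^sup>2) \<le> E\<^sup>2 \<longrightarrow>
    (\<Sum>\<alpha>\<in>F. cmod (l2_inner lborel f (shat (dg \<alpha>)))) \<le> B * E"
proof -
  obtain B0 where B0: "0 \<le> B0" "\<And>F :: ('n \<Rightarrow> nat) set. finite F \<Longrightarrow> (\<Sum>\<alpha>\<in>F. (1 + sh_ev (dg \<alpha>)) powr (- s)) \<le> B0"
    using diagonal_powr_sum_bounded[OF s] by blast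
  show ?thesis
  proof (intro exI[of _ "sqrt B0"] allI impI)
    fix f :: "(real ^ 'n) \<times> (real ^ 'n) \<Rightarrow> complex" and E and F :: "('n \<Rightarrow> nat) set"
    assume F: "finite F" and E: "0 \<le> E"
      and le: "(\<Sum>\<alpha>\<in>F. ((1 + sh_ev (dg \<alpha>)) powr (s / 2) * cmod (l2_inner lborel f (shat (dg \<alpha>))))\<^sup>2) \<le> E\<^sup>2"
    let ?w = "\<lambda>\<alpha>::'n \<Rightarrow> nat. 1 + sh_ev (dg \<alpha>)" and ?c = "\<lambda>\<alpha>. cmod (l2_inner lborel f (shat (dg \<alpha>)))"
    have w: "0 < ?w \<alpha>" for \<alpha> using sh_ev_nonneg[of "dg \<alpha>"] by simp
    show "(\<Sum>\<alpha>\<in>F. ?c \<alpha>) \<le> sqrt B0 * E"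
    proof (rule power2_le_imp_le)
      have "?c \<alpha> = ?w \<alpha> powr (- (s / 2)) * (?w \<alpha> powr (s / 2) * ?c \<alpha>)" for \<alpha>
        using w[of \<alpha>] by (simp only: mult.assoc[symmetric] powr_add[symmetric]) simp
      then have "(\<Sum>\<alpha>\<in>F. ?c \<alpha>) = (\<Sum>\<alpha>\<in>F. ?w \<alpha> powr (- (s / 2)) * (?w \<alpha> powr (s / 2) * ?c \<alpha>))"
        by (rule sum.cong[OF refl])
      then have "(\<Sum>\<alpha>\<in>F. ?c \<alpha>)\<^sup>2 \<le> (\<Sum>\<alpha>\<in>F. (?w \<alpha> powr (- (s / 2)))\<^sup>2) * (\<Sum>\<alpha>\<in>F. (?w \<alpha> powr (s / 2) * ?c \<alpha>)\<^sup>2)"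
        by (simp only: Cauchy_Schwarz_ineq_sum)
      also have "\<dots> \<le> B0 * E\<^sup>2"
      proof (rule mult_mono[OF _ le B0(1)])
        have "(?w \<alpha> powr (- (s / 2)))\<^sup>2 = ?w \<alpha> powr (- s)" for \<alpha>
          by (simp add: power2_eq_square powr_add[symmetric])
        then show "(\<Sum>\<alpha>\<in>F. (?w \<alpha> powr (- (s / 2)))\<^sup>2) \<le> B0" by (simp only: B0(2)[OF F])
      qed (simp add: sum_nonneg)
      finally show "(\<Sum>\<alpha>\<in>F. ?c \<alpha>)\<^sup>2 \<le> (sqrt B0 * E)\<^sup>2" using B0(1) by (simp add: power_mult_distrib)
    qed (use B0(1) E in simp)
  qed
qed

section \<open>Radial functions in the domain of the spectral powers\<close>

lemma shat_off_diagonal: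
  fixes f :: "(real ^ 'n::finite) \<times> (real ^ 'n) \<Rightarrow> complex"
  assumes f: "f \<in> schwartz" and rad: "radial f" and "\<gamma> \<notin> range dg"
  shows "l2_inner lborel f (shat \<gamma>) = 0"
proof -
  have "\<exists>i. \<gamma> (Inl i) \<noteq> \<gamma> (Inr i)"
  proof (rule ccontr)
    assume "\<nexists>i. \<gamma> (Inl i) \<noteq> \<gamma> (Inr i)"
    then have "\<gamma> = dg (\<lambda>i. \<gamma> (Inl i))" by (auto simp: fun_eq_iff dg_def split: sum.split)
    then show False using assms(3) by blast
  qed
  then obtain i where "\<gamma> (Inl i) \<noteq> \<gamma> (Inr i)" by blast
  then show ?thesis unfolding shat_eq l2_inner_scale_right by (simp add: radial_off_diagonal[OF f rad])
qed

lemma inj_dg: "inj dg"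
  by (rule injI) (metis dg_simps(1) ext)

text \<open>This places \<open>f\<close> in the domain of the power, without which
  \<open>spectral_apply\<close> would be an uncontrolled choice. Off-diagonal terms vanish, and the
  diagonal ones are bounded by the Sobolev estimate.\<close>

lemma radial_spectral_summable:
  fixes f :: "(real ^ 'n::finite) \<times> (real ^ 'n) \<Rightarrow> complex"
  assumes f: "f \<in> schwartz" and rad: "radial f"
  shows "summable (\<lambda>n. (cmod (complex_of_real ((1 + sh_ev (mi_enum n :: 'n + 'n \<Rightarrow> nat)) powr (s / 2)) * l2_inner lborel f (shat (mi_enum n))))\<^sup>2)"
proof -
  \<comment> \<open>The Sobolev estimate has natural exponents; rounding up is harmless as the base
    \<open>1 + sh_ev \<gamma>\<close> is at least 1.\<close>
  define N where "N = nat \<lceil>s\<rceil>"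
  have sN: "s \<le> real N" unfolding N_def by linarith
  obtain K where K: "\<And>F. finite F \<Longrightarrow> (\<Sum>\<alpha>\<in>F. (1 + sh_ev (dg \<alpha>)) ^ N * (cmod (l2_inner lborel f (shat (dg \<alpha>))))\<^sup>2) \<le> (K * sobolev_norm N f)\<^sup>2"
    using diagonal_sobolev[of N] f rad by blast
  let ?h = "\<lambda>\<gamma>::'n + 'n \<Rightarrow> nat. (cmod (complex_of_real ((1 + sh_ev \<gamma>) powr (s / 2)) * l2_inner lborel f (shat \<gamma>)))\<^sup>2"
  have hle: "?h \<gamma> \<le> (1 + sh_ev \<gamma>) ^ N * (cmod (l2_inner lborel f (shat \<gamma>)))\<^sup>2" for \<gamma>
  proof -
    have "((1 + sh_ev \<gamma>) powr (s / 2))\<^sup>2 = (1 + sh_ev \<gamma>) powr s"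
      by (simp add: power2_eq_square powr_add[symmetric])
    also have "\<dots> \<le> (1 + sh_ev \<gamma>) powr (real N)"
      using sN sh_ev_nonneg[of \<gamma>] by (intro powr_mono) auto
    also have "\<dots> = (1 + sh_ev \<gamma>) ^ N" using sh_ev_nonneg[of \<gamma>] by (intro powr_realpow) simp
    finally show ?thesis by (simp add: norm_mult power_mult_distrib mult_right_mono)
  qed
  show ?thesis
  proof (rule summableI_nonneg_bounded)
    fix m
    let ?G = "mi_enum ` {..<m} :: ('n + 'n \<Rightarrow> nat) set"
    let ?F = "{\<alpha>. dg \<alpha> \<in> ?G}"
    have F: "finite ?F"
      using finite_vimageI[OF _ inj_dg, of ?G] by (simp add: vimage_def)
    have "inj_on (mi_enum :: nat \<Rightarrow> 'n + 'n \<Rightarrow> nat) {..<m}"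
      using bij_mi_enum bij_is_inj inj_on_subset by blast
    then have "(\<Sum>n<m. ?h (mi_enum n)) = (\<Sum>\<gamma>\<in>?G. ?h \<gamma>)" by (simp add: sum.reindex)
    also have "\<dots> = (\<Sum>\<gamma>\<in>dg ` ?F. ?h \<gamma>)"
    proof (rule sum.mono_neutral_right)
      show "\<forall>\<gamma>\<in>?G - dg ` ?F. ?h \<gamma> = 0"
      proof
        fix \<gamma> assume "\<gamma> \<in> ?G - dg ` ?F"
        then have "\<gamma> \<notin> range dg" by blast
        from shat_off_diagonal[OF f rad this] show "?h \<gamma> = 0" by simp
      qed
    qed auto
    also have "\<dots> = (\<Sum>\<alpha>\<in>?F. ?h (dg \<alpha>))"
      by (simp add: sum.reindex inj_on_subset[OF inj_dg])
    also have "\<dots> \<le> (\<Sum>\<alpha>\<in>?F. (1 + sh_ev (dg \<alpha>)) ^ N * (cmod (l2_inner lborel f (shat (dg \<alpha>))))\<^sup>2)"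
      by (intro sum_mono hle)
    also have "\<dots> \<le> (K * sobolev_norm N f)\<^sup>2" by (rule K[OF F])
    finally show "(\<Sum>n<m. ?h (mi_enum n)) \<le> (K * sobolev_norm N f)\<^sup>2" .
  qed simp
qed

theorem lemma4p3:
  shows "(\<forall>s > real CARD('n::finite) + 1. \<exists>C::real.
            \<forall>f :: (real ^ 'n) \<times> (real ^ 'n) \<Rightarrow> complex. f \<in> schwartz \<and> radial f \<longrightarrow>
              trace_norm lborel (weyl_op (symp_fourier f))
                \<le> ennreal (C * l2_norm lborel
                     (spectral_apply lborel hermite_op (\<lambda>l. (1 + l) powr (s / 2)) f)))
       \<and> (\<exists>C'::real.
            \<forall>f :: (real ^ 'n) \<times> (real ^ 'n) \<Rightarrow> complex. f \<in> schwartz \<and> radial f \<longrightarrow>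
              trace_norm lborel (weyl_op (symp_fourier f))
                \<le> ennreal (C' * sobolev_norm (CARD('n) + 2) f))"
proof (intro conjI allI impI)
  fix s assume "s > real CARD('n) + 1"
  then have s: "real CARD('n) < s" by simp
  from diagonal_l1_bound[OF s] obtain B where B: "\<forall>(f :: (real ^ 'n) \<times> (real ^ 'n) \<Rightarrow> complex) E F. finite F \<longrightarrow> 0 \<le> E \<longrightarrow>
    (\<Sum>\<alpha>\<in>F. ((1 + sh_ev (dg \<alpha>)) powr (s / 2) * cmod (l2_inner lborel f (shat (dg \<alpha>))))\<^sup>2) \<le> E\<^sup>2 \<longrightarrow>
    (\<Sum>\<alpha>\<in>F. cmod (l2_inner lborel f (shat (dg \<alpha>)))) \<le> B * E" ..
  have "trace_norm lborel (weyl_op (symp_fourier f))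
      \<le> ennreal ((diag_const TYPE('n) * B) * l2_norm lborel (spectral_apply lborel hermite_op (\<lambda>l. (1 + l) powr (s / 2)) f))"
    if f: "f \<in> schwartz" and rad: "radial f" for f :: "(real ^ 'n) \<times> (real ^ 'n) \<Rightarrow> complex"
  proof -
    let ?g = "spectral_apply lborel hermite_op (\<lambda>l. (1 + l) powr (s / 2)) f"
    note g = spectral_apply_coeff[OF schwartz_L2[OF f] radial_spectral_summable[OF f rad, of s]]
    have "(\<Sum>\<alpha>\<in>F. cmod (l2_inner lborel f (shat (dg \<alpha>)))) \<le> B * l2_norm lborel ?g" if F: "finite F" for F
    proof (rule B[rule_format, OF F l2_norm_nonneg])
      \<comment> \<open>The weighted coefficients of \<open>f\<close> are the coefficients of
        \<open>?g\<close>, and those on the diagonal are a part of its Bessel sum.\<close>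
      have "(\<Sum>\<alpha>\<in>F. ((1 + sh_ev (dg \<alpha>)) powr (s / 2) * cmod (l2_inner lborel f (shat (dg \<alpha>))))\<^sup>2)
          = (\<Sum>\<gamma>\<in>dg ` F. (cmod (l2_inner lborel ?g (shat \<gamma>)))\<^sup>2)"
        by (simp add: sum.reindex inj_on_subset[OF inj_dg] g(2) norm_mult)
      also have "\<dots> \<le> (l2_norm lborel ?g)\<^sup>2"
        by (rule l2_Bessel[OF sherm_basis(2) _ g(1)]) (simp add: F)
      finally show "(\<Sum>\<alpha>\<in>F. ((1 + sh_ev (dg \<alpha>)) powr (s / 2) * cmod (l2_inner lborel f (shat (dg \<alpha>))))\<^sup>2) \<le> (l2_norm lborel ?g)\<^sup>2" .
    qed
    from trace_norm_radial_le[OF f rad this] show ?thesis by (simp add: mult.assoc)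
  qed
  then show "\<exists>C. \<forall>f :: (real ^ 'n) \<times> (real ^ 'n) \<Rightarrow> complex. f \<in> schwartz \<and> radial f \<longrightarrow>
      trace_norm lborel (weyl_op (symp_fourier f))
      \<le> ennreal (C * l2_norm lborel (spectral_apply lborel hermite_op (\<lambda>l. (1 + l) powr (s / 2)) f))"
    by blast
next
  let ?N = "CARD('n) + 2"
  have s: "real CARD('n) < real ?N" by simp
  from diagonal_l1_bound[OF s] obtain B where B: "\<forall>(f :: (real ^ 'n) \<times> (real ^ 'n) \<Rightarrow> complex) E F. finite F \<longrightarrow> 0 \<le> E \<longrightarrow>
    (\<Sum>\<alpha>\<in>F. ((1 + sh_ev (dg \<alpha>)) powr (real ?N / 2) * cmod (l2_inner lborel f (shat (dg \<alpha>))))\<^sup>2) \<le> E\<^sup>2 \<longrightarrow>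
    (\<Sum>\<alpha>\<in>F. cmod (l2_inner lborel f (shat (dg \<alpha>)))) \<le> B * E" ..
  obtain K where K0: "0 \<le> K" and K: "\<And>(f :: (real ^ 'n) \<times> (real ^ 'n) \<Rightarrow> complex) F. f \<in> schwartz \<Longrightarrow> radial f \<Longrightarrow> finite F \<Longrightarrow>
     (\<Sum>\<alpha>\<in>F. (1 + sh_ev (dg \<alpha>)) ^ ?N * (cmod (l2_inner lborel f (shat (dg \<alpha>))))\<^sup>2) \<le> (K * sobolev_norm ?N f)\<^sup>2"
    using diagonal_sobolev[of ?N, where 'n = 'n] by blast
  have "trace_norm lborel (weyl_op (symp_fourier f)) \<le> ennreal ((diag_const TYPE('n) * B * K) * sobolev_norm ?N f)"
    if f: "f \<in> schwartz" and rad: "radial f" for f :: "(real ^ 'n) \<times> (real ^ 'n) \<Rightarrow> complex"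
  proof -
    have pow: "((1 + sh_ev \<gamma>) powr (real ?N / 2) * x)\<^sup>2 = (1 + sh_ev \<gamma>) ^ ?N * x\<^sup>2" for \<gamma> :: "'n + 'n \<Rightarrow> nat" and x :: real
    proof -
      have "((1 + sh_ev \<gamma>) powr (real ?N / 2))\<^sup>2 = (1 + sh_ev \<gamma>) powr real ?N"
        by (simp only: power2_eq_square powr_add[symmetric] field_sum_of_halves)
      also have "\<dots> = (1 + sh_ev \<gamma>) ^ ?N" using sh_ev_nonneg[of \<gamma>] by (intro powr_realpow) simp
      finally show ?thesis by (simp only: power_mult_distrib)
    qed
    have "(\<Sum>\<alpha>\<in>F. cmod (l2_inner lborel f (shat (dg \<alpha>)))) \<le> B * (K * sobolev_norm ?N f)" if F: "finite F" for F
      by (rule B[rule_format, OF F mult_nonneg_nonneg[OF K0 sobolev_norm_nonneg]]) (simp only: pow K[OF f rad F])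
    from trace_norm_radial_le[OF f rad this] show ?thesis by (simp only: mult.assoc)
  qed
  then show "\<exists>C'. \<forall>f :: (real ^ 'n) \<times> (real ^ 'n) \<Rightarrow> complex. f \<in> schwartz \<and> radial f \<longrightarrow>
      trace_norm lborel (weyl_op (symp_fourier f)) \<le> ennreal (C' * sobolev_norm ?N f)"
    by blast
qed

end
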